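(* Let $G$ be a finitely presented group with a finite family $\Lambda$ of subgroups $G'\leq K\leq G$ such that $$\Sigma^1(G)^c=\bigcup_{K\in\Lambda} S(G,K).$$ Then there is a finitely presented $G'$-fibre product in $G\times G$ if and only if $\operatorname{rk}G/G'\leq 2\operatorname{rk}K/G'$ for any $K\in\Lambda$.
   Context: $G'$ denotes the commutator subgroup of $G$, and $\operatorname{rk}$ denotes the torsion-free rank of a finitely generated abelian group. A $G'$-fibre product in $G\times G$ is a subgroup of the form $H_\mu=\{(g_1,g_2)\in G\times G\mid \mu(g_1G')=g_2G'\}$ where $\mu:G/G'\to G/G'$ is an automorphism. A character of a group $G$ is a homomorphism $\chi:G\to\mathbb{R}$ to the additive group of reals. For a nonzero character $\chi$ put $[\chi]=\{t\chi\mid 0<t\in\mathbb{R}\}$, and let $S(G)=\{[\chi]\mid 0\neq\chi:G\to\mathbb{R}\}$ be the character sphere. For $K\leq G$, $S(G,K)=\{[\chi]\in S(G)\mid \chi|_K=0\}$. For a finitely generated group $G$, the Bieri-Neumann-Strebel invariant is $\Sigma^1(G)=\{[\chi]\in S(G)\mid G_\chi \text{ is of type } \mathrm{FP}_1\}$, where $G_\chi$ is the monoid $\{g\in G\mid\chi(g)\geq 0\}$ and type $\mathrm{FP}_1$ means that the trivial $\mathbb{Z}G_\chi$-module $\mathbb{Z}$ has a resolution by projective $\mathbb{Z}G_\chi$-modules which are finitely generated in degrees $0$ and $1$. $\Sigma^1(G)^c=S(G)\setminus\Sigma^1(G)$. *)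

theory Defs
  imports Complex_Main "HOL-Algebra.Generated_Groups" "HOL-Algebra.Module"
begin

section \<open>Finitely presented groups\<close>

text \<open>A letter \<open>(x, True)\<close> stands for the generator \<open>x\<close>, a letter \<open>(x, False)\<close> for its formal inverse.\<close>

type_synonym 'x word = "('x \<times> bool) list"

definition words :: "'x set \<Rightarrow> 'x word set" where
  "words X = lists (X \<times> UNIV)"

inductive_set presentation_rel :: "'x set \<Rightarrow> 'x word set \<Rightarrow> ('x word \<times> 'x word) set"
  for X :: "'x set" and R :: "'x word set" where
  refl: "u \<in> words X \<Longrightarrow> (u, u) \<in> presentation_rel X R"
| sym: "(u, v) \<in> presentation_rel X R \<Longrightarrow> (v, u) \<in> presentation_rel X R"
| trans: "(u, v) \<in> presentation_rel X R \<Longrightarrow> (v, w) \<in> presentation_rel X R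
    \<Longrightarrow> (u, w) \<in> presentation_rel X R"
| cancel: "u \<in> words X \<Longrightarrow> v \<in> words X \<Longrightarrow> x \<in> X
    \<Longrightarrow> (u @ [(x, b), (x, \<not> b)] @ v, u @ v) \<in> presentation_rel X R"
| relator: "u \<in> words X \<Longrightarrow> v \<in> words X \<Longrightarrow> r \<in> R \<Longrightarrow> r \<in> words X
    \<Longrightarrow> (u @ r @ v, u @ v) \<in> presentation_rel X R"

text \<open>The group \<open>\<langle>X | R\<rangle>\<close>, realised as words modulo \<^const>\<open>presentation_rel\<close>; the product of
  the classes of \<open>u\<close> and \<open>v\<close> is the class of \<open>u @ v\<close>.\<close>

definition presented_group :: "'x set \<Rightarrow> 'x word set \<Rightarrow> 'x word set monoid" where
  "presented_group X R =
    \<lparr>carrier = words X // presentation_rel X R,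
     mult = (\<lambda>A B. \<Union>u\<in>A. \<Union>v\<in>B. presentation_rel X R `` {u @ v}),
     one = presentation_rel X R `` {[]}\<rparr>"

definition finitely_presented :: "('a, 'b) monoid_scheme \<Rightarrow> bool" where
  "finitely_presented G \<longleftrightarrow>
    (\<exists>(X :: nat set) R. finite X \<and> finite R \<and> R \<subseteq> words X \<and> presented_group X R \<cong> G)"


section \<open>Commutator subgroup, torsion-free rank and fibre products\<close>

abbreviation commutator_subgroup :: "('a, 'b) monoid_scheme \<Rightarrow> 'a set" where
  "commutator_subgroup G \<equiv> derived G (carrier G)"

definition int_independent :: "('a, 'b) monoid_scheme \<Rightarrow> 'a set \<Rightarrow> bool" where
  "int_independent A S \<longleftrightarrow> S \<subseteq> carrier A \<and> finite S \<and>
    (\<forall>c :: 'a \<Rightarrow> int. finprod A (\<lambda>s. s [^]\<^bsub>A\<^esub> c s) S = \<one>\<^bsub>A\<^esub> \<longrightarrow> (\<forall>s\<in>S. c s = 0))"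

text \<open>Maximal size of a \<open>\<int>\<close>-independent set. Meaningful only when these sizes are bounded, in
  particular for finitely generated abelian groups.\<close>

definition torsion_free_rank :: "('a, 'b) monoid_scheme \<Rightarrow> nat" where
  "torsion_free_rank A = Sup {card S | S. int_independent A S}"

definition fibre_product ::
    "('a, 'b) monoid_scheme \<Rightarrow> 'a set \<Rightarrow> ('a set \<Rightarrow> 'a set) \<Rightarrow> ('a \<times> 'a) set" where
  "fibre_product G N \<mu> =
    {(g1, g2) \<in> carrier G \<times> carrier G. \<mu> (N #>\<^bsub>G\<^esub> g1) = N #>\<^bsub>G\<^esub> g2}"

definition is_commutator_fibre_product :: "('a, 'b) monoid_scheme \<Rightarrow> ('a \<times> 'a) set \<Rightarrow> bool" where
  "is_commutator_fibre_product G H \<longleftrightarrow>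
    (\<exists>\<mu> \<in> iso (G Mod commutator_subgroup G) (G Mod commutator_subgroup G).
       H = fibre_product G (commutator_subgroup G) \<mu>)"


section \<open>Modules over a not necessarily commutative ring\<close>

text \<open>The library locale for modules requires a commutative ring of scalars. As there, the fields
  \<^const>\<open>mult\<close> and \<^const>\<open>one\<close> of a module record are irrelevant.\<close>

locale left_module = R?: ring R + M?: abelian_group M
  for R :: "('r, 's) ring_scheme" (structure) and M :: "('r, 'm, 't) module_scheme" (structure) +
  assumes smult_closed: "\<lbrakk>a \<in> carrier R; x \<in> carrier M\<rbrakk> \<Longrightarrow> a \<odot>\<^bsub>M\<^esub> x \<in> carrier M"
    and smult_l_distr: "\<lbrakk>a \<in> carrier R; b \<in> carrier R; x \<in> carrier M\<rbrakk>
      \<Longrightarrow> (a \<oplus>\<^bsub>R\<^esub> b) \<odot>\<^bsub>M\<^esub> x = a \<odot>\<^bsub>M\<^esub> x \<oplus>\<^bsub>M\<^esub> b \<odot>\<^bsub>M\<^esub> x"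
    and smult_r_distr: "\<lbrakk>a \<in> carrier R; x \<in> carrier M; y \<in> carrier M\<rbrakk>
      \<Longrightarrow> a \<odot>\<^bsub>M\<^esub> (x \<oplus>\<^bsub>M\<^esub> y) = a \<odot>\<^bsub>M\<^esub> x \<oplus>\<^bsub>M\<^esub> a \<odot>\<^bsub>M\<^esub> y"
    and smult_assoc: "\<lbrakk>a \<in> carrier R; b \<in> carrier R; x \<in> carrier M\<rbrakk>
      \<Longrightarrow> (a \<otimes>\<^bsub>R\<^esub> b) \<odot>\<^bsub>M\<^esub> x = a \<odot>\<^bsub>M\<^esub> (b \<odot>\<^bsub>M\<^esub> x)"
    and smult_one: "x \<in> carrier M \<Longrightarrow> \<one>\<^bsub>R\<^esub> \<odot>\<^bsub>M\<^esub> x = x"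

definition left_module_hom ::
    "('r, 's) ring_scheme \<Rightarrow> ('r, 'm, 't) module_scheme \<Rightarrow> ('r, 'n, 'u) module_scheme \<Rightarrow> ('m \<Rightarrow> 'n) set"
  where
  "left_module_hom R M N =
    {f \<in> carrier M \<rightarrow> carrier N.
      (\<forall>x\<in>carrier M. \<forall>y\<in>carrier M. f (x \<oplus>\<^bsub>M\<^esub> y) = f x \<oplus>\<^bsub>N\<^esub> f y) \<and>
      (\<forall>a\<in>carrier R. \<forall>x\<in>carrier M. f (a \<odot>\<^bsub>M\<^esub> x) = a \<odot>\<^bsub>N\<^esub> f x)}"

definition fg_module :: "('r, 's) ring_scheme \<Rightarrow> ('r, 'm, 't) module_scheme \<Rightarrow> bool" where
  "fg_module R M \<longleftrightarrow>
    (\<exists>S. finite S \<and> S \<subseteq> carrier M \<and>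
      (\<forall>x\<in>carrier M. \<exists>a \<in> S \<rightarrow> carrier R. x = finsum M (\<lambda>s. a s \<odot>\<^bsub>M\<^esub> s) S))"

text \<open>The free module \<open>R\<^sup>(\<^sup>X\<^sup>)\<close> of finitely supported functions from \<open>X\<close> to \<open>R\<close>.\<close>

definition free_module :: "('r, 's) ring_scheme \<Rightarrow> 'x set \<Rightarrow> ('r, 'x \<Rightarrow> 'r) module" where
  "free_module R X =
    \<lparr>carrier = {f. (\<forall>x. f x \<in> carrier R) \<and> {x. f x \<noteq> \<zero>\<^bsub>R\<^esub>} \<subseteq> X \<and> finite {x. f x \<noteq> \<zero>\<^bsub>R\<^esub>}},
     mult = undefined, one = undefined,
     zero = (\<lambda>_. \<zero>\<^bsub>R\<^esub>), add = (\<lambda>f g x. f x \<oplus>\<^bsub>R\<^esub> g x),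
     smult = (\<lambda>a f x. a \<otimes>\<^bsub>R\<^esub> f x)\<rparr>"

text \<open>Projective means direct summand of a free module. It is no restriction to let the basis \<open>X\<close>
  consist of elements of the type of \<open>P\<close>: a direct summand \<open>P\<close> of a free module is also
  one of the free module on the set \<open>carrier P\<close>.\<close>

definition projective_module :: "('r, 's) ring_scheme \<Rightarrow> ('r, 'm, 't) module_scheme \<Rightarrow> bool" where
  "projective_module R P \<longleftrightarrow> left_module R P \<and>
    (\<exists>X :: 'm set. \<exists>i \<in> left_module_hom R P (free_module R X).
       \<exists>p \<in> left_module_hom R (free_module R X) P. \<forall>x\<in>carrier P. p (i x) = x)"

definition projective_resolution ::
    "('r, 's) ring_scheme \<Rightarrow> ('r, 'n, 't) module_scheme \<Rightarrow> (nat \<Rightarrow> ('r, 'm) module)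
      \<Rightarrow> (nat \<Rightarrow> 'm \<Rightarrow> 'm) \<Rightarrow> ('m \<Rightarrow> 'n) \<Rightarrow> bool" where
  "projective_resolution R M P d e \<longleftrightarrow> left_module R M \<and>
    (\<forall>n. projective_module R (P n)) \<and>
    e \<in> left_module_hom R (P 0) M \<and>
    (\<forall>n. d n \<in> left_module_hom R (P (Suc n)) (P n)) \<and>
    e ` carrier (P 0) = carrier M \<and>
    d 0 ` carrier (P 1) = {x \<in> carrier (P 0). e x = \<zero>\<^bsub>M\<^esub>} \<and>
    (\<forall>n. d (Suc n) ` carrier (P (Suc (Suc n))) = {x \<in> carrier (P (Suc n)). d n x = \<zero>\<^bsub>P n\<^esub>})"

text \<open>Type \<open>FP\<^sub>k\<close>. The modules of the resolution are taken with carriers in the type \<open>nat \<Rightarrow> 'r\<close>.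
  This is no restriction for a nonzero ring \<open>R\<close>: if \<open>M\<close> has any projective resolution finitely
  generated up to degree \<open>k\<close>, it has a free one of this kind all of whose terms have
  cardinality at most that of \<open>R \<times> \<nat>\<close>, and these can be transported to \<open>nat \<Rightarrow> 'r\<close>.\<close>

definition type_FP :: "nat \<Rightarrow> ('r, 's) ring_scheme \<Rightarrow> ('r, 'n, 't) module_scheme \<Rightarrow> bool" where
  "type_FP k R M \<longleftrightarrow>
    (\<exists>(P :: nat \<Rightarrow> ('r, nat \<Rightarrow> 'r) module) d e.
       projective_resolution R M P d e \<and> (\<forall>n\<le>k. fg_module R (P n)))"


section \<open>Monoid rings\<close>

definition monoid_ring :: "('a, 'b) monoid_scheme \<Rightarrow> ('a \<Rightarrow> int) ring" where
  "monoid_ring M =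
    \<lparr>carrier = {f. {x. f x \<noteq> 0} \<subseteq> carrier M \<and> finite {x. f x \<noteq> 0}},
     mult = (\<lambda>f g z. \<Sum>(x, y) \<in> {(x, y). f x \<noteq> 0 \<and> g y \<noteq> 0 \<and> x \<otimes>\<^bsub>M\<^esub> y = z}. f x * g y),
     one = (\<lambda>z. if z = \<one>\<^bsub>M\<^esub> then 1 else 0),
     zero = (\<lambda>_. 0), add = (\<lambda>f g z. f z + g z)\<rparr>"

text \<open>The module \<open>\<int>\<close> on which every element of the monoid acts as the identity; the ring acts
  through the augmentation.\<close>

definition trivial_module :: "('a \<Rightarrow> int, int) module" where
  "trivial_module =
    \<lparr>carrier = UNIV, mult = undefined, one = undefined, zero = 0, add = (+),
     smult = (\<lambda>f n. (\<Sum>x | f x \<noteq> 0. f x) * n)\<rparr>"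

definition monoid_type_FP :: "nat \<Rightarrow> ('a, 'b) monoid_scheme \<Rightarrow> bool" where
  "monoid_type_FP k M \<longleftrightarrow> type_FP k (monoid_ring M) trivial_module"


section \<open>Characters and the Bieri-Neumann-Strebel invariant\<close>

text \<open>Characters are extensional, so that each is determined by its values on \<open>G\<close>.\<close>

definition characters :: "('a, 'b) monoid_scheme \<Rightarrow> ('a \<Rightarrow> real) set" where
  "characters G = {\<chi> \<in> extensional (carrier G).
     \<forall>g\<in>carrier G. \<forall>h\<in>carrier G. \<chi> (g \<otimes>\<^bsub>G\<^esub> h) = \<chi> g + \<chi> h}"

definition nonzero_characters :: "('a, 'b) monoid_scheme \<Rightarrow> ('a \<Rightarrow> real) set" where
  "nonzero_characters G = {\<chi> \<in> characters G. \<exists>g\<in>carrier G. \<chi> g \<noteq> 0}"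

definition character_class :: "('a, 'b) monoid_scheme \<Rightarrow> ('a \<Rightarrow> real) \<Rightarrow> ('a \<Rightarrow> real) set" where
  "character_class G \<chi> = {(\<lambda>g\<in>carrier G. t * \<chi> g) | t. 0 < t}"

definition character_sphere :: "('a, 'b) monoid_scheme \<Rightarrow> ('a \<Rightarrow> real) set set" where
  "character_sphere G = {character_class G \<chi> | \<chi>. \<chi> \<in> nonzero_characters G}"

definition character_subsphere :: "('a, 'b) monoid_scheme \<Rightarrow> 'a set \<Rightarrow> ('a \<Rightarrow> real) set set" where
  "character_subsphere G K =
    {character_class G \<chi> | \<chi>. \<chi> \<in> nonzero_characters G \<and> (\<forall>k\<in>K. \<chi> k = 0)}"

definition character_monoid :: "('a, 'b) monoid_scheme \<Rightarrow> ('a \<Rightarrow> real) \<Rightarrow> ('a, 'b) monoid_scheme" where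
  "character_monoid G \<chi> = G\<lparr>carrier := {g \<in> carrier G. \<chi> g \<ge> 0}\<rparr>"

definition BNS_invariant :: "('a, 'b) monoid_scheme \<Rightarrow> ('a \<Rightarrow> real) set set" where
  "BNS_invariant G =
    {character_class G \<chi> | \<chi>. \<chi> \<in> nonzero_characters G \<and> monoid_type_FP 1 (character_monoid G \<chi>)}"

end

(* A character lies in Sigma^1(G) iff its half-space in the Cayley graph of G is connected; the
   augmentation ideal of the monoid ring translates FP_1 into this.

   Necessity: let chi1 and chi2 be characters of the two factors that cancel on the fibre product H, and
   suppose neither half-space is connected. Each yields a word in generators of H that represents an
   element of one copy of G' and leaves a component of its half-space. The commutator of the two words
   is trivial in H, but an edge labelling by involutions with trivial holonomy around all relators has
   nontrivial holonomy around it, so H is not finitely presented. If 2 rk K/G' < rk G/G', a nonzero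
   character vanishes on both K and its image under mu, which gives such a pair.

   Sufficiency: a generic unipotent shear mu of the coordinates of G/G' leaves no nonzero character
   vanishing on both K and the image of K', for any K, K'. Then every character direction of G x G modulo H
   is half-connected on one factor, and by compactness of the sphere finitely many pushing moves carry
   paths and loops of G x G into a bounded neighbourhood of H. This neighbourhood consists of finitely
   many cosets of H, and the Reidemeister-Schreier process gives a finite presentation. *)
theory Submission
  imports Defs "HOL-Analysis.L2_Norm" "HOL-Analysis.Function_Topology" "HOL-Computational_Algebra.Polynomial"
begin

section \<open>Words, paths and presentations\<close>

text \<open>Simple connectivity is never expressed through a 2-complex. It is tested by edge
  labellings with values in the self-maps of some type that are trivial on all closed paths of
  length at most \<open>d\<close>: a loop counts as filled if every such labelling has trivial
  holonomy around it. One language thus serves both directions. Necessity exhibits a single bad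
  labelling; sufficiency feeds the labelling by the action of rewritten edges on representatives of
  words to a simply connected ball.

  Pushing along a letter \<open>t\<close> lengthens the relators of the factor of \<open>t\<close>,
  so that flatness no longer covers them. A letter \<open>z\<close> of the other factor commutes
  with such a relator and moves it, unchanged in length, to a place where it is flat; only there is
  it pushed. Hence in each direction one half-connected character is enough, provided that the other
  one is nonzero.

  The factor 2 in the rank condition comes from the shear: it adds multiples of a set
  \<open>V\<close> of \<open>n div 2\<close> vectors on which its functionals vanish, and
  \<open>V\<close> must complement the coordinate vectors of every K to full rank.\<close>

lemma words_Nil [simp]: "[] \<in> words X"
  by (simp add: words_def)

lemma words_Cons [simp]: "s # w \<in> words X \<longleftrightarrow> fst s \<in> X & w \<in> words X"
  by (cases s) (auto simp: words_def)

lemma words_append [simp]: "u @ v \<in> words X \<longleftrightarrow> u \<in> words X & v \<in> words X"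
  by (auto simp: words_def)

lemma words_replicate: "fst s \<in> X ==> replicate n s \<in> words X"
  by (induction n) auto

lemma words_take: "w \<in> words X ==> take i w \<in> words X"
  by (metis append_take_drop_id words_append)

lemma words_iff: "w \<in> words X \<longleftrightarrow> (\<forall>s\<in>set w. fst s \<in> X)"
  by (induction w) auto

lemma finite_words_length: "finite X ==> finite {w \<in> words X. length w \<le> n}"
  using finite_lists_length_le[of "X \<times> (UNIV :: bool set)" n]
  by (simp add: words_def in_lists_conv_set subset_iff Ball_def conj_commute)

definition inv_letter :: "'x \<times> bool => 'x \<times> bool" where
  "inv_letter s = (fst s, \<not> snd s)"

definition inv_word :: "'x word => 'x word" where
  "inv_word w = rev (map inv_letter w)"

lemma fst_inv_letter [simp]: "fst (inv_letter s) = fst s"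
  by (simp add: inv_letter_def)

lemma inv_letter_inv_letter [simp]: "inv_letter (inv_letter s) = s"
  by (simp add: inv_letter_def)

lemma inv_word_Nil [simp]: "inv_word [] = []"
  by (simp add: inv_word_def)

lemma inv_word_Cons [simp]: "inv_word (s # w) = inv_word w @ [inv_letter s]"
  by (simp add: inv_word_def)

lemma inv_word_append [simp]: "inv_word (u @ v) = inv_word v @ inv_word u"
  by (simp add: inv_word_def)

lemma inv_word_inv_word [simp]: "inv_word (inv_word w) = w"
  by (induction w) auto

lemma length_inv_word [simp]: "length (inv_word w) = length w"
  by (simp add: inv_word_def)

lemma inv_word_words [simp]: "inv_word w \<in> words X \<longleftrightarrow> w \<in> words X"
  by (induction w) auto

lemma presentation_rel_words:
  "(u, v) \<in> presentation_rel X R ==> u \<in> words X & v \<in> words X"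
  by (induction rule: presentation_rel.induct) auto

lemma presentation_rel_cong_aux:
  "(u, v) \<in> presentation_rel X R ==> a \<in> words X ==> b \<in> words X
    ==> (a @ u @ b, a @ v @ b) \<in> presentation_rel X R"
proof (induction rule: presentation_rel.induct)
  case (refl u)
  then show ?case by (intro presentation_rel.refl) auto
next
  case (cancel u v x c)
  then show ?case
    using presentation_rel.cancel[of "a @ u" X "v @ b" x c R] by auto
next
  case (relator u v r)
  then show ?case
    using presentation_rel.relator[of "a @ u" X "v @ b" r R] by auto
qed (blast intro: presentation_rel.sym presentation_rel.trans)+

lemma presentation_rel_cong:
  assumes "(u, u') \<in> presentation_rel X R" "(v, v') \<in> presentation_rel X R"
  shows "(u @ v, u' @ v') \<in> presentation_rel X R"
  using presentation_rel_cong_aux[OF assms(1), of "[]" v]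
    presentation_rel_cong_aux[OF assms(2), of u' "[]"]
    presentation_rel_words[OF assms(1)] presentation_rel_words[OF assms(2)]
  by (auto intro: presentation_rel.trans)

lemma presentation_rel_inv_left: "w \<in> words X ==> (inv_word w @ w, []) \<in> presentation_rel X R"
proof (induction w)
  case Nil
  then show ?case by (simp add: presentation_rel.refl)
next
  case (Cons s w)
  have "(inv_word w @ [(fst s, \<not> snd s), (fst s, \<not> \<not> snd s)] @ w, inv_word w @ w) \<in> presentation_rel X R"
    using Cons.prems by (intro presentation_rel.cancel) auto
  then show ?case
    using Cons by (auto simp: inv_letter_def intro: presentation_rel.trans)
qed

definition map_word :: "('x => 'y) => 'x word => 'y word" where
  "map_word \<phi> w = map (apfst \<phi>) w"

lemma map_word_Nil [simp]: "map_word \<phi> [] = []"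
  by (simp add: map_word_def)

lemma map_word_Cons [simp]: "map_word \<phi> (s # w) = (\<phi> (fst s), snd s) # map_word \<phi> w"
  by (cases s) (simp add: map_word_def)

lemma map_word_append [simp]: "map_word \<phi> (u @ v) = map_word \<phi> u @ map_word \<phi> v"
  by (simp add: map_word_def)

lemma length_map_word [simp]: "length (map_word \<phi> w) = length w"
  by (simp add: map_word_def)

lemma map_word_words: "w \<in> words X ==> map_word \<phi> w \<in> words (\<phi> ` X)"
  by (induction w) auto

lemma words_imageE:
  assumes "w \<in> words (\<phi> ` X)"
  obtains w' where "w' \<in> words X" "w = map_word \<phi> w'"
proof -
  have "\<exists>w'. w' \<in> words X & w = map_word \<phi> w'"
    using assms
  proof (induction w)
    case (Cons s w)
    then obtain x w' where "x \<in> X" "fst s = \<phi> x" "w' \<in> words X" "w = map_word \<phi> w'"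
      by auto
    then show ?case by (intro exI[of _ "(x, snd s) # w'"]) (auto simp: prod_eq_iff)
  qed (auto intro: exI[of _ "[]"])
  then show thesis using that by blast
qed

text \<open>Relabelling of generators serves twice: to number generators by natural numbers, and to
  carry the presentation of \<open>G\<close> over to either factor of
  \<open>G \<times>\<times> G\<close>.\<close>

lemma presentation_rel_map:
  "(u, v) \<in> presentation_rel X R
    ==> (map_word \<phi> u, map_word \<phi> v) \<in> presentation_rel (\<phi> ` X) (map_word \<phi> ` R)"
proof (induction rule: presentation_rel.induct)
  case (cancel u v x b)
  then show ?case
    using presentation_rel.cancel[of "map_word \<phi> u" "\<phi> ` X" "map_word \<phi> v" "\<phi> x" b "map_word \<phi> ` R"]
    by (auto simp: map_word_words)
next
  case (relator u v r)
  then show ?case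
    using presentation_rel.relator[of "map_word \<phi> u" "\<phi> ` X" "map_word \<phi> v" "map_word \<phi> r"
        "map_word \<phi> ` R"]
    by (auto simp: map_word_words)
qed (auto intro: presentation_rel.intros map_word_words)

section \<open>Evaluation, paths and holonomy in the Cayley graph\<close>

definition letter_val :: "('a, 'b) monoid_scheme => ('x => 'a) => 'x \<times> bool => 'a" where
  "letter_val G f s = (if snd s then f (fst s) else inv\<^bsub>G\<^esub> f (fst s))"

primrec word_val :: "('a, 'b) monoid_scheme => ('x => 'a) => 'x word => 'a" where
  "word_val G f [] = \<one>\<^bsub>G\<^esub>"
| "word_val G f (s # w) = letter_val G f s \<otimes>\<^bsub>G\<^esub> word_val G f w"

primrec path_in :: "('a, 'b) monoid_scheme => ('x => 'a) => 'a set => 'a => 'x word => bool" where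
  "path_in G f W g [] \<longleftrightarrow> g \<in> W"
| "path_in G f W g (s # w) \<longleftrightarrow> g \<in> W & path_in G f W (g \<otimes>\<^bsub>G\<^esub> letter_val G f s) w"

text \<open>A labelling \<open>L\<close> attaches a self-map of \<open>'k\<close> to each oriented
  edge, like a connection on the Cayley graph; the holonomy is its parallel transport. Concatenation
  of paths becomes composition from left to right.\<close>

primrec holonomy ::
    "('a, 'b) monoid_scheme => ('x => 'a) => ('a => 'x \<times> bool => 'k => 'k) => 'a => 'x word => 'k => 'k" where
  "holonomy G f L g [] = id"
| "holonomy G f L g (s # w) = L g s \<circ> holonomy G f L (g \<otimes>\<^bsub>G\<^esub> letter_val G f s) w"

lemma path_in_mono: "path_in G f W g w ==> W \<subseteq> W' ==> path_in G f W' g w"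
  by (induction w arbitrary: g) auto

lemma path_in_start: "path_in G f W g w ==> g \<in> W"
  by (cases w) auto

locale generators = group G for G (structure) +
  fixes X :: "'x set" and f :: "'x => 'a"
  assumes generator_closed: "x \<in> X ==> f x \<in> carrier G"
begin

abbreviation lv where "lv \<equiv> letter_val G f"
abbreviation wv where "wv \<equiv> word_val G f"
abbreviation path where "path \<equiv> path_in G f"
abbreviation hol where "hol \<equiv> holonomy G f"

text \<open>The closed paths of length at most \<open>d\<close> inside \<open>W\<close> play the
  role of 2-cells. Testing a loop against all labellings that are trivial on them stands in for
  asking whether it bounds. Every base point \<open>g\<close> is quantified because \<open>W\<close>
  need not be invariant under translation.\<close>

definition flat :: "nat => 'a set => ('a => 'x \<times> bool => 'k => 'k) => bool" where
  "flat d W L \<longleftrightarrow> (\<forall>g\<in>carrier G. \<forall>w\<in>words X. length w \<le> d --> path W g w --> g \<otimes> wv w = g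
      --> hol L g w = id)"

lemma inv_mult_cancel [simp]:
  "x \<in> carrier G ==> y \<in> carrier G ==> inv x \<otimes> (x \<otimes> y) = y"
  "x \<in> carrier G ==> y \<in> carrier G ==> x \<otimes> (inv x \<otimes> y) = y"
  by (simp_all add: m_assoc[symmetric])

lemma letter_val_closed [simp]: "fst s \<in> X ==> lv s \<in> carrier G"
  by (auto simp: letter_val_def generator_closed)

lemma word_val_closed [simp]: "w \<in> words X ==> wv w \<in> carrier G"
  by (induction w) auto

lemma word_val_append [simp]:
  "u \<in> words X ==> v \<in> words X ==> wv (u @ v) = wv u \<otimes> wv v"
  by (induction u) (auto simp: m_assoc)

lemma letter_val_inv [simp]: "fst s \<in> X ==> lv (inv_letter s) = inv (lv s)"
  by (auto simp: letter_val_def inv_letter_def generator_closed)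

lemma word_val_inv [simp]: "w \<in> words X ==> wv (inv_word w) = inv (wv w)"
  by (induction w) (auto simp: inv_mult_group)

lemma presentation_rel_val:
  assumes "!!r. r \<in> R ==> wv r = \<one>" "(u, v) \<in> presentation_rel X R"
  shows "wv u = wv v"
  using assms(2)
proof (induction rule: presentation_rel.induct)
  case (cancel u v x b)
  have "wv [(x, b), (x, \<not> b)] = \<one>"
    using cancel by (auto simp: letter_val_def generator_closed)
  moreover have "wv (u @ [(x, b), (x, \<not> b)] @ v) = wv u \<otimes> (wv [(x, b), (x, \<not> b)] \<otimes> wv v)"
    using cancel word_val_append[of u "[(x, b), (x, \<not> b)] @ v"]
      word_val_append[of "[(x, b), (x, \<not> b)]" v] by (simp del: word_val.simps)
  ultimately show ?case using cancel by simp
qed (use assms in auto)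

lemma path_append:
  "g \<in> carrier G ==> u \<in> words X ==> v \<in> words X
    ==> path W g (u @ v) \<longleftrightarrow> path W g u & path W (g \<otimes> wv u) v"
  by (induction u arbitrary: g) (auto simp: m_assoc path_in_start)

lemma path_end: "g \<in> carrier G ==> w \<in> words X ==> path W g w ==> g \<otimes> wv w \<in> W"
  using path_append[of g w "[]" W] by auto

lemma path_inv:
  "g \<in> carrier G ==> w \<in> words X ==> path W (g \<otimes> wv w) (inv_word w) \<longleftrightarrow> path W g w"
proof (induction w arbitrary: g)
  case (Cons s w)
  then show ?case
    using path_append[of "g \<otimes> lv s \<otimes> wv w" "inv_word w" "[inv_letter s]" W]
      Cons.IH[of "g \<otimes> lv s"] by (auto simp: m_assoc path_in_start)
qed auto

lemma path_iff_prefixes: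
  "g \<in> carrier G ==> w \<in> words X
    ==> path W g w \<longleftrightarrow> (\<forall>i\<le>length w. g \<otimes> wv (take i w) \<in> W)"
proof (induction w arbitrary: g)
  case (Cons s w)
  have "(\<forall>i\<le>Suc n. P i) \<longleftrightarrow> P 0 & (\<forall>i\<le>n. P (Suc i))" for n and P :: "nat => bool"
    by (metis Suc_le_mono le0 not0_implies_Suc)
  then show ?case
    using Cons by (auto simp: m_assoc words_take)
qed auto

lemma path_translate:
  "k \<in> carrier G ==> g \<in> carrier G ==> w \<in> words X
    ==> path W (k \<otimes> g) w \<longleftrightarrow> path {x. k \<otimes> x \<in> W} g w"
  by (induction w arbitrary: g) (auto simp: m_assoc)

lemma holonomy_append:
  "g \<in> carrier G ==> u \<in> words X ==> v \<in> words X
    ==> hol L g (u @ v) = hol L g u \<circ> hol L (g \<otimes> wv u) v"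
  by (induction u arbitrary: g) (auto simp: m_assoc o_assoc)

lemma flatD:
  "flat d W L ==> g \<in> carrier G ==> w \<in> words X ==> length w \<le> d ==> path W g w ==> wv w = \<one>
    ==> hol L g w = id"
  by (auto simp: flat_def)

lemma closed_word_val: "g \<in> carrier G ==> w \<in> words X ==> g \<otimes> wv w = g \<longleftrightarrow> wv w = \<one>"
  using r_cancel_one' by (metis l_cancel_one r_cancel_one r_one word_val_closed l_cancel_one')

text \<open>Backtracks have length 2, so \<open>2 \<le> d\<close> makes opposite edges carry
  mutually inverse labels, although labels are not assumed bijective.\<close>

lemma flat_inv:
  assumes "flat d W L" "2 \<le> d" "g \<in> carrier G" "w \<in> words X" "path W g w"
  shows "hol L g w \<circ> hol L (g \<otimes> wv w) (inv_word w) = id"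
  using assms(3-5)
proof (induction w arbitrary: g)
  case (Cons s w)
  let ?h = "g \<otimes> lv s"
  have h: "?h \<in> carrier G" using Cons by simp
  have 1: "hol L g [s, inv_letter s] = id"
    using Cons.prems assms(2) path_in_start[of G f W ?h w]
    by (intro flatD[OF assms(1)]) (auto simp: m_assoc)
  have e: "?h \<otimes> wv w \<otimes> wv (inv_word w) = ?h"
    using Cons.prems by (simp add: m_assoc r_inv)
  have "hol L g (s # w) \<circ> hol L (g \<otimes> wv (s # w)) (inv_word (s # w))
     = L g s \<circ> (hol L ?h w \<circ> hol L (?h \<otimes> wv w) (inv_word w)) \<circ> L ?h (inv_letter s)"
    using Cons.prems h holonomy_append[of "?h \<otimes> wv w" "inv_word w" "[inv_letter s]" L] e
    by (simp add: m_assoc o_assoc)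
  also have "hol L ?h w \<circ> hol L (?h \<otimes> wv w) (inv_word w) = id"
    by (rule Cons.IH) (use Cons.prems h in auto)
  also have "L g s \<circ> id \<circ> L ?h (inv_letter s) = id"
    using 1 by simp
  finally show ?case .
qed auto

lemma flat_inv':
  assumes "flat d W L" "2 \<le> d" "g \<in> carrier G" "w \<in> words X" "path W g w"
  shows "hol L (g \<otimes> wv w) (inv_word w) \<circ> hol L g w = id"
  using flat_inv[OF assms(1,2), of "g \<otimes> wv w" "inv_word w"] assms(3-) path_inv[of g w W]
  by (auto simp: m_assoc r_inv)

text \<open>The path \<open>u\<close> followed by the reversed \<open>v\<close> is closed and of
  length at most \<open>d\<close>; the holonomy of the reversed \<open>v\<close> is then cancelled
  by \<open>flat_inv'\<close>.\<close>

lemma flat_eq: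
  assumes "flat d W L" "2 \<le> d" "g \<in> carrier G" "u \<in> words X" "v \<in> words X"
    and "path W g u" "path W g v" "wv u = wv v" "length u + length v \<le> d"
  shows "hol L g u = hol L g v"
proof -
  have "hol L g (u @ inv_word v) = id"
    using assms path_inv[of g v W]
    by (intro flatD[OF assms(1)]) (auto simp: path_append r_inv)
  then have 1: "hol L g u \<circ> hol L (g \<otimes> wv v) (inv_word v) = id"
    using assms by (simp add: holonomy_append)
  have "hol L g u = hol L g u \<circ> (hol L (g \<otimes> wv v) (inv_word v) \<circ> hol L g v)"
    using flat_inv'[OF assms(1,2), of g v] assms by simp
  also have "... = hol L g v"
    using 1 by (simp add: o_assoc)
  finally show ?thesis .
qed

end


section \<open>The presented group and its generators\<close>

definition word_class :: "'x set => 'x word set => 'x word => 'x word set" where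
  "word_class X R w = presentation_rel X R `` {w}"

lemma equiv_presentation_rel: "equiv (words X) (presentation_rel X R)"
  by (rule equivI)
    (auto simp: refl_on_def sym_def trans_def dest: presentation_rel_words intro: presentation_rel.intros)

lemma word_class_eq_iff:
  "u \<in> words X ==> v \<in> words X ==>
    word_class X R u = word_class X R v \<longleftrightarrow> (u, v) \<in> presentation_rel X R"
  unfolding word_class_def using eq_equiv_class_iff[OF equiv_presentation_rel] by blast

lemma presented_group_mult:
  assumes "u \<in> words X" "v \<in> words X"
  shows "word_class X R u \<otimes>\<^bsub>presented_group X R\<^esub> word_class X R v = word_class X R (u @ v)"
proof -
  have "word_class X R (u' @ v') = word_class X R (u @ v)"
    if "u' \<in> word_class X R u" "v' \<in> word_class X R v" for u' v'
  proof -
    have "(u, u') \<in> presentation_rel X R" "(v, v') \<in> presentation_rel X R"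
      using that by (auto simp: word_class_def)
    then have "(u @ v, u' @ v') \<in> presentation_rel X R"
      by (rule presentation_rel_cong)
    then show ?thesis
      using presentation_rel_words[of "u @ v" "u' @ v'" X R] word_class_eq_iff[of "u @ v" X "u' @ v'" R]
      by blast
  qed
  moreover have "u \<in> word_class X R u" "v \<in> word_class X R v"
    using assms by (auto simp: word_class_def intro: presentation_rel.refl)
  ultimately have "(\<Union>u'\<in>word_class X R u. \<Union>v'\<in>word_class X R v. word_class X R (u' @ v'))
      = word_class X R (u @ v)"
    by blast
  then show ?thesis
    by (simp add: presented_group_def word_class_def)
qed

lemma presented_group_carrier:
  "carrier (presented_group X R) = word_class X R ` words X"
  by (auto simp: presented_group_def quotient_def word_class_def)

lemma word_class_carrier: "u \<in> words X ==> word_class X R u \<in> carrier (presented_group X R)"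
  unfolding presented_group_carrier by (rule imageI)

lemma presented_group_one: "\<one>\<^bsub>presented_group X R\<^esub> = word_class X R []"
  by (simp add: presented_group_def word_class_def)

lemma group_presented_group: "group (presented_group X R)"
proof (rule groupI)
  let ?P = "presented_group X R"
  show "\<one>\<^bsub>?P\<^esub> \<in> carrier ?P"
    unfolding presented_group_carrier presented_group_one by (rule imageI) simp
  fix x assume "x \<in> carrier ?P"
  then obtain u where u: "u \<in> words X" "x = word_class X R u"
    by (auto simp: presented_group_carrier)
  show "\<one>\<^bsub>?P\<^esub> \<otimes>\<^bsub>?P\<^esub> x = x"
    using u presented_group_mult[of "[]" X u R] by (simp add: presented_group_one)
  have "word_class X R (inv_word u) \<otimes>\<^bsub>?P\<^esub> x = \<one>\<^bsub>?P\<^esub>"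
    using u by (simp add: presented_group_mult presented_group_one word_class_eq_iff presentation_rel_inv_left)
  moreover have "word_class X R (inv_word u) \<in> carrier ?P"
    unfolding presented_group_carrier using u by (intro imageI) simp
  ultimately show "\<exists>y\<in>carrier ?P. y \<otimes>\<^bsub>?P\<^esub> x = \<one>\<^bsub>?P\<^esub>"
    by blast
  fix y assume "y \<in> carrier ?P"
  then obtain v where v: "v \<in> words X" "y = word_class X R v"
    by (auto simp: presented_group_carrier)
  show "x \<otimes>\<^bsub>?P\<^esub> y \<in> carrier ?P"
    unfolding presented_group_carrier u v presented_group_mult[OF u(1) v(1)]
    using u v by (intro imageI) simp
  fix z assume "z \<in> carrier ?P"
  then obtain w where w: "w \<in> words X" "z = word_class X R w"
    by (auto simp: presented_group_carrier)
  show "x \<otimes>\<^bsub>?P\<^esub> y \<otimes>\<^bsub>?P\<^esub> z = x \<otimes>\<^bsub>?P\<^esub> (y \<otimes>\<^bsub>?P\<^esub> z)"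
    unfolding u v w using u(1) v(1) w(1) by (simp add: presented_group_mult)
qed

text \<open>The generator \<open>f x\<close> is the image of the class of a one-letter word under
  the isomorphism, so that evaluation in \<open>H\<close> agrees with the isomorphism on classes.
  Finite presentability is always used in this form.\<close>

lemma finitely_presentedE:
  assumes "group H" "finitely_presented H"
  obtains X :: "nat set" and R f where "finite X" "finite R" "R \<subseteq> words X" "generators H X f"
    "word_val H f ` words X = carrier H"
    "!!w. w \<in> words X ==> word_val H f w = \<one>\<^bsub>H\<^esub> \<longleftrightarrow> (w, []) \<in> presentation_rel X R"
proof -
  obtain X :: "nat set" and R where XR: "finite X" "finite R" "R \<subseteq> words X" "presented_group X R \<cong> H"
    using assms(2) by (auto simp: finitely_presented_def)
  let ?P = "presented_group X R"
  obtain \<phi> where \<phi>: "\<phi> \<in> iso ?P H"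
    using XR(4) by (auto simp: is_iso_def)
  interpret P: group ?P by (rule group_presented_group)
  interpret H: group H by (rule assms(1))
  interpret \<phi>: group_hom ?P H \<phi>
    using \<phi> by unfold_locales (simp add: iso_def)
  define f where "f x = \<phi> (word_class X R [(x, True)])" for x
  interpret H: generators H X f
    by unfold_locales (simp add: f_def word_class_carrier)
  have inv: "inv\<^bsub>?P\<^esub> word_class X R u = word_class X R (inv_word u)" if "u \<in> words X" for u
    using that by (intro P.inv_equality)
      (simp_all add: presented_group_mult word_class_carrier presented_group_one word_class_eq_iff
        presentation_rel_inv_left)
  have lv: "letter_val H f s = \<phi> (word_class X R [s])" if "fst s \<in> X" for s
  proof -
    have "inv\<^bsub>H\<^esub> \<phi> (word_class X R [(fst s, True)]) = \<phi> (word_class X R [(fst s, False)])"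
      using that inv[of "[(fst s, True)]"]
      by (subst \<phi>.hom_inv[symmetric]) (simp_all add: word_class_carrier inv_letter_def)
    then show ?thesis
      by (cases s) (auto simp: letter_val_def f_def)
  qed
  have wv: "word_val H f w = \<phi> (word_class X R w)" if "w \<in> words X" for w
    using that
  proof (induction w)
    case Nil
    then show ?case using \<phi>.hom_one by (simp add: presented_group_one)
  next
    case (Cons s w)
    then have "\<phi> (word_class X R [s]) \<otimes>\<^bsub>H\<^esub> \<phi> (word_class X R w) = \<phi> (word_class X R (s # w))"
      by (subst \<phi>.hom_mult[symmetric]) (simp_all add: word_class_carrier presented_group_mult)
    then show ?case using Cons by (simp add: lv)
  qed
  have "word_val H f ` words X = \<phi> ` carrier ?P"
    unfolding presented_group_carrier image_image by (rule image_cong) (simp_all add: wv)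
  also have "... = carrier H"
    using \<phi> by (simp add: iso_def bij_betw_def)
  finally have gen: "word_val H f ` words X = carrier H" .
  have "word_val H f w = \<one>\<^bsub>H\<^esub> \<longleftrightarrow> (w, []) \<in> presentation_rel X R" if w: "w \<in> words X" for w
  proof -
    have "word_val H f w = \<one>\<^bsub>H\<^esub> \<longleftrightarrow> \<phi> (word_class X R w) = \<phi> \<one>\<^bsub>?P\<^esub>"
      using w by (simp add: wv)
    also have "... \<longleftrightarrow> word_class X R w = word_class X R []"
      using \<phi> w by (subst inj_on_eq_iff[of \<phi> "carrier ?P"])
        (simp_all add: iso_def bij_betw_def word_class_carrier presented_group_one)
    also have "... \<longleftrightarrow> (w, []) \<in> presentation_rel X R"
      using w by (simp add: word_class_eq_iff)
    finally show ?thesis .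
  qed
  then show thesis
    using that[OF XR(1-3) H.generators_axioms gen] by blast
qed

lemma (in generators) presented_group_iso:
  assumes "R \<subseteq> words X" and one: "!!r. r \<in> R ==> wv r = \<one>"
    and gen: "carrier G \<subseteq> wv ` words X"
    and rel: "!!w. w \<in> words X ==> wv w = \<one> ==> (w, []) \<in> presentation_rel X R"
  shows "presented_group X R \<cong> G"
proof -
  let ?P = "presented_group X R"
  have iff: "wv u = wv v \<longleftrightarrow> (u, v) \<in> presentation_rel X R" if "u \<in> words X" "v \<in> words X" for u v
  proof
    assume "wv u = wv v"
    then have "(u @ inv_word v, []) \<in> presentation_rel X R"
      using that by (intro rel) (auto simp: r_inv)
    then have "(u @ inv_word v @ v, v) \<in> presentation_rel X R"
      using presentation_rel_cong[of "u @ inv_word v" "[]" X R v v] that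
      by (auto intro: presentation_rel.refl)
    moreover have "(u @ inv_word v @ v, u) \<in> presentation_rel X R"
      using presentation_rel_cong[of u u X R "inv_word v @ v" "[]"] that presentation_rel_inv_left[of v X R]
      by (auto intro: presentation_rel.refl)
    ultimately show "(u, v) \<in> presentation_rel X R"
      by (blast intro: presentation_rel.intros)
  qed (use presentation_rel_val one in blast)
  \<comment> \<open>A class is evaluated at a chosen representative; \<open>iff\<close> makes the
    choice immaterial.\<close>
  define \<phi> where "\<phi> A = wv (SOME w. w \<in> words X & A = word_class X R w)" for A
  have \<phi>: "\<phi> (word_class X R w) = wv w" if "w \<in> words X" for w
  proof -
    let ?v = "SOME v. v \<in> words X & word_class X R w = word_class X R v"
    have "?v \<in> words X & word_class X R w = word_class X R ?v"
      by (rule someI[of _ w]) (use that in auto)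
    then have "?v \<in> words X" "(w, ?v) \<in> presentation_rel X R"
      using word_class_eq_iff[OF that, of ?v R] by simp_all
    then have "wv w = wv ?v"
      using iff[OF that] by simp
    then show ?thesis
      by (simp add: \<phi>_def)
  qed
  have "\<phi> \<in> iso ?P G"
  proof (rule isoI)
    show "\<phi> \<in> hom ?P G"
    proof (rule homI)
      fix x assume "x \<in> carrier ?P"
      then obtain u where u: "u \<in> words X" "x = word_class X R u"
        by (auto simp: presented_group_carrier)
      then show "\<phi> x \<in> carrier G" by (simp add: \<phi>)
      fix y assume "y \<in> carrier ?P"
      then obtain v where "v \<in> words X" "y = word_class X R v"
        by (auto simp: presented_group_carrier)
      with u show "\<phi> (x \<otimes>\<^bsub>?P\<^esub> y) = \<phi> x \<otimes> \<phi> y"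
        by (simp add: presented_group_mult \<phi>)
    qed
    show "bij_betw \<phi> (carrier ?P) (carrier G)"
      unfolding bij_betw_def
    proof
      show "inj_on \<phi> (carrier ?P)"
      proof (rule inj_onI)
        fix x y assume "x \<in> carrier ?P" "y \<in> carrier ?P" and eq: "\<phi> x = \<phi> y"
        then obtain u v where "u \<in> words X" "x = word_class X R u" "v \<in> words X" "y = word_class X R v"
          by (auto simp: presented_group_carrier)
        then show "x = y"
          using eq iff[of u v] by (simp add: \<phi> word_class_eq_iff)
      qed
      show "\<phi> ` carrier ?P = carrier G"
      proof -
        have "\<phi> ` carrier ?P = wv ` words X"
          unfolding presented_group_carrier image_image by (rule image_cong) (simp_all add: \<phi>)
        also have "... = carrier G"
          using gen by auto
        finally show ?thesis .
      qed
    qed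
  qed
  then show ?thesis
    by (auto simp: is_iso_def)
qed

text \<open>The definition of finite presentability asks for generators in \<open>nat\<close>, so a
  finite generating set of any type is first numbered by an injection \<open>c\<close>.\<close>

lemma (in generators) finitely_presentedI:
  assumes "finite X" "finite R" "R \<subseteq> words X" and one: "!!r. r \<in> R ==> wv r = \<one>"
    and gen: "carrier G \<subseteq> wv ` words X"
    and rel: "!!w. w \<in> words X ==> wv w = \<one> ==> (w, []) \<in> presentation_rel X R"
  shows "finitely_presented G"
proof -
  obtain c :: "_ => nat" where c: "inj_on c X"
    using finite_imp_inj_to_nat_seg[OF assms(1)] by blast
  define f' where "f' = f \<circ> inv_into X c"
  interpret G': generators G "c ` X" f'
    using c by unfold_locales (auto simp: f'_def generator_closed)
  have lv: "letter_val G f' (c (fst s), snd s) = lv s" if "fst s \<in> X" for s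
    using that c by (simp add: letter_val_def f'_def)
  have wv: "word_val G f' (map_word c w) = wv w" if "w \<in> words X" for w
    using that by (induction w) (auto simp: lv)
  have "presented_group (c ` X) (map_word c ` R) \<cong> G"
  proof (rule G'.presented_group_iso)
    show "map_word c ` R \<subseteq> words (c ` X)"
      using assms(3) by (auto simp: map_word_words)
    show "word_val G f' r = \<one>" if "r \<in> map_word c ` R" for r
      using that assms(3) one by (auto simp: wv subset_iff)
    show "carrier G \<subseteq> word_val G f' ` words (c ` X)"
    proof
      fix g assume "g \<in> carrier G"
      then obtain w where w: "w \<in> words X" "g = wv w" using gen by auto
      show "g \<in> word_val G f' ` words (c ` X)"
        by (rule image_eqI[of _ _ "map_word c w"]) (simp_all add: w wv map_word_words)
    qed
    show "(w, []) \<in> presentation_rel (c ` X) (map_word c ` R)"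
      if "w \<in> words (c ` X)" "word_val G f' w = \<one>" for w
      using that(1)
    proof (rule words_imageE)
      fix w' assume w': "w' \<in> words X" "w = map_word c w'"
      then show ?thesis
        using rel[of w'] that(2) presentation_rel_map[of w' "[]" X R c] by (simp add: wv)
    qed
  qed
  moreover have "map_word c ` R \<subseteq> words (c ` X)"
    using assms(3) by (auto simp: map_word_words)
  ultimately show ?thesis
    unfolding finitely_presented_def
    by (intro exI[of _ "c ` X"] exI[of _ "map_word c ` R"]) (use assms(1,2) in simp)
qed

section \<open>Pushing paths in a product\<close>

context generators
begin

text \<open>The ball of radius \<open>k\<close> around \<open>x\<close> in the word metric of the
  Cayley graph.\<close>

definition near :: "'a => nat => 'a set" where
  "near x k = {x \<otimes> wv w |w. w \<in> words X & length w \<le> k}"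

lemma near_closed: "x \<in> carrier G ==> y \<in> near x k ==> y \<in> carrier G"
  by (auto simp: near_def)

lemma near_mono: "y \<in> near x k ==> k \<le> k' ==> y \<in> near x k'"
  by (auto simp: near_def intro: order_trans)

lemma near_word: "x \<in> carrier G ==> w \<in> words X ==> length w \<le> k ==> x \<otimes> wv w \<in> near x k"
  by (auto simp: near_def)

lemma near_step:
  assumes "x \<in> carrier G" "y \<in> near x k" "w \<in> words X" "k + length w \<le> k'"
  shows "y \<otimes> wv w \<in> near x k'"
proof -
  obtain u where "u \<in> words X" "length u \<le> k" "y = x \<otimes> wv u"
    using assms(2) by (auto simp: near_def)
  then show ?thesis
    using assms near_word[of x "u @ w" k'] by (simp add: m_assoc)
qed

lemma near_letter:
  "x \<in> carrier G ==> y \<in> near x k ==> fst s \<in> X ==> k < k' ==> y \<otimes> lv s \<in> near x k'"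
  using near_step[of x y k "[s]" k'] by simp

end

text \<open>An internal direct product of two presented groups: letters of \<open>X1\<close> and
  \<open>X2\<close> commute, and by \<open>factors_meet\<close> the subgroups that they generate
  meet trivially. The bound \<open>4 \<le> d\<close> makes each commutator of two letters a short
  closed path.\<close>

locale two_factors = generators G X f for G (structure) and X :: "'x set" and f +
  fixes X1 X2 :: "'x set" and R1 R2 :: "'x word set" and d :: nat
  assumes X_Un: "X = X1 \<union> X2" and X_disjoint: "X1 \<inter> X2 = {}"
    and letters_commute: "fst s \<in> X1 ==> fst s' \<in> X2
      ==> letter_val G f s \<otimes> letter_val G f s' = letter_val G f s' \<otimes> letter_val G f s"
    and relators1: "r \<in> R1 ==> r \<in> words X1 ==> word_val G f r = \<one> & length r \<le> d"
    and relators2: "r \<in> R2 ==> r \<in> words X2 ==> word_val G f r = \<one> & length r \<le> d"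
    and presentation1: "w \<in> words X1 ==> word_val G f w = \<one> ==> (w, []) \<in> presentation_rel X1 R1"
    and presentation2: "w \<in> words X2 ==> word_val G f w = \<one> ==> (w, []) \<in> presentation_rel X2 R2"
    and factors_meet: "u \<in> words X1 ==> v \<in> words X2 ==> word_val G f (u @ v) = \<one> ==> word_val G f u = \<one>"
    and d_ge: "4 \<le> d"

text \<open>The pushing data: the word \<open>c s\<close> leads from \<open>t\<close> to \<open>s t\<close>, so that right multiplication
  by \<open>t\<close> extends to paths. The letter \<open>z\<close> of the other factor moves loops of the first factor away.\<close>

locale pushing = two_factors G X f X1 X2 R1 R2 d for G (structure) and X :: "'x set" and f X1 X2 R1 R2 d +
  fixes t z :: "'x \<times> bool" and c :: "'x \<times> bool => 'x word" and \<epsilon> C :: real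
  assumes t_letter: "fst t \<in> X1" and z_letter: "fst z \<in> X2"
    and c_words: "fst s \<in> X1 ==> c s \<in> words X1"
    and c_val: "fst s \<in> X1 ==> letter_val G f t \<otimes> word_val G f (c s) = letter_val G f s \<otimes> letter_val G f t"
    and c_length: "fst s \<in> X1 ==> length (c s) + 3 \<le> d"
    and c_X2: "fst s \<in> X2 ==> c s = [s]"
    and eps_pos: "0 < \<epsilon>" and C_nonneg: "0 \<le> C"
begin

lemma X1_X: "fst s \<in> X1 ==> fst s \<in> X" and X2_X: "fst s \<in> X2 ==> fst s \<in> X"
  by (auto simp: X_Un)

lemma words_X1: "w \<in> words X1 ==> w \<in> words X" and words_X2: "w \<in> words X2 ==> w \<in> words X"
  by (auto simp: X_Un words_iff)

lemma t_X [simp]: "fst t \<in> X" and z_X [simp]: "fst z \<in> X"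
  using t_letter z_letter by (auto simp: X_Un)

lemma c_words_X [simp]: "fst s \<in> X ==> c s \<in> words X"
  using c_words[of s] c_X2[of s] by (auto simp: X_Un words_iff)

lemma c_val_X: "fst s \<in> X ==> lv t \<otimes> wv (c s) = lv s \<otimes> lv t"
  using c_val[of s] c_X2[of s] letters_commute[OF t_letter, of s] by (auto simp: X_Un)

lemma c_length_X: "fst s \<in> X ==> length (c s) + 3 \<le> d"
  using c_length c_X2[of s] d_ge by (cases "fst s \<in> X1") (auto simp: X_Un)

text \<open>Right multiplication by \<open>t\<close> is not a map of the Cayley graph. Replacing
  each letter \<open>s\<close> by the path \<open>c s\<close> repairs this: a path \<open>w\<close>
  from \<open>y\<close> corresponds to the path \<open>push w\<close> from \<open>y t\<close>, and
  by \<open>push_val\<close> the ends match.\<close>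

definition push :: "'x word => 'x word" where
  "push w = concat (map c w)"

lemma push_simps [simp]: "push [] = []" "push (s # w) = c s @ push w" "push (u @ v) = push u @ push v"
  by (simp_all add: push_def)

lemma push_words [simp]: "w \<in> words X ==> push w \<in> words X"
  by (induction w) auto

lemma push_words1: "w \<in> words X1 ==> push w \<in> words X1"
  by (induction w) (auto simp: c_words)

lemma push_words2: "w \<in> words X2 ==> push w = w"
  by (induction w) (auto simp: c_X2)

lemma push_val: "w \<in> words X ==> lv t \<otimes> wv (push w) = wv w \<otimes> lv t"
proof (induction w)
  case (Cons s w)
  have "lv t \<otimes> wv (push (s # w)) = lv t \<otimes> wv (c s) \<otimes> wv (push w)"
    using Cons by (simp add: m_assoc)
  also have "... = lv s \<otimes> (lv t \<otimes> wv (push w))"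
    using Cons.prems by (simp add: c_val_X m_assoc)
  finally show ?case using Cons by (simp add: m_assoc)
qed simp

abbreviation pushn where "pushn n \<equiv> push ^^ n"

lemma pushn_simps [simp]: "pushn n [] = []" "pushn n (u @ v) = pushn n u @ pushn n v"
  by (induction n) auto

lemma pushn_words [simp]: "w \<in> words X ==> pushn n w \<in> words X"
  and pushn_words1: "w \<in> words X1 ==> pushn n w \<in> words X1"
  and pushn_words2: "w \<in> words X2 ==> pushn n w = w"
  by (induction n) (auto simp: push_words1 push_words2)

definition tn where "tn n = wv (replicate n t)"
definition zn where "zn n = wv (replicate n z)"

lemma tn_closed [simp]: "tn n \<in> carrier G" and zn_closed [simp]: "zn n \<in> carrier G"
  by (simp_all add: tn_def zn_def words_replicate)

lemma tn_0 [simp]: "tn 0 = \<one>" and zn_0 [simp]: "zn 0 = \<one>"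
  by (simp_all add: tn_def zn_def)

lemma tn_Suc: "tn (Suc n) = tn n \<otimes> lv t" and zn_Suc: "zn (Suc n) = zn n \<otimes> lv z"
  using word_val_append[of "replicate n t" "[t]"] word_val_append[of "replicate n z" "[z]"]
  by (simp_all add: tn_def zn_def replicate_append_same words_replicate)

lemma pushn_val: "w \<in> words X ==> tn n \<otimes> wv (pushn n w) = wv w \<otimes> tn n"
proof (induction n)
  case (Suc n)
  have "tn (Suc n) \<otimes> wv (pushn (Suc n) w) = tn n \<otimes> (lv t \<otimes> wv (push (pushn n w)))"
    using Suc.prems by (simp add: tn_Suc m_assoc)
  also have "... = (tn n \<otimes> wv (pushn n w)) \<otimes> lv t"
    using Suc.prems by (simp add: push_val m_assoc)
  finally show ?case using Suc by (simp add: tn_Suc m_assoc)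
qed simp

lemma X1_words_commute:
  assumes "w \<in> words X1" "fst s \<in> X2"
  shows "wv w \<otimes> lv s = lv s \<otimes> wv w"
  using assms(1)
proof (induction w)
  case (Cons a w)
  have cl: "lv a \<in> carrier G" "wv w \<in> carrier G" "lv s \<in> carrier G"
    using Cons.prems assms(2) X1_X X2_X words_X1 by auto
  have "wv (a # w) \<otimes> lv s = lv a \<otimes> (lv s \<otimes> wv w)"
    using Cons cl by (simp add: m_assoc)
  also have "... = lv s \<otimes> wv (a # w)"
    using Cons.prems assms(2) cl letters_commute[of a s] by (simp add: m_assoc[symmetric])
  finally show ?case .
qed (use X2_X[OF assms(2)] in simp)

lemma tn_commute: "fst s \<in> X2 ==> tn n \<otimes> lv s = lv s \<otimes> tn n"
  unfolding tn_def using t_letter by (intro X1_words_commute words_replicate)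

lemma tn_zn: "tn n \<otimes> zn i = zn i \<otimes> tn n"
proof (induction i)
  case (Suc i)
  have "tn n \<otimes> zn (Suc i) = zn i \<otimes> (tn n \<otimes> lv z)"
    using Suc by (simp add: zn_Suc m_assoc[symmetric])
  then show ?case
    using z_letter by (simp add: zn_Suc tn_commute m_assoc)
qed simp

text \<open>\<open>\<beta>\<close> is a height that looks like a character on the ball of radius
  \<open>D\<close> around \<open>x\<close>: steps by \<open>t\<close> and by \<open>z\<close> gain
  at least \<open>\<epsilon>\<close>, the paths \<open>c s\<close> stay \<open>\<epsilon>\<close>
  above the lower end of the edge \<open>s\<close>, and no letter loses more than \<open>C\<close>.
  It is applied with \<open>\<beta> y = \<rho> - N y\<close>, the depth of \<open>y\<close> inside a
  large ball.\<close>

definition region :: "'a => nat => ('a => real) => 'a set => bool" where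
  "region x D \<beta> W \<longleftrightarrow> x \<in> carrier G & 0 \<le> \<beta> x &
    (\<forall>y\<in>carrier G. \<forall>s. fst s \<in> X --> \<beta> y - C \<le> \<beta> (y \<otimes> lv s)) &
    (\<forall>y\<in>near x D. \<beta> y + \<epsilon> \<le> \<beta> (y \<otimes> lv t)) &
    (\<forall>y\<in>near x D. \<beta> y + \<epsilon> \<le> \<beta> (y \<otimes> lv z)) &
    (\<forall>y\<in>near x D. \<forall>s. fst s \<in> X1 --> (\<forall>i\<le>length (c s).
        min (\<beta> y) (\<beta> (y \<otimes> lv s)) + \<epsilon> \<le> \<beta> (y \<otimes> lv t \<otimes> wv (take i (c s))))) &
    (\<forall>y\<in>near x D. 0 \<le> \<beta> y --> y \<in> W)"

text \<open>Height and distance are tracked together: each push gains \<open>\<epsilon>\<close> in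
  \<open>m\<close> and costs a bounded amount in \<open>k\<close>; as long as
  \<open>k \<le> D\<close>, height at least 0 implies membership in \<open>W\<close>.\<close>

definition lev :: "'a => ('a => real) => real => nat => 'a set" where
  "lev x \<beta> m k = {y \<in> near x k. m \<le> \<beta> y}"

lemma lev_mono: "k \<le> k' ==> m' \<le> m ==> lev x \<beta> m k \<subseteq> lev x \<beta> m' k'"
  by (auto simp: lev_def near_mono)

lemma path_lev_mono: "path (lev x \<beta> m k) y w ==> k \<le> k' ==> m' \<le> m ==> path (lev x \<beta> m' k') y w"
  by (erule path_in_mono) (rule lev_mono)

context
  fixes x D \<beta> W
  assumes region: "region x D \<beta> W"
begin

lemma x_closed [simp]: "x \<in> carrier G" and beta_x: "0 \<le> \<beta> x"
  and beta_lip: "y \<in> carrier G ==> fst s \<in> X ==> \<beta> y - C \<le> \<beta> (y \<otimes> lv s)"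
  and beta_t: "y \<in> near x D ==> \<beta> y + \<epsilon> \<le> \<beta> (y \<otimes> lv t)"
  and beta_z: "y \<in> near x D ==> \<beta> y + \<epsilon> \<le> \<beta> (y \<otimes> lv z)"
  and beta_c1: "y \<in> near x D ==> fst s \<in> X1 ==> i \<le> length (c s) ==>
        min (\<beta> y) (\<beta> (y \<otimes> lv s)) + \<epsilon> \<le> \<beta> (y \<otimes> lv t \<otimes> wv (take i (c s)))"
  and near_W: "y \<in> near x D ==> 0 \<le> \<beta> y ==> y \<in> W"
  using region unfolding region_def by blast+

lemma beta_word: "y \<in> carrier G ==> w \<in> words X ==> \<beta> y - C * length w \<le> \<beta> (y \<otimes> wv w)"
proof (induction w arbitrary: y)
  case (Cons s w)
  then show ?case
    using Cons.IH[of "y \<otimes> lv s"] beta_lip[of y s] by (simp add: m_assoc algebra_simps)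
qed simp

lemma lev_closed: "y \<in> lev x \<beta> m k ==> y \<in> carrier G"
  by (auto simp: lev_def intro: near_closed[OF x_closed])

text \<open>For a letter of \<open>X2\<close> the path \<open>c s\<close> is the single edge
  \<open>s\<close>, whose ends are the original ends moved by \<open>t\<close>, so the gain along
  \<open>t\<close> at both ends suffices.\<close>

lemma beta_c:
  assumes "y \<in> near x D" "y \<otimes> lv s \<in> near x D" "fst s \<in> X" "i \<le> length (c s)"
  shows "min (\<beta> y) (\<beta> (y \<otimes> lv s)) + \<epsilon> \<le> \<beta> (y \<otimes> lv t \<otimes> wv (take i (c s)))"
proof (cases "fst s \<in> X1")
  case True
  then show ?thesis using beta_c1 assms by blast
next
  case False
  then have s: "fst s \<in> X2" using assms(3) X_Un by auto
  have y: "y \<in> carrier G" using assms(1) near_closed[OF x_closed] by blast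
  have "i = 0 | i = 1" using assms(4) s by (auto simp: c_X2)
  moreover have "y \<otimes> lv t \<otimes> lv s = y \<otimes> lv s \<otimes> lv t"
    using s y assms(3) t_letter letters_commute[of t s] by (simp add: m_assoc)
  ultimately show ?thesis
    using beta_t[OF assms(1)] beta_t[OF assms(2)] s y assms(3) by (auto simp: c_X2)
qed

lemma push_letter_path:
  assumes "y \<in> lev x \<beta> m k" "y \<otimes> lv s \<in> lev x \<beta> m k" "fst s \<in> X" "k \<le> D"
  shows "path (lev x \<beta> (m + \<epsilon>) (k + 1 + d)) (y \<otimes> lv t) (c s)"
proof -
  have y: "y \<in> carrier G" using assms(1) lev_closed by blast
  have "y \<otimes> lv t \<otimes> wv (take i (c s)) \<in> lev x \<beta> (m + \<epsilon>) (k + 1 + d)" if i: "i \<le> length (c s)" for i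
  proof -
    have "min (\<beta> y) (\<beta> (y \<otimes> lv s)) + \<epsilon> \<le> \<beta> (y \<otimes> lv t \<otimes> wv (take i (c s)))"
      using assms i near_mono by (intro beta_c) (auto simp: lev_def)
    moreover have "y \<otimes> wv (t # take i (c s)) \<in> near x (k + 1 + d)"
      using assms c_length_X[of s] by (intro near_step[of x y k]) (auto simp: lev_def words_take)
    ultimately show ?thesis
      using assms(1-3) y by (auto simp: lev_def m_assoc words_take)
  qed
  then show ?thesis
    using y assms(3) by (simp add: path_iff_prefixes)
qed

lemma push_path:
  "y \<in> carrier G ==> w \<in> words X ==> path (lev x \<beta> m k) y w ==> k \<le> D
    ==> path (lev x \<beta> (m + \<epsilon>) (k + 1 + d)) (y \<otimes> lv t) (push w)"
proof (induction w arbitrary: y)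
  case Nil
  then show ?case
    using beta_t[of y] near_letter[of x y k t "k + 1 + d"] by (auto simp: lev_def near_mono)
next
  case (Cons s w)
  have s: "fst s \<in> X" "w \<in> words X" using Cons.prems by auto
  have 1: "path (lev x \<beta> (m + \<epsilon>) (k + 1 + d)) (y \<otimes> lv t) (c s)"
    using Cons.prems by (intro push_letter_path) (auto simp: path_in_start)
  have "y \<otimes> lv t \<otimes> wv (c s) = y \<otimes> lv s \<otimes> lv t"
    using Cons.prems(1) s c_val_X[of s] by (simp add: m_assoc)
  then show ?case
    using 1 Cons.IH[of "y \<otimes> lv s"] Cons.prems s by (simp add: path_append)
qed

lemma pushn_path:
  "y \<in> carrier G ==> w \<in> words X ==> path (lev x \<beta> m k) y w ==> k + n * (1 + d) \<le> D
    ==> path (lev x \<beta> (m + n * \<epsilon>) (k + n * (1 + d))) (y \<otimes> tn n) (pushn n w)"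
proof (induction n)
  case (Suc n)
  have "path (lev x \<beta> (m + n * \<epsilon> + \<epsilon>) (k + n * (1 + d) + 1 + d)) (y \<otimes> tn n \<otimes> lv t) (push (pushn n w))"
    using Suc by (intro push_path) auto
  then show ?case
    using Suc.prems by (simp add: tn_Suc m_assoc algebra_simps)
qed auto

text \<open>\<open>z\<close> commutes with the letters of \<open>X1\<close>, so translating such a
  path by \<open>z\<close> leaves its word unchanged. In contrast to pushing along \<open>t\<close>,
  nothing gets longer.\<close>

lemma lift_path:
  assumes "y \<in> carrier G" "w \<in> words X1" "path (lev x \<beta> m k) y w" "k \<le> D"
  shows "path (lev x \<beta> (m + \<epsilon>) (k + 1)) (y \<otimes> lv z) w"
proof -
  have w: "w \<in> words X" using assms(2) words_X1 by auto
  have "y \<otimes> lv z \<otimes> wv (take i w) \<in> lev x \<beta> (m + \<epsilon>) (k + 1)" if "i \<le> length w" for i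
  proof -
    let ?p = "y \<otimes> wv (take i w)"
    have p: "?p \<in> lev x \<beta> m k" using assms w that by (simp add: path_iff_prefixes)
    have "lv z \<otimes> wv (take i w) = wv (take i w) \<otimes> lv z"
      using X1_words_commute[OF words_take[OF assms(2)] z_letter] by simp
    then have "y \<otimes> lv z \<otimes> wv (take i w) = ?p \<otimes> lv z"
      using assms(1) w by (simp add: m_assoc words_take)
    moreover have "?p \<otimes> lv z \<in> lev x \<beta> (m + \<epsilon>) (k + 1)"
      using p assms(4) beta_z[of ?p] near_letter[of x ?p k z "k + 1"] by (auto simp: lev_def near_mono)
    ultimately show ?thesis by simp
  qed
  then show ?thesis
    using assms(1) w by (simp add: path_iff_prefixes)
qed

lemma liftn_path:
  assumes "y \<in> carrier G" "w \<in> words X1" "path (lev x \<beta> m k) y w"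
  shows "k + n \<le> D ==> path (lev x \<beta> (m + n * \<epsilon>) (k + n)) (y \<otimes> zn n) w"
proof (induction n)
  case (Suc n)
  have "path (lev x \<beta> (m + n * \<epsilon> + \<epsilon>) (k + n + 1)) (y \<otimes> zn n \<otimes> lv z) w"
    using Suc assms by (intro lift_path) auto
  then show ?case
    using assms by (simp add: zn_Suc m_assoc algebra_simps)
qed (use assms in auto)

lemma start_path:
  assumes "a \<in> words X" "w \<in> words X"
  shows "path (lev x \<beta> (- C * (length a + length w)) (length a + length w)) (x \<otimes> wv a) w"
  using assms
proof (subst path_iff_prefixes; (intro allI impI)?)
  fix j assume j: "j \<le> length w"
  have "- C * (length a + length w) \<le> - C * length (a @ take j w)"
    using C_nonneg j by (intro mult_left_mono_neg) auto
  also have "... \<le> \<beta> (x \<otimes> wv (a @ take j w))"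
    using beta_word[of x "a @ take j w"] beta_x assms by (simp add: words_take)
  finally show "x \<otimes> wv a \<otimes> wv (take j w) \<in> lev x \<beta> (- C * (length a + length w)) (length a + length w)"
    using assms near_word[of x "a @ take j w" "length a + length w"] by (simp add: lev_def words_take m_assoc)
qed auto

text \<open>A path within \<open>length a + length w\<close> letters of \<open>x\<close> lies at
  most \<open>C\<close> times that distance below height 0; \<open>n\<close> pushes of gain
  \<open>\<epsilon>\<close> make up for it.\<close>

lemma start_pushn_path:
  assumes "a \<in> words X" "w \<in> words X" "C * (length a + length w) \<le> n * \<epsilon>"
    and "length a + length w + n * (1 + d) \<le> D"
  shows "path (lev x \<beta> 0 (length a + length w + n * (1 + d))) (x \<otimes> wv a \<otimes> tn n) (pushn n w)"
  using assms
  by (intro path_lev_mono[OF pushn_path[OF _ _ start_path[of a w], of n]]) auto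

lemma lev_W: "k \<le> D ==> lev x \<beta> 0 k \<subseteq> W"
  by (auto simp: lev_def intro: near_W near_mono)

lemma path_W: "path (lev x \<beta> 0 k) y w ==> k \<le> D ==> path W y w"
  by (erule path_in_mono) (rule lev_W)

context
  fixes L :: "'a => 'x \<times> bool => 'k => 'k"
  assumes flat: "flat d W L"
begin

lemma two_le_d: "2 \<le> d"
  using d_ge by simp

lemma edge_inverse:
  assumes "y \<in> lev x \<beta> 0 k" "y \<otimes> lv s \<in> lev x \<beta> 0 k" "fst s \<in> X" "k \<le> D"
  shows "L y s \<circ> L (y \<otimes> lv s) (inv_letter s) = id" "L (y \<otimes> lv s) (inv_letter s) \<circ> L y s = id"
proof -
  have "y \<in> carrier G" "y \<in> W" "y \<otimes> lv s \<in> W"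
    using assms lev_W[of k] lev_closed by auto
  then show "L y s \<circ> L (y \<otimes> lv s) (inv_letter s) = id" "L (y \<otimes> lv s) (inv_letter s) \<circ> L y s = id"
    using flat_inv[OF flat two_le_d, of y "[s]"] flat_inv'[OF flat two_le_d, of y "[s]"] assms(3) by auto
qed

text \<open>A path and its pushed copy bound a ladder whose rungs are edges \<open>t\<close>. Each
  cell compares \<open>s t\<close> with \<open>t (c s)\<close>, a closed path of length
  \<open>length (c s) + 3\<close>, which \<open>c_length\<close> bounds by \<open>d\<close>.\<close>

lemma push_hol:
  "y \<in> carrier G ==> w \<in> words X ==> path (lev x \<beta> 0 k) y w ==> k + 1 + d \<le> D
    ==> hol L y w \<circ> L (y \<otimes> wv w) t = L y t \<circ> hol L (y \<otimes> lv t) (push w)"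
proof (induction w arbitrary: y)
  case (Cons s w)
  let ?k = "k + 1 + d"
  have s: "fst s \<in> X" "w \<in> words X" using Cons.prems by auto
  have ys: "y \<in> lev x \<beta> 0 k" "y \<otimes> lv s \<in> lev x \<beta> 0 k"
    using Cons.prems path_in_start[of G f _ "y \<otimes> lv s" w] by auto
  have "path (lev x \<beta> (0 + \<epsilon>) ?k) (y \<otimes> lv t) (c s)"
    using ys s Cons.prems by (intro push_letter_path) auto
  then have pc: "path (lev x \<beta> 0 ?k) (y \<otimes> lv t) (c s)"
    using eps_pos by (auto elim: path_lev_mono)
  have up: "y' \<otimes> lv t \<in> lev x \<beta> 0 ?k" if "y' \<in> lev x \<beta> 0 k" for y'
    using that beta_t[of y'] near_letter[of x y' k t ?k] eps_pos Cons.prems(4)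
    by (auto simp: lev_def near_mono)
  have "hol L y [s, t] = hol L y (t # c s)"
  proof (rule flat_eq[OF flat two_le_d])
    show "path W y [s, t]" "path W y (t # c s)"
      using ys up[of "y \<otimes> lv s"] pc lev_W[of ?k] lev_mono[of k ?k 0 0 x \<beta>] Cons.prems(4)
      by (auto intro: path_W)
    show "wv [s, t] = wv (t # c s)"
      using s c_val_X[of s] by simp
    show "length [s, t] + length (t # c s) \<le> d"
      using c_length_X[OF s(1)] by simp
  qed (use s Cons.prems in auto)
  then have 1: "L y s \<circ> L (y \<otimes> lv s) t = L y t \<circ> hol L (y \<otimes> lv t) (c s)"
    by simp
  have 2: "hol L (y \<otimes> lv s) w \<circ> L (y \<otimes> lv s \<otimes> wv w) t
      = L (y \<otimes> lv s) t \<circ> hol L (y \<otimes> lv s \<otimes> lv t) (push w)"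
    by (rule Cons.IH) (use Cons.prems s in auto)
  have "hol L y (s # w) \<circ> L (y \<otimes> wv (s # w)) t
      = L y s \<circ> (hol L (y \<otimes> lv s) w \<circ> L (y \<otimes> lv s \<otimes> wv w) t)"
    using s Cons.prems(1) by (simp add: m_assoc o_assoc)
  also have "... = (L y s \<circ> L (y \<otimes> lv s) t) \<circ> hol L (y \<otimes> lv s \<otimes> lv t) (push w)"
    unfolding 2 by (simp add: o_assoc)
  also have "... = L y t \<circ> (hol L (y \<otimes> lv t) (c s) \<circ> hol L (y \<otimes> lv s \<otimes> lv t) (push w))"
    unfolding 1 by (simp add: o_assoc)
  also have "y \<otimes> lv s \<otimes> lv t = y \<otimes> lv t \<otimes> wv (c s)"
    using Cons.prems(1) s c_val_X[of s] by (simp add: m_assoc)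
  also have "hol L (y \<otimes> lv t) (c s) \<circ> hol L (y \<otimes> lv t \<otimes> wv (c s)) (push w)
      = hol L (y \<otimes> lv t) (push (s # w))"
    using Cons.prems(1) s by (simp add: holonomy_append)
  finally show ?case .
qed simp

text \<open>The same ladder for a letter \<open>s\<close> commuting with the path; its cells are
  commutator squares of length 4.\<close>

lemma translate_hol:
  "y \<in> carrier G ==> w \<in> words X1 ==> fst s \<in> X2 ==> path (lev x \<beta> 0 k) y w
    ==> path (lev x \<beta> 0 k) (y \<otimes> lv s) w ==> k \<le> D
    ==> hol L y w \<circ> L (y \<otimes> wv w) s = L y s \<circ> hol L (y \<otimes> lv s) w"
proof (induction w arbitrary: y)
  case Nil
  then show ?case by simp
next
  case (Cons a w)
  have a: "fst a \<in> X" "w \<in> words X" "fst s \<in> X" using Cons.prems words_X1 X1_X X2_X by auto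
  have com: "lv a \<otimes> lv s = lv s \<otimes> lv a"
    using Cons.prems letters_commute[of a s] by simp
  then have com': "y \<otimes> lv s \<otimes> lv a = y \<otimes> lv a \<otimes> lv s"
    using Cons.prems a by (simp add: m_assoc)
  have "hol L y [a, s] = hol L y [s, a]"
  proof (rule flat_eq[OF flat two_le_d])
    have "path W y (a # w)" "path W (y \<otimes> lv s) (a # w)"
      using Cons.prems path_W by blast+
    then show "path W y [a, s]" "path W y [s, a]"
      using path_in_start[of G f W "y \<otimes> lv a" w] path_in_start[of G f W "y \<otimes> lv s \<otimes> lv a" w] com'
      by auto
    show "wv [a, s] = wv [s, a]"
      using a com by simp
  qed (use a Cons.prems d_ge in auto)
  then have 1: "L y a \<circ> L (y \<otimes> lv a) s = L y s \<circ> L (y \<otimes> lv s) a"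
    by simp
  have 2: "hol L (y \<otimes> lv a) w \<circ> L (y \<otimes> lv a \<otimes> wv w) s = L (y \<otimes> lv a) s \<circ> hol L (y \<otimes> lv a \<otimes> lv s) w"
    by (rule Cons.IH) (use Cons.prems a com' in auto)
  have "hol L y (a # w) \<circ> L (y \<otimes> wv (a # w)) s
      = L y a \<circ> (hol L (y \<otimes> lv a) w \<circ> L (y \<otimes> lv a \<otimes> wv w) s)"
    using a Cons.prems(1) by (simp add: m_assoc o_assoc)
  also have "... = (L y a \<circ> L (y \<otimes> lv a) s) \<circ> hol L (y \<otimes> lv a \<otimes> lv s) w"
    unfolding 2 by (simp add: o_assoc)
  also have "... = L y s \<circ> hol L (y \<otimes> lv s) (a # w)"
    unfolding 1 by (simp add: com' o_assoc)
  finally show ?case .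
qed

lemma conjugate_id:
  assumes "A \<circ> B = id" "B \<circ> A = id" "P \<circ> A = A \<circ> Q"
  shows "P = id \<longleftrightarrow> Q = id"
proof -
  have "P = A \<circ> Q \<circ> B" "Q = B \<circ> P \<circ> A"
    using assms by (metis comp_assoc comp_id) (metis assms comp_assoc id_comp)
  then show ?thesis using assms by (metis comp_id)
qed

text \<open>For a closed path the two ends of the ladder are the same rung, so each push conjugates
  the holonomy by an invertible label and preserves whether it is trivial.\<close>

lemma pushn_hol_closed:
  "y \<in> carrier G ==> w \<in> words X ==> wv w = \<one> ==> path (lev x \<beta> 0 k) y w ==> k + n * (1 + d) \<le> D
    ==> hol L (y \<otimes> tn n) (pushn n w) = id \<longleftrightarrow> hol L y w = id"
proof (induction n)
  case (Suc n)
  let ?y = "y \<otimes> tn n" and ?w = "pushn n w" and ?k = "k + n * (1 + d)"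
  have y: "?y \<in> carrier G" "?w \<in> words X" using Suc by auto
  have p: "path (lev x \<beta> 0 ?k) ?y ?w"
    using Suc.prems eps_pos by (intro path_lev_mono[OF pushn_path[of y w 0 k n]]) auto
  have "path (lev x \<beta> (0 + \<epsilon>) (?k + 1 + d)) (?y \<otimes> lv t) (push ?w)"
    using y p Suc.prems(5) by (intro push_path) auto
  then have p': "path (lev x \<beta> 0 (?k + 1 + d)) (?y \<otimes> lv t) (push ?w)"
    using eps_pos by (auto elim: path_lev_mono)
  have "tn n \<otimes> wv ?w = tn n"
    using pushn_val[of w n] Suc.prems by simp
  then have one: "wv ?w = \<one>"
    using y l_cancel_one[of "tn n" "wv ?w"] by simp
  have "hol L ?y ?w \<circ> L (?y \<otimes> wv ?w) t = L ?y t \<circ> hol L (?y \<otimes> lv t) (push ?w)"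
    using y p Suc.prems(5) by (intro push_hol) auto
  then have "hol L ?y ?w \<circ> L ?y t = L ?y t \<circ> hol L (?y \<otimes> lv t) (push ?w)"
    using one y by simp
  then have "hol L ?y ?w = id \<longleftrightarrow> hol L (?y \<otimes> lv t) (push ?w) = id"
    using path_in_start[OF path_lev_mono[OF p, of "?k + 1 + d" 0]] path_in_start[OF p'] Suc.prems(5)
    by (intro conjugate_id[where A = "L ?y t" and B = "L (?y \<otimes> lv t) (inv_letter t)"]
        edge_inverse[of _ "?k + 1 + d"]) auto
  moreover have "hol L ?y ?w = id \<longleftrightarrow> hol L y w = id"
    by (rule Suc.IH) (use Suc.prems in auto)
  ultimately show ?case
    using Suc.prems y by (simp only: tn_Suc m_assoc[symmetric] tn_closed letter_val_closed t_X funpow.simps o_apply)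
qed simp

lemma liftn_hol_closed:
  assumes "y \<in> carrier G" "w \<in> words X1" "wv w = \<one>" "path (lev x \<beta> 0 k) y w"
  shows "k + n \<le> D ==> hol L (y \<otimes> zn n) w = id \<longleftrightarrow> hol L y w = id"
proof (induction n)
  case (Suc n)
  let ?y = "y \<otimes> zn n"
  have y: "?y \<in> carrier G" "w \<in> words X" using assms words_X1 by auto
  have p: "path (lev x \<beta> 0 (k + Suc n)) ?y w"
    using Suc.prems eps_pos assms by (intro path_lev_mono[OF liftn_path[of y w 0 k n]]) auto
  have p': "path (lev x \<beta> 0 (k + Suc n)) (?y \<otimes> lv z) w"
    using Suc.prems eps_pos assms liftn_path[of y w 0 k "Suc n"]
    by (simp add: zn_Suc m_assoc) (erule path_lev_mono; simp)
  have "hol L ?y w \<circ> L (?y \<otimes> wv w) z = L ?y z \<circ> hol L (?y \<otimes> lv z) w"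
    using y p p' Suc.prems assms z_letter by (intro translate_hol) auto
  then have "hol L ?y w \<circ> L ?y z = L ?y z \<circ> hol L (?y \<otimes> lv z) w"
    using y assms by simp
  then have "hol L ?y w = id \<longleftrightarrow> hol L (?y \<otimes> lv z) w = id"
    using path_in_start[OF p] path_in_start[OF p'] Suc.prems
    by (intro conjugate_id[where A = "L ?y z" and B = "L (?y \<otimes> lv z) (inv_letter z)"]
        edge_inverse[of _ "k + Suc n"]) auto
  moreover have "hol L ?y w = id \<longleftrightarrow> hol L y w = id"
    by (rule Suc.IH) (use Suc.prems in auto)
  ultimately show ?case
    using assms(1) y by (simp only: zn_Suc m_assoc[symmetric] zn_closed letter_val_closed z_X)
qed (use assms in simp)

text \<open>The pushed relator may be too long for flatness, and the unpushed one may leave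
  \<open>W\<close>. Translation by \<open>z\<close> keeps the length and gains height: at
  \<open>y z^i\<close> the relator lies in \<open>W\<close> and is flat. From there it is pushed
  \<open>n\<close> times. Since \<open>t\<close> and \<open>z\<close> commute, the result is the
  translate by \<open>z^i\<close> of the desired loop, and triviality descends to it.\<close>

lemma relator_hol1:
  assumes y: "y \<in> near x k0" and r: "r \<in> words X1" "wv r = \<one>" "length r \<le> d"
    and p: "path (lev x \<beta> 0 k) (y \<otimes> tn n) (pushn n r)"
    and i: "C * (k0 + d) \<le> i * \<epsilon>" and D: "k0 + d + i + n * (1 + d) \<le> D" "k + i \<le> D"
  shows "hol L (y \<otimes> tn n) (pushn n r) = id"
proof -
  have yc: "y \<in> carrier G" using y near_closed[OF x_closed] by blast
  have rX: "r \<in> words X" using r words_X1 by blast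
  obtain a where a: "a \<in> words X" "length a \<le> k0" "y = x \<otimes> wv a"
    using y by (auto simp: near_def)
  have "path (lev x \<beta> (- C * (k0 + d)) (k0 + d)) y r"
    unfolding path_iff_prefixes[OF yc rX]
  proof (intro allI impI)
    fix j assume "j \<le> length r"
    have "- C * (k0 + d) \<le> - C * length (a @ take j r)"
      using a(2) r(3) C_nonneg by (intro mult_left_mono_neg) auto
    also have "... \<le> \<beta> (x \<otimes> wv (a @ take j r))"
      using beta_word[of x "a @ take j r"] beta_x a rX by (simp add: words_take)
    finally show "y \<otimes> wv (take j r) \<in> lev x \<beta> (- C * (k0 + d)) (k0 + d)"
      using a rX r(3) near_word[of x "a @ take j r" "k0 + d"]
      by (simp add: lev_def words_take m_assoc)
  qed
  then have "path (lev x \<beta> (- C * (k0 + d) + i * \<epsilon>) (k0 + d + i)) (y \<otimes> zn i) r"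
    using yc r(1) D by (intro liftn_path) auto
  then have p1: "path (lev x \<beta> 0 (k0 + d + i)) (y \<otimes> zn i) r"
    using i by (auto elim: path_lev_mono)
  then have "hol L (y \<otimes> zn i) r = id"
    using yc rX r D by (intro flatD[OF flat]) (auto intro: path_W)
  then have "hol L (y \<otimes> zn i \<otimes> tn n) (pushn n r) = id"
    using pushn_hol_closed[of "y \<otimes> zn i" r "k0 + d + i" n] yc rX r p1 D by auto
  moreover have "tn n \<otimes> wv (pushn n r) = tn n"
    using pushn_val[of r n] rX r by simp
  then have "wv (pushn n r) = \<one>"
    using l_cancel_one[of "tn n" "wv (pushn n r)"] rX by simp
  ultimately show ?thesis
    using liftn_hol_closed[of "y \<otimes> tn n" "pushn n r" k i] yc r p D
    by (auto simp: m_assoc tn_zn pushn_words1)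
qed

end

end

section \<open>Identities of holonomy that hold after enough pushes\<close>

definition hol_agree :: "'k itself => nat => nat => 'x word => 'x word => 'x word => bool" where
  "hol_agree k n D0 a u v \<longleftrightarrow> (\<forall>x D \<beta> W (L :: 'a => 'x \<times> bool => 'k => 'k). D0 \<le> D -->
    region x D \<beta> W --> flat d W L -->
    hol L (x \<otimes> wv a \<otimes> tn n) (pushn n u) = hol L (x \<otimes> wv a \<otimes> tn n) (pushn n v))"

text \<open>Agreement of the pushed copies of \<open>u\<close> and \<open>v\<close>, read from the
  offset \<open>a\<close>, is asked for large \<open>n\<close> only, because a word deep below
  height 0 needs many pushes before it enters \<open>W\<close>. The radius \<open>D0\<close> may
  depend on \<open>n\<close>, but not on the base point, the height or the labelling.\<close>

definition hol_eq :: "'k itself => 'x word => 'x word => 'x word => bool" where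
  "hol_eq k a u v \<longleftrightarrow> (\<exists>N. \<forall>n\<ge>N. \<exists>D0. hol_agree k n D0 a u v)"

lemma hol_agreeI:
  assumes "!!x D \<beta> W (L :: 'a => 'x \<times> bool => 'k => 'k). D0 \<le> D ==> region x D \<beta> W ==> flat d W L
    ==> x \<in> carrier G
    ==> hol L (x \<otimes> wv a \<otimes> tn n) (pushn n u) = hol L (x \<otimes> wv a \<otimes> tn n) (pushn n v)"
  shows "hol_agree (k :: 'k itself) n D0 a u v"
  using assms x_closed unfolding hol_agree_def by simp

lemma hol_agreeD:
  fixes L :: "'a => 'x \<times> bool => 'k => 'k"
  assumes "hol_agree (k :: 'k itself) n D0 a u v" "D0 \<le> D" "region x D \<beta> W" "flat d W L"
  shows "hol L (x \<otimes> wv a \<otimes> tn n) (pushn n u) = hol L (x \<otimes> wv a \<otimes> tn n) (pushn n v)"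
  using assms(1)[unfolded hol_agree_def, rule_format, OF assms(2-4)] .

lemma hol_eqE:
  assumes "hol_eq k a u v"
  obtains N :: nat and D where "!!n. N \<le> n ==> hol_agree k n (D n) a u v"
proof -
  obtain N where "\<forall>n. \<exists>D0. N \<le> n --> hol_agree k n D0 a u v"
    using assms unfolding hol_eq_def by blast
  then obtain D where "\<forall>n. N \<le> n --> hol_agree k n (D n) a u v"
    using choice[of "%n D0. N \<le> n --> hol_agree k n D0 a u v"] by blast
  then show thesis using that by blast
qed

lemma hol_eqI: "(!!n. N \<le> n ==> hol_agree k n (D n) a u v) ==> hol_eq k a u v"
  unfolding hol_eq_def by blast

lemma hol_eq_refl: "hol_eq k a u u"
  by (rule hol_eqI) (rule hol_agreeI, rule HOL.refl)

lemma hol_eq_sym: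
  assumes "hol_eq (k :: 'k itself) a u v"
  shows "hol_eq k a v u"
proof (rule hol_eqE[OF assms])
  fix N D assume D: "!!n. N \<le> n ==> hol_agree k n (D n) a u v"
  show ?thesis
    by (rule hol_eqI, rule hol_agreeI, rule HOL.sym, rule hol_agreeD[OF D])
qed

lemma hol_eq_trans:
  assumes "hol_eq (k :: 'k itself) a u v" "hol_eq k a v w"
  shows "hol_eq k a u w"
proof (rule hol_eqE[OF assms(1)], rule hol_eqE[OF assms(2)])
  fix N1 D1 N2 D2
  assume 1: "!!n. N1 \<le> n ==> hol_agree k n (D1 n) a u v"
    and 2: "!!n. N2 \<le> n ==> hol_agree k n (D2 n) a v w"
  show ?thesis
  proof (rule hol_eqI[of "max N1 N2" _ "%n. max (D1 n) (D2 n)"], rule hol_agreeI)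
    fix n x D \<beta> W and L :: "'a => 'x \<times> bool => 'k => 'k"
    assume A: "max N1 N2 \<le> n" "max (D1 n) (D2 n) \<le> D" "region x D \<beta> W" "flat d W L"
    show "hol L (x \<otimes> wv a \<otimes> tn n) (pushn n u) = hol L (x \<otimes> wv a \<otimes> tn n) (pushn n w)"
      using hol_agreeD[OF 1[of n] _ A(3,4)] hol_agreeD[OF 2[of n] _ A(3,4)] A(1,2)
      by simp
  qed
qed

text \<open>The pushed copy of \<open>u\<close> leads from offset \<open>a\<close> to offset
  \<open>a @ u\<close>, because \<open>t^n\<close> times the pushed word is the word times
  \<open>t^n\<close>. Equal values of \<open>u\<close> and \<open>u'\<close> let the second pieces
  start at the same vertex.\<close>

lemma hol_eq_append:
  assumes "hol_eq (k :: 'k itself) a u u'" "hol_eq k (a @ u) v v'" "wv u = wv u'"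
    and w: "a \<in> words X" "u \<in> words X" "u' \<in> words X" "v \<in> words X" "v' \<in> words X"
  shows "hol_eq k a (u @ v) (u' @ v')"
proof (rule hol_eqE[OF assms(1)], rule hol_eqE[OF assms(2)])
  fix N1 D1 N2 D2
  assume N1: "!!n. N1 \<le> n ==> hol_agree k n (D1 n) a u u'"
    and N2: "!!n. N2 \<le> n ==> hol_agree k n (D2 n) (a @ u) v v'"
  show ?thesis
  proof (rule hol_eqI[of "max N1 N2" _ "%n. max (D1 n) (D2 n)"], rule hol_agreeI)
    fix n x D \<beta> W and L :: "'a => 'x \<times> bool => 'k => 'k"
    assume A: "max N1 N2 \<le> n" "max (D1 n) (D2 n) \<le> D" "region x D \<beta> W" "flat d W L"
      and x: "x \<in> carrier G"
    let ?p = "x \<otimes> wv a \<otimes> tn n"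
    have e: "?p \<otimes> wv (pushn n w) = x \<otimes> (wv a \<otimes> wv w) \<otimes> tn n" if "w \<in> words X" for w
      using that x w(1) pushn_val[of w n] by (simp add: m_assoc)
    have 1: "hol L ?p (pushn n u) = hol L ?p (pushn n u')"
      by (rule hol_agreeD[OF N1[of n] _ A(3,4)]) (use A in auto)
    have "hol L (x \<otimes> wv (a @ u) \<otimes> tn n) (pushn n v) = hol L (x \<otimes> wv (a @ u) \<otimes> tn n) (pushn n v')"
      by (rule hol_agreeD[OF N2[of n] _ A(3,4)]) (use A in auto)
    then have 2: "hol L (?p \<otimes> wv (pushn n u)) (pushn n v) = hol L (?p \<otimes> wv (pushn n u')) (pushn n v')"
      using w assms(3) by (simp add: e)
    show "hol L ?p (pushn n (u @ v)) = hol L ?p (pushn n (u' @ v'))"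
      using w x 1 2 by (simp add: holonomy_append)
  qed
qed

lemma archimedean_eps: "\<exists>N. \<forall>n\<ge>N. r \<le> real n * \<epsilon>"
proof -
  obtain N :: nat where "r < N * \<epsilon>"
    using ex_less_of_nat_mult[OF eps_pos] by blast
  then have "r \<le> n * \<epsilon>" if "N \<le> n" for n
    using mult_right_mono[of "real N" "real n" \<epsilon>] eps_pos that by linarith
  then show ?thesis by blast
qed

text \<open>A relator in \<open>X2\<close> is not changed by pushing, so flatness applies as soon as
  it lies in \<open>W\<close>; one in \<open>X1\<close> needs the detour of
  \<open>relator_hol1\<close>.\<close>

lemma hol_eq_relator:
  assumes a: "a \<in> words X" and r: "r \<in> words X1 | r \<in> words X2" "wv r = \<one>" "length r \<le> d"
  shows "hol_eq (k :: 'k itself) a r []"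
proof -
  have rX: "r \<in> words X" using r words_X1 words_X2 by blast
  obtain N :: nat where N: "!!n :: nat. N \<le> n ==> C * (length a + length r) \<le> n * \<epsilon>"
    using archimedean_eps by blast
  obtain i :: nat where i: "C * (length a + d) \<le> i * \<epsilon>"
    using archimedean_eps by blast
  show ?thesis
  proof (rule hol_eqI[of N _ "%n. length a + d + i + n * (1 + d) + length r"], rule hol_agreeI)
    fix n x D \<beta> W and L :: "'a => 'x \<times> bool => 'k => 'k"
    assume n: "N \<le> n" and reg: "region x D \<beta> W" "flat d W L" and x: "x \<in> carrier G"
      and D: "length a + d + i + n * (1 + d) + length r \<le> D"
    have p: "path (lev x \<beta> 0 (length a + length r + n * (1 + d))) (x \<otimes> wv a \<otimes> tn n) (pushn n r)"
      using n D a rX by (intro start_pushn_path[OF reg(1)] N) auto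
    have "hol L (x \<otimes> wv a \<otimes> tn n) (pushn n r) = id"
    proof (cases "r \<in> words X1")
      case True
      show ?thesis
        by (rule relator_hol1[OF reg, where ?k0.0 = "length a" and i = i and k = "length a + length r + n * (1 + d)"])
          (use True a r p i D x in \<open>auto intro: near_word\<close>)
    next
      case False
      then have r2: "r \<in> words X2" using r by blast
      then have "path W (x \<otimes> wv a \<otimes> tn n) r"
        using path_W[OF reg(1) p] D by (simp add: pushn_words2)
      then have "hol L (x \<otimes> wv a \<otimes> tn n) r = id"
        using x a rX r by (intro flatD[OF reg(2)]) auto
      then show ?thesis using r2 by (simp add: pushn_words2)
    qed
    then show "hol L (x \<otimes> wv a \<otimes> tn n) (pushn n r) = hol L (x \<otimes> wv a \<otimes> tn n) (pushn n [])"
      by simp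
  qed
qed

lemma hol_eq_presentation:
  assumes "(u, v) \<in> presentation_rel Y R"
    and "Y = X1 & R = R1 | Y = X2 & R = R2" "a \<in> words X"
  shows "hol_eq (k :: 'k itself) a u v"
  using assms(1)
proof (induction rule: presentation_rel.induct)
  case (cancel u v x b)
  have YX: "w \<in> words X" if "w \<in> words Y" for w
    using that assms(2) words_X1 words_X2 by blast
  let ?r = "[(x, b), (x, \<not> b)]"
  have r: "?r \<in> words X1 | ?r \<in> words X2" "wv ?r = \<one>"
    using cancel assms(2) YX[of ?r] by (auto simp: letter_val_def generator_closed)
  have "hol_eq k (a @ u) (?r @ v) ([] @ v)"
    using r assms(3) cancel YX[of u] YX[of v] YX[of ?r] d_ge
    by (intro hol_eq_append hol_eq_relator hol_eq_refl) auto
  then show ?case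
    using assms(3) cancel YX[of u] YX[of v] YX[of ?r] r by (intro hol_eq_append hol_eq_refl) auto
next
  case (relator u v r)
  have YX: "w \<in> words X" if "w \<in> words Y" for w
    using that assms(2) words_X1 words_X2 by blast
  have r: "wv r = \<one>" "length r \<le> d" "r \<in> words X1 | r \<in> words X2"
    using relator assms(2) relators1 relators2 by auto
  have "hol_eq k (a @ u) (r @ v) ([] @ v)"
    using r assms(3) relator YX by (intro hol_eq_append hol_eq_relator hol_eq_refl) auto
  then show ?case
    using assms(3) relator YX r by (intro hol_eq_append hol_eq_refl) auto
next
  case (refl u)
  show ?case by (rule hol_eq_refl)
next
  case (sym u v)
  show ?case by (rule hol_eq_sym) (rule sym.IH)
next
  case (trans u v w)
  show ?case by (rule hol_eq_trans) (rule trans.IH)+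
qed

lemma hol_eq_swap:
  assumes a: "a \<in> words X" and w: "w \<in> words X1" and s: "fst s \<in> X2"
  shows "hol_eq (k :: 'k itself) a (s # w) (w @ [s])"
proof -
  have wX: "w \<in> words X" "fst s \<in> X" using w s words_X1 X2_X by blast+
  obtain N :: nat where N: "!!n :: nat. N \<le> n ==> C * (length a + 1 + length w) \<le> n * \<epsilon>"
    using archimedean_eps[of "C * (length a + 1 + length w)"] by blast
  have N': "C * (length a + length w) \<le> n * \<epsilon>" if "N \<le> n" for n :: nat
    using N[OF that] C_nonneg by (simp add: algebra_simps)
  show ?thesis
  proof (rule hol_eqI[of N _ "%n. length a + 1 + length w + n * (1 + d)"], rule hol_agreeI)
    fix n x D \<beta> W and L :: "'a => 'x \<times> bool => 'k => 'k"
    assume n: "N \<le> n" and reg: "region x D \<beta> W" "flat d W L" and x: "x \<in> carrier G"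
      and D: "length a + 1 + length w + n * (1 + d) \<le> D"
    let ?k = "length a + 1 + length w + n * (1 + d)" and ?p = "x \<otimes> wv a \<otimes> tn n"
    have "path (lev x \<beta> 0 (length a + length w + n * (1 + d))) ?p (pushn n w)"
      using D a wX by (intro start_pushn_path[OF reg(1)] N' n) auto
    then have p: "path (lev x \<beta> 0 ?k) ?p (pushn n w)"
      by (rule path_lev_mono) auto
    have "path (lev x \<beta> 0 (length (a @ [s]) + length w + n * (1 + d))) (x \<otimes> wv (a @ [s]) \<otimes> tn n) (pushn n w)"
      using D a wX N[OF n] by (intro start_pushn_path[OF reg(1)]) (auto simp: algebra_simps)
    then have p': "path (lev x \<beta> 0 ?k) (?p \<otimes> lv s) (pushn n w)"
      using x a wX tn_commute[OF s, of n] by (simp add: m_assoc)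
    have "hol L ?p (pushn n w) \<circ> L (?p \<otimes> wv (pushn n w)) s = L ?p s \<circ> hol L (?p \<otimes> lv s) (pushn n w)"
      using x a w s p p' D by (intro translate_hol[OF reg]) (auto simp: pushn_words1)
    then have "hol L ?p (pushn n w @ [s]) = hol L ?p (s # pushn n w)"
      using x a wX by (simp add: holonomy_append)
    moreover have "pushn n [s] = [s]"
      using s by (intro pushn_words2) auto
    moreover have "pushn n (s # w) = pushn n [s] @ pushn n w"
      using pushn_simps(2)[of n "[s]" w] by simp
    ultimately show "hol L ?p (pushn n (s # w)) = hol L ?p (pushn n (w @ [s]))"
      by simp
  qed
qed

abbreviation part1 where "part1 w \<equiv> filter (%s. fst s \<in> X1) w"
abbreviation part2 where "part2 w \<equiv> filter (%s. fst s \<notin> X1) w"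

lemma part_words: "w \<in> words X ==> part1 w \<in> words X1" "w \<in> words X ==> part2 w \<in> words X2"
  by (auto simp: words_iff X_Un)

lemma hol_eq_parts:
  "a \<in> words X ==> w \<in> words X ==> hol_eq k a w (part1 w @ part2 w) & wv w = wv (part1 w @ part2 w)"
proof (induction w arbitrary: a)
  case (Cons s w)
  let ?w1 = "part1 w" and ?w2 = "part2 w"
  have w: "?w1 \<in> words X1" "?w2 \<in> words X2" "?w1 \<in> words X" "?w2 \<in> words X" "fst s \<in> X" "w \<in> words X"
    using Cons.prems part_words words_X1 words_X2 by auto
  have IH: "hol_eq k (a @ [s]) w (?w1 @ ?w2)" "wv w = wv (?w1 @ ?w2)"
    using Cons.IH[of "a @ [s]"] Cons.prems by auto
  have 1: "hol_eq k a ([s] @ w) ([s] @ (?w1 @ ?w2))"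
    using Cons.prems w IH by (intro hol_eq_append hol_eq_refl) auto
  show ?case
  proof (cases "fst s \<in> X1")
    case True
    then show ?thesis using 1 IH w by simp
  next
    case False
    then have s: "fst s \<in> X2" using w X_Un by auto
    have v: "wv (s # ?w1) = wv (?w1 @ [s])"
      using w X1_words_commute[OF w(1) s] by simp
    have "hol_eq k a ((s # ?w1) @ ?w2) ((?w1 @ [s]) @ ?w2)"
      using Cons.prems w s v by (intro hol_eq_append hol_eq_swap hol_eq_refl) auto
    then have "hol_eq k a (s # w) (?w1 @ [s] @ ?w2)"
      using 1 hol_eq_trans[of k a "s # w" "s # ?w1 @ ?w2"] by simp
    moreover have "wv (s # w) = wv ((s # ?w1) @ ?w2)"
      using IH w by (simp add: m_assoc)
    then have "wv (s # w) = wv ((?w1 @ [s]) @ ?w2)"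
      using v w by (simp only: word_val_append words_append words_Cons words_Nil)
    ultimately show ?thesis using False by simp
  qed
qed (simp add: hol_eq_refl)

lemma hol_eq_closed:
  assumes w: "w \<in> words X" "wv w = \<one>"
  shows "hol_eq k [] w []"
proof -
  have p: "part1 w \<in> words X1" "part2 w \<in> words X2" "part1 w \<in> words X" "part2 w \<in> words X"
    using w part_words words_X1 words_X2 by blast+
  have 1: "hol_eq k [] w (part1 w @ part2 w)" "wv (part1 w @ part2 w) = \<one>"
    using hol_eq_parts[of "[]" w k] w by auto
  have o1: "wv (part1 w) = \<one>"
    using factors_meet[OF p(1,2) 1(2)] .
  then have o2: "wv (part2 w) = \<one>"
    using 1(2) p by simp
  have "hol_eq k [] (part1 w @ part2 w) ([] @ [])"
  proof (rule hol_eq_append)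
    show "hol_eq k [] (part1 w) []"
      by (rule hol_eq_presentation[OF presentation1[OF p(1) o1]]) auto
    show "hol_eq k ([] @ part1 w) (part2 w) []"
      by (rule hol_eq_presentation[OF presentation2[OF p(2) o2]]) (use p in auto)
  qed (use p o1 in auto)
  then show ?thesis
    using hol_eq_trans[OF 1(1)] by simp
qed

text \<open>A loop at height at least 0 is pushed up until \<open>hol_eq_closed\<close> applies, and
  \<open>pushn_hol_closed\<close> brings triviality back down. The radius \<open>D0\<close> depends
  on the word alone.\<close>

lemma loop_fill:
  assumes w: "w \<in> words X" "wv w = \<one>"
  shows "\<exists>D0. \<forall>x D \<beta> W (L :: 'a => 'x \<times> bool => 'k => 'k). D0 \<le> D --> region x D \<beta> W --> flat d W L -->
    path {y. 0 \<le> \<beta> y} x w --> hol L x w = id"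
proof -
  have "hol_eq TYPE('k) [] w []"
    using hol_eq_closed[OF w] .
  then obtain N D1' where "!!n. N \<le> n ==> hol_agree TYPE('k) n (D1' n) [] w []"
    using hol_eqE[of "TYPE('k)" "[]" w "[]"] by metis
  then obtain n D1 where D1: "hol_agree TYPE('k) n D1 [] w []"
    by blast
  show ?thesis
  proof (rule exI[of _ "max D1 (length w + n * (1 + d))"], intro allI impI)
    fix x D \<beta> W and L :: "'a => 'x \<times> bool => 'k => 'k"
    assume D: "max D1 (length w + n * (1 + d)) \<le> D" and reg: "region x D \<beta> W" "flat d W L"
      and p: "path {y. 0 \<le> \<beta> y} x w"
    have x: "x \<in> carrier G" by (rule x_closed[OF reg(1)])
    have "path (lev x \<beta> 0 (length w)) x w"
      using p x w unfolding path_iff_prefixes[OF x w(1)]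
      by (auto simp: lev_def words_take intro!: near_word)
    then have "hol L (x \<otimes> tn n) (pushn n w) = id \<longleftrightarrow> hol L x w = id"
      using x w D by (intro pushn_hol_closed[OF reg]) auto
    moreover have "hol L (x \<otimes> wv [] \<otimes> tn n) (pushn n w) = hol L (x \<otimes> wv [] \<otimes> tn n) (pushn n [])"
      by (rule hol_agreeD[OF D1 _ reg]) (use D in simp)
    ultimately show "hol L x w = id"
      using x by simp
  qed
qed

text \<open>The detour climbs along \<open>t^n\<close>, follows the pushed path and descends again.
  The legs along \<open>t\<close> leave points of height at least 0 and only gain; the middle is
  high enough by the choice of \<open>n\<close>. The length of the detour depends on
  \<open>w\<close> alone.\<close>

lemma path_fill:
  assumes w: "w \<in> words X"
  shows "\<exists>D0 K. \<forall>x D \<beta> W. D0 \<le> D --> region x D \<beta> W --> 0 \<le> \<beta> (x \<otimes> wv w) -->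
    (\<exists>p\<in>words X. length p \<le> K & path W x p & wv p = wv w)"
proof -
  obtain n :: nat where n: "C * length w \<le> n * \<epsilon>"
    using archimedean_eps by blast
  let ?t = "replicate n t"
  let ?p = "?t @ pushn n w @ inv_word ?t"
  have pX: "?t \<in> words X" "?p \<in> words X" using w by (auto simp: words_replicate)
  have tnt: "tn n = wv ?t" by (simp add: tn_def)
  show ?thesis
  proof (rule exI[of _ "length w + n * (1 + d)"], rule exI[of _ "length ?p"], intro allI impI, rule bexI[of _ ?p], intro conjI)
    fix x D \<beta> W
    assume D: "length w + n * (1 + d) \<le> D" and reg: "region x D \<beta> W" and b: "0 \<le> \<beta> (x \<otimes> wv w)"
    have x: "x \<in> carrier G" by (rule x_closed[OF reg])
    have up: "path (lev x \<beta> 0 (length w + n)) y ?t" if y: "y \<in> near x (length w)" "0 \<le> \<beta> y" for y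
    proof -
      have yc: "y \<in> carrier G" using near_closed[OF x y(1)] .
      have st: "0 \<le> \<beta> (y \<otimes> wv (replicate j t)) & y \<otimes> wv (replicate j t) \<in> near x (length w + j)" if "j \<le> n" for j
        using that
      proof (induction j)
        case (Suc j)
        have "y \<otimes> wv (replicate (Suc j) t) = y \<otimes> wv (replicate j t) \<otimes> lv t"
          using yc tn_Suc[of j] by (simp add: tn_def[symmetric] m_assoc del: replicate.simps)
        moreover have "y \<otimes> wv (replicate j t) \<in> near x D"
          using Suc D by (intro near_mono[of _ x "length w + j" D]) auto
        ultimately show ?case
          using Suc beta_t[OF reg, of "y \<otimes> wv (replicate j t)"] eps_pos
            near_letter[OF x, of "y \<otimes> wv (replicate j t)" "length w + j" t] by auto
      qed (use y yc in auto)
      then show ?thesis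
        using yc pX near_mono[OF conjunct2[OF st], of _ "length w + n"] st
        by (subst path_iff_prefixes) (auto simp: lev_def min_def)
    qed
    have 1: "path (lev x \<beta> 0 D) x ?t"
      using up[of x] near_word[OF x, of "[]" "length w"] x beta_x[OF reg] D by (auto elim: path_lev_mono)
    have "path (lev x \<beta> 0 (length ([] :: 'x word) + length w + n * (1 + d))) (x \<otimes> wv [] \<otimes> tn n) (pushn n w)"
      using D w n by (intro start_pushn_path[OF reg]) auto
    then have 2: "path (lev x \<beta> 0 D) (x \<otimes> wv ?t) (pushn n w)"
      using x D by (simp add: tnt) (erule path_lev_mono; simp)
    have "path (lev x \<beta> 0 D) (x \<otimes> wv w) ?t"
      using up[of "x \<otimes> wv w"] near_word[OF x w, of "length w"] b D by (auto elim: path_lev_mono)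
    then have 3: "path (lev x \<beta> 0 D) (x \<otimes> wv w \<otimes> wv ?t) (inv_word ?t)"
      using x w pX by (subst path_inv) auto
    have e: "wv ?t \<otimes> wv (pushn n w) = wv w \<otimes> wv ?t"
      using pushn_val[OF w, of n] by (simp add: tnt)
    have "path (lev x \<beta> 0 D) x ?p"
      using 1 2 3 x w pX e by (simp add: path_append m_assoc)
    then show "path W x ?p"
      using path_W[OF reg] by blast
    show "wv ?p = wv w"
      using w pX e by (simp add: m_assoc[symmetric]) (simp add: m_assoc r_inv)
    show "length ?p \<le> length ?p" by simp
  qed (use pX in auto)
qed

end

section \<open>Pushing paths into a ball\<close>

text \<open>A derivation from \<open>u\<close> to \<open>v\<close> involves finitely many words and
  so stays within a bounded distance of the base point; there each elementary move inserts or
  removes a closed path of length at most \<open>d\<close>.\<close>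

lemma (in generators) presentation_rel_hol:
  assumes "(u, v) \<in> presentation_rel X R"
    and R: "!!r. r \<in> R ==> r \<in> words X ==> wv r = \<one> & length r \<le> d" and d: "2 \<le> d"
  shows "\<exists>D. \<forall>x\<in>carrier G. \<forall>W (L :: 'a => 'x \<times> bool => 'k => 'k). near x D \<subseteq> W --> flat d W L -->
    hol L x u = hol L x v"
proof -
  have key: "\<exists>D. \<forall>x\<in>carrier G. \<forall>W (L :: 'a => 'x \<times> bool => 'k => 'k). near x D \<subseteq> W --> flat d W L -->
      hol L x (u @ r @ v) = hol L x (u @ v)"
    if w: "u \<in> words X" "v \<in> words X" "r \<in> words X" "wv r = \<one>" "length r \<le> d" for u v r
  proof (intro exI[of _ "length u + length r"] ballI allI impI)
    fix x W and L :: "'a => 'x \<times> bool => 'k => 'k"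
    assume x: "x \<in> carrier G" and W: "near x (length u + length r) \<subseteq> W" and L: "flat d W L"
    have "x \<otimes> wv u \<otimes> wv (take i r) \<in> W" if "i \<le> length r" for i
      using x w near_word[OF x, of "u @ take i r" "length u + length r"] W by (auto simp: words_take m_assoc)
    then have "path W (x \<otimes> wv u) r"
      using x w by (subst path_iff_prefixes) auto
    then have "hol L (x \<otimes> wv u) r = id"
      using x w by (intro flatD[OF L]) auto
    then show "hol L x (u @ r @ v) = hol L x (u @ v)"
      using x w by (simp add: holonomy_append)
  qed
  show ?thesis
    using assms(1)
  proof (induction rule: presentation_rel.induct)
    case (sym u v)
    then show ?case by (simp only: eq_commute[of "hol _ _ v"])
  next
    case (trans u v w)
    obtain D1 where
      D1: "\<forall>x\<in>carrier G. \<forall>W (L :: 'a => 'x \<times> bool => 'k => 'k). near x D1 \<subseteq> W --> flat d W L -->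
        hol L x u = hol L x v"
      using trans.IH(1) ..
    obtain D2 where
      D2: "\<forall>x\<in>carrier G. \<forall>W (L :: 'a => 'x \<times> bool => 'k => 'k). near x D2 \<subseteq> W --> flat d W L -->
        hol L x v = hol L x w"
      using trans.IH(2) ..
    show ?case
    proof (intro exI[of _ "max D1 D2"] ballI allI impI)
      fix x W and L :: "'a => 'x \<times> bool => 'k => 'k"
      assume x: "x \<in> carrier G" and W: "near x (max D1 D2) \<subseteq> W" and L: "flat d W L"
      have "near x D1 \<subseteq> W" "near x D2 \<subseteq> W"
        using W near_mono[of _ x D1 "max D1 D2"] near_mono[of _ x D2 "max D1 D2"] by auto
      then show "hol L x u = hol L x w"
        using D1[rule_format, OF x _ L] D2[rule_format, OF x _ L] by simp
    qed
  next
    case (cancel u v x b)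
    then show ?case
      using d by (intro key) (auto simp: letter_val_def generator_closed)
  next
    case (relator u v r)
    then show ?case
      using R[of r] by (intro key) auto
  qed auto
qed

section \<open>Short relators present the product group\<close>

context two_factors
begin

lemma swap_factors: "two_factors G X f X2 X1 R2 R1 d"
proof unfold_locales
  show "X = X2 \<union> X1" "X2 \<inter> X1 = {}" "4 \<le> d"
    using X_Un X_disjoint d_ge by auto
  have X12: "w \<in> words X" if "w \<in> words X1 | w \<in> words X2" for w
    using that by (auto simp: X_Un words_iff)
  fix u v assume uv: "u \<in> words X2" "v \<in> words X1" "wv (u @ v) = \<one>"
  have "wv (v @ u) = wv v \<otimes> wv u \<otimes> (wv v \<otimes> inv (wv v))"
    using uv X12 by (simp add: r_inv)
  also have "... = wv v \<otimes> wv (u @ v) \<otimes> inv (wv v)"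
    using uv(1,2) X12 by (simp add: m_assoc)
  also have "... = \<one>"
    using uv X12 by (simp add: r_inv)
  finally have "wv (v @ u) = \<one>" .
  then show "wv u = \<one>"
    using factors_meet[OF uv(2,1)] uv X12 by simp
qed (use relators1 relators2 presentation1 presentation2 letters_commute in \<open>simp_all\<close>)

definition short_relators :: "'x word set" where
  "short_relators = {r \<in> words X. wv r = \<one> & length r \<le> d}"

text \<open>Commutator squares, which are short since \<open>4 \<le> d\<close>, sort a word into its
  two parts; by \<open>factors_meet\<close> the parts are trivial separately.\<close>

lemma closed_presentation:
  assumes w: "w \<in> words X" "wv w = \<one>"
  shows "(w, []) \<in> presentation_rel X short_relators"
proof -
  let ?P = "presentation_rel X short_relators"
  have X12: "w \<in> words X" if "w \<in> words X1 | w \<in> words X2" for w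
    using that by (auto simp: X_Un words_iff)
  have rfl: "(u, u) \<in> ?P" if "u \<in> words X" for u
    using that by (rule presentation_rel.refl)
  have swap1: "([s, a], [a, s]) \<in> ?P" if s: "fst s \<in> X2" "fst a \<in> X1" for s a
  proof -
    have X: "fst s \<in> X" "fst a \<in> X" using s X_Un by auto
    let ?r = "[s, a, inv_letter s, inv_letter a]"
    have com: "lv a \<otimes> lv s = lv s \<otimes> lv a"
      using s letters_commute[of a s] by simp
    have "wv ?r = lv s \<otimes> lv a \<otimes> inv (lv a \<otimes> lv s)"
      using X by (simp add: m_assoc inv_mult_group)
    also have "... = \<one>"
      using X com by (simp add: r_inv)
    finally have "?r \<in> short_relators"
      using X d_ge by (simp add: short_relators_def)
    then have 1: "(?r @ [a, s], [a, s]) \<in> ?P"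
      using presentation_rel.relator[of "[]" X "[a, s]" ?r short_relators] X by simp
    have "([s, a] @ (inv_word [a, s] @ [a, s]), [s, a] @ []) \<in> ?P"
      using X by (intro presentation_rel_cong rfl presentation_rel_inv_left) auto
    then have "(?r @ [a, s], [s, a]) \<in> ?P" by simp
    then show ?thesis
      using 1 by (blast intro: presentation_rel.intros)
  qed
  have swap: "(s # u, u @ [s]) \<in> ?P" if "fst s \<in> X2" "u \<in> words X1" for s u
    using that(2)
  proof (induction u)
    case Nil
    then show ?case using that(1) X_Un rfl[of "[s]"] by simp
  next
    case (Cons a u)
    have X: "fst s \<in> X" "fst a \<in> X" "u \<in> words X" using that(1) Cons.prems X12 X_Un by auto
    have "([s, a] @ u, [a, s] @ u) \<in> ?P"
      using X that(1) Cons.prems by (intro presentation_rel_cong swap1 rfl) auto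
    moreover have "([a] @ (s # u), [a] @ (u @ [s])) \<in> ?P"
      using X Cons by (intro presentation_rel_cong rfl) auto
    ultimately show ?case
      using presentation_rel.trans[of "s # a # u" "a # s # u"] by simp
  qed
  have parts: "\<exists>u v. u \<in> words X1 & v \<in> words X2 & (w, u @ v) \<in> ?P"
    using w(1)
  proof (induction w)
    case Nil
    then show ?case using rfl[of "[]"] by (intro exI[of _ "[]"]) simp
  next
    case (Cons s w)
    then obtain u v where uv: "u \<in> words X1" "v \<in> words X2" "(w, u @ v) \<in> ?P"
      by auto
    have s: "fst s \<in> X" using Cons.prems by simp
    have 1: "(s # w, s # u @ v) \<in> ?P"
      using presentation_rel_cong[OF rfl[of "[s]"] uv(3)] s by simp
    show ?case
    proof (cases "fst s \<in> X1")
      case True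
      then show ?thesis
        using uv 1 by (intro exI[of _ "s # u"] exI[of _ v]) simp
    next
      case False
      then have s2: "fst s \<in> X2" using s X_Un by auto
      have "((s # u) @ v, (u @ [s]) @ v) \<in> ?P"
        using uv s2 X12 by (intro presentation_rel_cong swap rfl) auto
      then have "(s # w, u @ s # v) \<in> ?P"
        using 1 presentation_rel.trans[of "s # w" "s # u @ v"] by simp
      then show ?thesis
        using uv s2 by (intro exI[of _ u] exI[of _ "s # v"]) simp
    qed
  qed
  have mono: "(u, v) \<in> ?P" if "(u, v) \<in> presentation_rel Y R" "Y = X1 & R = R1 | Y = X2 & R = R2" for u v Y R
    using that(1)
  proof (induction rule: presentation_rel.induct)
    case (relator u v r)
    then have "r \<in> short_relators"
      using that(2) relators1[of r] relators2[of r] X12[of r] by (auto simp: short_relators_def)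
    then show ?case
      using relator that(2) X12[of u] X12[of v] X12[of r] by (intro presentation_rel.relator) auto
  next
    case (refl u)
    then show ?case using that(2) X12[of u] by (intro presentation_rel.refl) auto
  next
    case (cancel u v x b)
    then show ?case using that(2) X12[of u] X12[of v] X_Un by (intro presentation_rel.cancel) auto
  qed (blast intro: presentation_rel.intros)+
  obtain u v where uv: "u \<in> words X1" "v \<in> words X2" "(w, u @ v) \<in> ?P"
    using parts by blast
  have "wv (u @ v) = wv w"
    using presentation_rel_val[OF _ uv(3)] by (auto simp: short_relators_def)
  then have o: "wv (u @ v) = \<one>" using w by simp
  have o1: "wv u = \<one>" using factors_meet[OF uv(1,2) o] .
  then have o2: "wv v = \<one>" using o uv X12 by simp
  have "(u @ v, [] @ []) \<in> ?P"
    by (intro presentation_rel_cong mono[OF presentation1[OF uv(1) o1]] mono[OF presentation2[OF uv(2) o2]]) auto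
  then show ?thesis
    using uv(3) presentation_rel.trans by fastforce
qed

lemma interior_fill:
  assumes w: "w \<in> words X" "wv w = \<one>"
  shows "\<exists>D. \<forall>x\<in>carrier G. \<forall>W (L :: 'a => 'x \<times> bool => 'k => 'k). near x D \<subseteq> W --> flat d W L -->
    hol L x w = id"
  using presentation_rel_hol[OF closed_presentation[OF w], of d] d_ge
  by (simp add: short_relators_def)

end

section \<open>Euclidean estimates\<close>

definition inner_prod :: "nat => (nat => real) => (nat => real) => real" where
  "inner_prod n u v = (\<Sum>i<n. u i * v i)"

definition norm2 :: "nat => (nat => real) => real" where
  "norm2 n u = L2_set u {..<n}"

lemma norm2_sq: "(norm2 n u)\<^sup>2 = inner_prod n u u"
  by (simp add: norm2_def L2_set_def inner_prod_def sum_nonneg power2_eq_square)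

lemma norm2_nonneg [simp]: "0 \<le> norm2 n u"
  by (simp add: norm2_def)

lemma norm2_triangle: "norm2 n (%i. u i + v i) \<le> norm2 n u + norm2 n v"
  by (simp add: norm2_def L2_set_triangle_ineq)

lemma norm2_minus: "norm2 n (%i. - u i) = norm2 n u"
  by (simp add: norm2_def L2_set_def)

lemma norm2_cong: "(!!i. i < n ==> u i = v i) ==> norm2 n u = norm2 n v"
  unfolding norm2_def by (rule L2_set_cong) auto

lemma norm2_scale: "norm2 n (%i. c * u i) = \<bar>c\<bar> * norm2 n u"
proof -
  have "norm2 n (%i. c * u i) = L2_set (%i. \<bar>c\<bar> * u i) {..<n}"
    by (simp add: norm2_def L2_set_def power_mult_distrib)
  then show ?thesis
    by (simp add: norm2_def L2_set_right_distrib)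
qed

lemma inner_prod_bound: "\<bar>inner_prod n u v\<bar> \<le> norm2 n u * norm2 n v"
proof -
  have "\<bar>inner_prod n u v\<bar> \<le> (\<Sum>i<n. \<bar>u i\<bar> * \<bar>v i\<bar>)"
    unfolding inner_prod_def abs_mult[symmetric] by (rule sum_abs)
  also have "... \<le> norm2 n u * norm2 n v"
    unfolding norm2_def by (rule L2_set_mult_ineq)
  finally show ?thesis .
qed

lemma inner_prod_add: "inner_prod n u (%i. v i + w i) = inner_prod n u v + inner_prod n u w"
  by (simp add: inner_prod_def algebra_simps sum.distrib)

lemma inner_prod_add_left: "inner_prod n (%i. v i + w i) u = inner_prod n v u + inner_prod n w u"
  by (simp add: inner_prod_def algebra_simps sum.distrib)

lemma inner_prod_commute: "inner_prod n u v = inner_prod n v u"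
  by (simp add: inner_prod_def mult.commute)

lemma inner_prod_scale_left: "inner_prod n (%i. c * v i) u = c * inner_prod n v u"
  by (simp add: inner_prod_def sum_distrib_left mult.assoc)

text \<open>Uses \<open>r^2 - s^2 = (r - s)(r + s)\<close>, where \<open>r + s\<close> is close to
  twice the norm of \<open>a\<close>. Replacing \<open>b\<close> by \<open>a\<close> and dropping
  the square of \<open>v\<close> costs \<open>3 B^2\<close>, replacing \<open>r + s\<close> costs
  another \<open>3 B^2\<close>; dividing \<open>6 B^2\<close> by twice the norm of \<open>a\<close>
  gives the constant 3.\<close>

lemma norm2_linearisation:
  assumes a: "3 * B\<^sup>2 \<le> \<epsilon> * norm2 n a" "0 < norm2 n a"
    and b: "norm2 n (%i. b i - a i) \<le> B" and v: "norm2 n v \<le> B"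
  shows "\<bar>norm2 n (%i. b i + v i) - norm2 n b - inner_prod n a v / norm2 n a\<bar> \<le> \<epsilon>"
proof -
  let ?A = "norm2 n a" and ?r = "norm2 n (%i. b i + v i)" and ?s = "norm2 n b"
  let ?c = "%i. b i - a i"
  have B: "0 \<le> B" using v order_trans[OF norm2_nonneg] by blast
  have rs: "?r \<le> ?s + norm2 n v" by (rule norm2_triangle)
  have "?s = norm2 n (%i. (b i + v i) + - v i)" by simp
  also have "... \<le> ?r + norm2 n v" using norm2_triangle[of n "%i. b i + v i" "%i. - v i"] by (simp add: norm2_minus)
  finally have D: "\<bar>?r - ?s\<bar> \<le> B" using rs v by linarith
  have "?s = norm2 n (%i. a i + ?c i)" by simp
  also have "... \<le> ?A + norm2 n ?c" by (rule norm2_triangle)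
  finally have s1: "?s \<le> ?A + B" using b by linarith
  have "?A = norm2 n (%i. b i + - ?c i)" by simp
  also have "... \<le> ?s + norm2 n ?c" using norm2_triangle[of n b "%i. - ?c i"] norm2_minus[of n ?c] by simp
  finally have s2: "?A \<le> ?s + B" using b by linarith
  define e2 where "e2 = ?r + ?s - 2 * ?A"
  have e2: "\<bar>e2\<bar> \<le> 3 * B" using D s1 s2 unfolding e2_def by linarith
  define e1 where "e1 = 2 * inner_prod n ?c v + (norm2 n v)\<^sup>2"
  have "inner_prod n b v = inner_prod n (%i. a i + ?c i) v" by simp
  also have "... = inner_prod n a v + inner_prod n ?c v" by (rule inner_prod_add_left)
  finally have bv: "inner_prod n b v = inner_prod n a v + inner_prod n ?c v" .
  have "?r\<^sup>2 - ?s\<^sup>2 = 2 * inner_prod n b v + (norm2 n v)\<^sup>2"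
    by (simp add: norm2_sq inner_prod_add inner_prod_add_left inner_prod_commute[of n v b])
  then have "(?r - ?s) * (?r + ?s) = 2 * inner_prod n a v + e1"
    unfolding e1_def bv by (simp add: power2_eq_square algebra_simps)
  then have eq: "(?r - ?s) * (2 * ?A) - 2 * inner_prod n a v = e1 - (?r - ?s) * e2"
    unfolding e2_def by (simp add: algebra_simps)
  have c1: "\<bar>inner_prod n ?c v\<bar> \<le> B * B"
    using inner_prod_bound[of n ?c v] mult_mono[OF b v B norm2_nonneg] by linarith
  have c2: "(norm2 n v)\<^sup>2 \<le> B\<^sup>2" "0 \<le> (norm2 n v)\<^sup>2"
    using v by (auto intro: power_mono)
  have e1: "\<bar>e1\<bar> \<le> 3 * B\<^sup>2"
    unfolding e1_def using c1 c2 unfolding power2_eq_square[of B] abs_le_iff by linarith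
  have "\<bar>(?r - ?s) * e2\<bar> \<le> B * (3 * B)"
    unfolding abs_mult using D e2 B by (intro mult_mono) auto
  then have "\<bar>(?r - ?s) * (2 * ?A) - 2 * inner_prod n a v\<bar> \<le> 6 * B\<^sup>2"
    using e1 unfolding eq by (simp add: power2_eq_square abs_le_iff)
  then have "\<bar>(?r - ?s) * ?A - inner_prod n a v\<bar> \<le> \<epsilon> * ?A"
    using a(1) by (simp add: abs_le_iff)
  moreover have "?r - ?s - inner_prod n a v / ?A = ((?r - ?s) * ?A - inner_prod n a v) / ?A"
    using a(2) by (simp add: field_simps)
  ultimately show ?thesis
    using a(2) by (simp add: abs_divide pos_divide_le_eq)
qed


text \<open>\<open>h\<close> maps the group to \<open>n\<close>-dimensional space, and each member
  of \<open>certs\<close> is pushing data that works for some directions. Gains of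
  \<open>2 * \<epsilon>\<close> in the linear functional leave at least \<open>\<epsilon>\<close>
  after at most two linearisation errors of \<open>\<epsilon> / 2\<close>.\<close>

locale ball_pushing = two_factors G X f X1 X2 R1 R2 d
  for G (structure) and X :: "'x set" and f X1 X2 R1 R2 d +
  fixes n :: nat and h :: "'a => nat => real" and \<epsilon> C :: real
    and certs :: "('x set \<times> ('x \<times> bool) \<times> ('x \<times> bool) \<times> ('x \<times> bool => 'x word)) set"
  assumes finite_X: "finite X"
    and h_mult: "g \<in> carrier G ==> g' \<in> carrier G ==> i < n ==> h (g \<otimes> g') i = h g i + h g' i"
    and h_bound: "fst s \<in> X ==> norm2 n (h (letter_val G f s)) \<le> C"
    and finite_certs: "finite certs"
    and cert_pushing: "(Y, t, z, c) \<in> certs ==> Y \<subseteq> X & (\<exists>Y' Q Q'. pushing G X f Y Y' Q Q' d t z c \<epsilon> C)"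
    and eps: "0 < \<epsilon>" "0 \<le> C"
    and certs: "norm2 n u = 1 ==>
      \<exists>(Y, t, z, c) \<in> certs. 2 * \<epsilon> \<le> inner_prod n u (h (letter_val G f t)) &
        2 * \<epsilon> \<le> inner_prod n u (h (letter_val G f z)) &
        (\<forall>s. fst s \<in> Y --> (\<forall>i\<le>length (c s).
          min 0 (inner_prod n u (h (letter_val G f s))) + 2 * \<epsilon>
            \<le> inner_prod n u (h (letter_val G f t \<otimes> word_val G f (take i (c s))))))"
begin

definition N where "N g = norm2 n (h g)"
text \<open>The preimage of a Euclidean ball, which serves as a bounded neighbourhood of the kernel
  of \<open>h\<close>.\<close>

definition V where "V \<rho> = {g \<in> carrier G. N g \<le> \<rho>}"

lemma N_mult: "g \<in> carrier G ==> g' \<in> carrier G ==> N (g \<otimes> g') \<le> N g + N g'"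
  using norm2_triangle[of n "h g" "h g'"] norm2_cong[of n "h (g \<otimes> g')" "%i. h g i + h g' i"] h_mult
  by (simp add: N_def)

lemma N_word: "w \<in> words X ==> N (wv w) \<le> C * length w"
proof (induction w)
  case Nil
  have "h \<one> i = 0" if "i < n" for i using h_mult[of \<one> \<one> i] that by simp
  then have "N \<one> = norm2 n (%i. 0)" unfolding N_def by (rule norm2_cong)
  then show ?case by (simp add: norm2_def L2_set_def)
next
  case (Cons s w)
  then show ?case
    using N_mult[of "lv s" "wv w"] h_bound[of s] by (simp add: N_def algebra_simps)
qed

lemma N_step: "g \<in> carrier G ==> w \<in> words X ==> N (g \<otimes> wv w) \<le> N g + C * length w"
  using N_mult[of g "wv w"] N_word[of w] by simp

lemma V_closed: "g \<in> V \<rho> ==> g \<in> carrier G"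
  by (simp add: V_def)

lemma V_mono: "\<rho> \<le> \<rho>' ==> V \<rho> \<subseteq> V \<rho>'"
  by (auto simp: V_def)

lemma near_N:
  assumes "x \<in> carrier G" "y \<in> near x D"
  shows "y \<in> carrier G" "N y \<le> N x + C * D" "norm2 n (%i. h y i - h x i) \<le> C * D"
proof -
  obtain w where w: "w \<in> words X" "length w \<le> D" "y = x \<otimes> wv w"
    using assms(2) by (auto simp: near_def)
  show "y \<in> carrier G" using w assms by simp
  have l: "C * length w \<le> C * D"
    using w(2) eps(2) by (intro mult_left_mono) auto
  show "N y \<le> N x + C * D"
    using N_step[OF assms(1) w(1)] w l by simp
  have "norm2 n (%i. h y i - h x i) = N (wv w)"
    unfolding N_def using h_mult[of x "wv w"] assms(1) w by (intro norm2_cong) simp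
  then show "norm2 n (%i. h y i - h x i) \<le> C * D"
    using N_word[OF w(1)] l by simp
qed

text \<open>Far out, spheres are almost flat: for increments of norm at most
  \<open>B = C * D\<close> the linearisation error is at most \<open>\<epsilon> / 2\<close> once
  \<open>N x \<ge> 6 * B^2 / \<epsilon>\<close>.\<close>

lemma far_approximation:
  fixes D :: nat
  shows "\<exists>M>0. \<forall>x\<in>carrier G. M \<le> N x --> (\<forall>y\<in>near x D. \<forall>w\<in>words X. length w \<le> D -->
    \<bar>N (y \<otimes> wv w) - N y - inner_prod n (h x) (h (wv w)) / N x\<bar> \<le> \<epsilon> / 2)"
proof -
  define B where "B = C * D"
  define M where "M = max 1 (6 * B\<^sup>2 / \<epsilon>)"
  have M: "0 < M" "3 * B\<^sup>2 \<le> (\<epsilon> / 2) * M"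
    using eps(1) by (auto simp: M_def max_def field_simps)
  show ?thesis
  proof (intro exI[of _ M] conjI ballI allI impI)
    fix x y w
    assume x: "x \<in> carrier G" "M \<le> N x" and y: "y \<in> near x D" and w: "w \<in> words X" "length w \<le> D"
    have yc: "y \<in> carrier G" by (rule near_N(1)[OF x(1) y])
    have "(\<epsilon> / 2) * M \<le> (\<epsilon> / 2) * N x"
      using x(2) eps(1) by (intro mult_left_mono) auto
    then have a: "3 * B\<^sup>2 \<le> (\<epsilon> / 2) * norm2 n (h x)" "0 < norm2 n (h x)"
      using M x(2) by (auto simp: N_def)
    have "C * length w \<le> C * D"
      using w(2) eps(2) by (intro mult_left_mono) auto
    then have b: "norm2 n (h (wv w)) \<le> B"
      using N_word[OF w(1)] by (simp add: N_def B_def)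
    have "N (y \<otimes> wv w) = norm2 n (%i. h y i + h (wv w) i)"
      unfolding N_def using h_mult yc w by (intro norm2_cong) simp
    then show "\<bar>N (y \<otimes> wv w) - N y - inner_prod n (h x) (h (wv w)) / N x\<bar> \<le> \<epsilon> / 2"
      using norm2_linearisation[OF a near_N(3)[OF x(1) y, folded B_def] b] by (simp add: N_def)
  qed (rule M(1))
qed

text \<open>The direction \<open>u\<close> points from \<open>h x\<close> towards the origin, so a
  gain in the pairing with \<open>u\<close> is a decrease of \<open>N\<close>.\<close>

lemma far_region_aux:
  assumes P: "pushing G X f Y1 Y2 Q1 Q2 d t z c \<epsilon> C" "Y1 \<subseteq> X"
    and x: "x \<in> carrier G" "0 < N x" "N x \<le> \<rho>"
    and approx: "!!y w. y \<in> near x D ==> w \<in> words X ==> length w \<le> d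
      ==> \<bar>N (y \<otimes> wv w) - N y - inner_prod n (h x) (h (wv w)) / N x\<bar> \<le> \<epsilon> / 2"
    and u: "!!v. inner_prod n u v = - inner_prod n (h x) v / N x"
    and ct: "2 * \<epsilon> \<le> inner_prod n u (h (lv t))" and cz: "2 * \<epsilon> \<le> inner_prod n u (h (lv z))"
    and cc: "!!s i. fst s \<in> Y1 ==> i \<le> length (c s) ==>
      min 0 (inner_prod n u (h (lv s))) + 2 * \<epsilon> \<le> inner_prod n u (h (lv t \<otimes> wv (take i (c s))))"
  shows "pushing.region G X f Y1 t z c \<epsilon> C x D (%y. \<rho> - N y) (V \<rho>)"
proof -
  interpret P: pushing G X f Y1 Y2 Q1 Q2 d t z c \<epsilon> C by (rule P(1))
  have d1: "4 \<le> d" by (rule P.d_ge)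
  have wstep: "N (y \<otimes> wv w) \<le> N y - inner_prod n u (h (wv w)) + \<epsilon> / 2"
    "N y - inner_prod n u (h (wv w)) - \<epsilon> / 2 \<le> N (y \<otimes> wv w)"
    if "y \<in> near x D" "w \<in> words X" "length w \<le> d" for y w
  proof -
    have "\<bar>N (y \<otimes> wv w) - N y + inner_prod n u (h (wv w))\<bar> \<le> \<epsilon> / 2"
      using approx[of y w] that u[of "h (wv w)"] by simp
    then show "N (y \<otimes> wv w) \<le> N y - inner_prod n u (h (wv w)) + \<epsilon> / 2"
      "N y - inner_prod n u (h (wv w)) - \<epsilon> / 2 \<le> N (y \<otimes> wv w)"
      unfolding abs_le_iff by linarith+
  qed
  have step: "N (y \<otimes> lv s) \<le> N y - inner_prod n u (h (lv s)) + \<epsilon> / 2"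
    "N y - inner_prod n u (h (lv s)) - \<epsilon> / 2 \<le> N (y \<otimes> lv s)" if "y \<in> near x D" "fst s \<in> X" for y s
    using wstep[of y "[s]"] that d1 by auto
  show ?thesis
    unfolding P.region_def
  proof (intro conjI ballI allI impI)
    show "x \<in> carrier G" "0 \<le> \<rho> - N x" using x by auto
    fix y and s :: "'x \<times> bool" assume "y \<in> carrier G" "fst s \<in> X"
    then show "\<rho> - N y - C \<le> \<rho> - N (y \<otimes> lv s)"
      using N_step[of y "[s]"] by simp
  next
    fix y assume y: "y \<in> near x D"
    show "\<rho> - N y + \<epsilon> \<le> \<rho> - N (y \<otimes> lv t)" "\<rho> - N y + \<epsilon> \<le> \<rho> - N (y \<otimes> lv z)"
      using step(1)[OF y, of t] step(1)[OF y, of z] ct cz eps(1) by auto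
    show "y \<in> V \<rho>" if "0 \<le> \<rho> - N y"
      using that near_N(1)[OF x(1) y] by (simp add: V_def)
    fix s :: "'x \<times> bool" and i assume s: "fst s \<in> Y1" and i: "i \<le> length (c s)"
    have sX: "fst s \<in> X" using s P(2) by auto
    have yc: "y \<in> carrier G" by (rule near_N(1)[OF x(1) y])
    let ?w = "t # take i (c s)"
    have w: "?w \<in> words X" "length ?w \<le> d"
      using P.c_words_X[OF sX] P.c_length_X[OF sX] by (auto simp: words_take)
    have "N (y \<otimes> wv ?w) \<le> N y - inner_prod n u (h (wv ?w)) + \<epsilon> / 2"
      by (rule wstep(1)[OF y w])
    moreover have "wv ?w = lv t \<otimes> wv (take i (c s))" by simp
    moreover have "y \<otimes> wv ?w = y \<otimes> lv t \<otimes> wv (take i (c s))"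
      using yc w by (simp add: m_assoc)
    ultimately have "N (y \<otimes> lv t \<otimes> wv (take i (c s)))
        \<le> N y - (min 0 (inner_prod n u (h (lv s))) + 2 * \<epsilon>) + \<epsilon> / 2"
      using cc[OF s i] by simp
    also have "... \<le> max (N y) (N (y \<otimes> lv s)) - \<epsilon>"
      using step(2)[OF y sX] eps(1) by (auto simp: min_def max_def)
    finally show "min (\<rho> - N y) (\<rho> - N (y \<otimes> lv s)) + \<epsilon> \<le> \<rho> - N (y \<otimes> lv t \<otimes> wv (take i (c s)))"
      by (auto simp: min_def max_def split: if_splits)
  qed
qed

definition cert_region where
  "cert_region a x D \<beta> W \<longleftrightarrow> (case a of (Y, t, z, c) => pushing.region G X f Y t z c \<epsilon> C x D \<beta> W)"

lemma cert_cases: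
  assumes "a \<in> certs"
  obtains Y t z c Y' Q Q' where "a = (Y, t, z, c)" "pushing G X f Y Y' Q Q' d t z c \<epsilon> C"
    "cert_region a = pushing.region G X f Y t z c \<epsilon> C"
proof -
  obtain Y t z c where a: "a = (Y, t, z, c)" by (cases a)
  then show ?thesis using that[OF a] cert_pushing[of Y t z c] assms by (auto simp: cert_region_def fun_eq_iff)
qed

lemma far_region:
  fixes D :: nat
  shows "\<exists>M>0. \<forall>x\<in>carrier G. \<forall>\<rho>. M \<le> N x --> N x \<le> \<rho> -->
    (\<exists>a\<in>certs. cert_region a x D (%y. \<rho> - N y) (V \<rho>))"
proof -
  obtain M where M: "0 < M" and approx: "\<forall>x\<in>carrier G. M \<le> N x --> (\<forall>y\<in>near x (max D d). \<forall>w\<in>words X.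
      length w \<le> max D d --> \<bar>N (y \<otimes> wv w) - N y - inner_prod n (h x) (h (wv w)) / N x\<bar> \<le> \<epsilon> / 2)"
    using far_approximation[of "max D d"] by blast
  show ?thesis
  proof (intro exI[of _ M] conjI ballI allI impI)
    fix x \<rho> assume x: "x \<in> carrier G" "M \<le> N x" "N x \<le> \<rho>"
    have Nx: "0 < N x" using M x by simp
    have ap: "\<bar>N (y \<otimes> wv w) - N y - inner_prod n (h x) (h (wv w)) / N x\<bar> \<le> \<epsilon> / 2"
      if "y \<in> near x D" "w \<in> words X" "length w \<le> d" for y w
      using approx[rule_format, OF x(1,2), of y w] that near_mono[OF that(1), of "max D d"] by auto
    define u where "u = (%i. - 1 / N x * h x i)"
    have u: "inner_prod n u v = - inner_prod n (h x) v / N x" for v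
      unfolding u_def inner_prod_scale_left by simp
    have "norm2 n u = 1"
      unfolding u_def norm2_scale using Nx by (simp add: N_def)
    then obtain Y t z c where cert: "(Y, t, z, c) \<in> certs"
      "2 * \<epsilon> \<le> inner_prod n u (h (lv t))" "2 * \<epsilon> \<le> inner_prod n u (h (lv z))"
      "\<forall>s. fst s \<in> Y --> (\<forall>i\<le>length (c s).
          min 0 (inner_prod n u (h (lv s))) + 2 * \<epsilon> \<le> inner_prod n u (h (lv t \<otimes> wv (take i (c s)))))"
      using certs[of u] by blast
    obtain Y' Q Q' where P: "Y \<subseteq> X" "pushing G X f Y Y' Q Q' d t z c \<epsilon> C" using cert_pushing[OF cert(1)] by blast
    have "pushing.region G X f Y t z c \<epsilon> C x D (%y. \<rho> - N y) (V \<rho>)"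
      by (rule far_region_aux[OF P(2,1) x(1) Nx x(3) ap u cert(2,3)]) (use cert(4) in blast)+
    then show "\<exists>a\<in>certs. cert_region a x D (%y. \<rho> - N y) (V \<rho>)"
      using cert(1) by (auto simp: cert_region_def)
  qed (rule M)
qed

lemma near_V:
  assumes "x \<in> carrier G" "N x \<le> M" "M + C * D \<le> \<rho>"
  shows "near x D \<subseteq> V \<rho>"
  using near_N[OF assms(1)] assms(2,3) by (fastforce simp: V_def)

lemma path_nonneg: "path (V \<rho>) x w ==> path {y. 0 \<le> \<rho> - N y} x w"
  by (erule path_in_mono) (auto simp: V_def)

lemma loop_fill_certs:
  assumes w: "w \<in> words X" "wv w = \<one>"
  shows "\<exists>D. \<forall>a\<in>certs. \<forall>x \<beta> W (L :: 'a => 'x \<times> bool => 'k => 'k).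
    cert_region a x D \<beta> W --> flat d W L --> path {y. 0 \<le> \<beta> y} x w --> hol L x w = id"
proof -
  have 1: "\<forall>\<^sub>F D in sequentially. \<forall>x \<beta> W (L :: 'a => 'x \<times> bool => 'k => 'k).
    cert_region a x D \<beta> W --> flat d W L --> path {y. 0 \<le> \<beta> y} x w --> hol L x w = id" if a: "a \<in> certs" for a
    using a
  proof (rule cert_cases)
    fix Y t z c Y' Q Q' assume P: "pushing G X f Y Y' Q Q' d t z c \<epsilon> C"
      and r: "cert_region a = pushing.region G X f Y t z c \<epsilon> C"
    interpret P: pushing G X f Y Y' Q Q' d t z c \<epsilon> C by (rule P)
    show ?thesis
      using P.loop_fill[OF w, where 'k = 'k] unfolding eventually_sequentially r by blast
  qed
  have "\<forall>\<^sub>F D in sequentially. \<forall>a\<in>certs. \<forall>x \<beta> W (L :: 'a => 'x \<times> bool => 'k => 'k).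
    cert_region a x D \<beta> W --> flat d W L --> path {y. 0 \<le> \<beta> y} x w --> hol L x w = id"
    by (intro eventually_ball_finite finite_certs ballI 1)
  from eventually_happens'[OF sequentially_bot this] show ?thesis .
qed

definition fillable :: "'k itself => real => 'x word => bool" where
  "fillable k \<rho> w \<longleftrightarrow> (\<forall>x\<in>carrier G. \<forall>L :: 'a => 'x \<times> bool => 'k => 'k.
    flat d (V \<rho>) L --> path (V \<rho>) x w --> hol L x w = id)"

text \<open>A base point far out lies in a region of some certificate, where the loop is pushed
  inwards; around a base point near the centre the ball contains all the room that an ordinary
  derivation takes.\<close>

lemma ball_fill:
  assumes w: "w \<in> words X" "wv w = \<one>"
  shows "\<forall>\<^sub>F \<rho> in at_top. fillable (k :: 'k itself) \<rho> w"
proof -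
  obtain D1 where D1: "\<forall>a\<in>certs. \<forall>x \<beta> W (L :: 'a => 'x \<times> bool => 'k => 'k).
      cert_region a x D1 \<beta> W --> flat d W L --> path {y. 0 \<le> \<beta> y} x w --> hol L x w = id"
    using loop_fill_certs[OF w, where 'k = 'k] by blast
  obtain D2 where D2: "\<forall>x\<in>carrier G. \<forall>W (L :: 'a => 'x \<times> bool => 'k => 'k). near x D2 \<subseteq> W -->
      flat d W L --> hol L x w = id"
    using interior_fill[OF w, where 'k = 'k] by blast
  obtain M where M: "\<forall>x\<in>carrier G. \<forall>\<rho>. M \<le> N x --> N x \<le> \<rho> -->
    (\<exists>a\<in>certs. cert_region a x D1 (%y. \<rho> - N y) (V \<rho>))"
    using far_region[of D1] by blast
  have "fillable k \<rho> w" if \<rho>: "M + C * D2 \<le> \<rho>" for \<rho>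
    unfolding fillable_def
  proof (intro ballI allI impI)
    fix x and L :: "'a => 'x \<times> bool => 'k => 'k"
    assume x: "x \<in> carrier G" and L: "flat d (V \<rho>) L" and p: "path (V \<rho>) x w"
    show "hol L x w = id"
    proof (cases "M \<le> N x")
      case True
      have "N x \<le> \<rho>" using path_in_start[OF p] by (simp add: V_def)
      with True obtain a where "a \<in> certs" "cert_region a x D1 (%y. \<rho> - N y) (V \<rho>)"
        using M[rule_format, OF x] by blast
      then show ?thesis
        using D1[THEN bspec, of a] L path_nonneg[OF p] by blast
    next
      case False
      then show ?thesis
        using D2 x near_V[OF x _ \<rho>] L by auto
    qed
  qed
  then show ?thesis
    unfolding eventually_at_top_linorder by blast
qed

definition joinable :: "real => nat => 'x word => bool" where
  "joinable \<rho> K w \<longleftrightarrow> (\<forall>x\<in>V \<rho>. x \<otimes> wv w \<in> V \<rho> -->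
    (\<exists>p\<in>words X. length p \<le> K & path (V \<rho>) x p & wv p = wv w))"

lemma joinable_mono: "joinable \<rho> K w ==> K \<le> K' ==> joinable \<rho> K' w"
  unfolding joinable_def by (meson order_trans)

lemma path_fill_certs:
  assumes w: "w \<in> words X"
  shows "\<exists>K. \<forall>a\<in>certs. \<forall>x \<beta> W. cert_region a x K \<beta> W --> 0 \<le> \<beta> (x \<otimes> wv w) -->
    (\<exists>p\<in>words X. length p \<le> K & path W x p & wv p = wv w)"
proof -
  have 1: "\<forall>\<^sub>F K in sequentially. \<forall>x \<beta> W. cert_region a x K \<beta> W --> 0 \<le> \<beta> (x \<otimes> wv w) -->
      (\<exists>p\<in>words X. length p \<le> K & path W x p & wv p = wv w)" if a: "a \<in> certs" for a
    using a
  proof (rule cert_cases)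
    fix Y t z c Y' Q Q' assume P: "pushing G X f Y Y' Q Q' d t z c \<epsilon> C"
      and r: "cert_region a = pushing.region G X f Y t z c \<epsilon> C"
    interpret P: pushing G X f Y Y' Q Q' d t z c \<epsilon> C by (rule P)
    obtain D0 K where D0: "\<forall>x D \<beta> W. D0 \<le> D --> P.region x D \<beta> W --> 0 \<le> \<beta> (x \<otimes> wv w) -->
        (\<exists>p\<in>words X. length p \<le> K & path W x p & wv p = wv w)"
      using P.path_fill[OF w] by blast
    show ?thesis
      unfolding eventually_sequentially r
      by (rule exI[of _ "max D0 K"]) (meson D0 order_trans max.bounded_iff)
  qed
  have "\<forall>\<^sub>F K in sequentially. \<forall>a\<in>certs. \<forall>x \<beta> W. cert_region a x K \<beta> W --> 0 \<le> \<beta> (x \<otimes> wv w) -->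
      (\<exists>p\<in>words X. length p \<le> K & path W x p & wv p = wv w)"
    by (intro eventually_ball_finite finite_certs ballI 1)
  from eventually_happens'[OF sequentially_bot this] show ?thesis .
qed

lemma ball_join:
  assumes w: "w \<in> words X"
  shows "\<exists>K. \<forall>\<^sub>F \<rho> in at_top. joinable \<rho> K w"
proof -
  obtain K where K: "\<forall>a\<in>certs. \<forall>x \<beta> W. cert_region a x K \<beta> W --> 0 \<le> \<beta> (x \<otimes> wv w) -->
      (\<exists>p\<in>words X. length p \<le> K & path W x p & wv p = wv w)"
    using path_fill_certs[OF w] by blast
  obtain M where M: "\<forall>x\<in>carrier G. \<forall>\<rho>. M \<le> N x --> N x \<le> \<rho> -->
    (\<exists>a\<in>certs. cert_region a x K (%y. \<rho> - N y) (V \<rho>))"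
    using far_region[of K] by blast
  have "joinable \<rho> (max K (length w)) w" if \<rho>: "M + C * length w \<le> \<rho>" for \<rho>
    unfolding joinable_def
  proof (intro ballI allI impI)
    fix x assume x: "x \<in> V \<rho>" "x \<otimes> wv w \<in> V \<rho>"
    have xc: "x \<in> carrier G" "N x \<le> \<rho>" and xw: "0 \<le> \<rho> - N (x \<otimes> wv w)" using x by (auto simp: V_def)
    show "\<exists>p\<in>words X. length p \<le> max K (length w) & path (V \<rho>) x p & wv p = wv w"
    proof (cases "M \<le> N x")
      case True
      then obtain a where "a \<in> certs" "cert_region a x K (%y. \<rho> - N y) (V \<rho>)"
        using M[rule_format, OF xc(1)] xc(2) by blast
      then have "\<exists>p\<in>words X. length p \<le> K & path (V \<rho>) x p & wv p = wv w"
        using K[THEN bspec, of a] xw by blast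
      then show ?thesis by (meson max.coboundedI1)
    next
      case False
      then have "near x (length w) \<subseteq> V \<rho>"
        using near_V[OF xc(1) _ \<rho>] by simp
      then have "path (V \<rho>) x w"
        using xc w near_word[OF xc(1) words_take[OF w]] by (subst path_iff_prefixes) auto
      then show ?thesis using w by (intro bexI[of _ w]) auto
    qed
  qed
  then show ?thesis
    unfolding eventually_at_top_linorder by blast
qed

text \<open>A region of radius 0 for the ball of radius \<open>\<rho> + \<epsilon>\<close> suffices:
  the letter \<open>t\<close> of its certificate lowers \<open>N\<close> by at least
  \<open>\<epsilon>\<close>.\<close>

lemma ball_push_vertex:
  "\<forall>\<^sub>F \<rho> in at_top. \<forall>v\<in>V (\<rho> + \<epsilon>). \<exists>p\<in>words X. length p \<le> 1 & v \<otimes> wv p \<in> V \<rho>"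
proof -
  obtain M where M: "\<forall>x\<in>carrier G. \<forall>\<rho>. M \<le> N x --> N x \<le> \<rho> -->
    (\<exists>a\<in>certs. cert_region a x 0 (%y. \<rho> - N y) (V \<rho>))"
    using far_region[of 0] by blast
  have "\<exists>p\<in>words X. length p \<le> 1 & v \<otimes> wv p \<in> V \<rho>" if \<rho>: "M \<le> \<rho>" and v: "v \<in> V (\<rho> + \<epsilon>)" for \<rho> v
  proof (cases "v \<in> V \<rho>")
    case True
    then show ?thesis using V_closed by (intro bexI[of _ "[]"]) auto
  next
    case False
    have vc: "v \<in> carrier G" "N v \<le> \<rho> + \<epsilon>" "M \<le> N v" using v False \<rho> by (auto simp: V_def)
    have v0: "v \<in> near v 0" using near_word[OF vc(1), of "[]" 0] vc by simp
    obtain a where a: "a \<in> certs" "cert_region a v 0 (%y. (\<rho> + \<epsilon>) - N y) (V (\<rho> + \<epsilon>))"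
      using M[rule_format, OF vc(1,3,2)] by blast
    show ?thesis
      using a(1)
    proof (rule cert_cases)
      fix Y t z c Y' Q Q' assume P: "pushing G X f Y Y' Q Q' d t z c \<epsilon> C"
        and r: "cert_region a = pushing.region G X f Y t z c \<epsilon> C"
      interpret P: pushing G X f Y Y' Q Q' d t z c \<epsilon> C by (rule P)
      have "fst t \<in> X & (\<rho> + \<epsilon>) - N v + \<epsilon> \<le> (\<rho> + \<epsilon>) - N (v \<otimes> lv t)"
        using P.beta_t[OF a(2)[unfolded r] v0] by simp
      then show ?thesis
        using vc by (intro bexI[of _ "[t]"]) (auto simp: V_def)
    qed
  qed
  then show ?thesis
    unfolding eventually_at_top_linorder by blast
qed

section \<open>Retracting a ball onto a slightly smaller one\<close>

primrec subst_path :: "('a => 'x \<times> bool => 'x word) => 'a => 'x word => 'x word" where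
  "subst_path \<pi> v [] = []"
| "subst_path \<pi> v (s # w) = \<pi> v s @ subst_path \<pi> (v \<otimes> lv s) w"

text \<open>A coarse retraction of the ball of radius \<open>\<rho> + \<epsilon>\<close> onto that
  of radius \<open>\<rho>\<close>: the word \<open>\<sigma> v\<close> moves the vertex
  \<open>v\<close> inside, and the path \<open>\<pi> v s\<close> replaces the edge \<open>s\<close>
  at \<open>v\<close>. The smaller ball is fixed, and \<open>K\<close> bounds the
  stretching.\<close>

definition pushes_in :: "real => nat => ('a => 'x word) => ('a => 'x \<times> bool => 'x word) => bool" where
  "pushes_in \<rho> K \<sigma> \<pi> \<longleftrightarrow>
    (\<forall>v. \<sigma> v \<in> words X & (v \<in> V (\<rho> + \<epsilon>) --> v \<otimes> wv (\<sigma> v) \<in> V \<rho>) & (v \<in> V \<rho> --> \<sigma> v = [])) &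
    (\<forall>v s. fst s \<in> X --> v \<in> V (\<rho> + \<epsilon>) --> v \<otimes> lv s \<in> V (\<rho> + \<epsilon>) -->
      \<pi> v s \<in> words X & length (\<pi> v s) \<le> K & path (V \<rho>) (v \<otimes> wv (\<sigma> v)) (\<pi> v s) &
      v \<otimes> wv (\<sigma> v) \<otimes> wv (\<pi> v s) = v \<otimes> lv s \<otimes> wv (\<sigma> (v \<otimes> lv s))) &
    (\<forall>v s. v \<in> V \<rho> --> v \<otimes> lv s \<in> V \<rho> --> \<pi> v s = [s])"

lemma pushes_in_exists:
  assumes vertex: "\<forall>v\<in>V (\<rho> + \<epsilon>). \<exists>p\<in>words X. length p \<le> 1 & v \<otimes> wv p \<in> V \<rho>"
    and join: "!!w. w \<in> words X ==> length w \<le> 3 ==> joinable \<rho> K w" and K: "1 \<le> K"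
  obtains \<sigma> \<pi> where "pushes_in \<rho> K \<sigma> \<pi>"
proof -
  have VV: "v \<in> V (\<rho> + \<epsilon>)" if "v \<in> V \<rho>" for v
    using that V_mono[of \<rho> "\<rho> + \<epsilon>"] eps(1) by auto
  have "\<exists>p. p \<in> words X & length p \<le> 1 & (v \<in> V (\<rho> + \<epsilon>) --> v \<otimes> wv p \<in> V \<rho>) & (v \<in> V \<rho> --> p = [])" for v
  proof (cases "v \<in> V \<rho> | v \<notin> V (\<rho> + \<epsilon>)")
    case True
    then show ?thesis using V_closed by (intro exI[of _ "[]"]) auto
  next
    case False
    then show ?thesis using vertex by blast
  qed
  then have "\<exists>\<sigma>. \<forall>v. \<sigma> v \<in> words X & length (\<sigma> v) \<le> 1 & (v \<in> V (\<rho> + \<epsilon>) --> v \<otimes> wv (\<sigma> v) \<in> V \<rho>)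
      & (v \<in> V \<rho> --> \<sigma> v = [])"
    by (intro choice allI)
  then obtain \<sigma> where "\<forall>v. \<sigma> v \<in> words X & length (\<sigma> v) \<le> 1 & (v \<in> V (\<rho> + \<epsilon>) --> v \<otimes> wv (\<sigma> v) \<in> V \<rho>)
      & (v \<in> V \<rho> --> \<sigma> v = [])" ..
  note \<sigma> = spec[OF this]
  have "\<exists>p. (fst s \<in> X --> v \<in> V (\<rho> + \<epsilon>) --> v \<otimes> lv s \<in> V (\<rho> + \<epsilon>) -->
      p \<in> words X & length p \<le> K & path (V \<rho>) (v \<otimes> wv (\<sigma> v)) p &
      v \<otimes> wv (\<sigma> v) \<otimes> wv p = v \<otimes> lv s \<otimes> wv (\<sigma> (v \<otimes> lv s))) &
      (v \<in> V \<rho> --> v \<otimes> lv s \<in> V \<rho> --> p = [s])" for v s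
  proof (cases "v \<in> V \<rho> & v \<otimes> lv s \<in> V \<rho>")
    case True
    then show ?thesis
      using \<sigma>[of v] \<sigma>[of "v \<otimes> lv s"] V_closed K by (intro exI[of _ "[s]"]) auto
  next
    case False
    show ?thesis
    proof (cases "fst s \<in> X & v \<in> V (\<rho> + \<epsilon>) & v \<otimes> lv s \<in> V (\<rho> + \<epsilon>)")
      case True
      let ?v = "v \<otimes> wv (\<sigma> v)" and ?u = "\<sigma> (v \<otimes> lv s)"
      \<comment> \<open>Back along \<open>\<sigma> v\<close>, across the edge, and inwards from its
        other end: at most three letters, whence the bound in the assumption
        \<open>join\<close>.\<close>
      let ?q = "inv_word (\<sigma> v) @ [s] @ ?u"
      have q: "?q \<in> words X" "length ?q \<le> 3"
        using \<sigma>[of v] \<sigma>[of "v \<otimes> lv s"] True by auto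
      have cl: "v \<in> carrier G" "\<sigma> v \<in> words X" "?u \<in> words X"
        using True V_closed \<sigma> by auto
      have e: "?v \<otimes> wv ?q = v \<otimes> lv s \<otimes> wv ?u"
        using cl True by (simp add: m_assoc)
      then have "?v \<in> V \<rho>" "?v \<otimes> wv ?q \<in> V \<rho>"
        using \<sigma>[of v] \<sigma>[of "v \<otimes> lv s"] True by auto
      then obtain p where "p \<in> words X" "length p \<le> K" "path (V \<rho>) ?v p" "wv p = wv ?q"
        using join[OF q] unfolding joinable_def by blast
      then show ?thesis
        using False e by (intro exI[of _ p]) auto
    qed (use False in auto)
  qed
  then have "\<exists>\<pi>. \<forall>v. \<forall>s. (fst s \<in> X --> v \<in> V (\<rho> + \<epsilon>) --> v \<otimes> lv s \<in> V (\<rho> + \<epsilon>) -->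
      \<pi> v s \<in> words X & length (\<pi> v s) \<le> K & path (V \<rho>) (v \<otimes> wv (\<sigma> v)) (\<pi> v s) &
      v \<otimes> wv (\<sigma> v) \<otimes> wv (\<pi> v s) = v \<otimes> lv s \<otimes> wv (\<sigma> (v \<otimes> lv s))) &
      (v \<in> V \<rho> --> v \<otimes> lv s \<in> V \<rho> --> \<pi> v s = [s])"
    by (intro choice allI)
  then obtain \<pi> where \<pi>: "\<forall>v. \<forall>s. (fst s \<in> X --> v \<in> V (\<rho> + \<epsilon>) --> v \<otimes> lv s \<in> V (\<rho> + \<epsilon>) -->
      \<pi> v s \<in> words X & length (\<pi> v s) \<le> K & path (V \<rho>) (v \<otimes> wv (\<sigma> v)) (\<pi> v s) &
      v \<otimes> wv (\<sigma> v) \<otimes> wv (\<pi> v s) = v \<otimes> lv s \<otimes> wv (\<sigma> (v \<otimes> lv s))) &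
      (v \<in> V \<rho> --> v \<otimes> lv s \<in> V \<rho> --> \<pi> v s = [s])" ..
  have "pushes_in \<rho> K \<sigma> \<pi>"
    unfolding pushes_in_def
  proof (intro conjI allI)
    fix v and s :: "'x \<times> bool"
    show "\<sigma> v \<in> words X" "v \<in> V (\<rho> + \<epsilon>) --> v \<otimes> wv (\<sigma> v) \<in> V \<rho>" "v \<in> V \<rho> --> \<sigma> v = []"
      using \<sigma>[of v] by auto
    show "fst s \<in> X --> v \<in> V (\<rho> + \<epsilon>) --> v \<otimes> lv s \<in> V (\<rho> + \<epsilon>) -->
      \<pi> v s \<in> words X & length (\<pi> v s) \<le> K & path (V \<rho>) (v \<otimes> wv (\<sigma> v)) (\<pi> v s) &
      v \<otimes> wv (\<sigma> v) \<otimes> wv (\<pi> v s) = v \<otimes> lv s \<otimes> wv (\<sigma> (v \<otimes> lv s))"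
      using conjunct1[OF spec[OF spec[OF \<pi>, of v], of s]] .
    show "v \<in> V \<rho> --> v \<otimes> lv s \<in> V \<rho> --> \<pi> v s = [s]"
      using conjunct2[OF spec[OF spec[OF \<pi>, of v], of s]] .
  qed
  then show thesis by (rule that)
qed

context
  fixes \<rho> K \<sigma> \<pi>
  assumes pushes: "pushes_in \<rho> K \<sigma> \<pi>"
begin

lemma sigma_words: "\<sigma> v \<in> words X"
  and sigma_V: "v \<in> V (\<rho> + \<epsilon>) ==> v \<otimes> wv (\<sigma> v) \<in> V \<rho>"
  and sigma_id: "v \<in> V \<rho> ==> \<sigma> v = []"
  using pushes unfolding pushes_in_def by blast+

lemma pi_words: "fst s \<in> X ==> v \<in> V (\<rho> + \<epsilon>) ==> v \<otimes> lv s \<in> V (\<rho> + \<epsilon>) ==> \<pi> v s \<in> words X"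
  and pi_length: "fst s \<in> X ==> v \<in> V (\<rho> + \<epsilon>) ==> v \<otimes> lv s \<in> V (\<rho> + \<epsilon>) ==> length (\<pi> v s) \<le> K"
  and pi_path: "fst s \<in> X ==> v \<in> V (\<rho> + \<epsilon>) ==> v \<otimes> lv s \<in> V (\<rho> + \<epsilon>)
    ==> path (V \<rho>) (v \<otimes> wv (\<sigma> v)) (\<pi> v s)"
  and pi_val: "fst s \<in> X ==> v \<in> V (\<rho> + \<epsilon>) ==> v \<otimes> lv s \<in> V (\<rho> + \<epsilon>)
    ==> v \<otimes> wv (\<sigma> v) \<otimes> wv (\<pi> v s) = v \<otimes> lv s \<otimes> wv (\<sigma> (v \<otimes> lv s))"
  and pi_id: "v \<in> V \<rho> ==> v \<otimes> lv s \<in> V \<rho> ==> \<pi> v s = [s]"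
  using pushes unfolding pushes_in_def by blast+

text \<open>The labelling of the smaller ball pulled back along the retraction, which extends it to
  the larger ball.\<close>

definition push_label :: "('a => 'x \<times> bool => 'k => 'k) => 'a => 'x \<times> bool => 'k => 'k" where
  "push_label L v s = hol L (v \<otimes> wv (\<sigma> v)) (\<pi> v s)"

lemma subst_path:
  "w \<in> words X ==> path (V (\<rho> + \<epsilon>)) v w ==>
    subst_path \<pi> v w \<in> words X & length (subst_path \<pi> v w) \<le> K * length w &
    path (V \<rho>) (v \<otimes> wv (\<sigma> v)) (subst_path \<pi> v w) &
    v \<otimes> wv (\<sigma> v) \<otimes> wv (subst_path \<pi> v w) = v \<otimes> wv w \<otimes> wv (\<sigma> (v \<otimes> wv w)) &
    hol (push_label L) v w = hol L (v \<otimes> wv (\<sigma> v)) (subst_path \<pi> v w)"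
proof (induction w arbitrary: v)
  case Nil
  then have "v \<in> carrier G" "v \<in> V (\<rho> + \<epsilon>)" by (auto dest: V_closed)
  then show ?case using sigma_words sigma_V by auto
next
  case (Cons s w)
  let ?v = "v \<otimes> wv (\<sigma> v)" and ?vs = "v \<otimes> lv s"
  have s: "fst s \<in> X" "w \<in> words X" and v: "v \<in> V (\<rho> + \<epsilon>)" "?vs \<in> V (\<rho> + \<epsilon>)" "path (V (\<rho> + \<epsilon>)) ?vs w"
    using Cons.prems path_in_start[of G f "V (\<rho> + \<epsilon>)" ?vs w] by auto
  have vc: "v \<in> carrier G" "?v \<in> carrier G" using v V_closed sigma_words by auto
  note IH = Cons.IH[OF s(2) v(3)]
  note pi = pi_words[OF s(1) v(1,2)] pi_length[OF s(1) v(1,2)] pi_path[OF s(1) v(1,2)] pi_val[OF s(1) v(1,2)]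
  have 1: "?v \<otimes> wv (\<pi> v s) = ?vs \<otimes> wv (\<sigma> ?vs)" by (rule pi(4))
  have "?v \<otimes> wv (subst_path \<pi> v (s # w)) = ?v \<otimes> wv (\<pi> v s) \<otimes> wv (subst_path \<pi> ?vs w)"
    using vc pi(1) IH by (simp add: m_assoc sigma_words)
  also have "... = ?vs \<otimes> wv (\<sigma> ?vs) \<otimes> wv (subst_path \<pi> ?vs w)"
    by (simp only: 1)
  also have "... = v \<otimes> wv (s # w) \<otimes> wv (\<sigma> (v \<otimes> wv (s # w)))"
    using IH vc s by (simp add: m_assoc)
  finally have val: "?v \<otimes> wv (subst_path \<pi> v (s # w)) = v \<otimes> wv (s # w) \<otimes> wv (\<sigma> (v \<otimes> wv (s # w)))" .
  have pth: "path (V \<rho>) ?v (subst_path \<pi> v (s # w))"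
    using vc pi(1,3) IH 1 by (simp add: path_append)
  have hl: "hol (push_label L) v (s # w) = hol L ?v (subst_path \<pi> v (s # w))"
  proof -
    have "push_label L v s = hol L ?v (\<pi> v s)" by (simp add: push_label_def)
    then show ?thesis using vc pi(1) IH 1 by (simp add: holonomy_append)
  qed
  have len: "length (subst_path \<pi> v (s # w)) \<le> K * length (s # w)"
    using pi(2) IH by simp
  show ?case using val pth hl len pi(1) IH by simp
qed

lemma subst_path_id: "w \<in> words X ==> path (V \<rho>) v w ==> subst_path \<pi> v w = w"
  by (induction w arbitrary: v) (auto simp: pi_id path_in_start)

lemma push_label_id:
  assumes "w \<in> words X" "path (V \<rho>) v w"
  shows "hol (push_label L) v w = hol L v w"
proof -
  have "path (V (\<rho> + \<epsilon>)) v w"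
    using assms(2) V_mono[of \<rho> "\<rho> + \<epsilon>"] eps(1) by (auto elim: path_in_mono)
  moreover have "v \<in> V \<rho>" using path_in_start[OF assms(2)] .
  ultimately show ?thesis
    using subst_path[OF assms(1), of v L] subst_path_id[OF assms] sigma_id[of v] V_closed[of v] by simp
qed

text \<open>A closed path of length at most \<open>d\<close> is stretched to one of length at most
  \<open>K * d\<close> in the smaller ball, where \<open>fill\<close> makes the original labelling
  trivial.\<close>

lemma push_label_flat:
  assumes L: "flat d (V \<rho>) L"
    and fill: "!!w. w \<in> words X ==> wv w = \<one> ==> length w \<le> K * d ==> fillable (TYPE('k)) \<rho> w"
  shows "flat d (V (\<rho> + \<epsilon>)) (push_label (L :: 'a => 'x \<times> bool => 'k => 'k))"
  unfolding flat_def
proof (intro ballI allI impI)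
  fix v w assume v: "v \<in> carrier G" and w: "w \<in> words X" "length w \<le> d" "path (V (\<rho> + \<epsilon>)) v w"
    "v \<otimes> wv w = v"
  let ?v = "v \<otimes> wv (\<sigma> v)" and ?w = "subst_path \<pi> v w"
  note S = subst_path[OF w(1,3), where L = L]
  have vc: "?v \<in> carrier G" using v sigma_words by simp
  have "?v \<otimes> wv ?w = ?v" using S w(4) by simp
  then have "wv ?w = \<one>" using S vc closed_word_val by blast
  moreover have "length ?w \<le> K * d"
    using S mult_le_mono2[OF w(2), of K] by linarith
  ultimately have "fillable (TYPE('k)) \<rho> ?w"
    using fill S by blast
  then have "hol L ?v ?w = id"
    unfolding fillable_def using vc L S by blast
  then show "hol (push_label L) v w = id" using S by simp
qed

end

lemma path_enlarge: "path (V \<rho>) v w ==> \<rho> \<le> \<rho>' ==> path (V \<rho>') v w"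
  by (erule path_in_mono) (rule V_mono)

text \<open>A flat labelling is extended outwards in steps of \<open>\<epsilon>\<close> until the
  ball contains the neighbourhood of \<open>\<one>\<close> in which the loop has an ordinary
  derivation; paths, conversely, are retracted inwards. To iterate, the thresholds have to hold for
  all larger radii at once.\<close>

theorem ball_simply_connected:
  shows "\<exists>\<rho>\<ge>0. (\<forall>w\<in>words X. wv w = \<one> --> path (V \<rho>) \<one> w -->
      (\<forall>L :: 'a => 'x \<times> bool => 'k => 'k. flat d (V \<rho>) L --> hol L \<one> w = id)) &
    (\<forall>w\<in>words X. wv w \<in> V \<rho> --> (\<exists>p\<in>words X. path (V \<rho>) \<one> p & wv p = wv w))"
proof -
  have fin: "finite {w \<in> words X. length w \<le> k}" for k :: nat
    by (rule finite_words_length[OF finite_X])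
  obtain K0 where K0: "!!w. w \<in> words X ==> \<forall>\<^sub>F \<rho> in at_top. joinable \<rho> (K0 w) w"
    using ball_join by metis
  \<comment> \<open>\<open>pushes_in_exists\<close> has to join words of length at most 3 only.
    \<open>K\<close> depends on no radius, so only finitely many words, those of length at most
    \<open>K * d\<close>, have to be fillable.\<close>
  define K where "K = Max (insert 1 (K0 ` {w \<in> words X. length w \<le> 3}))"
  have K: "1 \<le> K" "!!w. w \<in> words X ==> length w \<le> 3 ==> K0 w \<le> K"
    unfolding K_def using fin[of 3] by (auto intro!: Max_ge)
  have "\<forall>\<^sub>F \<rho> in at_top. \<forall>w\<in>{w \<in> words X. length w \<le> 3}. joinable \<rho> (K0 w) w"
    using K0 by (intro eventually_ball_finite fin) auto
  then have join: "\<forall>\<^sub>F \<rho> in at_top. \<forall>w\<in>{w \<in> words X. length w \<le> 3}. joinable \<rho> K w"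
    by (rule eventually_mono) (use K(2) joinable_mono in blast)
  have fill: "\<forall>\<^sub>F \<rho> in at_top. \<forall>w\<in>{w \<in> {w \<in> words X. length w \<le> K * d}. wv w = \<one>}. fillable (TYPE('k)) \<rho> w"
  proof (rule eventually_ball_finite)
    show "finite {w \<in> {w \<in> words X. length w \<le> K * d}. wv w = \<one>}"
      by (rule finite_subset[OF _ fin[of "K * d"]]) auto
  qed (use ball_fill in auto)
  have "\<forall>\<^sub>F \<rho> in at_top. (0 :: real) \<le> \<rho>" by (rule eventually_ge_at_top)
  from eventually_conj[OF this eventually_conj[OF join eventually_conj[OF fill ball_push_vertex]]]
  obtain \<rho> :: real where \<rho>: "!!\<rho>'. \<rho> \<le> \<rho>' ==> 0 \<le> \<rho>' & (\<forall>w\<in>{w \<in> words X. length w \<le> 3}. joinable \<rho>' K w) &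
      (\<forall>w\<in>{w \<in> {w \<in> words X. length w \<le> K * d}. wv w = \<one>}. fillable (TYPE('k)) \<rho>' w) &
      (\<forall>v\<in>V (\<rho>' + \<epsilon>). \<exists>p\<in>words X. length p \<le> 1 & v \<otimes> wv p \<in> V \<rho>')"
    unfolding eventually_at_top_linorder by blast
  have push: "\<exists>\<sigma> \<pi>. pushes_in \<rho>' K \<sigma> \<pi>" if "\<rho> \<le> \<rho>'" for \<rho>'
    by (rule pushes_in_exists[of \<rho>' K]) (use \<rho>[OF that] K(1) in blast)+
  have eps_k: "\<rho> \<le> \<rho> + real k * \<epsilon>" for k using eps(1) by simp
  have loops: "!!L :: 'a => 'x \<times> bool => 'k => 'k. flat d (V \<rho>) L ==> hol L \<one> w = id"
    if w: "w \<in> words X" "wv w = \<one>" "path (V \<rho>) \<one> w" for w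
  proof -
    obtain D where D: "\<forall>x\<in>carrier G. \<forall>W (L :: 'a => 'x \<times> bool => 'k => 'k). near x D \<subseteq> W -->
        flat d W L --> hol L x w = id"
      using interior_fill[OF w(1,2), where 'k = 'k] by blast
    obtain k :: nat where k: "C * D < k * \<epsilon>"
      using ex_less_of_nat_mult[OF eps(1)] by blast
    have N1: "N \<one> \<le> \<rho>" using path_in_start[OF w(3)] by (simp add: V_def)
    have "hol L \<one> w = id" if "flat d (V (\<rho> + j * \<epsilon>)) L" "j \<le> k"
      for j :: nat and L :: "'a => 'x \<times> bool => 'k => 'k"
      using that(2,1)
    \<comment> \<open>Descending induction from the radius \<open>\<rho> + k * \<epsilon>\<close>:
      the labelling is extended to larger balls while the loop stays the same.\<close>
    proof (induction arbitrary: L rule: inc_induct)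
      case base
      have "near \<one> D \<subseteq> V (\<rho> + k * \<epsilon>)"
        using k N1 by (intro near_V[of \<one> \<rho>]) auto
      then show ?case using D base by blast
    next
      case (step j)
      let ?\<rho> = "\<rho> + j * \<epsilon>"
      obtain \<sigma> \<pi> where P: "pushes_in ?\<rho> K \<sigma> \<pi>" using push[OF eps_k[of j]] by blast
      have e: "\<rho> + real (Suc j) * \<epsilon> = ?\<rho> + \<epsilon>" by (simp add: algebra_simps)
      have "flat d (V (?\<rho> + \<epsilon>)) (push_label \<sigma> \<pi> L)"
        by (rule push_label_flat[OF P step.prems]) (use \<rho>[OF eps_k[of j]] in blast)
      then have "hol (push_label \<sigma> \<pi> L) \<one> w = id"
        using step.IH unfolding e by blast
      then show ?case
        unfolding push_label_id[OF P w(1) path_enlarge[OF w(3) eps_k]] .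
    qed
    from this[of 0] show "!!L :: 'a => 'x \<times> bool => 'k => 'k. flat d (V \<rho>) L ==> hol L \<one> w = id"
      by simp
  qed
  have conn: "\<exists>p\<in>words X. path (V \<rho>) \<one> p & wv p = wv w" if w: "w \<in> words X" "wv w \<in> V \<rho>" for w
  proof -
    obtain k :: nat where k: "C * length w < k * \<epsilon>"
      using ex_less_of_nat_mult[OF eps(1)] by blast
    have one: "\<one> \<in> V \<rho>" using \<rho>[of \<rho>] N_word[of "[]"] by (simp add: V_def)
    have "near \<one> (length w) \<subseteq> V (\<rho> + k * \<epsilon>)"
      using k one by (intro near_V[of \<one> \<rho>]) (auto simp: V_def)
    then have pk: "path (V (\<rho> + k * \<epsilon>)) \<one> w"
      using w near_word[OF one_closed words_take[OF w(1)], of _ "length w"] by (subst path_iff_prefixes) auto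
    have "\<exists>p\<in>words X. path (V (\<rho> + j * \<epsilon>)) \<one> p & wv p = wv w" if "j \<le> k" for j
      using that
    \<comment> \<open>Here the path itself is retracted; its ends lie in the smallest ball and
      remain fixed.\<close>
    proof (induction rule: inc_induct)
      case base
      then show ?case using pk w by blast
    next
      case (step j)
      let ?\<rho> = "\<rho> + j * \<epsilon>"
      obtain \<sigma> \<pi> where P: "pushes_in ?\<rho> K \<sigma> \<pi>" using push[OF eps_k[of j]] by blast
      have e: "\<rho> + real (Suc j) * \<epsilon> = ?\<rho> + \<epsilon>" by (simp add: algebra_simps)
      obtain p where p: "p \<in> words X" "path (V (?\<rho> + \<epsilon>)) \<one> p" "wv p = wv w"
        using step.IH unfolding e by blast
      have "\<one> \<in> V ?\<rho>" "wv w \<in> V ?\<rho>" using one w V_mono[OF eps_k[of j]] by auto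
      then have "\<sigma> \<one> = []" "\<sigma> (wv p) = []" using sigma_id[OF P] p by auto
      then have "subst_path \<pi> \<one> p \<in> words X" "path (V ?\<rho>) \<one> (subst_path \<pi> \<one> p)" "wv (subst_path \<pi> \<one> p) = wv w"
        using subst_path[OF P p(1,2), of "%_ _. id"] p w(1) by auto
      then show ?case by blast
    qed
    from this[of 0] show ?thesis by simp
  qed
  show ?thesis
  proof (rule exI[of _ \<rho>], intro conjI ballI impI allI)
    show "0 \<le> \<rho>" using \<rho>[of \<rho>] by blast
  next
    fix w and L :: "'a => 'x \<times> bool => 'k => 'k"
    assume "w \<in> words X" "wv w = \<one>" "path (V \<rho>) \<one> w" "flat d (V \<rho>) L"
    then show "hol L \<one> w = id" by (rule loops)
  next
    fix w assume "w \<in> words X" "wv w \<in> V \<rho>"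
    then show "\<exists>p\<in>words X. path (V \<rho>) \<one> p & wv p = wv w" by (rule conn)
  qed
qed

end

section \<open>Presentations of subgroups\<close>

text \<open>The Reidemeister-Schreier presentation, restricted to the part \<open>V\<close> of the Cayley graph.\<close>

locale schreier = generators G X f for G (structure) and X :: "'x set" and f +
  fixes H V :: "'a set" and d :: nat
  assumes finite_X: "finite X" and subgroup: "subgroup H G"
    and V_sub: "V \<subseteq> carrier G" and one_V: "\<one> \<in> V"
    and V_invariant: "k \<in> H ==> v \<in> V ==> k \<otimes> v \<in> V"
    and finite_cosets: "finite ((%v. H #> v) ` V)"
    and d_ge: "2 \<le> d"
    and loops: "w \<in> words X ==> word_val G f w = \<one> ==> path_in G f V \<one> w ==>
      generators.flat G X f d V (L :: 'a => 'x \<times> bool => ('a set \<times> 'x \<times> bool) word => ('a set \<times> 'x \<times> bool) word)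
      ==> holonomy G f L \<one> w = id"
    and connected: "g \<in> V ==> \<exists>p\<in>words X. path_in G f V \<one> p & word_val G f p = g"
begin

abbreviation cl where "cl v \<equiv> H #> v"

definition Q where "Q = cl ` V"

lemma H_carrier: "k \<in> H ==> k \<in> carrier G"
  using subgroup.mem_carrier[OF subgroup] .

lemma H_sub: "H \<subseteq> carrier G"
  using H_carrier by blast

lemma H_one: "\<one> \<in> H" and H_mult: "a \<in> H ==> b \<in> H ==> a \<otimes> b \<in> H" and H_inv: "a \<in> H ==> inv a \<in> H"
  using subgroup.one_closed[OF subgroup] subgroup.m_closed[OF subgroup] subgroup.m_inv_closed[OF subgroup] by auto

lemma cl_mult: "v \<in> carrier G ==> g \<in> carrier G ==> cl v #> g = cl (v \<otimes> g)"
  by (rule coset_mult_assoc[OF H_sub])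

lemma cl_eqD:
  assumes "v \<in> carrier G" "v' \<in> carrier G" "cl v = cl v'"
  shows "v \<otimes> inv v' \<in> H"
proof -
  have "v \<in> cl v'" using assms rcos_self[OF assms(1) subgroup] by simp
  then obtain k where "k \<in> H" "v = k \<otimes> v'" by (auto simp: r_coset_def)
  then show ?thesis using assms(2) H_carrier by (simp add: m_assoc r_inv)
qed

lemma cl_H_mult: "k \<in> H ==> v \<in> carrier G ==> cl (k \<otimes> v) = cl v"
  using coset_mult_assoc[OF H_sub, of k v] coset_join2[OF _ subgroup, of k] H_carrier by simp

lemma V_iff:
  assumes "v \<in> carrier G"
  shows "v \<in> V \<longleftrightarrow> cl v \<in> Q"
proof
  assume "cl v \<in> Q"
  then obtain v' where v': "v' \<in> V" "cl v = cl v'" by (auto simp: Q_def)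
  have "v' \<in> carrier G" using v' V_sub by blast
  then have "v \<otimes> inv v' \<in> H" using assms v' cl_eqD by blast
  then have "(v \<otimes> inv v') \<otimes> v' \<in> V" using v' V_invariant by blast
  then show "v \<in> V" using assms \<open>v' \<in> carrier G\<close> by (simp add: m_assoc)
qed (simp add: Q_def)

lemma H_V: "k \<in> H ==> k \<in> V"
  using V_invariant[OF _ one_V, of k] H_carrier by simp

text \<open>A transversal given by paths inside \<open>V\<close>. The coset of \<open>H\<close> gets
  the empty path, so that closed paths at \<open>\<one>\<close> are rewritten without a correction
  factor.\<close>

definition \<tau> :: "'a set => 'x word" where
  "\<tau> q = (if q = cl \<one> then [] else SOME p. p \<in> words X & path V \<one> p & cl (wv p) = q)"

lemma tau:
  assumes "q \<in> Q"
  shows "\<tau> q \<in> words X & path V \<one> (\<tau> q) & cl (wv (\<tau> q)) = q"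
proof (cases "q = cl \<one>")
  case True
  then show ?thesis using one_V by (simp add: \<tau>_def)
next
  case False
  obtain v where "v \<in> V" "q = cl v" using assms by (auto simp: Q_def)
  then obtain p where "p \<in> words X & path V \<one> p & cl (wv p) = q"
    using connected[of v] by blast
  then show ?thesis
    using someI[of "%p. p \<in> words X & path V \<one> p & cl (wv p) = q" p] False by (simp add: \<tau>_def)
qed

definition \<sigma> where "\<sigma> q = wv (\<tau> q)"

lemma sigma_closed: "q \<in> Q ==> \<sigma> q \<in> carrier G" and cl_sigma: "q \<in> Q ==> cl (\<sigma> q) = q"
  using tau unfolding \<sigma>_def by auto

lemma sigma_one: "\<sigma> (cl \<one>) = \<one>"
  by (simp add: \<sigma>_def \<tau>_def)

text \<open>An edge and its reverse are separate generators, which keeps \<open>ybar\<close> free of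
  formal inverses; the backtracks among the relators tie them together.\<close>

definition Y :: "('a set \<times> 'x \<times> bool) set" where
  "Y = Q \<times> X \<times> UNIV"

text \<open>The Schreier generator of an edge between two cosets in \<open>Q\<close>. An edge
  leaving \<open>Q\<close> gets the value one and is killed by a relator of its own.\<close>

definition ygen :: "'a set \<times> 'x \<times> bool => 'a" where
  "ygen y = (if fst y #> lv (snd y) \<in> Q
    then \<sigma> (fst y) \<otimes> lv (snd y) \<otimes> inv (\<sigma> (fst y #> lv (snd y))) else \<one>)"

primrec ybar :: "'a set => 'x word => ('a set \<times> 'x \<times> bool) word" where
  "ybar q [] = []"
| "ybar q (s # w) = ((q, s), True) # ybar (q #> lv s) w"

text \<open>Short closed paths in \<open>V\<close>, the transversal paths, and the edges that leave
  \<open>Q\<close>. A relator of the first kind depends on \<open>v\<close> only through its coset,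
  hence finiteness.\<close>

definition R :: "('a set \<times> 'x \<times> bool) word set" where
  "R = {ybar (cl v) r |v r. v \<in> V & r \<in> words X & length r \<le> d & wv r = \<one> & path V v r} \<union>
    (%q. ybar (cl \<one>) (\<tau> q)) ` Q \<union> (%y. [(y, True)]) ` {y \<in> Y. fst y #> lv (snd y) \<notin> Q}"

abbreviation (input) GH where "GH \<equiv> G\<lparr>carrier := H\<rparr>"

abbreviation P where "P \<equiv> presentation_rel Y R"

lemma finite_Y: "finite Y"
  using finite_X finite_cosets by (simp add: Y_def Q_def)

lemma finite_R: "finite R"
proof -
  have "{ybar (cl v) r |v r. v \<in> V & r \<in> words X & length r \<le> d & wv r = \<one> & path V v r}
      \<subseteq> (%(q, r). ybar q r) ` (Q \<times> {r \<in> words X. length r \<le> d})"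
    by (auto simp: Q_def)
  then have "finite {ybar (cl v) r |v r. v \<in> V & r \<in> words X & length r \<le> d & wv r = \<one> & path V v r}"
    using finite_words_length[OF finite_X, of d] finite_cosets
    by (elim finite_subset) (simp add: Q_def)
  then show ?thesis
    using finite_Y finite_cosets by (simp add: R_def Q_def)
qed

lemma group_GH: "group GH"
  by (rule subgroup.subgroup_is_group[OF subgroup is_group])

lemma ygen_H: "y \<in> Y ==> ygen y \<in> H"
proof -
  assume y: "y \<in> Y"
  show "ygen y \<in> H"
  proof (cases "fst y #> lv (snd y) \<in> Q")
    case True
    have c: "fst y \<in> Q" "fst (snd y) \<in> X" using y by (auto simp: Y_def)
    have "cl (\<sigma> (fst y) \<otimes> lv (snd y)) = cl (\<sigma> (fst y #> lv (snd y)))"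
      using c True cl_mult[of "\<sigma> (fst y)" "lv (snd y)"] by (simp add: sigma_closed cl_sigma)
    then have "\<sigma> (fst y) \<otimes> lv (snd y) \<otimes> inv (\<sigma> (fst y #> lv (snd y))) \<in> H"
      using c True by (intro cl_eqD) (auto simp: sigma_closed)
    then show ?thesis using True by (simp add: ygen_def)
  next
    case False
    then show ?thesis by (simp add: ygen_def H_one)
  qed
qed

sublocale Y: generators GH Y ygen
  using group_GH ygen_H by (intro generators.intro generators_axioms.intro) auto

lemma ybar_append: "ybar q (u @ v) = ybar q u @ ybar (fold (%s q. q #> lv s) u q) v"
  by (induction u arbitrary: q) auto

lemma fold_coset:
  "v \<in> carrier G ==> w \<in> words X ==> fold (%s q. q #> lv s) w (cl v) = cl (v \<otimes> wv w)"
  by (induction w arbitrary: v) (auto simp: cl_mult m_assoc)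

lemma ybar_append':
  "v \<in> carrier G ==> u \<in> words X ==> ybar (cl v) (u @ w) = ybar (cl v) u @ ybar (cl (v \<otimes> wv u)) w"
  by (simp add: ybar_append fold_coset)

lemma ybar_words: "v \<in> carrier G ==> w \<in> words X ==> path V v w ==> ybar (cl v) w \<in> words Y"
  by (induction w arbitrary: v) (auto simp: Y_def V_iff cl_mult)

text \<open>The transversal factors of consecutive edges cancel; those at the two ends
  remain.\<close>

lemma ybar_val:
  "v \<in> carrier G ==> w \<in> words X ==> path V v w ==>
    word_val GH ygen (ybar (cl v) w) = \<sigma> (cl v) \<otimes> wv w \<otimes> inv (\<sigma> (cl (v \<otimes> wv w)))"
proof (induction w arbitrary: v)
  case Nil
  then show ?case by (simp add: V_iff sigma_closed r_inv)
next
  case (Cons s w)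
  let ?vs = "v \<otimes> lv s"
  have s: "fst s \<in> X" "w \<in> words X" "v \<in> V" "?vs \<in> V" "path V ?vs w"
    using Cons.prems path_in_start[of G f V ?vs w] by auto
  have e: "?vs \<otimes> wv w \<in> V" using path_end[OF _ s(2,5)] Cons.prems s by simp
  have Q: "cl v \<in> Q" "cl ?vs \<in> Q" "cl (?vs \<otimes> wv w) \<in> Q"
    using s e Q_def by auto
  have "ygen (cl v, s) = \<sigma> (cl v) \<otimes> lv s \<otimes> inv (\<sigma> (cl ?vs))"
    using Q Cons.prems(1) s by (simp add: ygen_def cl_mult)
  then show ?case
    using Cons s Q by (simp add: letter_val_def[of GH] cl_mult m_assoc sigma_closed)
qed

lemma R_words: "R \<subseteq> words Y"
proof
  fix r assume "r \<in> R"
  then consider v w where "r = ybar (cl v) w" "v \<in> V" "w \<in> words X" "path V v w"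
    | q where "q \<in> Q" "r = ybar (cl \<one>) (\<tau> q)" | y where "y \<in> Y" "r = [(y, True)]"
    by (auto simp: R_def)
  then show "r \<in> words Y"
    using V_sub tau one_closed by cases (auto intro: ybar_words)
qed

lemma R_val: "r \<in> R ==> word_val GH ygen r = \<one>\<^bsub>GH\<^esub>"
proof -
  assume "r \<in> R"
  then consider v w where "r = ybar (cl v) w" "v \<in> V" "w \<in> words X" "path V v w" "wv w = \<one>"
    | q where "q \<in> Q" "r = ybar (cl \<one>) (\<tau> q)"
    | y where "y \<in> Y" "r = [(y, True)]" "fst y #> lv (snd y) \<notin> Q"
    by (auto simp: R_def)
  then show ?thesis
  proof cases
    case (1 v w)
    then have "v \<in> carrier G" "cl v \<in> Q" using V_sub Q_def by auto
    then show ?thesis using 1 by (simp add: ybar_val sigma_closed r_inv)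
  next
    case (2 q)
    then show ?thesis
      using tau[OF 2(1)] sigma_one by (simp add: ybar_val) (simp add: \<sigma>_def r_inv)
  next
    case (3 y)
    then show ?thesis by (simp add: letter_val_def ygen_def)
  qed
qed

lemma generated: "carrier GH \<subseteq> word_val GH ygen ` words Y"
proof
  fix k assume "k \<in> carrier GH"
  then have k: "k \<in> H" by simp
  then obtain p where p: "p \<in> words X" "path V \<one> p" "wv p = k"
    using connected H_V by blast
  have "cl k = cl \<one>" using cl_H_mult[OF k one_closed] H_carrier[OF k] by simp
  then have "word_val GH ygen (ybar (cl \<one>) p) = k"
    using p H_carrier[OF k] by (simp add: ybar_val sigma_one)
  then show "k \<in> word_val GH ygen ` words Y"
    using ybar_words[OF one_closed p(1,2)] by blast
qed

lemma P_refl: "u \<in> words Y ==> (u, u) \<in> P"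
  by (rule presentation_rel.refl)

lemma ybar_closed:
  assumes "v \<in> V" "r \<in> words X" "length r \<le> d" "wv r = \<one>" "path V v r"
  shows "(ybar (cl v) r, []) \<in> P"
proof -
  have r: "ybar (cl v) r \<in> R" using assms unfolding R_def by blast
  then have "([] @ ybar (cl v) r @ [], [] @ []) \<in> P"
    using R_words by (intro presentation_rel.relator) auto
  then show ?thesis by simp
qed

lemma ybar_inverse:
  "v \<in> carrier G ==> w \<in> words X ==> path V v w ==>
    (ybar (cl v) w @ ybar (cl (v \<otimes> wv w)) (inv_word w), []) \<in> P"
proof (induction w arbitrary: v)
  case Nil
  then show ?case by (simp add: P_refl)
next
  case (Cons s w)
  let ?vs = "v \<otimes> lv s" and ?y = "[((cl v, s), True)]"
  have s: "fst s \<in> X" "w \<in> words X" "v \<in> V" "?vs \<in> V" "path V ?vs w"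
    using Cons.prems path_in_start[of G f V ?vs w] by auto
  have vc: "v \<in> carrier G" "?vs \<in> carrier G" using Cons.prems s by auto
  have e: "v \<otimes> wv (s # w) \<otimes> wv (inv_word w) = ?vs"
    using vc s by (simp add: m_assoc r_inv)
  let ?z = "((cl ?vs, inv_letter s), True)"
  have yz: "(?y @ [?z], []) \<in> P"
    using ybar_closed[of v "[s, inv_letter s]"] s vc d_ge by (simp add: cl_mult m_assoc r_inv)
  have yw: "?y \<in> words Y" "[?z] \<in> words Y"
    using s by (auto simp: Y_def Q_def mem_Times_iff)
  have "ybar (cl v) (s # w) @ ybar (cl (v \<otimes> wv (s # w))) (inv_word (s # w))
      = ?y @ (ybar (cl ?vs) w @ ybar (cl (?vs \<otimes> wv w)) (inv_word w)) @ [?z]"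
    using vc s e ybar_append'[of "v \<otimes> wv (s # w)" "inv_word w" "[inv_letter s]"]
    by (simp add: cl_mult m_assoc)
  moreover have "(?y @ (ybar (cl ?vs) w @ ybar (cl (?vs \<otimes> wv w)) (inv_word w)) @ [?z], ?y @ [] @ [?z]) \<in> P"
    using Cons.IH[OF vc(2) s(2,5)] yw by (intro presentation_rel_cong P_refl) auto
  ultimately show ?case
    using yz by (auto intro: presentation_rel.trans)
qed

lemma P_inverse:
  assumes "(u @ v, []) \<in> P"
  shows "(v, inv_word u) \<in> P"
proof -
  have w: "u \<in> words Y" "v \<in> words Y" using presentation_rel_words[OF assms] by auto
  have "((inv_word u @ u) @ v, [] @ v) \<in> P"
    using w by (intro presentation_rel_cong presentation_rel_inv_left P_refl)
  moreover have "(inv_word u @ (u @ v), inv_word u @ []) \<in> P"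
    using w assms by (intro presentation_rel_cong P_refl) auto
  ultimately show ?thesis
    by (auto intro: presentation_rel.intros)
qed

text \<open>The generator of the edge \<open>s\<close> at \<open>q\<close> comes from the loop that
  runs along \<open>\<tau> q\<close>, then \<open>s\<close>, then back along the transversal path of
  the next coset, since the transversal parts are relators. The last leg lies in \<open>V\<close>,
  being a translate by an element of \<open>H\<close> of a path from \<open>\<one>\<close>. For an
  inverse letter the loop is reversed.\<close>

lemma letter_ybar:
  assumes "fst y \<in> Y"
  shows "\<exists>w\<in>words X. path V \<one> w & wv w \<in> H & ([y], ybar (cl \<one>) w) \<in> P"
proof -
  obtain q s b where y: "y = ((q, s), b)" by (metis prod.collapse)
  have qs: "q \<in> Q" "fst s \<in> X" using assms y by (auto simp: Y_def)
  have yY: "[((q, s), True)] \<in> words Y" using assms y by (simp add: Y_def)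
  have pos: "\<exists>w\<in>words X. path V \<one> w & wv w \<in> H & ([((q, s), True)], ybar (cl \<one>) w) \<in> P"
  proof (cases "q #> lv s \<in> Q")
    case True
    let ?q = "q #> lv s"
    let ?w = "\<tau> q @ [s] @ inv_word (\<tau> ?q)"
    note t = tau[OF qs(1)] tau[OF True]
    have sq: "cl (\<sigma> q) = q" "\<sigma> q \<in> carrier G" "\<sigma> ?q \<in> carrier G" "cl (\<sigma> ?q) = ?q"
      using qs True sigma_closed cl_sigma by auto
    have qs': "cl (\<sigma> q \<otimes> lv s) = ?q" using sq cl_mult[of "\<sigma> q" "lv s"] qs by simp
    have wv: "wv ?w = \<sigma> q \<otimes> lv s \<otimes> inv (\<sigma> ?q)"
      using t qs by (simp add: \<sigma>_def m_assoc)
    have H: "wv ?w \<in> H"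
      unfolding wv using sq qs qs' by (intro cl_eqD) auto
    have pt: "path V (wv ?w) (\<tau> ?q)"
    proof -
      have "path {x. wv ?w \<otimes> x \<in> V} \<one> (\<tau> ?q)"
        using t(2) V_invariant[OF H] by (auto elim: path_in_mono)
      then show ?thesis using path_translate[of "wv ?w" \<one> "\<tau> ?q" V] t H_carrier[OF H] by simp
    qed
    have e: "wv ?w \<otimes> wv (\<tau> ?q) = \<sigma> q \<otimes> lv s"
      unfolding wv using sq qs t by (simp add: \<sigma>_def m_assoc)
    have p3: "path V (\<sigma> q \<otimes> lv s) (inv_word (\<tau> ?q))"
      using path_inv[of "wv ?w" "\<tau> ?q" V] pt t H_carrier[OF H] unfolding e by simp
    have qV: "\<sigma> q \<in> V" "\<sigma> q \<otimes> lv s \<in> V" using V_iff sq qs' qs True by auto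
    have pw: "path V \<one> ?w"
      using t p3 qs qV sq by (simp add: path_append \<sigma>_def[symmetric])
    have "ybar (cl \<one>) ?w = ybar (cl \<one>) (\<tau> q) @ [((q, s), True)] @ ybar ?q (inv_word (\<tau> ?q))"
      using t qs sq by (simp add: ybar_append' \<sigma>_def[symmetric])
    moreover have "(ybar (cl \<one>) (\<tau> q), []) \<in> P" "(ybar (cl \<one>) (\<tau> ?q), []) \<in> P"
    proof -
      have "ybar (cl \<one>) (\<tau> q') \<in> R" if "q' \<in> Q" for q' using that unfolding R_def by blast
      then show "(ybar (cl \<one>) (\<tau> q), []) \<in> P" "(ybar (cl \<one>) (\<tau> ?q), []) \<in> P"
        using presentation_rel.relator[of "[]" Y "[]" _ R] R_words qs True by auto
    qed
    note rel = this
    have inv: "(ybar ?q (inv_word (\<tau> ?q)), []) \<in> P"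
    proof -
      have "(ybar (cl \<one>) (\<tau> ?q) @ ybar (cl (\<one> \<otimes> wv (\<tau> ?q))) (inv_word (\<tau> ?q)), []) \<in> P"
        using t by (intro ybar_inverse) auto
      then have 1: "(ybar (cl \<one>) (\<tau> ?q) @ ybar ?q (inv_word (\<tau> ?q)), []) \<in> P"
        using t by simp
      then have "ybar ?q (inv_word (\<tau> ?q)) \<in> words Y" using presentation_rel_words by fastforce
      then have "(ybar (cl \<one>) (\<tau> ?q) @ ybar ?q (inv_word (\<tau> ?q)), [] @ ybar ?q (inv_word (\<tau> ?q))) \<in> P"
        using rel by (intro presentation_rel_cong P_refl)
      then show ?thesis using 1 by (auto intro: presentation_rel.intros)
    qed
    have "(ybar (cl \<one>) (\<tau> q) @ [((q, s), True)] @ ybar ?q (inv_word (\<tau> ?q)), [] @ [((q, s), True)] @ []) \<in> P"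
      using rel inv yY by (intro presentation_rel_cong P_refl)
    ultimately have "([((q, s), True)], ybar (cl \<one>) ?w) \<in> P"
      by (auto intro: presentation_rel.sym)
    then show ?thesis using pw H t qs by (intro bexI[of _ ?w]) auto
  next
    case False
    then have "[((q, s), True)] \<in> R"
      using yY by (auto simp: R_def)
    then have "([] @ [((q, s), True)] @ [], [] @ []) \<in> P"
      using yY by (intro presentation_rel.relator) auto
    then show ?thesis
      using one_V H_one by (intro bexI[of _ "[]"]) auto
  qed
  show ?thesis
  proof (cases b)
    case True
    then show ?thesis using pos y by simp
  next
    case False
    obtain w where w: "w \<in> words X" "path V \<one> w" "wv w \<in> H" "([((q, s), True)], ybar (cl \<one>) w) \<in> P"
      using pos by blast
    let ?v = "inv (wv w)"
    have vH: "?v \<in> H" using w H_inv by blast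
    have vc: "?v \<in> carrier G" using vH H_carrier by blast
    have "path {x. ?v \<otimes> x \<in> V} \<one> w"
      using w(2) V_invariant[OF vH] by (auto elim: path_in_mono)
    then have pv: "path V ?v w"
      using path_translate[OF vc one_closed w(1), of V] vc by simp
    then have p1: "path V \<one> (inv_word w)"
      using path_inv[OF vc w(1), of V] w by simp
    have clv: "cl ?v = cl \<one>" using cl_H_mult[OF vH one_closed] vc by simp
    have yb: "ybar (cl \<one>) w \<in> words Y" using ybar_words[OF one_closed w(1,2)] .
    have "(ybar (cl ?v) w @ ybar (cl (?v \<otimes> wv w)) (inv_word w), []) \<in> P"
      by (rule ybar_inverse[OF vc w(1) pv])
    then have 1: "(ybar (cl \<one>) w @ ybar (cl \<one>) (inv_word w), []) \<in> P"
      using w(1) by (simp add: clv)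
    have "([((q, s), True)] @ ybar (cl \<one>) (inv_word w), ybar (cl \<one>) w @ ybar (cl \<one>) (inv_word w)) \<in> P"
      using w(4) presentation_rel_words[OF 1] by (intro presentation_rel_cong P_refl) auto
    then have "([((q, s), True)] @ ybar (cl \<one>) (inv_word w), []) \<in> P"
      using 1 presentation_rel.trans by blast
    from P_inverse[OF this] have "([y], ybar (cl \<one>) (inv_word w)) \<in> P"
      using False y by (simp add: inv_letter_def presentation_rel.sym)
    then show ?thesis
      using p1 w H_inv by (intro bexI[of _ "inv_word w"]) auto
  qed
qed

lemma word_ybar:
  "u \<in> words Y ==> \<exists>w\<in>words X. path V \<one> w & wv w \<in> H & (u, ybar (cl \<one>) w) \<in> P"
proof (induction u)
  case Nil
  then show ?case using one_V H_one P_refl[of "[]"] by (intro bexI[of _ "[]"]) auto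
next
  case (Cons y u)
  obtain w1 where w1: "w1 \<in> words X" "path V \<one> w1" "wv w1 \<in> H" "([y], ybar (cl \<one>) w1) \<in> P"
    using letter_ybar[of y] Cons.prems by auto
  obtain w2 where w2: "w2 \<in> words X" "path V \<one> w2" "wv w2 \<in> H" "(u, ybar (cl \<one>) w2) \<in> P"
    using Cons by auto
  have "path {x. wv w1 \<otimes> x \<in> V} \<one> w2"
    using w2(2) V_invariant[OF w1(3)] by (auto elim: path_in_mono)
  then have "path V (wv w1) w2"
    using path_translate[of "wv w1" \<one> w2 V] w1 w2 by simp
  then have p: "path V \<one> (w1 @ w2)"
    using w1 w2 by (simp add: path_append)
  have "cl (wv w1) = cl \<one>" using cl_H_mult[OF w1(3) one_closed] w1 by simp
  then have "ybar (cl \<one>) (w1 @ w2) = ybar (cl \<one>) w1 @ ybar (cl \<one>) w2"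
    using w1 by (simp add: ybar_append')
  then have "(y # u, ybar (cl \<one>) (w1 @ w2)) \<in> P"
    using presentation_rel_cong[OF w1(4) w2(4)] by simp
  then show ?case
    using p w1 w2 H_mult by (intro bexI[of _ "w1 @ w2"]) auto
qed

text \<open>The chosen word depends only on the class of \<open>u\<close> (\<open>cr_eq\<close>), so
  classes are represented inside the type of words, the type for which \<open>loops\<close> is
  assumed.\<close>

definition cr :: "('a set \<times> 'x \<times> bool) word => ('a set \<times> 'x \<times> bool) word" where
  "cr u = (SOME v. (u, v) \<in> P)"

lemma cr: "u \<in> words Y ==> (u, cr u) \<in> P"
  unfolding cr_def using someI[of "%v. (u, v) \<in> P" u] P_refl by blast

lemma cr_eq: "(u, v) \<in> P ==> cr u = cr v"
proof -
  assume uv: "(u, v) \<in> P"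
  have "(u, w) \<in> P \<longleftrightarrow> (v, w) \<in> P" for w
    using uv presentation_rel.trans[of _ _ Y R] presentation_rel.sym[of _ _ Y R] by blast
  then show ?thesis by (simp add: cr_def)
qed

text \<open>The letters act on chosen representatives of the elements of the presented group.\<close>

definition Lab :: "'a => 'x \<times> bool => ('a set \<times> 'x \<times> bool) word => ('a set \<times> 'x \<times> bool) word" where
  "Lab v s u = (if u \<in> cr ` words Y then cr (((cl v, s), True) # u) else u)"

lemma hol_Lab:
  "v \<in> carrier G ==> w \<in> words X ==> path V v w ==> u \<in> words Y ==>
    hol Lab v w (cr u) = cr (ybar (cl v) w @ u)"
proof (induction w arbitrary: v)
  case (Cons s w)
  let ?vs = "v \<otimes> lv s"
  have s: "fst s \<in> X" "w \<in> words X" "v \<in> V" "path V ?vs w"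
    using Cons.prems path_in_start[of G f V ?vs w] by auto
  have vc: "v \<in> carrier G" "?vs \<in> carrier G" using Cons.prems s by auto
  have yb: "ybar (cl ?vs) w @ u \<in> words Y"
    using ybar_words[OF vc(2) s(2,4)] Cons.prems by simp
  have y: "[((cl v, s), True)] \<in> words Y" using s by (auto simp: Y_def Q_def mem_Times_iff)
  have "hol Lab v (s # w) (cr u) = Lab v s (cr (ybar (cl ?vs) w @ u))"
    using Cons.IH[OF vc(2) s(2,4)] Cons.prems by simp
  also have "... = cr ([((cl v, s), True)] @ cr (ybar (cl ?vs) w @ u))"
    using yb by (simp add: Lab_def)
  also have "... = cr ([((cl v, s), True)] @ (ybar (cl ?vs) w @ u))"
    using y yb cr[OF yb] presentation_rel.sym by (intro cr_eq presentation_rel_cong P_refl) blast+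
  finally show ?case using vc s by (simp add: cl_mult)
qed simp

lemma hol_Lab_outside: "u \<notin> cr ` words Y ==> hol Lab v w u = u"
  by (induction w arbitrary: v) (auto simp: Lab_def)

text \<open>On representatives a short closed path acts by prepending a relator; on all other words
  every label is the identity.\<close>

lemma flat_Lab: "flat d V Lab"
  unfolding flat_def
proof (intro ballI allI impI ext)
  fix v w u assume v: "v \<in> carrier G" and w: "w \<in> words X" "length w \<le> d" "path V v w" "v \<otimes> wv w = v"
  show "hol Lab v w u = id u"
  proof (cases "u \<in> cr ` words Y")
    case True
    then obtain u' where u': "u' \<in> words Y" "u = cr u'" by blast
    have "(ybar (cl v) w, []) \<in> P"
      using w v closed_word_val[OF v w(1)] path_in_start[OF w(3)] by (intro ybar_closed) auto
    then have "(ybar (cl v) w @ u', [] @ u') \<in> P"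
      using u' by (intro presentation_rel_cong P_refl)
    then show ?thesis
      using hol_Lab[OF v w(1,3) u'(1)] u'(2) cr_eq by fastforce
  next
    case False
    then show ?thesis by (simp add: hol_Lab_outside)
  qed
qed

text \<open>A word of value one is equivalent to the rewriting of a closed path in \<open>V\<close>.
  The action has trivial holonomy around that path; applied to the representative of the empty word,
  this says that the rewriting is trivial in the presented group.\<close>

lemma relations:
  assumes "u \<in> words Y" "word_val GH ygen u = \<one>\<^bsub>GH\<^esub>"
  shows "(u, []) \<in> P"
proof -
  obtain w where w: "w \<in> words X" "path V \<one> w" "wv w \<in> H" "(u, ybar (cl \<one>) w) \<in> P"
    using word_ybar[OF assms(1)] by blast
  have "cl (wv w) = cl \<one>" using cl_H_mult[OF w(3) one_closed] w by simp
  then have "word_val GH ygen (ybar (cl \<one>) w) = wv w"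
    using w by (simp add: ybar_val sigma_one)
  moreover have "word_val GH ygen u = word_val GH ygen (ybar (cl \<one>) w)"
    using Y.presentation_rel_val[OF R_val w(4)] .
  ultimately have "wv w = \<one>" using assms(2) by simp
  then have "hol Lab \<one> w = id"
    using loops[OF w(1) _ w(2) flat_Lab] by blast
  then have "cr [] = cr (ybar (cl \<one>) w @ [])"
    using hol_Lab[OF one_closed w(1,2) words_Nil] by simp
  then have "cr [] = cr (ybar (cl \<one>) w)" by simp
  moreover have "(ybar (cl \<one>) w, cr (ybar (cl \<one>) w)) \<in> P" "([], cr []) \<in> P"
    using presentation_rel_words[OF w(4)] cr by auto
  ultimately show ?thesis
    using w(4) presentation_rel.trans[of _ _ Y R] presentation_rel.sym[of _ _ Y R] by metis
qed

theorem finitely_presented_subgroup: "finitely_presented GH"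
  using finite_Y finite_R R_words R_val generated relations by (rule Y.finitely_presentedI)

end

section \<open>Finitely presented subgroups of \<open>G \<times> G\<close>\<close>

definition half_space :: "('a, 'b) monoid_scheme => ('a => real) => real => 'a set" where
  "half_space G \<chi> m = {g \<in> carrier G. m \<le> \<chi> g}"

definition half_connected :: "('a, 'b) monoid_scheme => 'x set => ('x => 'a) => ('a => real) => bool" where
  "half_connected G X f \<chi> \<longleftrightarrow> (\<forall>g\<in>half_space G \<chi> 0.
    \<exists>w\<in>words X. path_in G f (half_space G \<chi> 0) \<one>\<^bsub>G\<^esub> w & word_val G f w = g)"

definition additive :: "('a, 'b) monoid_scheme => ('a => real) => bool" where
  "additive G \<chi> \<longleftrightarrow> (\<forall>g\<in>carrier G. \<forall>h\<in>carrier G. \<chi> (g \<otimes>\<^bsub>G\<^esub> h) = \<chi> g + \<chi> h)"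

context group
begin

lemma additiveD: "additive G \<chi> ==> g \<in> carrier G ==> h \<in> carrier G ==> \<chi> (g \<otimes> h) = \<chi> g + \<chi> h"
  by (simp add: additive_def)

lemma additive_one: "additive G \<chi> ==> \<chi> \<one> = 0"
  using additiveD[of \<chi> \<one> \<one>] by simp

lemma additive_inv: "additive G \<chi> ==> g \<in> carrier G ==> \<chi> (inv g) = - \<chi> g"
  using additiveD[of \<chi> g "inv g"] additive_one[of \<chi>] by (simp add: r_inv)

end

context generators
begin

lemma nonzero_letter:
  assumes "additive G \<chi>" "w \<in> words X" "\<chi> (wv w) ~= 0"
  shows "\<exists>s. fst s \<in> X & 0 < \<chi> (lv s)"
  using assms(2,3)
proof (induction w)
  case (Cons s w)
  have "\<chi> (lv s) ~= 0 | \<chi> (wv w) ~= 0"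
    using Cons.prems additiveD[OF assms(1), of "lv s" "wv w"] by auto
  then show ?case
  proof
    assume "\<chi> (lv s) ~= 0"
    then show ?thesis
      using additive_inv[OF assms(1), of "lv s"] Cons.prems
      by (intro exI[of _ "if 0 < \<chi> (lv s) then s else inv_letter s"]) auto
  qed (use Cons in auto)
qed (use additive_one[OF assms(1)] in simp)

text \<open>For \<open>\<chi> k < 0\<close> the path to \<open>inv k\<close> in the half-space is
  translated by \<open>k\<close> and reversed, which bounds its heights below by
  \<open>\<chi> k\<close>.\<close>

lemma half_connected_path:
  assumes \<chi>: "additive G \<chi>" and conn: "half_connected G X f \<chi>" and k: "k \<in> carrier G"
  shows "\<exists>w\<in>words X. wv w = k & (\<forall>i\<le>length w. min 0 (\<chi> k) \<le> \<chi> (wv (take i w)))"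
proof (cases "0 \<le> \<chi> k")
  case True
  then obtain w where w: "w \<in> words X" "path (half_space G \<chi> 0) \<one> w" "wv w = k"
    using conn k unfolding half_connected_def half_space_def by blast
  then show ?thesis
    using True by (intro bexI[of _ w]) (auto simp: path_iff_prefixes half_space_def words_take)
next
  case False
  then have "inv k \<in> half_space G \<chi> 0"
    using k additive_inv[OF \<chi> k] by (simp add: half_space_def)
  then obtain w where w: "w \<in> words X" "path (half_space G \<chi> 0) \<one> w" "wv w = inv k"
    using conn unfolding half_connected_def by blast
  have "path {x. k \<otimes> x \<in> half_space G \<chi> (\<chi> k)} \<one> w"
    using w(2) by (rule path_in_mono) (use k additiveD[OF \<chi>] in \<open>auto simp: half_space_def\<close>)
  then have "path (half_space G \<chi> (\<chi> k)) k w"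
    using path_translate[OF k one_closed w(1)] k by simp
  then have "path (half_space G \<chi> (\<chi> k)) \<one> (inv_word w)"
    using path_inv[OF k w(1)] w k by (simp add: r_inv)
  then show ?thesis
    using False w k by (intro bexI[of _ "inv_word w"]) (auto simp: path_iff_prefixes half_space_def words_take)
qed

end

text \<open>Directions are functions on \<open>nat\<close> that vanish from \<open>n\<close> on, so
  the sphere is a closed subset of a product of intervals and points, compact by Tychonoff.\<close>

lemma compact_unit_sphere:
  "compact {u :: nat => real. (\<forall>i\<ge>n. u i = 0) & norm2 n u = 1}" (is "compact ?K")
proof -
  let ?B = "Pi\<^sub>E UNIV (%i. if i < n then {-1..1} else {0 :: real})"
  have "compactin (product_topology (%i. euclidean) UNIV) ?B"
    by (subst compactin_PiE) (auto simp: compactin_euclidean_iff)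
  then have B: "compact ?B"
    by (simp add: euclidean_product_topology compactin_euclidean_iff)
  have "continuous_on UNIV (%u :: nat => real. norm2 n u)"
    unfolding norm2_def L2_set_def by (intro continuous_intros continuous_on_product_coordinates)
  then have "closed ((%u :: nat => real. norm2 n u) -` {1})"
    by (intro closed_vimage) auto
  with B have "compact (?B \<inter> (%u :: nat => real. norm2 n u) -` {1})"
    by (rule compact_Int_closed)
  also have "?B \<inter> (%u :: nat => real. norm2 n u) -` {1} = ?K"
  proof (intro equalityI subsetI)
    fix u assume u: "u \<in> ?K"
    have "\<bar>u i\<bar> \<le> 1" if "i < n" for i
    proof -
      have "\<bar>u i\<bar> \<le> L2_set (%i. \<bar>u i\<bar>) {..<n}"
        using that by (intro member_le_L2_set[of "{..<n}" i "%i. \<bar>u i\<bar>"]) auto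
      then show ?thesis using u by (simp add: norm2_def L2_set_def)
    qed
    then show "u \<in> ?B \<inter> (%u :: nat => real. norm2 n u) -` {1}"
      using u by (auto simp: PiE_iff abs_le_iff)
  next
    fix u assume u: "u \<in> ?B \<inter> (%u :: nat => real. norm2 n u) -` {1}"
    have "u i \<in> (if i < n then {-1..1} else {0})" for i
      using u by (auto simp: PiE_iff split: if_splits)
    then have "u i = 0" if "n \<le> i" for i using that by (metis not_less singletonD)
    then show "u \<in> ?K" using u by simp
  qed
  finally show ?thesis .
qed

lemma continuous_inner_prod [continuous_intros]: "continuous_on S (%u. inner_prod n u v)"
  unfolding inner_prod_def by (intro continuous_intros continuous_on_subset[OF continuous_on_product_coordinates]) auto


definition pair_gen :: "('a, 'b) monoid_scheme => ('x => 'a) => 'x + 'x => 'a \<times> 'a" where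
  "pair_gen G f y = (case y of Inl x => (f x, \<one>\<^bsub>G\<^esub>) | Inr x => (\<one>\<^bsub>G\<^esub>, f x))"

text \<open>\<open>a\<close> and \<open>b\<close> are additive on the two factors, and
  \<open>H\<close> will be a subgroup on which they agree. The functional \<open>u\<close> of their
  difference restricts to minus the pairing with \<open>a\<close> on the first factor and to the
  pairing with \<open>b\<close> on the second, whence the sign in
  \<open>one_connected\<close>.\<close>

locale square_group = generators G X f for G (structure) and X :: "'x set" and f +
  fixes R :: "'x word set" and n :: nat and a b :: "'a => nat => real"
  assumes finite_X: "finite X" and finite_R: "finite R" and R_words: "R \<subseteq> words X"
    and R_val: "r \<in> R ==> word_val G f r = \<one>"
    and presentation: "w \<in> words X ==> word_val G f w = \<one> ==> (w, []) \<in> presentation_rel X R"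
    and generated: "carrier G \<subseteq> word_val G f ` words X"
    and a_mult: "g \<in> carrier G ==> g' \<in> carrier G ==> i < n ==> a (g \<otimes> g') i = a g i + a g' i"
    and b_mult: "g \<in> carrier G ==> g' \<in> carrier G ==> i < n ==> b (g \<otimes> g') i = b g i + b g' i"
    and nonzero: "norm2 n u = 1 ==> \<exists>g\<in>carrier G. inner_prod n u (a g) ~= 0"
      "norm2 n u = 1 ==> \<exists>g\<in>carrier G. inner_prod n u (b g) ~= 0"
    and one_connected: "norm2 n u = 1 ==> half_connected G X f (%g. - inner_prod n u (a g)) |
      half_connected G X f (%g. inner_prod n u (b g))"
begin

abbreviation GG where "GG \<equiv> G \<times>\<times> G"
abbreviation F where "F \<equiv> pair_gen G f"
abbreviation XX where "XX \<equiv> X <+> X"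

definition h :: "'a \<times> 'a => nat => real" where
  "h p i = b (snd p) i - a (fst p) i"

sublocale GG: generators GG XX F
proof (intro generators.intro generators_axioms.intro)
  show "group GG" by (rule DirProd_group[OF is_group is_group])
  show "F x \<in> carrier GG" if "x \<in> XX" for x
    using that by (auto simp: pair_gen_def generator_closed)
qed

lemma GG_letter:
  "x \<in> X ==> GG.lv (Inl x, c) = (lv (x, c), \<one>)" "x \<in> X ==> GG.lv (Inr x, c) = (\<one>, lv (x, c))"
  using inv_DirProd[OF is_group is_group]
  by (auto simp: letter_val_def pair_gen_def generator_closed)

lemma GG_word1: "w \<in> words X ==> GG.wv (map_word Inl w) = (wv w, \<one>)"
  by (induction w) (auto simp: GG_letter)

lemma GG_word2: "w \<in> words X ==> GG.wv (map_word Inr w) = (\<one>, wv w)"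
  by (induction w) (auto simp: GG_letter)

lemma words_XX: "w \<in> words (Inl ` X) ==> w \<in> words XX" "w \<in> words (Inr ` X) ==> w \<in> words XX"
  by (auto simp: words_iff)

lemma two_factors_GG:
  assumes "4 \<le> d" "!!r. r \<in> R ==> length r \<le> d"
  shows "two_factors GG XX F (Inl ` X) (Inr ` X) (map_word Inl ` R) (map_word Inr ` R) d"
proof (intro two_factors.intro two_factors_axioms.intro)
  show "generators GG XX F" ..
  show "XX = Inl ` X \<union> Inr ` X" by (rule Plus_def)
  show "Inl ` X \<inter> Inr ` X = {}" by auto
  show "4 \<le> d" by (rule assms)
  show "GG.lv s \<otimes>\<^bsub>GG\<^esub> GG.lv s' = GG.lv s' \<otimes>\<^bsub>GG\<^esub> GG.lv s"
    if "fst s \<in> Inl ` X" "fst s' \<in> Inr ` X" for s s' :: "('x + 'x) \<times> bool"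
    using that by (cases s; cases s') (auto simp: GG_letter)
  show "GG.wv r = \<one>\<^bsub>GG\<^esub> & length r \<le> d" if "r \<in> map_word Inl ` R" for r
    using that R_words R_val assms by (auto simp: GG_word1 subset_iff)
  show "GG.wv r = \<one>\<^bsub>GG\<^esub> & length r \<le> d" if "r \<in> map_word Inr ` R" for r
    using that R_words R_val assms by (auto simp: GG_word2 subset_iff)
  show "(w, []) \<in> presentation_rel (Inl ` X) (map_word Inl ` R)"
    if "w \<in> words (Inl ` X)" "GG.wv w = \<one>\<^bsub>GG\<^esub>" for w
    using that(1)
  proof (rule words_imageE)
    fix w' assume w': "w' \<in> words X" "w = map_word Inl w'"
    then have "wv w' = \<one>" using that(2) by (simp add: GG_word1)
    then show ?thesis
      using presentation_rel_map[OF presentation[OF w'(1)], of Inl] w' by simp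
  qed
  show "(w, []) \<in> presentation_rel (Inr ` X) (map_word Inr ` R)"
    if "w \<in> words (Inr ` X)" "GG.wv w = \<one>\<^bsub>GG\<^esub>" for w
    using that(1)
  proof (rule words_imageE)
    fix w' assume w': "w' \<in> words X" "w = map_word Inr w'"
    then have "wv w' = \<one>" using that(2) by (simp add: GG_word2)
    then show ?thesis
      using presentation_rel_map[OF presentation[OF w'(1)], of Inr] w' by simp
  qed
  fix u v assume uv: "u \<in> words (Inl ` X)" "v \<in> words (Inr ` X)" "GG.wv (u @ v) = \<one>\<^bsub>GG\<^esub>"
  show "GG.wv u = \<one>\<^bsub>GG\<^esub>"
    using uv(1)
  proof (rule words_imageE)
    fix u' assume u': "u' \<in> words X" "u = map_word Inl u'"
    show ?thesis
      using uv(2)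
    proof (rule words_imageE)
      fix v' assume v': "v' \<in> words X" "v = map_word Inr v'"
      have "GG.wv (u @ v) = (wv u', wv v')"
        using u' v' words_XX uv(1,2) by (subst GG.word_val_append) (auto simp: GG_word1 GG_word2)
      then show ?thesis using uv(3) u' by (simp add: GG_word1)
    qed
  qed
qed

lemma h_mult:
  "p \<in> carrier GG ==> q \<in> carrier GG ==> i < n ==> h (p \<otimes>\<^bsub>GG\<^esub> q) i = h p i + h q i"
  by (cases p; cases q) (auto simp: h_def a_mult b_mult)

lemma h_additive: "additive GG (%p. inner_prod n u (h p))"
  unfolding additive_def
proof (intro ballI)
  fix p q assume pq: "p \<in> carrier GG" "q \<in> carrier GG"
  have "inner_prod n u (h (p \<otimes>\<^bsub>GG\<^esub> q)) = inner_prod n u (%i. h p i + h q i)"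
    unfolding inner_prod_def using h_mult[OF pq] by (intro sum.cong) auto
  then show "inner_prod n u (h (p \<otimes>\<^bsub>GG\<^esub> q)) = inner_prod n u (h p) + inner_prod n u (h q)"
    by (simp add: inner_prod_add)
qed

definition char1 where "char1 u g = inner_prod n u (h (g, \<one>))"
definition char2 where "char2 u g = inner_prod n u (h (\<one>, g))"

lemma char_additive: "additive G (char1 u)" "additive G (char2 u)"
proof -
  have "char1 u (g \<otimes> g') = char1 u g + char1 u g'" "char2 u (g \<otimes> g') = char2 u g + char2 u g'"
    if "g \<in> carrier G" "g' \<in> carrier G" for g g'
    using GG.additiveD[OF h_additive[of u], of "(g, \<one>)" "(g', \<one>)"]
      GG.additiveD[OF h_additive[of u], of "(\<one>, g)" "(\<one>, g')"] that
    by (auto simp: char1_def char2_def)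
  then show "additive G (char1 u)" "additive G (char2 u)"
    by (auto simp: additive_def)
qed

lemma a_one: "i < n ==> a \<one> i = 0" and b_one: "i < n ==> b \<one> i = 0"
  using a_mult[of \<one> \<one> i] b_mult[of \<one> \<one> i] by auto

lemma char1_eq: "char1 u g = - inner_prod n u (a g)"
  by (simp add: char1_def inner_prod_def h_def b_one sum_negf)

lemma char2_eq: "char2 u g = inner_prod n u (b g)"
  by (simp add: char2_def inner_prod_def h_def a_one)

section \<open>Certificates and the compactness argument\<close>

type_synonym 'y cert = "'y set \<times> ('y \<times> bool) \<times> ('y \<times> bool) \<times> ('y \<times> bool => 'y word)"

definition cert_words :: "('x + 'x) cert => bool" where
  "cert_words = (%(Y, t, z, c). Y \<in> {Inl ` X, Inr ` X} & fst t \<in> Y & fst z \<in> XX - Y &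
    (\<forall>s. fst s \<in> Y --> c s \<in> words Y & GG.lv t \<otimes>\<^bsub>GG\<^esub> GG.wv (c s) = GG.lv s \<otimes>\<^bsub>GG\<^esub> GG.lv t) &
    (\<forall>s. fst s \<in> XX - Y --> c s = [s]))"

text \<open>The inequalities are strict so that the directions served by fixed data form an open
  set.\<close>

definition cert_gain :: "('x + 'x) cert => real => (nat => real) => bool" where
  "cert_gain = (%(Y, t, z, c) e u. e < inner_prod n u (h (GG.lv t)) & e < inner_prod n u (h (GG.lv z)) &
    (\<forall>s \<in> Y \<times> UNIV. \<forall>i\<in>{..length (c s)}.
      min 0 (inner_prod n u (h (GG.lv s))) + e < inner_prod n u (h (GG.lv t \<otimes>\<^bsub>GG\<^esub> GG.wv (take i (c s))))))"

lemma open_cert_gain: "cert_words k ==> open {u. cert_gain k e u}"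
proof -
  assume k: "cert_words k"
  obtain Y t z c where e: "k = (Y, t, z, c)" by (cases k)
  then have "finite Y" using k finite_X by (auto simp: cert_words_def)
  then show ?thesis
    unfolding e cert_gain_def prod.case Collect_conj_eq Collect_ball_eq
    by (intro open_Int open_INT open_Collect_less continuous_intros ballI finite_cartesian_product) auto
qed

text \<open>A half-connected character of one factor, embedded by \<open>\<phi>\<close>, gives the words \<open>c\<close> of a certificate:
  conjugates \<open>t\<^sup>-\<^sup>1 s t\<close> are joined to \<open>1\<close> inside the half-space.\<close>

lemma cert_exists_side:
  fixes \<iota> \<iota>' :: "'x => 'x + 'x"
  assumes \<chi>: "additive G \<chi>" "half_connected G X f \<chi>" "\<exists>g\<in>carrier G. \<chi> g ~= 0"
    and \<chi>': "additive G \<chi>'" "\<exists>g\<in>carrier G. \<chi>' g ~= 0"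
    and \<iota>: "inj \<iota>" "\<iota> ` X \<in> {Inl ` X, Inr ` X}" "\<iota>' ` X \<subseteq> XX - \<iota> ` X"
    and \<phi>: "!!x b. x \<in> X ==> GG.lv (\<iota> x, b) = \<phi> (lv (x, b))"
      "!!w. w \<in> words X ==> GG.wv (map_word \<iota> w) = \<phi> (wv w)"
      "!!g g'. \<phi> g \<otimes>\<^bsub>GG\<^esub> \<phi> g' = \<phi> (g \<otimes> g')" "!!g. inner_prod n u (h (\<phi> g)) = \<chi> g"
    and \<phi>': "!!x b. x \<in> X ==> inner_prod n u (h (GG.lv (\<iota>' x, b))) = \<chi>' (lv (x, b))"
  shows "\<exists>k e. 0 < e & cert_words k & cert_gain k e u"
proof -
  obtain t0 where t0: "fst t0 \<in> X" "0 < \<chi> (lv t0)"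
    using \<chi>(3) generated nonzero_letter[OF \<chi>(1)] by blast
  obtain z0 where z0: "fst z0 \<in> X" "0 < \<chi>' (lv z0)"
    using \<chi>'(2) generated nonzero_letter[OF \<chi>'(1)] by blast
  \<comment> \<open>With this conjugate \<open>lv t0 \<otimes> k s = lv s \<otimes> lv t0\<close>,
    and \<open>\<chi>\<close> agrees on \<open>k s\<close> and \<open>lv s\<close>; the path to
    \<open>k s\<close> thus dips no lower than the minimum of 0 and that value.\<close>
  define k where "k s = inv (lv t0) \<otimes> (lv s \<otimes> lv t0)" for s
  have kc: "k s \<in> carrier G" "\<chi> (k s) = \<chi> (lv s)" if "fst s \<in> X" for s
    using that t0 additive_inv[OF \<chi>(1)] additiveD[OF \<chi>(1)] by (auto simp: k_def)
  have "\<exists>w. fst s \<in> X --> w \<in> words X & wv w = k s & (\<forall>i\<le>length w. min 0 (\<chi> (lv s)) \<le> \<chi> (wv (take i w)))" for s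
    using half_connected_path[OF \<chi>(1,2), of "k s"] kc[of s] by metis
  then have "\<exists>c0. \<forall>s. fst s \<in> X --> c0 s \<in> words X & wv (c0 s) = k s &
      (\<forall>i\<le>length (c0 s). min 0 (\<chi> (lv s)) \<le> \<chi> (wv (take i (c0 s))))"
    by (intro choice allI)
  then obtain c0 where c0: "\<forall>s. fst s \<in> X --> c0 s \<in> words X & wv (c0 s) = k s &
      (\<forall>i\<le>length (c0 s). min 0 (\<chi> (lv s)) \<le> \<chi> (wv (take i (c0 s))))" ..
  define c where "c s = (if fst s \<in> \<iota> ` X then map_word \<iota> (c0 (inv_into UNIV \<iota> (fst s), snd s)) else [s])" for s :: "('x + 'x) \<times> bool"
  define t where "t = (\<iota> (fst t0), snd t0)"
  define z where "z = (\<iota>' (fst z0), snd z0)"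
  have tv: "GG.lv t = \<phi> (lv t0)" and zv: "inner_prod n u (h (GG.lv z)) = \<chi>' (lv z0)"
    using t0 z0 \<phi>(1) \<phi>' by (simp_all add: t_def z_def)
  have cx: "c (\<iota> x, b) = map_word \<iota> (c0 (x, b))" if "x \<in> X" for x b
    using that inv_f_f[OF \<iota>(1)] by (simp add: c_def)
  have "cert_words (\<iota> ` X, t, z, c)"
    unfolding cert_words_def prod.case
  proof (intro conjI allI impI \<iota>(2))
    show "fst t \<in> \<iota> ` X" "fst z \<in> XX - \<iota> ` X" using t0 z0 \<iota>(3) by (auto simp: t_def z_def)
    fix s :: "('x + 'x) \<times> bool"
    show "c s = [s]" if "fst s \<in> XX - \<iota> ` X" using that by (simp add: c_def)
    assume "fst s \<in> \<iota> ` X"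
    then obtain x b where x: "x \<in> X" "s = (\<iota> x, b)" by (cases s) auto
    have c0x: "c0 (x, b) \<in> words X" "wv (c0 (x, b)) = k (x, b)"
      using c0[rule_format, of "(x, b)"] x by auto
    show "c s \<in> words (\<iota> ` X)" unfolding x(2) cx[OF x(1)] by (rule map_word_words[OF c0x(1)])
    show "GG.lv t \<otimes>\<^bsub>GG\<^esub> GG.wv (c s) = GG.lv s \<otimes>\<^bsub>GG\<^esub> GG.lv t"
      unfolding x(2) cx[OF x(1)] tv \<phi>(1)[OF x(1)] \<phi>(2)[OF c0x(1)] \<phi>(3) c0x(2) k_def using x(1) t0 by simp
  qed
  \<comment> \<open>Halving makes both gains strict. On a path \<open>c s\<close> the whole gain
    comes from the preceding letter \<open>t\<close>.\<close>
  moreover define e where "e = min (\<chi> (lv t0)) (\<chi>' (lv z0)) / 2"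
  have e: "0 < e" "e < \<chi> (lv t0)" "e < \<chi>' (lv z0)" using t0 z0 by (auto simp: e_def min_def)
  have "cert_gain (\<iota> ` X, t, z, c) e u"
    unfolding cert_gain_def prod.case tv zv \<phi>(4)
  proof (intro conjI ballI e(2,3))
    fix s :: "('x + 'x) \<times> bool" and i assume "s \<in> \<iota> ` X \<times> UNIV" and i: "i \<in> {..length (c s)}"
    then obtain x b where x: "x \<in> X" "s = (\<iota> x, b)" by (cases s) auto
    have c0x: "c0 (x, b) \<in> words X" "min 0 (\<chi> (lv (x, b))) \<le> \<chi> (wv (take i (c0 (x, b))))"
      using c0[rule_format, of "(x, b)"] x i by (auto simp: cx)
    have ts: "take i (c (\<iota> x, b)) = map_word \<iota> (take i (c0 (x, b)))"
      unfolding cx[OF x(1)] map_word_def by (rule take_map)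
    show "min 0 (inner_prod n u (h (GG.lv s))) + e < inner_prod n u (h (\<phi> (lv t0) \<otimes>\<^bsub>GG\<^esub> GG.wv (take i (c s))))"
      unfolding x(2) ts \<phi>(2)[OF words_take[OF c0x(1)]] \<phi>(3,4) \<phi>(1)[OF x(1)]
      using additiveD[OF \<chi>(1), of "lv t0" "wv (take i (c0 (x, b)))"] c0x e t0 by (simp add: words_take)
  qed
  ultimately show ?thesis using e(1) by blast
qed

lemma cert_exists:
  assumes "norm2 n u = 1"
  shows "\<exists>k e. 0 < e & cert_words k & cert_gain k e u"
proof -
  have c1: "char1 u = (%g. - inner_prod n u (a g))" and c2: "char2 u = (%g. inner_prod n u (b g))"
    by (simp_all add: char1_eq char2_eq fun_eq_iff)
  have nz: "\<exists>g\<in>carrier G. char1 u g ~= 0" "\<exists>g\<in>carrier G. char2 u g ~= 0"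
    using nonzero[OF assms] by (auto simp: c1 c2)
  from one_connected[OF assms] show ?thesis
    unfolding c1[symmetric] c2[symmetric]
  proof
    assume "half_connected G X f (char1 u)"
    then show ?thesis
      by (rule cert_exists_side[OF char_additive(1) _ nz(1) char_additive(2) nz(2), where \<iota> = Inl and \<iota>' = Inr and \<phi> = "%g. (g, \<one>)"])
        (auto simp: GG_letter GG_word1 char1_def char2_def)
  next
    assume "half_connected G X f (char2 u)"
    then show ?thesis
      by (rule cert_exists_side[OF char_additive(2) _ nz(2) char_additive(1) nz(1), where \<iota> = Inr and \<iota>' = Inl and \<phi> = "%g. (\<one>, g)"])
        (auto simp: GG_letter GG_word2 char1_def char2_def)
  qed
qed

theorem finitely_presented_kernel:
  assumes H: "subgroup H GG" "!!k i. k \<in> H ==> i < n ==> h k i = 0"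
    and cosets: "!!\<rho>. finite ((%v. H #>\<^bsub>GG\<^esub> v) ` {v \<in> carrier GG. norm2 n (h v) \<le> \<rho>})"
  shows "finitely_presented (GG\<lparr>carrier := H\<rparr>)"
proof -
  let ?K = "{u :: nat => real. (\<forall>i\<ge>n. u i = 0) & norm2 n u = 1}"
  let ?\<C> = "{(k, e). 0 < e & cert_words k}"
  have cover: "?K \<subseteq> (\<Union>x\<in>?\<C>. case x of (k, e) => {u. cert_gain k e u})"
    using cert_exists by fastforce
  have op: "open (case x of (k, e) => {u. cert_gain k e u})" if "x \<in> ?\<C>" for x
    using that by (cases x) (simp add: open_cert_gain)
  obtain S where S: "S \<subseteq> ?\<C>" "finite S" "?K \<subseteq> (\<Union>x\<in>S. case x of (k, e) => {u. cert_gain k e u})"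
    by (rule compactE_image[OF compact_unit_sphere[of n] op cover])
  \<comment> \<open>Half the least gain in the subcover, because \<open>ball_pushing\<close> asks
    for \<open>2 * \<epsilon>\<close>; the inserted 1 keeps the minimum defined.\<close>
  define \<epsilon> where "\<epsilon> = Min (insert 1 (snd ` S)) / 2"
  have "0 < Min (insert 1 (snd ` S))"
    using S(1,2) by (subst Min_gr_iff) force+
  moreover have "Min (insert 1 (snd ` S)) \<le> e" if "(k, e) \<in> S" for k e
    using S(2) that by (intro Min_le) force+
  ultimately have eps: "0 < \<epsilon>" "!!k e. (k, e) \<in> S ==> 2 * \<epsilon> \<le> e"
    by (auto simp: \<epsilon>_def)
  define ls where "ls = (%((k, e :: real), s). length (snd (snd (snd k)) s) + 3) ` (S \<times> (XX \<times> (UNIV :: bool set)))"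
  \<comment> \<open>Large enough for the relators of \<open>G\<close>, the commutator squares and
    the ladder cells of length \<open>length (c s) + 3\<close>.\<close>
  define d where "d = Max (insert 4 (length ` R \<union> ls))"
  have fin: "finite (length ` R \<union> ls)"
    unfolding ls_def using finite_R S(2) finite_X by (intro finite_UnI finite_imageI finite_cartesian_product finite_Plus) auto
  have d4: "4 \<le> d" and dR: "!!r. r \<in> R ==> length r \<le> d" and dl: "!!l. l \<in> ls ==> l \<le> d"
    unfolding d_def using fin by (auto intro!: Max_ge)
  define C where "C = Max (insert 0 ((%s. norm2 n (h (GG.lv s))) ` (XX \<times> UNIV)))"
  have finC: "finite ((%s. norm2 n (h (GG.lv s))) ` (XX \<times> UNIV))"
    using finite_X by (intro finite_imageI finite_cartesian_product finite_Plus) auto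
  have C: "0 \<le> C" "!!s. fst s \<in> XX ==> norm2 n (h (GG.lv s)) \<le> C"
    unfolding C_def using finC by (auto intro!: Max_ge simp: mem_Times_iff)
  interpret T: two_factors GG XX F "Inl ` X" "Inr ` X" "map_word Inl ` R" "map_word Inr ` R" d
    by (rule two_factors_GG[OF d4 dR])
  have len: "length (c s) + 3 \<le> d" if "((Y, t, z, c), e) \<in> S" "fst s \<in> XX" for Y t z c e s
  proof (rule dl)
    show "length (c s) + 3 \<in> ls"
      unfolding ls_def using that by (intro image_eqI[of _ _ "(((Y, t, z, c), e), s)"]) (auto simp: mem_Times_iff)
  qed
  have P: "Y \<subseteq> XX & (\<exists>Y' Q Q'. pushing GG XX F Y Y' Q Q' d t z c \<epsilon> C)" if k: "(Y, t, z, c) \<in> fst ` S" for Y t z c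
  proof -
    obtain e where e: "((Y, t, z, c), e) \<in> S" using k by auto
    then have "cert_words (Y, t, z, c)" using S(1) by blast
    then have W: "Y \<in> {Inl ` X, Inr ` X}" "fst t \<in> Y" "fst z \<in> XX - Y"
      "\<forall>s. fst s \<in> Y --> c s \<in> words Y & GG.lv t \<otimes>\<^bsub>GG\<^esub> GG.wv (c s) = GG.lv s \<otimes>\<^bsub>GG\<^esub> GG.lv t"
      "\<forall>s. fst s \<in> XX - Y --> c s = [s]"
      unfolding cert_words_def prod.case by - ((elim conjE, assumption)+)
    have YX: "Y \<subseteq> XX" using W(1) by auto
    have XXd: "XX - Inl ` X = Inr ` X" "XX - Inr ` X = Inl ` X" by auto
    have "\<exists>Q Q'. two_factors GG XX F Y (XX - Y) Q Q' d"
    proof (cases "Y = Inl ` X")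
      case True
      show ?thesis unfolding True XXd by (intro exI) (rule T.two_factors_axioms)
    next
      case False
      then have Y: "Y = Inr ` X" using W(1) by blast
      show ?thesis unfolding Y XXd by (intro exI) (rule T.swap_factors)
    qed
    then obtain Q Q' where T: "two_factors GG XX F Y (XX - Y) Q Q' d" by (elim exE)
    have l: "length (c s) + 3 \<le> d" if "fst s \<in> Y" for s using len[OF e, of s] that YX by auto
    have "pushing GG XX F Y (XX - Y) Q Q' d t z c \<epsilon> C"
      by (intro pushing.intro T pushing_axioms.intro) (rule W(2,3) eps(1) C(1) l conjunct1[OF W(4)[rule_format]]
        conjunct2[OF W(4)[rule_format]] W(5)[rule_format], assumption?)+
    then show ?thesis using YX by blast
  qed
  have gain: "\<exists>(Y, t, z, c) \<in> fst ` S. 2 * \<epsilon> \<le> inner_prod n u (h (GG.lv t)) &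
        2 * \<epsilon> \<le> inner_prod n u (h (GG.lv z)) & (\<forall>s. fst s \<in> Y --> (\<forall>i\<le>length (c s).
          min 0 (inner_prod n u (h (GG.lv s))) + 2 * \<epsilon>
            \<le> inner_prod n u (h (GG.lv t \<otimes>\<^bsub>GG\<^esub> GG.wv (take i (c s))))))"
    if u: "norm2 n u = 1" for u
  proof -
    \<comment> \<open>The compact sphere contains only functions vanishing from \<open>n\<close> on,
      so \<open>u\<close> is truncated; its pairings do not change.\<close>
    let ?u = "%i. if i < n then u i else 0"
    have ip: "inner_prod n ?u v = inner_prod n u v" for v by (simp add: inner_prod_def)
    have "norm2 n ?u = norm2 n u" by (rule norm2_cong) simp
    then have "?u \<in> ?K" using u by simp
    from subsetD[OF S(3) this] obtain y where y: "y \<in> S" "?u \<in> (case y of (k, e) => {u. cert_gain k e u})"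
      by blast
    obtain Y t z c e where "y = ((Y, t, z, c), e)" by (cases y) auto
    with y have x: "((Y, t, z, c), e) \<in> S" "cert_gain (Y, t, z, c) e ?u" by simp_all
    have g: "e < inner_prod n u (h (GG.lv t))" "e < inner_prod n u (h (GG.lv z))"
      "!!s i. s \<in> Y \<times> UNIV ==> i \<in> {..length (c s)} ==>
      min 0 (inner_prod n u (h (GG.lv s))) + e < inner_prod n u (h (GG.lv t \<otimes>\<^bsub>GG\<^esub> GG.wv (take i (c s))))"
      using x(2) unfolding cert_gain_def prod.case ip by blast+
    have e: "2 * \<epsilon> \<le> e" using eps(2)[OF x(1)] .
    have mem: "(Y, t, z, c) \<in> fst ` S" using x(1) by force
    show ?thesis
    proof (rule bexI[OF _ mem], unfold prod.case, intro conjI allI impI)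
      show "2 * \<epsilon> \<le> inner_prod n u (h (GG.lv t))" "2 * \<epsilon> \<le> inner_prod n u (h (GG.lv z))"
        using g(1,2) e by linarith+
      fix s i assume "fst s \<in> Y" "i \<le> length (c s)"
      then have "min 0 (inner_prod n u (h (GG.lv s))) + e < inner_prod n u (h (GG.lv t \<otimes>\<^bsub>GG\<^esub> GG.wv (take i (c s))))"
        by (intro g(3)) (auto simp: mem_Times_iff)
      then show "min 0 (inner_prod n u (h (GG.lv s))) + 2 * \<epsilon>
          \<le> inner_prod n u (h (GG.lv t \<otimes>\<^bsub>GG\<^esub> GG.wv (take i (c s))))"
        using e by linarith
    qed
  qed
  interpret B: ball_pushing GG XX F "Inl ` X" "Inr ` X" "map_word Inl ` R" "map_word Inr ` R" d n h \<epsilon> C "fst ` S"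
  proof (intro ball_pushing.intro T.two_factors_axioms ball_pushing_axioms.intro)
    show "finite XX" using finite_X by simp
    show "finite (fst ` S)" using S(2) by simp
    show "h (g \<otimes>\<^bsub>GG\<^esub> g') i = h g i + h g' i" if "g \<in> carrier GG" "g' \<in> carrier GG" "i < n" for g g' i
      by (rule h_mult[OF that])
    show "norm2 n (h (GG.lv s)) \<le> C" if "fst s \<in> XX" for s
      by (rule C(2)[OF that])
  qed (rule P eps(1) C(1) gain, assumption?)+
  obtain \<rho> where \<rho>: "0 \<le> \<rho>"
    "\<forall>w\<in>words XX. GG.wv w = \<one>\<^bsub>GG\<^esub> --> GG.path (B.V \<rho>) \<one>\<^bsub>GG\<^esub> w -->
      (\<forall>L :: 'a \<times> 'a => ('x + 'x) \<times> bool => (('a \<times> 'a) set \<times> ('x + 'x) \<times> bool) word => (('a \<times> 'a) set \<times> ('x + 'x) \<times> bool) word.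
        GG.flat d (B.V \<rho>) L --> GG.hol L \<one>\<^bsub>GG\<^esub> w = id)"
    "\<forall>w\<in>words XX. GG.wv w \<in> B.V \<rho> --> (\<exists>p\<in>words XX. GG.path (B.V \<rho>) \<one>\<^bsub>GG\<^esub> p & GG.wv p = GG.wv w)"
    using B.ball_simply_connected by blast
  have gen: "\<exists>w\<in>words XX. GG.wv w = g" if "g \<in> carrier GG" for g
  proof -
    have "fst g \<in> word_val G f ` words X" "snd g \<in> word_val G f ` words X"
      using that generated by auto
    then obtain w1 w2 where "w1 \<in> words X" "w2 \<in> words X" "fst g = wv w1" "snd g = wv w2"
      by (elim imageE)
    then have w: "w1 \<in> words X" "w2 \<in> words X" "g = (wv w1, wv w2)"
      by (simp_all add: prod_eq_iff)
    then have "GG.wv (map_word Inl w1 @ map_word Inr w2) = g"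
      using words_XX map_word_words[OF w(1), of Inl] map_word_words[OF w(2), of Inr]
      by (subst GG.word_val_append) (auto simp: GG_word1 GG_word2)
    then show ?thesis
      using w words_XX(1)[OF map_word_words[OF w(1)]] words_XX(2)[OF map_word_words[OF w(2)]]
      by (intro bexI[of _ "map_word Inl w1 @ map_word Inr w2"]) auto
  qed
  interpret Sch: schreier GG XX F H "B.V \<rho>" d
  proof (intro schreier.intro GG.generators_axioms schreier_axioms.intro)
    show "finite XX" by (rule B.finite_X)
    show "subgroup H GG" by (rule H(1))
    show "B.V \<rho> \<subseteq> carrier GG" using B.V_closed by blast
    show "\<one>\<^bsub>GG\<^esub> \<in> B.V \<rho>" using B.N_word[of "[]"] \<rho>(1) by (simp add: B.V_def)
    show "k \<otimes>\<^bsub>GG\<^esub> v \<in> B.V \<rho>" if "k \<in> H" "v \<in> B.V \<rho>" for k v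
    proof -
      have c: "k \<in> carrier GG" "v \<in> carrier GG"
        using that subgroup.mem_carrier[OF H(1)] B.V_closed by blast+
      have "norm2 n (h (k \<otimes>\<^bsub>GG\<^esub> v)) = norm2 n (h v)"
        using h_mult[OF c] H(2)[OF that(1)] by (intro norm2_cong) simp
      then show ?thesis using that c GG.m_closed[OF c] by (simp add: B.V_def B.N_def)
    qed
    show "finite ((%v. H #>\<^bsub>GG\<^esub> v) ` B.V \<rho>)"
      using cosets[of \<rho>] by (simp add: B.V_def B.N_def)
    show "2 \<le> d" using d4 by simp
    show "\<exists>p\<in>words XX. GG.path (B.V \<rho>) \<one>\<^bsub>GG\<^esub> p & GG.wv p = g" if "g \<in> B.V \<rho>" for g
      using gen[OF B.V_closed[OF that]] \<rho>(3) that by blast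
  qed (use \<rho>(2) in blast)
  show ?thesis by (rule Sch.finitely_presented_subgroup)
qed

end

section \<open>An obstruction to finite presentability\<close>

context generators
begin

text \<open>For \<open>m \<le> 0\<close> this is the component of \<open>\<one>\<close> in the
  half-space at height \<open>m\<close>.\<close>

definition reach :: "('a => real) => real => 'a set" where
  "reach \<chi> m = {wv w |w. w \<in> words X & path (half_space G \<chi> m) \<one> w}"

lemma reachI: "w \<in> words X ==> path (half_space G \<chi> m) \<one> w ==> wv w \<in> reach \<chi> m"
  by (auto simp: reach_def)

lemma reach_step:
  assumes g: "g \<in> reach \<chi> m" "fst s \<in> X" "m \<le> \<chi> (g \<otimes> lv s)"
  shows "g \<otimes> lv s \<in> reach \<chi> m"
proof -
  obtain w where w: "w \<in> words X" "path (half_space G \<chi> m) \<one> w" "g = wv w"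
    using g(1) unfolding reach_def by blast
  then have "path (half_space G \<chi> m) \<one> (w @ [s])"
    using g path_end[OF one_closed w(1,2)] by (simp add: path_append half_space_def)
  then show ?thesis using reachI[of "w @ [s]"] w g by simp
qed

lemma path_half_space_translate:
  assumes "additive G \<chi>" "k \<in> carrier G" "w \<in> words X" "path (half_space G \<chi> m) \<one> w"
  shows "path (half_space G \<chi> (\<chi> k + m)) k w"
proof -
  have "path {x. k \<otimes> x \<in> half_space G \<chi> (\<chi> k + m)} \<one> w"
    using assms(4) by (rule path_in_mono) (use assms(2) additiveD[OF assms(1)] in \<open>auto simp: half_space_def\<close>)
  then show ?thesis
    using path_translate[OF assms(2) one_closed assms(3)] assms(2) by simp
qed

lemma path_ascending:
  assumes "additive G \<chi>" "g \<in> carrier G" "w \<in> words X" "m \<le> \<chi> g" "\<forall>s\<in>set w. 0 \<le> \<chi> (lv s)"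
  shows "path (half_space G \<chi> m) g w"
  using assms(2-5)
proof (induction w arbitrary: g)
  case (Cons s w)
  then show ?case
    using Cons.IH[of "g \<otimes> lv s"] additiveD[OF assms(1), of g "lv s"] by (auto simp: half_space_def)
qed (auto simp: half_space_def)

lemma path_descending:
  assumes "additive G \<chi>" "g \<in> carrier G" "w \<in> words X" "m \<le> \<chi> (g \<otimes> wv w)" "\<forall>s\<in>set w. \<chi> (lv s) \<le> 0"
  shows "path (half_space G \<chi> m) g w"
  using assms(2-5)
proof (induction w arbitrary: g)
  case (Cons s w)
  have "\<chi> (wv w) \<le> 0" if "w \<in> words X" "\<forall>s\<in>set w. \<chi> (lv s) \<le> 0" for w
    using that by (induction w) (use additive_one[OF assms(1)] additiveD[OF assms(1)] in auto)
  from this[of "s # w"] have "m \<le> \<chi> g"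
    using Cons.prems additiveD[OF assms(1), of g "wv (s # w)"] by auto
  then show ?case
    using Cons.IH[of "g \<otimes> lv s"] Cons.prems by (auto simp: half_space_def m_assoc)
qed (auto simp: half_space_def)

lemma replicate_val:
  assumes "additive G \<chi>" "fst s \<in> X"
  shows "\<chi> (wv (replicate k s)) = k * \<chi> (lv s)"
proof (induction k)
  case 0
  show ?case by (simp add: additive_one[OF assms(1)])
next
  case (Suc k)
  then show ?case
    using additiveD[OF assms(1), of "lv s" "wv (replicate k s)"] assms(2)
    by (simp add: words_replicate algebra_simps)
qed

text \<open>A power \<open>t^k\<close> of height at least \<open>c\<close> absorbs the depth: the
  path to \<open>t^-k g t^k\<close> is translated by \<open>t^k\<close>, and the two legs along
  powers of \<open>t\<close> stay at height at least 0.\<close>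

lemma coarsely_half_connected:
  assumes \<chi>: "additive G \<chi>" and t: "fst t \<in> X" "0 < \<chi> (lv t)"
    and reach: "half_space G \<chi> 0 \<subseteq> reach \<chi> (- c)"
  shows "half_connected G X f \<chi>"
  unfolding half_connected_def
proof
  fix g assume g: "g \<in> half_space G \<chi> 0"
  then have gc: "g \<in> carrier G" "0 \<le> \<chi> g" by (auto simp: half_space_def)
  obtain k :: nat where k: "c \<le> k * \<chi> (lv t)"
    using reals_Archimedean3[OF t(2)] less_imp_le by blast
  let ?w = "replicate k t" and ?t = "wv (replicate k t)"
  have w: "?w \<in> words X" "inv_word ?w \<in> words X" using t(1) by (auto simp: words_replicate)
  have tv: "\<chi> ?t = k * \<chi> (lv t)" by (rule replicate_val[OF \<chi> t(1)])
  let ?g = "inv ?t \<otimes> g \<otimes> ?t"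
  have "\<chi> ?g = \<chi> g"
    using gc w additiveD[OF \<chi>] additive_inv[OF \<chi>] by simp
  then have "?g \<in> half_space G \<chi> 0"
    using gc w by (simp add: half_space_def)
  then obtain v where v: "v \<in> words X" "path (half_space G \<chi> (- c)) \<one> v" "wv v = ?g"
    using reach by (auto simp: reach_def)
  have up: "path (half_space G \<chi> 0) y ?w" if "y \<in> carrier G" "0 \<le> \<chi> y" for y
    using that w t(2) by (intro path_ascending[OF \<chi>]) auto
  have "path (half_space G \<chi> (\<chi> ?t + - c)) ?t v"
    using w v by (intro path_half_space_translate[OF \<chi>]) auto
  then have p2: "path (half_space G \<chi> 0) ?t v"
    by (rule path_in_mono) (use k tv in \<open>auto simp: half_space_def\<close>)
  have p3: "path (half_space G \<chi> 0) (g \<otimes> ?t) (inv_word ?w)"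
    using path_inv[OF gc(1) w(1)] up[OF gc] by simp
  have e: "?t \<otimes> ?g = g \<otimes> ?t" "g \<otimes> ?t \<otimes> inv ?t = g"
    using gc w(1) by (simp_all add: m_assoc r_inv)
  have "path (half_space G \<chi> 0) \<one> (?w @ v @ inv_word ?w)"
    using up[OF one_closed] additive_one[OF \<chi>] p2 p3 w v e by (simp add: path_append)
  moreover have "wv (?w @ v @ inv_word ?w) = g"
    using w v gc by (simp add: m_assoc r_inv)
  ultimately show "\<exists>w\<in>words X. path (half_space G \<chi> 0) \<one> w & wv w = g"
    using w v by (intro bexI[of _ "?w @ v @ inv_word ?w"]) auto
qed

abbreviation "G' \<equiv> derived G (carrier G)"

lemma coset_hom: "g \<in> carrier G ==> g' \<in> carrier G ==>
    G' #> (g \<otimes> g') = (G' #> g) \<otimes>\<^bsub>G Mod G'\<^esub> (G' #> g')"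
  using normal.rcos_sum[OF derived_self_is_normal, of g g'] by simp

lemma coset_Mod: "g \<in> carrier G ==> G' #> g \<in> carrier (G Mod G')"
  by (auto simp: carrier_FactGroup)

lemma sort_word_coset:
  assumes "w \<in> words X"
  shows "G' #> wv (filter P w @ filter (%s. \<not> P s) w) = G' #> wv w"
proof -
  interpret Q: comm_group "G Mod G'" by (rule derived_quot_is_comm_group)
  have fw: "filter Q w \<in> words X" if "w \<in> words X" for Q and w :: "'x word"
    using that by (auto simp: words_iff)
  show ?thesis
    using assms
  proof (induction w)
    case (Cons s w)
    let ?u = "filter P w" and ?v = "filter (%s. \<not> P s) w" and ?p = "%g. G' #> g"
    have w: "fst s \<in> X" "w \<in> words X" "?u \<in> words X" "?v \<in> words X" using Cons.prems fw by auto
    have cl: "?p (lv s) \<in> carrier (G Mod G')" "?p (wv ?u) \<in> carrier (G Mod G')" "?p (wv ?v) \<in> carrier (G Mod G')"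
      using w by (auto intro: coset_Mod)
    have IH: "?p (wv ?u) \<otimes>\<^bsub>G Mod G'\<^esub> ?p (wv ?v) = ?p (wv w)"
      using Cons.IH[OF w(2)] w by (simp add: coset_hom del: mult_FactGroup)
    have "?p (wv (s # w)) = ?p (lv s) \<otimes>\<^bsub>G Mod G'\<^esub> (?p (wv ?u) \<otimes>\<^bsub>G Mod G'\<^esub> ?p (wv ?v))"
      using w IH by (simp add: coset_hom del: mult_FactGroup)
    also have "... = ?p (wv (filter P (s # w) @ filter (%s. \<not> P s) (s # w)))"
    proof (cases "P s")
      case True
      then show ?thesis using w by (simp add: coset_hom del: mult_FactGroup)
    next
      case False
      have "?p (lv s) \<otimes>\<^bsub>G Mod G'\<^esub> (?p (wv ?u) \<otimes>\<^bsub>G Mod G'\<^esub> ?p (wv ?v))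
          = ?p (wv ?u) \<otimes>\<^bsub>G Mod G'\<^esub> (?p (lv s) \<otimes>\<^bsub>G Mod G'\<^esub> ?p (wv ?v))"
        using cl by (rule Q.m_lcomm)
      then show ?thesis using w False by (simp add: coset_hom del: mult_FactGroup)
    qed
    finally show ?case by simp
  qed simp
qed

lemma derived_additive: "additive G \<chi> ==> n \<in> G' ==> \<chi> n = 0"
proof -
  assume \<chi>: "additive G \<chi>" and "n \<in> G'"
  then have "n \<in> generate G (derived_set G (carrier G))" by (simp add: derived_def)
  then show "\<chi> n = 0"
  proof (induction rule: generate.induct)
    case (incl g)
    then show ?case
      using additiveD[OF \<chi>] additive_inv[OF \<chi>] by auto
  next
    case (inv g)
    then show ?case
      using additiveD[OF \<chi>] additive_inv[OF \<chi>] derived_set_in_carrier[of "carrier G"] by auto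
  next
    case (eng g k)
    then show ?case
      using additiveD[OF \<chi>, of g k] derived_in_carrier[of "carrier G"] by (auto simp: derived_def)
  qed (rule additive_one[OF \<chi>])
qed

text \<open>Modulo \<open>G'\<close> the letters of a word may be sorted, so that it first climbs and then descends.\<close>

lemma derived_not_reachable:
  assumes \<chi>: "additive G \<chi>" and t: "fst t \<in> X" "0 < \<chi> (lv t)" and gen: "carrier G \<subseteq> wv ` words X"
    and not: "\<not> half_connected G X f \<chi>" and c: "0 \<le> c"
  obtains n where "n \<in> G'" "n \<notin> reach \<chi> (- c)"
proof -
  have "half_space G \<chi> 0 \<subseteq> reach \<chi> (- c)" if sub: "G' \<subseteq> reach \<chi> (- c)"
  proof
    fix g assume g: "g \<in> half_space G \<chi> 0"
    then have gc: "g \<in> carrier G" "0 \<le> \<chi> g" by (auto simp: half_space_def)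
    obtain w where w: "w \<in> words X" "wv w = g" using gen gc by auto
    let ?u = "filter (%s. 0 \<le> \<chi> (lv s)) w" and ?v = "filter (%s. \<not> 0 \<le> \<chi> (lv s)) w"
    have uv: "?u \<in> words X" "?v \<in> words X" using w by (auto simp: words_iff)
    let ?g = "wv (?u @ ?v)"
    have gc': "?g \<in> carrier G" using uv by simp
    have "g \<in> G' #> ?g"
      using sort_word_coset[OF w(1)] w(2) rcos_self[OF gc(1) derived_is_subgroup[of "carrier G"]] by simp
    then obtain n where n: "n \<in> G'" "g = n \<otimes> ?g" by (auto simp: r_coset_def)
    have nc: "n \<in> carrier G" using n derived_in_carrier[of "carrier G"] by auto
    obtain p where p: "p \<in> words X" "path (half_space G \<chi> (- c)) \<one> p" "wv p = n"
      using sub n(1) by (auto simp: reach_def)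
    have n0: "\<chi> n = 0" by (rule derived_additive[OF \<chi> n(1)])
    have 1: "path (half_space G \<chi> 0) n ?u"
      using nc uv n0 by (intro path_ascending[OF \<chi>]) auto
    have "n \<otimes> wv ?u \<otimes> wv ?v = g" using n nc uv by (simp add: m_assoc)
    then have 2: "path (half_space G \<chi> 0) (n \<otimes> wv ?u) ?v"
      using nc uv gc by (intro path_descending[OF \<chi>]) auto
    have "path (half_space G \<chi> 0) n (?u @ ?v)"
      using 1 2 nc uv by (simp add: path_append)
    then have "path (half_space G \<chi> (- c)) n (?u @ ?v)"
      by (rule path_in_mono) (use c in \<open>auto simp: half_space_def\<close>)
    then have "path (half_space G \<chi> (- c)) \<one> (p @ ?u @ ?v)"
      using p uv nc by (simp add: path_append)
    moreover have "wv (p @ ?u @ ?v) = g" using p uv n by simp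
    ultimately show "g \<in> reach \<chi> (- c)"
      using reachI[of "p @ ?u @ ?v"] p uv by simp
  qed
  then show thesis
    using coarsely_half_connected[OF \<chi> t] not that by blast
qed

end

text \<open>A lift of an unreachable commutator element may rise above height 0. Conjugation by
  \<open>t^k\<close>, with \<open>k * \<chi> (lv t)\<close> at least its maximal height, lowers the
  whole path to height at most 0 and keeps the second coordinate trivial. The conjugate is still
  unreachable, since a path to it could be translated up by \<open>t^k\<close> and completed to a
  path to the original element.\<close>

lemma one_sided_word:
  assumes "generators G X f1" "generators G X f2"
    and \<chi>: "additive G \<chi>" "\<exists>g\<in>carrier G. \<chi> g ~= 0"
    and gen: "carrier G \<subseteq> word_val G f1 ` words X"
    and not: "\<not> half_connected G X f1 \<chi>" and c: "0 \<le> c"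
    and lift: "!!n. n \<in> commutator_subgroup G ==>
      \<exists>w\<in>words X. word_val G f1 w = n & word_val G f2 w = \<one>\<^bsub>G\<^esub>"
  obtains w where "w \<in> words X" "word_val G f2 w = \<one>\<^bsub>G\<^esub>" "\<chi> (word_val G f1 w) = 0"
    "word_val G f1 w \<notin> generators.reach G X f1 \<chi> (- c)"
    "!!i. i \<le> length w ==> \<chi> (word_val G f1 (take i w)) \<le> 0"
proof -
  interpret A: generators G X f1 by (rule assms(1))
  interpret B: generators G X f2 by (rule assms(2))
  obtain t where t: "fst t \<in> X" "0 < \<chi> (A.lv t)"
    using \<chi>(2) gen A.nonzero_letter[OF \<chi>(1)] by blast
  obtain n where n: "n \<in> commutator_subgroup G" "n \<notin> A.reach \<chi> (- c)"
    using A.derived_not_reachable[OF \<chi>(1) t gen not c] by blast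
  obtain w where w: "w \<in> words X" "A.wv w = n" "B.wv w = \<one>\<^bsub>G\<^esub>"
    using lift[OF n(1)] by blast
  define M where "M = Max ((%i. \<chi> (A.wv (take i w))) ` {..length w})"
  have M: "\<chi> (A.wv (take i w)) \<le> M" if "i \<le> length w" for i
    unfolding M_def using that by (intro Max_ge) auto
  obtain k :: nat where k: "M \<le> k * \<chi> (A.lv t)"
    using reals_Archimedean3[OF t(2)] less_imp_le by blast
  let ?u = "replicate k t"
  have u: "?u \<in> words X" using t(1) by (rule words_replicate)
  let ?t = "A.wv ?u"
  have tv: "\<chi> ?t = k * \<chi> (A.lv t)" by (rule A.replicate_val[OF \<chi>(1) t(1)])
  have kt: "0 \<le> k * \<chi> (A.lv t)" using t(2) by simp
  have tc: "?t \<in> carrier G" "n \<in> carrier G" using u w by auto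
  let ?w = "inv_word ?u @ w @ ?u"
  note \<chi>_mult = A.additiveD[OF \<chi>(1)] and \<chi>_inv = A.additive_inv[OF \<chi>(1)]
  have n0: "\<chi> n = 0" by (rule A.derived_additive[OF \<chi>(1) n(1)])
  show thesis
  proof (rule that[of ?w])
    show "?w \<in> words X" using u w by simp
    show "B.wv ?w = \<one>\<^bsub>G\<^esub>" using u w by (simp add: A.m_assoc)
    show "\<chi> (A.wv ?w) = 0" using u w tc n0 by (simp add: \<chi>_mult \<chi>_inv)
    show "A.wv ?w \<notin> A.reach \<chi> (- c)"
    proof
      assume "A.wv ?w \<in> A.reach \<chi> (- c)"
      then obtain v where v: "v \<in> words X" "A.path (half_space G \<chi> (- c)) \<one>\<^bsub>G\<^esub> v" "A.wv v = A.wv ?w"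
        by (auto simp: A.reach_def)
      have up: "A.path (half_space G \<chi> 0) y ?u" if "y \<in> carrier G" "0 \<le> \<chi> y" for y
        using that u t(2) by (intro A.path_ascending[OF \<chi>(1)]) auto
      have up': "A.path (half_space G \<chi> (- c)) y ?u" if "y \<in> carrier G" "0 \<le> \<chi> y" for y
        using up[OF that] by (rule path_in_mono) (use c in \<open>auto simp: half_space_def\<close>)
      have "A.path (half_space G \<chi> (\<chi> ?t + - c)) ?t v"
        using tc v by (intro A.path_half_space_translate[OF \<chi>(1)]) auto
      then have p2: "A.path (half_space G \<chi> (- c)) ?t v"
        by (rule path_in_mono) (use kt tv in \<open>auto simp: half_space_def\<close>)
      have p3: "A.path (half_space G \<chi> (- c)) (n \<otimes>\<^bsub>G\<^esub> ?t) (inv_word ?u)"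
        using A.path_inv[OF tc(2) u] up'[OF tc(2)] n0 by simp
      have e: "?t \<otimes>\<^bsub>G\<^esub> A.wv ?w = n \<otimes>\<^bsub>G\<^esub> ?t" "n \<otimes>\<^bsub>G\<^esub> ?t \<otimes>\<^bsub>G\<^esub> inv\<^bsub>G\<^esub> ?t = n"
        using u w tc by (simp_all add: A.m_assoc A.r_inv)
      have "A.path (half_space G \<chi> (- c)) \<one>\<^bsub>G\<^esub> (?u @ v @ inv_word ?u)"
        using up'[OF A.one_closed] A.additive_one[OF \<chi>(1)] p2 p3 u v e by (simp add: A.path_append)
      moreover have "A.wv (?u @ v @ inv_word ?u) = (?t \<otimes>\<^bsub>G\<^esub> A.wv v) \<otimes>\<^bsub>G\<^esub> inv\<^bsub>G\<^esub> ?t"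
        using u v(1) by (simp add: A.m_assoc)
      then have "A.wv (?u @ v @ inv_word ?u) = n"
        unfolding v(3) e .
      ultimately show False
        using n(2) A.reachI[of "?u @ v @ inv_word ?u"] u v by simp
    qed
    fix i assume "i \<le> length ?w"
    have ch: "\<chi> (A.wv (take j ?u)) = j * \<chi> (A.lv t)" "\<chi> (A.wv (take j (inv_word ?u))) = - (j * \<chi> (A.lv t))"
      if "j \<le> k" for j
    proof -
      have iu: "inv_word ?u = replicate k (inv_letter t)" by (simp add: inv_word_def)
      show "\<chi> (A.wv (take j ?u)) = j * \<chi> (A.lv t)"
        using that A.replicate_val[OF \<chi>(1) t(1)] by (simp add: min_def)
      show "\<chi> (A.wv (take j (inv_word ?u))) = - (j * \<chi> (A.lv t))"
        using that A.replicate_val[OF \<chi>(1), of "inv_letter t" j] t(1) by (simp add: iu min_def \<chi>_inv)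
    qed
    consider "i \<le> k" | "k < i" "i \<le> k + length w" | "k + length w < i" by linarith
    then show "\<chi> (A.wv (take i ?w)) \<le> 0"
    proof cases
      case 1
      then show ?thesis using ch(2)[OF 1] t(2) by simp
    next
      case 2
      then have ti: "take i ?w = inv_word ?u @ take (i - k) w" by simp
      have "\<chi> (A.wv (inv_word ?u @ take (i - k) w)) = - \<chi> ?t + \<chi> (A.wv (take (i - k) w))"
        using u w by (simp add: \<chi>_mult \<chi>_inv words_take)
      then have "\<chi> (A.wv (take i ?w)) = - \<chi> ?t + \<chi> (A.wv (take (i - k) w))"
        unfolding ti .
      moreover have "i - k \<le> length w" using 2 by linarith
      ultimately show ?thesis using M[of "i - k"] k tv by linarith
    next
      case 3
      let ?j = "i - k - length w"
      have j: "?j \<le> k" using \<open>i \<le> length ?w\<close> by simp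
      have ti: "take i ?w = inv_word ?u @ w @ take ?j ?u" using 3 by simp
      have "\<chi> (A.wv (inv_word ?u @ w @ take ?j ?u)) = - \<chi> ?t + (\<chi> n + \<chi> (A.wv (take ?j ?u)))"
        using u w tc words_take[OF u, of ?j] by (simp add: \<chi>_mult \<chi>_inv del: take_replicate)
      then have "\<chi> (A.wv (take i ?w)) = - \<chi> ?t + (\<chi> n + \<chi> (A.wv (take ?j ?u)))"
        unfolding ti .
      moreover have "?j * \<chi> (A.lv t) \<le> k * \<chi> (A.lv t)"
        using j t(2) by (intro mult_right_mono) auto
      ultimately show ?thesis using ch(1)[OF j] tv n0 by linarith
    qed
  qed
qed

text \<open>\<open>U\<close> and \<open>V\<close> are the parts of \<open>H\<close> where
  \<open>\<chi>1\<close> is at least \<open>-c\<close> and at most \<open>c\<close>. On the overlap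
  neither coordinate can leave its component along an edge, so the predicate \<open>F\<close> is
  constant along edges there. Negating along the edges of \<open>U\<close> where \<open>F\<close>
  changes is therefore flat, as every short loop lies in \<open>U\<close> or in \<open>V\<close>. It
  is the double cover obtained from two pieces with disconnected overlap.\<close>

theorem finitely_presented_imp_half_connected:
  fixes G :: "('a, 'b) monoid_scheme" and X :: "'x set" and f :: "'x => 'a \<times> 'a"
  assumes G: "group G" and H: "subgroup H (G \<times>\<times> G)"
    and f: "generators ((G \<times>\<times> G)\<lparr>carrier := H\<rparr>) X f" and X: "finite X" and R: "finite R"
    and gen: "word_val ((G \<times>\<times> G)\<lparr>carrier := H\<rparr>) f ` words X = H"
    and rel: "!!w. w \<in> words X ==>
      word_val ((G \<times>\<times> G)\<lparr>carrier := H\<rparr>) f w = \<one>\<^bsub>G \<times>\<times> G\<^esub> \<longleftrightarrow> (w, []) \<in> presentation_rel X R"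
    and Rw: "R \<subseteq> words X"
    and proj: "carrier G \<subseteq> fst ` H" "carrier G \<subseteq> snd ` H"
    and comm: "!!n. n \<in> commutator_subgroup G ==> (n, \<one>\<^bsub>G\<^esub>) \<in> H & (\<one>\<^bsub>G\<^esub>, n) \<in> H"
    and \<chi>1: "additive G \<chi>1" and \<chi>2: "additive G \<chi>2" and opp: "!!p. p \<in> H ==> \<chi>1 (fst p) = - \<chi>2 (snd p)"
    and nonzero: "\<exists>g\<in>carrier G. \<chi>1 g ~= 0"
  shows "half_connected G X (fst \<circ> f) \<chi>1 | half_connected G X (snd \<circ> f) \<chi>2"
proof (rule ccontr)
  assume "\<not> ?thesis"
  then have not: "\<not> half_connected G X (fst \<circ> f) \<chi>1" "\<not> half_connected G X (snd \<circ> f) \<chi>2" by auto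
  interpret G: group G by (rule G)
  let ?GG = "G \<times>\<times> G"
  let ?H = "?GG\<lparr>carrier := H\<rparr>"
  interpret GG: group ?GG by (rule DirProd_group[OF G G])
  interpret H: generators ?H X f by (rule f)
  have HG: "p \<in> H ==> p \<in> carrier ?GG" for p using subgroup.mem_carrier[OF H] .
  have fH: "f x \<in> H" if "x \<in> X" for x using H.generator_closed[OF that] by simp
  define f1 f2 where "f1 = fst \<circ> f" and "f2 = snd \<circ> f"
  have f12: "f1 x = fst (f x)" "f2 x = snd (f x)" for x by (simp_all add: f1_def f2_def)
  note not = not[folded f1_def f2_def]
  have fG: "fst (f x) \<in> carrier G" "snd (f x) \<in> carrier G" if "x \<in> X" for x
    using HG[OF fH[OF that]] by (auto simp: mem_Times_iff)
  interpret A: generators G X f1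
    by unfold_locales (simp add: fG f12)
  interpret B: generators G X f2
    by unfold_locales (simp add: fG f12)
  have lv: "H.lv s = (A.lv s, B.lv s)" if s: "fst s \<in> X" for s
  proof -
    have fs: "f (fst s) \<in> H" "f (fst s) \<in> carrier G \<times> carrier G" using fH[OF s] HG[OF fH[OF s]] by auto
    have "inv\<^bsub>?H\<^esub> f (fst s) = inv\<^bsub>?GG\<^esub> f (fst s)"
      using GG.m_inv_consistent[OF H fs(1)] .
    also have "... = (inv\<^bsub>G\<^esub> fst (f (fst s)), inv\<^bsub>G\<^esub> snd (f (fst s)))"
      using inv_DirProd[OF G G, of "fst (f (fst s))" "snd (f (fst s))"] fs(2) by (auto simp: mem_Times_iff)
    finally show ?thesis by (simp add: letter_val_def f12)
  qed
  have wv: "H.wv w = (A.wv w, B.wv w)" if "w \<in> words X" for w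
    using that by (induction w) (auto simp: lv)
  have Hc: "H.wv w \<in> H" if "w \<in> words X" for w using H.word_val_closed[OF that] by simp
  have lift: "\<exists>w\<in>words X. A.wv w = fst p & B.wv w = snd p" if p: "p \<in> H" for p
  proof -
    have "p \<in> H.wv ` words X" unfolding gen by (rule p)
    then obtain w where "w \<in> words X" "p = H.wv w" by (elim imageE)
    then show ?thesis using wv by (intro bexI[of _ w]) simp_all
  qed
  have lift1: "\<exists>w\<in>words X. A.wv w = n & B.wv w = \<one>\<^bsub>G\<^esub>"
    and lift2: "\<exists>w\<in>words X. B.wv w = n & A.wv w = \<one>\<^bsub>G\<^esub>" if n: "n \<in> commutator_subgroup G" for n
    using lift[OF conjunct1[OF comm[OF n]]] lift[OF conjunct2[OF comm[OF n]]] by auto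
  have gen1: "carrier G \<subseteq> A.wv ` words X" and gen2: "carrier G \<subseteq> B.wv ` words X"
  proof -
    have "g \<in> A.wv ` words X" "g \<in> B.wv ` words X" if g: "g \<in> carrier G" for g
    proof -
      obtain p where p: "g = fst p" "p \<in> H" using subsetD[OF proj(1) g] by (elim imageE)
      obtain q where q: "g = snd q" "q \<in> H" using subsetD[OF proj(2) g] by (elim imageE)
      show "g \<in> A.wv ` words X" using lift[OF p(2)] unfolding p(1) by (metis imageI)
      show "g \<in> B.wv ` words X" using lift[OF q(2)] unfolding q(1) by (metis imageI)
    qed
    then show "carrier G \<subseteq> A.wv ` words X" "carrier G \<subseteq> B.wv ` words X" by blast+
  qed
  define d where "d = Max (insert 2 (length ` R))"
  have d: "2 \<le> d" "!!r. r \<in> R ==> length r \<le> d"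
    unfolding d_def using R by (auto intro!: Max_ge)
  define C where "C = Max (insert 0 ((%s. \<bar>\<chi>1 (A.lv s)\<bar>) ` (X \<times> UNIV)))"
  have C: "0 \<le> C" "!!s. fst s \<in> X ==> \<bar>\<chi>1 (A.lv s)\<bar> \<le> C"
    unfolding C_def using X by (auto intro!: Max_ge simp: mem_Times_iff)
  have Cw: "\<bar>\<chi>1 (A.wv w)\<bar> \<le> C * length w" if "w \<in> words X" for w
    using that
  proof (induction w)
    case Nil
    then show ?case using G.additive_one[OF \<chi>1] by simp
  next
    case (Cons s w)
    then have "\<bar>\<chi>1 (A.lv s)\<bar> \<le> C" "\<bar>\<chi>1 (A.wv w)\<bar> \<le> C * length w" using C(2)[of s] by auto
    then show ?case
      using Cons.prems G.additiveD[OF \<chi>1, of "A.lv s" "A.wv w"] by (simp add: algebra_simps abs_le_iff)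
  qed
  \<comment> \<open>At most \<open>d\<close> letters change \<open>\<chi>1\<close> by at most
    \<open>c\<close>, so a short loop based at nonnegative height stays in \<open>U\<close> and any
    other one in \<open>V\<close>.\<close>
  define c where "c = C * d"
  have c0: "0 \<le> c" using C(1) by (simp add: c_def)
  have nonzero2: "\<exists>g\<in>carrier G. \<chi>2 g ~= 0"
  proof -
    obtain g where "g \<in> carrier G" "\<chi>1 g ~= 0" using nonzero by blast
    moreover obtain p where "p \<in> H" "g = fst p" using proj(1) \<open>g \<in> carrier G\<close> by auto
    ultimately show ?thesis
      using opp[of p] HG[of p] by (intro bexI[of _ "snd p"]) (auto simp: mem_Times_iff)
  qed
  obtain w1 where w1: "w1 \<in> words X" "B.wv w1 = \<one>\<^bsub>G\<^esub>" "\<chi>1 (A.wv w1) = 0" "A.wv w1 \<notin> A.reach \<chi>1 (- c)"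
    "!!i. i \<le> length w1 ==> \<chi>1 (A.wv (take i w1)) \<le> 0"
    by (rule one_sided_word[OF A.generators_axioms B.generators_axioms \<chi>1 nonzero gen1 not(1) c0 lift1]) (assumption, rule that)
  obtain w2 where w2: "w2 \<in> words X" "A.wv w2 = \<one>\<^bsub>G\<^esub>" "\<chi>2 (B.wv w2) = 0" "B.wv w2 \<notin> B.reach \<chi>2 (- c)"
    "!!i. i \<le> length w2 ==> \<chi>2 (B.wv (take i w2)) \<le> 0"
    by (rule one_sided_word[OF B.generators_axioms A.generators_axioms \<chi>2 nonzero2 gen2 not(2) c0 lift2]) (assumption, rule that)
  define U where "U = {p \<in> H. - c \<le> \<chi>1 (fst p)}"
  define V where "V = {p \<in> H. \<chi>1 (fst p) \<le> c}"
  \<comment> \<open>On the overlap \<open>\<chi>2 = - \<chi>1\<close> is at least \<open>-c\<close>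
    as well, so \<open>reach_step\<close> applies to both coordinates.\<close>
  define F where "F p \<longleftrightarrow> fst p \<in> A.reach \<chi>1 (- c) & snd p \<in> B.reach \<chi>2 (- c)" for p
  define L where "L p s = (if p \<in> U & p \<otimes>\<^bsub>?H\<^esub> H.lv s \<in> U & F p ~= F (p \<otimes>\<^bsub>?H\<^esub> H.lv s) then Not else id)" for p s
  have Fstep: "F (p \<otimes>\<^bsub>?H\<^esub> H.lv s)"
    if p: "p \<in> U" "p \<in> V" "p \<otimes>\<^bsub>?H\<^esub> H.lv s \<in> U" "p \<otimes>\<^bsub>?H\<^esub> H.lv s \<in> V" "fst s \<in> X" "F p" for p s
  proof -
    obtain p1 p2 where pp: "p = (p1, p2)" by (cases p)
    have ps: "p \<otimes>\<^bsub>?H\<^esub> H.lv s = (p1 \<otimes>\<^bsub>G\<^esub> A.lv s, p2 \<otimes>\<^bsub>G\<^esub> B.lv s)"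
      using lv[OF p(5)] pp by simp
    have "- c \<le> \<chi>1 (p1 \<otimes>\<^bsub>G\<^esub> A.lv s)" "\<chi>1 (p1 \<otimes>\<^bsub>G\<^esub> A.lv s) \<le> c" "(p1 \<otimes>\<^bsub>G\<^esub> A.lv s, p2 \<otimes>\<^bsub>G\<^esub> B.lv s) \<in> H"
      using p(3,4) ps by (auto simp: U_def V_def)
    moreover from this have "- c \<le> \<chi>2 (p2 \<otimes>\<^bsub>G\<^esub> B.lv s)" using opp by fastforce
    moreover have "p1 \<in> A.reach \<chi>1 (- c)" "p2 \<in> B.reach \<chi>2 (- c)" using p(6) by (simp_all add: F_def pp)
    ultimately show ?thesis
      using A.reach_step[of p1 \<chi>1 "- c" s] B.reach_step[of p2 \<chi>2 "- c" s] p(5) unfolding ps F_def by simp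
  qed
  have Fconst: "F p \<longleftrightarrow> F (p \<otimes>\<^bsub>?H\<^esub> H.lv s)"
    if p: "p \<in> U" "p \<in> V" "p \<otimes>\<^bsub>?H\<^esub> H.lv s \<in> U" "p \<otimes>\<^bsub>?H\<^esub> H.lv s \<in> V" "fst s \<in> X" for p s
  proof
    assume a: "F (p \<otimes>\<^bsub>?H\<^esub> H.lv s)"
    have pH: "p \<in> carrier ?H" using p(1) by (simp add: U_def)
    have "p \<otimes>\<^bsub>?H\<^esub> H.lv s \<otimes>\<^bsub>?H\<^esub> H.lv (inv_letter s) = p"
      using H.r_inv[OF H.letter_val_closed[OF p(5)]] H.r_one[OF pH]
        H.m_assoc[OF pH H.letter_val_closed[OF p(5)], of "H.lv (inv_letter s)"] p(5)
      by (simp only: H.letter_val_inv H.inv_closed H.letter_val_closed fst_inv_letter)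
    then show "F p"
      using Fstep[OF p(3,4), of "inv_letter s"] p a by simp
  qed (rule Fstep[OF p])
  have Vpath: "H.hol L p w = id" if "w \<in> words X" "H.path V p w" for p w
    using that
  proof (induction w arbitrary: p)
    case (Cons s w)
    have "L p s = id"
      using Fconst[of p s] Cons.prems path_in_start[of ?H f V "p \<otimes>\<^bsub>?H\<^esub> H.lv s" w]
      unfolding L_def by auto
    then show ?case using Cons by simp
  qed simp
  \<comment> \<open>Along a path in \<open>U\<close> the negations telescope to a comparison of its
    two ends.\<close>
  have Upath: "H.hol L p w = (if F p = F (p \<otimes>\<^bsub>?H\<^esub> H.wv w) then id else Not)"
    if "w \<in> words X" "H.path U p w" for p w
    using that
  proof (induction w arbitrary: p)
    case Nil
    then have "p \<in> carrier ?H" by (simp add: U_def)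
    then have "p \<otimes>\<^bsub>?H\<^esub> \<one>\<^bsub>?H\<^esub> = p" by (rule H.r_one)
    then show ?case by simp
  next
    case (Cons s w)
    let ?ps = "p \<otimes>\<^bsub>?H\<^esub> H.lv s"
    have p: "p \<in> U" "?ps \<in> U" "p \<in> carrier ?H" "fst s \<in> X" "w \<in> words X"
      using Cons.prems path_in_start[of ?H f U ?ps w] by (auto simp: U_def)
    have Lp: "L p s = (if F p = F ?ps then id else Not)" using p unfolding L_def by auto
    have IH: "H.hol L ?ps w = (if F ?ps = F (?ps \<otimes>\<^bsub>?H\<^esub> H.wv w) then id else Not)"
      by (rule Cons.IH) (use Cons.prems in auto)
    have e: "?ps \<otimes>\<^bsub>?H\<^esub> H.wv w = p \<otimes>\<^bsub>?H\<^esub> H.wv (s # w)"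
      using H.m_assoc[OF p(3) H.letter_val_closed[OF p(4)] H.word_val_closed[OF p(5)]] by simp
    show ?case
      unfolding holonomy.simps Lp IH e by (auto simp: fun_eq_iff)
  qed
  have flat: "H.flat d (carrier ?H) L"
    unfolding H.flat_def
  proof (intro ballI allI impI)
    fix p w assume p: "p \<in> carrier ?H" and w: "w \<in> words X" "length w \<le> d" "p \<otimes>\<^bsub>?H\<^esub> H.wv w = p"
    obtain p1 p2 where pp: "p = (p1, p2)" by (cases p)
    have pc: "p1 \<in> carrier G" using HG[of p] p pp by auto
    have near: "\<bar>\<chi>1 (fst (p \<otimes>\<^bsub>?H\<^esub> H.wv (take i w))) - \<chi>1 p1\<bar> \<le> c" for i
    proof -
      have ww: "take i w \<in> words X" using w(1) by (rule words_take)
      have "C * length (take i w) \<le> c"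
        unfolding c_def using w(2) C(1) by (intro mult_left_mono) auto
      then show ?thesis
        using Cw[OF ww] G.additiveD[OF \<chi>1 pc A.word_val_closed[OF ww]] wv[OF ww] pp by simp
    qed
    have inH: "p \<otimes>\<^bsub>?H\<^esub> H.wv (take i w) \<in> H" for i
      using H.m_closed[OF p H.word_val_closed[OF words_take[OF w(1), of i]]] by simp
    show "H.hol L p w = id"
    proof (cases "0 \<le> \<chi>1 p1")
      case True
      have "p \<otimes>\<^bsub>?H\<^esub> H.wv (take i w) \<in> U" for i
        using near[of i] True inH[of i] unfolding U_def abs_le_iff mem_Collect_eq by linarith
      then have "H.path U p w" unfolding H.path_iff_prefixes[OF p w(1)] by blast
      from Upath[OF w(1) this] show ?thesis unfolding w(3) by simp
    next
      case False
      have "p \<otimes>\<^bsub>?H\<^esub> H.wv (take i w) \<in> V" for i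
        using near[of i] False inH[of i] unfolding V_def abs_le_iff mem_Collect_eq by linarith
      then have "H.path V p w" unfolding H.path_iff_prefixes[OF p w(1)] by blast
      from Vpath[OF w(1) this] show ?thesis .
    qed
  qed
  let ?W = "w1 @ w2 @ inv_word w1 @ inv_word w2"
  have W: "?W \<in> words X" using w1 w2 by simp
  have "H.wv ?W = \<one>\<^bsub>?GG\<^esub>"
    using w1(1,2) w2(1,2) by (subst wv[OF W]) (simp add: G.r_inv)
  then have "(?W, []) \<in> presentation_rel X R" using rel[OF W] by blast
  moreover have "H.wv r = \<one>\<^bsub>?H\<^esub> & length r \<le> d" if "r \<in> R" "r \<in> words X" for r
  proof -
    have "([] @ r @ [], [] @ []) \<in> presentation_rel X R"
      using that by (intro presentation_rel.relator) auto
    then show ?thesis using rel[OF that(2)] d(2)[OF that(1)] by simp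
  qed
  ultimately obtain D where D: "\<forall>x\<in>carrier ?H. \<forall>W (L :: _ => _ => bool => bool). H.near x D \<subseteq> W -->
      H.flat d W L --> H.hol L x ?W = H.hol L x []"
    using H.presentation_rel_hol[OF _ _ d(1), of ?W "[]" R, where 'k = bool] by blast
  have "H.near \<one>\<^bsub>?H\<^esub> D \<subseteq> carrier ?H" using H.near_closed[OF H.one_closed] by blast
  from D[THEN bspec, OF H.one_closed, rule_format, OF this flat]
  have trivial: "H.hol L \<one>\<^bsub>?H\<^esub> ?W = id"
    unfolding holonomy.simps .
  define p0 p1 p2 p3 where "p0 = \<one>\<^bsub>?H\<^esub>" and "p1 = (A.wv w1, \<one>\<^bsub>G\<^esub>)" and "p2 = (A.wv w1, B.wv w2)" and "p3 = (\<one>\<^bsub>G\<^esub>, B.wv w2)"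
  have v1: "H.wv w1 = p1" and v2: "H.wv w2 = p3" using wv w1 w2 by (auto simp: p1_def p3_def)
  have pH: "p0 \<in> carrier ?H" "p1 \<in> carrier ?H" "p3 \<in> carrier ?H"
    using H.one_closed H.word_val_closed[OF w1(1)] H.word_val_closed[OF w2(1)] unfolding p0_def v1 v2 by auto
  have q1: "p0 \<otimes>\<^bsub>?H\<^esub> H.wv w1 = p1" and q2: "p1 \<otimes>\<^bsub>?H\<^esub> H.wv w2 = p2" and q3: "p3 \<otimes>\<^bsub>?H\<^esub> H.wv w1 = p2"
    and q4: "p0 \<otimes>\<^bsub>?H\<^esub> H.wv w2 = p3"
    unfolding v1 v2 using w1(1) w2(1) by (auto simp: p0_def p1_def p2_def p3_def)
  have p2H: "p2 \<in> carrier ?H" using H.m_closed[OF pH(2) H.word_val_closed[OF w2(1)]] unfolding q2 .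
  have inV: "H.path V q w1" if q: "q \<in> carrier ?H" "\<chi>1 (fst q) = 0" for q
    unfolding H.path_iff_prefixes[OF q(1) w1(1)]
  proof (intro allI impI)
    fix i assume i: "i \<le> length w1"
    have ww: "take i w1 \<in> words X" using w1(1) by (rule words_take)
    have qc: "fst q \<in> carrier G" using HG[of q] q by (auto simp: mem_Times_iff)
    have "\<chi>1 (fst (q \<otimes>\<^bsub>?H\<^esub> H.wv (take i w1))) = \<chi>1 (A.wv (take i w1))"
      using G.additiveD[OF \<chi>1 qc A.word_val_closed[OF ww]] wv[OF ww] q(2) by (cases q) simp
    moreover have "q \<otimes>\<^bsub>?H\<^esub> H.wv (take i w1) \<in> H"
      using H.m_closed[OF q(1) H.word_val_closed[OF ww]] by simp
    ultimately show "q \<otimes>\<^bsub>?H\<^esub> H.wv (take i w1) \<in> V"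
      using w1(5)[OF i] c0 unfolding V_def by simp
  qed
  have inU: "H.path U q w2" if q: "q \<in> carrier ?H" "\<chi>1 (fst q) = 0" for q
    unfolding H.path_iff_prefixes[OF q(1) w2(1)]
  proof (intro allI impI)
    fix i assume i: "i \<le> length w2"
    have ww: "take i w2 \<in> words X" using w2(1) by (rule words_take)
    have qc: "fst q \<in> carrier G" using HG[of q] q by (auto simp: mem_Times_iff)
    have "\<chi>1 (fst (q \<otimes>\<^bsub>?H\<^esub> H.wv (take i w2))) = \<chi>1 (A.wv (take i w2))"
      using G.additiveD[OF \<chi>1 qc A.word_val_closed[OF ww]] wv[OF ww] q(2) by (cases q) simp
    also have "... = - \<chi>2 (B.wv (take i w2))"
      using opp[OF Hc[OF ww]] wv[OF ww] by simp
    finally have e: "\<chi>1 (fst (q \<otimes>\<^bsub>?H\<^esub> H.wv (take i w2))) = - \<chi>2 (B.wv (take i w2))" .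
    have "q \<otimes>\<^bsub>?H\<^esub> H.wv (take i w2) \<in> H"
      using H.m_closed[OF q(1) H.word_val_closed[OF ww]] by simp
    then show "q \<otimes>\<^bsub>?H\<^esub> H.wv (take i w2) \<in> U"
      using w2(5)[OF i] c0 e unfolding U_def by simp
  qed
  have ch0: "\<chi>1 (fst p0) = 0" "\<chi>1 (fst p1) = 0" "\<chi>1 (fst p3) = 0"
    using G.additive_one[OF \<chi>1] w1(3) by (auto simp: p0_def p1_def p3_def)
  have F1: "\<not> F p1" "\<not> F p2" "\<not> F p3" using w1(4) w2(4) by (auto simp: F_def p1_def p2_def p3_def)
  have F0: "F p0"
  proof -
    have "A.wv [] \<in> A.reach \<chi>1 (- c)" "B.wv [] \<in> B.reach \<chi>2 (- c)"
      using c0 G.additive_one[OF \<chi>1] G.additive_one[OF \<chi>2]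
      by (intro A.reachI B.reachI; simp add: half_space_def)+
    then show ?thesis by (simp add: F_def p0_def)
  qed
  have h1: "H.hol L p0 w1 = id" using Vpath[OF w1(1) inV[OF pH(1) ch0(1)]] .
  have h2: "H.hol L p1 w2 = id" using Upath[OF w2(1) inU[OF pH(2) ch0(2)]] F1 unfolding q2 by simp
  have "H.path V p2 (inv_word w1)"
    using H.path_inv[OF pH(3) w1(1)] inV[OF pH(3) ch0(3)] unfolding q3 by blast
  then have h3: "H.hol L p2 (inv_word w1) = id" using Vpath w1(1) by simp
  have U4: "H.path U p3 (inv_word w2)"
    using H.path_inv[OF pH(1) w2(1)] inU[OF pH(1) ch0(1)] unfolding q4 by blast
  have e4: "p3 \<otimes>\<^bsub>?H\<^esub> H.wv (inv_word w2) = p0"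
    using H.word_val_inv[OF w2(1)] H.r_inv[OF H.word_val_closed[OF w2(1)]] unfolding v2 p0_def by simp
  have e3: "p2 \<otimes>\<^bsub>?H\<^esub> H.wv (inv_word w1) = p3"
    using H.word_val_inv[OF w1(1)] H.r_inv[OF H.word_val_closed[OF w1(1)]]
      H.m_assoc[OF pH(3) H.word_val_closed[OF w1(1)] H.inv_closed[OF H.word_val_closed[OF w1(1)]]] H.r_one[OF pH(3)]
    unfolding q3[symmetric] by simp
  \<comment> \<open>The only nontrivial side of the commutator: it ends at the reachable
    \<open>p0\<close>. Two other sides run in \<open>V\<close>, and the remaining one runs in
    \<open>U\<close> between unreachable ends.\<close>
  have h4: "H.hol L p3 (inv_word w2) = Not"
    using Upath[OF _ U4] w2(1) F0 F1 unfolding e4 by simp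
  have "H.hol L p0 ?W = H.hol L p0 w1 \<circ> (H.hol L p1 w2 \<circ> (H.hol L p2 (inv_word w1) \<circ> H.hol L p3 (inv_word w2)))"
    using H.holonomy_append[OF pH(1) w1(1), of "w2 @ inv_word w1 @ inv_word w2" L]
      H.holonomy_append[OF pH(2) w2(1), of "inv_word w1 @ inv_word w2" L]
      H.holonomy_append[OF p2H, of "inv_word w1" "inv_word w2" L] w1(1) w2(1)
    unfolding q1 q2 e3 by simp
  then have "(id :: bool => bool) = Not"
    using trivial[folded p0_def] unfolding h1 h2 h3 h4 by simp
  then show False by (simp add: fun_eq_iff)
qed

section \<open>Monoid rings\<close>

lemma monoid_ring_simps [simp]:
  "carrier (monoid_ring M) = {f. {x. f x ~= 0} \<subseteq> carrier M & finite {x. f x ~= 0}}"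
  "\<one>\<^bsub>monoid_ring M\<^esub> = (%z. if z = \<one>\<^bsub>M\<^esub> then 1 else 0)"
  "\<zero>\<^bsub>monoid_ring M\<^esub> = (%_. 0)"
  "f \<oplus>\<^bsub>monoid_ring M\<^esub> g = (%z. f z + g z)"
  by (simp_all add: monoid_ring_def)

lemma monoid_ring_carrierI:
  "{x. f x ~= 0} \<subseteq> carrier M ==> finite {x. f x ~= 0} ==> f \<in> carrier (monoid_ring M)"
  unfolding monoid_ring_simps mem_Collect_eq by (rule conjI)

lemma monoid_ring_finite: "f \<in> carrier (monoid_ring M) ==> finite {x. f x ~= 0}"
  unfolding monoid_ring_simps mem_Collect_eq by (rule conjunct2)

lemma monoid_ring_nonzero: "f \<in> carrier (monoid_ring M) ==> f x ~= 0 ==> x \<in> carrier M"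
  by auto

lemma monoid_ring_support: "f \<in> carrier (monoid_ring M) ==> {x. f x ~= 0} \<subseteq> carrier M"
  unfolding monoid_ring_simps mem_Collect_eq by (rule conjunct1)

lemma sum_support:
  fixes f :: "'a => 'c :: comm_monoid_add"
  assumes "finite A" "{x. f x ~= 0} \<subseteq> A"
  shows "(\<Sum>x | f x ~= 0. f x) = sum f A"
  using assms by (intro sum.mono_neutral_left) auto

text \<open>Summing over fixed finite supersets of the supports makes distributivity a termwise
  matter.\<close>

lemma monoid_ring_mult:
  fixes f g :: "'a => int"
  assumes "finite A" "finite B" "{x. f x ~= 0} \<subseteq> A" "{x. g x ~= 0} \<subseteq> B"
  shows "(f \<otimes>\<^bsub>monoid_ring M\<^esub> g) z = (\<Sum>x\<in>A. \<Sum>y\<in>B. if x \<otimes>\<^bsub>M\<^esub> y = z then f x * g y else 0)"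
proof -
  let ?S = "{(x, y). f x ~= 0 & g y ~= 0 & x \<otimes>\<^bsub>M\<^esub> y = z}"
  let ?F = "%(x, y). if x \<otimes>\<^bsub>M\<^esub> y = z then f x * g y else 0"
  have "(f \<otimes>\<^bsub>monoid_ring M\<^esub> g) z = sum ?F ?S"
    unfolding monoid_ring_def by (auto intro!: sum.cong)
  also have "... = sum ?F (A \<times> B)"
    using assms by (intro sum.mono_neutral_left finite_cartesian_product) (auto split: if_splits)
  also have "... = (\<Sum>x\<in>A. \<Sum>y\<in>B. if x \<otimes>\<^bsub>M\<^esub> y = z then f x * g y else 0)"
    by (simp add: sum.cartesian_product)
  finally show ?thesis .
qed

lemma monoid_ring_mult_support:
  fixes f g :: "'a => int"
  assumes "finite A" "finite B" "{x. f x ~= 0} \<subseteq> A" "{x. g x ~= 0} \<subseteq> B"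
  shows "{z. (f \<otimes>\<^bsub>monoid_ring M\<^esub> g) z ~= 0} \<subseteq> (%(x, y). x \<otimes>\<^bsub>M\<^esub> y) ` (A \<times> B)"
proof
  fix z assume "z \<in> {z. (f \<otimes>\<^bsub>monoid_ring M\<^esub> g) z ~= 0}"
  then have "(\<Sum>x\<in>A. \<Sum>y\<in>B. if x \<otimes>\<^bsub>M\<^esub> y = z then f x * g y else 0) ~= 0"
    using monoid_ring_mult[OF assms, of M z] by simp
  then obtain x where "x \<in> A" "(\<Sum>y\<in>B. if x \<otimes>\<^bsub>M\<^esub> y = z then f x * g y else 0) ~= 0"
    by (rule sum.not_neutral_contains_not_neutral)
  moreover from this(2) obtain y where "y \<in> B" "(if x \<otimes>\<^bsub>M\<^esub> y = z then f x * g y else 0) ~= 0"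
    by (rule sum.not_neutral_contains_not_neutral)
  ultimately show "z \<in> (%(x, y). x \<otimes>\<^bsub>M\<^esub> y) ` (A \<times> B)"
    by (auto split: if_splits)
qed

definition single :: "'a => int => 'a => int" where
  "single g n = (%z. if z = g then n else 0)"

definition augmentation :: "('a => int) => int" where
  "augmentation f = (\<Sum>x | f x ~= 0. f x)"

lemma augmentation_eq: "finite A ==> {x. f x ~= 0} \<subseteq> A ==> augmentation f = sum f A"
  unfolding augmentation_def by (rule sum_support)

lemma single_carrier [simp]: "g \<in> carrier M ==> single g n \<in> carrier (monoid_ring M)"
  by (auto simp: single_def)

lemma augmentation_add:
  assumes "f \<in> carrier (monoid_ring M)" "g \<in> carrier (monoid_ring M)"
  shows "augmentation (%z. f z + g z) = augmentation f + augmentation g"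
proof -
  let ?A = "{x. f x ~= 0} \<union> {x. g x ~= 0}"
  have A: "finite ?A" using assms by simp
  have "augmentation (%z. f z + g z) = (\<Sum>x\<in>?A. f x + g x)"
    by (rule augmentation_eq[OF A]) auto
  also have "... = augmentation f + augmentation g"
    unfolding sum.distrib using augmentation_eq[OF A, of f] augmentation_eq[OF A, of g] by auto
  finally show ?thesis .
qed

lemma augmentation_single [simp]: "augmentation (single g n) = n"
proof -
  have "{x. single g n x ~= 0} \<subseteq> {g}" by (auto simp: single_def)
  then show ?thesis using augmentation_eq[of "{g}" "single g n"] by (simp add: single_def)
qed

lemma sum_sum_if:
  fixes F :: "'a => 'b => int"
  assumes "finite C" "!!x y. x \<in> A ==> y \<in> B ==> m x y \<in> C"
  shows "(\<Sum>z\<in>C. G z * (\<Sum>x\<in>A. \<Sum>y\<in>B. if m x y = z then F x y else 0))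
    = (\<Sum>x\<in>A. \<Sum>y\<in>B. G (m x y) * F x y)"
proof -
  have "(\<Sum>z\<in>C. G z * (\<Sum>x\<in>A. \<Sum>y\<in>B. if m x y = z then F x y else 0))
      = (\<Sum>z\<in>C. \<Sum>x\<in>A. \<Sum>y\<in>B. if m x y = z then G (m x y) * F x y else 0)"
    unfolding sum_distrib_left by (intro sum.cong) auto
  also have "... = (\<Sum>x\<in>A. \<Sum>z\<in>C. \<Sum>y\<in>B. if m x y = z then G (m x y) * F x y else 0)"
    by (rule sum.swap)
  also have "... = (\<Sum>x\<in>A. \<Sum>y\<in>B. \<Sum>z\<in>C. if m x y = z then G (m x y) * F x y else 0)"
    by (intro sum.cong[OF HOL.refl] sum.swap)
  also have "... = (\<Sum>x\<in>A. \<Sum>y\<in>B. G (m x y) * F x y)"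
    using assms by (intro sum.cong[OF HOL.refl]) (simp add: sum.delta)
  finally show ?thesis .
qed

context monoid
begin

abbreviation "ZM \<equiv> monoid_ring G"
abbreviation ZM_mult (infixl "\<star>" 70) where "r \<star> s \<equiv> r \<otimes>\<^bsub>ZM\<^esub> s"

lemma ZM_mult_closed:
  assumes "f \<in> carrier ZM" "g \<in> carrier ZM"
  shows "f \<star> g \<in> carrier ZM"
proof -
  note f = monoid_ring_finite[OF assms(1)] monoid_ring_support[OF assms(1)]
  note g = monoid_ring_finite[OF assms(2)] monoid_ring_support[OF assms(2)]
  have s: "{z. (f \<star> g) z ~= 0} \<subseteq> (%(x, y). x \<otimes> y) ` ({x. f x ~= 0} \<times> {x. g x ~= 0})"
    by (rule monoid_ring_mult_support[OF f(1) g(1)]) (rule subset_refl)+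
  have "finite {z. (f \<star> g) z ~= 0}"
    by (rule finite_subset[OF s]) (intro finite_imageI finite_cartesian_product f g)
  moreover have "{z. (f \<star> g) z ~= 0} \<subseteq> carrier G"
  proof (rule subset_trans[OF s], rule image_subsetI)
    fix p assume "p \<in> {x. f x ~= 0} \<times> {x. g x ~= 0}"
    then show "(case p of (x, y) => x \<otimes> y) \<in> carrier G"
      using m_closed[of "fst p" "snd p"] f(2) g(2) by (simp add: case_prod_beta mem_Times_iff subset_iff)
  qed
  ultimately show ?thesis by (intro monoid_ring_carrierI)
qed

text \<open>The sums with weight \<open>F\<close> are additive functionals on the ring. Weight 1
  gives multiplicativity of the augmentation, and other weights give associativity and the
  invariance used for type FP1.\<close>

lemma functional_mult:
  fixes f g F :: "'a => int"
  assumes f: "f \<in> carrier ZM" and g: "g \<in> carrier ZM"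
  shows "(\<Sum>z | (f \<star> g) z ~= 0. F z * (f \<star> g) z)
    = (\<Sum>x | f x ~= 0. \<Sum>y | g y ~= 0. F (x \<otimes> y) * (f x * g y))"
proof -
  let ?A = "{x. f x ~= 0}" and ?B = "{x. g x ~= 0}" and ?C = "(%(x, y). x \<otimes> y) ` ({x. f x ~= 0} \<times> {x. g x ~= 0})"
  note fin = monoid_ring_finite[OF f] monoid_ring_finite[OF g]
  have fC: "finite ?C" by (intro finite_imageI finite_cartesian_product fin)
  have "(\<Sum>z | (f \<star> g) z ~= 0. F z * (f \<star> g) z) = (\<Sum>z\<in>?C. F z * (f \<star> g) z)"
  proof (rule sum.mono_neutral_left[OF fC])
    show "{z. (f \<star> g) z ~= 0} \<subseteq> ?C"
      by (rule monoid_ring_mult_support[OF fin(1,2)]) (rule subset_refl)+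
  qed simp
  also have "... = (\<Sum>z\<in>?C. F z * (\<Sum>x\<in>?A. \<Sum>y\<in>?B. if x \<otimes> y = z then f x * g y else 0))"
    by (intro sum.cong HOL.refl arg_cong2[where f = "(*)"] monoid_ring_mult[OF fin(1,2)] subset_refl)
  also have "... = (\<Sum>x\<in>?A. \<Sum>y\<in>?B. F (x \<otimes> y) * (f x * g y))"
    by (rule sum_sum_if[OF fC]) blast
  finally show ?thesis .
qed

lemma ZM_mult_eq:
  assumes "f \<in> carrier ZM" "g \<in> carrier ZM"
  shows "(f \<star> g) z = (\<Sum>x | f x ~= 0. \<Sum>y | g y ~= 0. if x \<otimes> y = z then f x * g y else 0)"
  by (rule monoid_ring_mult[OF monoid_ring_finite[OF assms(1)] monoid_ring_finite[OF assms(2)]])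
    (rule subset_refl)+

lemma augmentation_mult:
  assumes "f \<in> carrier ZM" "g \<in> carrier ZM"
  shows "augmentation (f \<star> g) = augmentation f * augmentation g"
proof -
  have "augmentation (f \<star> g) = (\<Sum>x | f x ~= 0. \<Sum>y | g y ~= 0. f x * g y)"
    using functional_mult[OF assms, of "%_. 1"] unfolding augmentation_def mult_1_left .
  then show ?thesis unfolding augmentation_def sum_product .
qed

lemma ZM_assoc:
  assumes f: "f \<in> carrier ZM" and g: "g \<in> carrier ZM" and k: "k \<in> carrier ZM"
  shows "(f \<star> g) \<star> k = f \<star> (g \<star> k)"
proof (rule ext)
  fix z
  let ?A = "{x. f x ~= 0}" and ?B = "{x. g x ~= 0}" and ?C = "{x. k x ~= 0}"
  define fg gk where "fg = f \<star> g" and "gk = g \<star> k"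
  have fgc: "fg \<in> carrier ZM" "gk \<in> carrier ZM" unfolding fg_def gk_def by (intro ZM_mult_closed f g k)+
  note c = monoid_ring_nonzero[OF f] monoid_ring_nonzero[OF g] monoid_ring_nonzero[OF k]
  \<comment> \<open>The coefficient at \<open>z\<close> is a functional of \<open>fg\<close>: its
    weight at \<open>u\<close> sums the coefficients of \<open>k\<close> at all \<open>w\<close>
    with \<open>u \<otimes> w = z\<close>.\<close>
  have "(fg \<star> k) z
      = (\<Sum>u | fg u ~= 0. (\<Sum>w\<in>?C. if u \<otimes> w = z then k w else 0) * fg u)"
    unfolding ZM_mult_eq[OF fgc(1) k] sum_distrib_right by (intro sum.cong HOL.refl) simp
  also have "... = (\<Sum>x\<in>?A. \<Sum>y\<in>?B. (\<Sum>w\<in>?C. if x \<otimes> y \<otimes> w = z then k w else 0) * (f x * g y))"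
    unfolding fg_def by (rule functional_mult[OF f g])
  also have "... = (\<Sum>x\<in>?A. \<Sum>y\<in>?B. \<Sum>w\<in>?C. (if x \<otimes> (y \<otimes> w) = z then f x else 0) * (g y * k w))"
    unfolding sum_distrib_right
  proof (intro sum.cong HOL.refl)
    fix x y w assume "x \<in> ?A" "y \<in> ?B" "w \<in> ?C"
    then have "x \<otimes> y \<otimes> w = x \<otimes> (y \<otimes> w)" using c by (intro m_assoc) simp_all
    then show "(if x \<otimes> y \<otimes> w = z then k w else 0) * (f x * g y)
        = (if x \<otimes> (y \<otimes> w) = z then f x else 0) * (g y * k w)" by simp
  qed
  also have "... = (\<Sum>x\<in>?A. \<Sum>v | gk v ~= 0. (if x \<otimes> v = z then f x else 0) * gk v)"
    unfolding gk_def by (intro sum.cong HOL.refl functional_mult[OF g k, symmetric])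
  also have "... = (f \<star> gk) z"
    unfolding ZM_mult_eq[OF f fgc(2)] by (intro sum.cong HOL.refl) simp
  finally show "((f \<star> g) \<star> k) z = (f \<star> (g \<star> k)) z"
    unfolding fg_def gk_def .
qed

lemma ZM_add_closed: "f \<in> carrier ZM ==> g \<in> carrier ZM ==> (%z. f z + g z) \<in> carrier ZM"
proof -
  assume "f \<in> carrier ZM" "g \<in> carrier ZM"
  moreover have "{z. f z + g z ~= 0} \<subseteq> {x. f x ~= 0} \<union> {x. g x ~= 0}" by auto
  ultimately show ?thesis by (auto intro: finite_subset)
qed

lemma ZM_ring: "ring ZM"
proof (rule ringI)
  show "abelian_group ZM"
  proof (rule abelian_groupI)
    show "\<exists>g\<in>carrier ZM. g \<oplus>\<^bsub>ZM\<^esub> f = \<zero>\<^bsub>ZM\<^esub>" if "f \<in> carrier ZM" for f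
      using that by (intro bexI[of _ "%z. - f z"]) auto
  qed (use ZM_add_closed in \<open>auto simp: add.assoc add.commute\<close>)
  show "monoid ZM"
  proof (rule monoidI)
    show "\<one>\<^bsub>ZM\<^esub> \<in> carrier ZM" by auto
    fix f assume f: "f \<in> carrier ZM"
    have o: "{x. \<one>\<^bsub>ZM\<^esub> x ~= (0 :: int)} \<subseteq> {\<one>}" by auto
    have fc: "x \<in> carrier G" if "f x ~= 0" for x using f that by auto
    have "(\<one>\<^bsub>ZM\<^esub> \<star> f) z = (\<Sum>x\<in>{\<one>}. \<Sum>y | f y ~= 0. if x \<otimes> y = z then \<one>\<^bsub>ZM\<^esub> x * f y else 0)" for z
      using f o by (intro monoid_ring_mult) auto
    also have "... z = (\<Sum>y | f y ~= 0. if y = z then f y else 0)" for z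
      using fc by (auto intro!: sum.cong)
    also have "... z = f z" for z
      using f by (simp add: sum.delta)
    finally show "\<one>\<^bsub>ZM\<^esub> \<star> f = f" by blast
    have "(f \<star> \<one>\<^bsub>ZM\<^esub>) z = (\<Sum>x | f x ~= 0. \<Sum>y\<in>{\<one>}. if x \<otimes> y = z then f x * \<one>\<^bsub>ZM\<^esub> y else 0)" for z
      using f o by (intro monoid_ring_mult) auto
    also have "... z = (\<Sum>y | f y ~= 0. if y = z then f y else 0)" for z
      using fc by (auto intro!: sum.cong)
    also have "... z = f z" for z
      using f by (simp add: sum.delta)
    finally show "f \<star> \<one>\<^bsub>ZM\<^esub> = f" by blast
  qed (use ZM_assoc ZM_mult_closed in blast)+
next
  fix f g k assume c: "f \<in> carrier ZM" "g \<in> carrier ZM" "k \<in> carrier ZM"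
  let ?S = "{x. f x ~= 0} \<union> {x. g x ~= 0}"
  have S: "finite ?S" "finite {x. k x ~= 0}" using c by auto
  show "(f \<oplus>\<^bsub>ZM\<^esub> g) \<star> k = (f \<star> k) \<oplus>\<^bsub>ZM\<^esub> (g \<star> k)"
  proof
    fix z
    have "((%z. f z + g z) \<star> k) z = (\<Sum>x\<in>?S. \<Sum>y | k y ~= 0. if x \<otimes> y = z then (f x + g x) * k y else 0)"
      using S by (intro monoid_ring_mult) auto
    also have "... = (\<Sum>x\<in>?S. \<Sum>y | k y ~= 0. if x \<otimes> y = z then f x * k y else 0)
        + (\<Sum>x\<in>?S. \<Sum>y | k y ~= 0. if x \<otimes> y = z then g x * k y else 0)"
      unfolding sum.distrib[symmetric] by (intro sum.cong) (auto simp: algebra_simps)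
    also have "... = (f \<star> k) z + (g \<star> k) z"
      using S by (subst (1 2) monoid_ring_mult[OF S]) auto
    finally show "((f \<oplus>\<^bsub>ZM\<^esub> g) \<star> k) z = ((f \<star> k) \<oplus>\<^bsub>ZM\<^esub> (g \<star> k)) z"
      by simp
  qed
  show "k \<star> (f \<oplus>\<^bsub>ZM\<^esub> g) = (k \<star> f) \<oplus>\<^bsub>ZM\<^esub> (k \<star> g)"
  proof
    fix z
    have "(k \<star> (%z. f z + g z)) z = (\<Sum>x | k x ~= 0. \<Sum>y\<in>?S. if x \<otimes> y = z then k x * (f y + g y) else 0)"
      using S by (intro monoid_ring_mult) auto
    also have "... = (\<Sum>x | k x ~= 0. \<Sum>y\<in>?S. if x \<otimes> y = z then k x * f y else 0)
        + (\<Sum>x | k x ~= 0. \<Sum>y\<in>?S. if x \<otimes> y = z then k x * g y else 0)"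
      unfolding sum.distrib[symmetric] by (intro sum.cong) (auto simp: algebra_simps)
    also have "... = (k \<star> f) z + (k \<star> g) z"
      using S by (subst (1 2) monoid_ring_mult[OF S(2,1)]) auto
    finally show "(k \<star> (f \<oplus>\<^bsub>ZM\<^esub> g)) z = ((k \<star> f) \<oplus>\<^bsub>ZM\<^esub> (k \<star> g)) z"
      by simp
  qed
qed

lemma left_module_trivial: "left_module ZM trivial_module"
proof (intro left_module.intro ZM_ring left_module_axioms.intro)
  show "abelian_group (trivial_module :: ('a => int, int) module)"
    by (rule abelian_groupI) (auto simp: trivial_module_def intro: exI[of _ "- x" for x])
  have sm: "f \<odot>\<^bsub>trivial_module\<^esub> n = augmentation f * n" for f :: "'a => int" and n
    by (simp add: trivial_module_def augmentation_def)
  have ad: "a \<oplus>\<^bsub>trivial_module :: ('a => int, int) module\<^esub> b = a + b" for a b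
    by (simp add: trivial_module_def)
  fix f g x y assume f: "f \<in> carrier ZM" and g: "g \<in> carrier ZM"
  show "(f \<oplus>\<^bsub>ZM\<^esub> g) \<odot>\<^bsub>trivial_module\<^esub> x = f \<odot>\<^bsub>trivial_module\<^esub> x \<oplus>\<^bsub>trivial_module :: ('a => int, int) module\<^esub> g \<odot>\<^bsub>trivial_module\<^esub> x"
    unfolding sm ad monoid_ring_simps augmentation_add[OF f g] by (simp add: algebra_simps)
  show "(f \<star> g) \<odot>\<^bsub>trivial_module\<^esub> x = f \<odot>\<^bsub>trivial_module\<^esub> (g \<odot>\<^bsub>trivial_module\<^esub> x)"
    unfolding sm augmentation_mult[OF f g] by simp
  show "f \<odot>\<^bsub>trivial_module\<^esub> (x \<oplus>\<^bsub>trivial_module :: ('a => int, int) module\<^esub> y)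
      = f \<odot>\<^bsub>trivial_module\<^esub> x \<oplus>\<^bsub>trivial_module :: ('a => int, int) module\<^esub> f \<odot>\<^bsub>trivial_module\<^esub> y"
    unfolding sm ad by (simp add: algebra_simps)
next
  fix x :: int
  have "augmentation (\<one>\<^bsub>ZM\<^esub>) = 1"
    using augmentation_single[of \<one> 1] by (simp add: single_def)
  then show "\<one>\<^bsub>ZM\<^esub> \<odot>\<^bsub>trivial_module\<^esub> x = x"
    by (simp add: trivial_module_def augmentation_def)
qed (simp add: trivial_module_def)

end

section \<open>Free modules and resolutions\<close>

definition basis_vector :: "('r, 's) ring_scheme => 'x => 'x => 'r" where
  "basis_vector R x = (%y. if y = x then \<one>\<^bsub>R\<^esub> else \<zero>\<^bsub>R\<^esub>)"

lemma free_module_sel: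
  "\<zero>\<^bsub>free_module R X\<^esub> = (%_. \<zero>\<^bsub>R\<^esub>)"
  "f \<oplus>\<^bsub>free_module R X\<^esub> g = (%x. f x \<oplus>\<^bsub>R\<^esub> g x)"
  "a \<odot>\<^bsub>free_module R X\<^esub> f = (%x. a \<otimes>\<^bsub>R\<^esub> f x)"
  by (simp_all add: free_module_def)

lemma free_module_carrier:
  "f \<in> carrier (free_module R X) \<longleftrightarrow>
    (\<forall>x. f x \<in> carrier R) & {x. f x ~= \<zero>\<^bsub>R\<^esub>} \<subseteq> X & finite {x. f x ~= \<zero>\<^bsub>R\<^esub>}"
  by (simp add: free_module_def)

lemma free_moduleI:
  assumes "!!x. f x \<in> carrier R" "!!x. x \<notin> A ==> f x = \<zero>\<^bsub>R\<^esub>" "finite A" "A \<subseteq> X"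
  shows "f \<in> carrier (free_module R X)"
proof -
  have "{x. f x ~= \<zero>\<^bsub>R\<^esub>} \<subseteq> A" using assms(2) by blast
  then show ?thesis
    unfolding free_module_carrier using assms(1,4) finite_subset[OF _ assms(3)] by blast
qed

lemma free_moduleD:
  assumes "f \<in> carrier (free_module R X)"
  shows "f x \<in> carrier R" "finite {x. f x ~= \<zero>\<^bsub>R\<^esub>}" "{x. f x ~= \<zero>\<^bsub>R\<^esub>} \<subseteq> X"
  using assms unfolding free_module_carrier by blast+

lemma left_module_homD:
  assumes "\<phi> \<in> left_module_hom R M N"
  shows "x \<in> carrier M ==> \<phi> x \<in> carrier N"
    and "x \<in> carrier M ==> y \<in> carrier M ==> \<phi> (x \<oplus>\<^bsub>M\<^esub> y) = \<phi> x \<oplus>\<^bsub>N\<^esub> \<phi> y"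
    and "a \<in> carrier R ==> x \<in> carrier M ==> \<phi> (a \<odot>\<^bsub>M\<^esub> x) = a \<odot>\<^bsub>N\<^esub> \<phi> x"
  using assms by (auto simp: left_module_hom_def)

context ring
begin

lemma left_module_free: "left_module R (free_module R X)"
proof (intro left_module.intro left_module_axioms.intro)
  let ?F = "free_module R X"
  show "ring R" by (rule ring_axioms)
  have add: "f \<oplus>\<^bsub>?F\<^esub> g \<in> carrier ?F" if "f \<in> carrier ?F" "g \<in> carrier ?F" for f g
    unfolding free_module_sel
    by (rule free_moduleI[of _ _ "{x. f x ~= \<zero>} \<union> {x. g x ~= \<zero>}"])
      (use free_moduleD[OF that(1)] free_moduleD[OF that(2)] in auto)
  show "abelian_group ?F"
  proof (rule abelian_groupI)
    show "\<exists>g\<in>carrier ?F. g \<oplus>\<^bsub>?F\<^esub> f = \<zero>\<^bsub>?F\<^esub>" if "f \<in> carrier ?F" for f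
    proof (rule bexI)
      show "(%x. \<ominus> f x) \<oplus>\<^bsub>?F\<^esub> f = \<zero>\<^bsub>?F\<^esub>"
        unfolding free_module_sel using free_moduleD(1)[OF that] by (simp add: l_neg)
      show "(%x. \<ominus> f x) \<in> carrier ?F"
        by (rule free_moduleI[of _ _ "{x. f x ~= \<zero>}"]) (use free_moduleD[OF that] in auto)
    qed
    show "\<zero>\<^bsub>?F\<^esub> \<in> carrier ?F" by (rule free_moduleI[of _ _ "{}"]) (auto simp: free_module_sel)
  qed (use add in \<open>auto simp: free_module_sel free_moduleD(1) a_assoc intro!: a_comm\<close>)
  show "a \<odot>\<^bsub>?F\<^esub> f \<in> carrier ?F" if "a \<in> carrier R" "f \<in> carrier ?F" for a f
    unfolding free_module_sel
    by (rule free_moduleI[of _ _ "{x. f x ~= \<zero>}"]) (use that free_moduleD[OF that(2)] in auto)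
qed (auto simp: free_module_sel free_moduleD(1) l_distr r_distr m_assoc)

lemma basis_vector_carrier: "x \<in> X ==> basis_vector R x \<in> carrier (free_module R X)"
  by (rule free_moduleI[of _ _ "{x}"]) (auto simp: basis_vector_def)

text \<open>\<open>projective_module\<close> wants a basis consisting of elements of the type of the
  module, so the free module on \<open>X\<close> is shown to be a retract of the one on its own
  basis vectors. These are distinct because \<open>\<one> ~= \<zero>\<close>.\<close>

lemma projective_free_module:
  assumes "\<one> ~= \<zero>"
  shows "projective_module R (free_module R X :: ('a, 'x => 'a) module)"
  unfolding projective_module_def
proof (intro conjI left_module_free)
  let ?b = "basis_vector R :: 'x => 'x => 'a"
  have inj: "x = y" if "?b x = ?b y" for x y
    using fun_cong[OF that, of x] assms by (auto simp: basis_vector_def split: if_splits)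
  define i where "i f y = (if y \<in> range ?b then f (inv_into UNIV ?b y) else \<zero>)" for f :: "'x => 'a" and y
  have i: "i f (?b x) = f x" for f x
    using inv_f_f[of ?b x] inj by (auto simp: i_def inj_def)
  have hom1: "i \<in> left_module_hom R (free_module R X) (free_module R (?b ` X))"
    unfolding left_module_hom_def
  proof (intro CollectI conjI Pi_I ballI)
    fix f assume f: "f \<in> carrier (free_module R X)"
    show "i f \<in> carrier (free_module R (?b ` X))"
    proof (rule free_moduleI[of _ _ "?b ` {x. f x ~= \<zero>}"])
      show "i f y = \<zero>" if "y \<notin> ?b ` {x. f x ~= \<zero>}" for y
      proof (cases "y \<in> range ?b")
        case True
        then obtain x where "y = ?b x" by blast
        then show ?thesis using that i[of f x] by auto
      qed (simp add: i_def)
    qed (use free_moduleD[OF f] in \<open>auto simp: i_def\<close>)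
  qed (auto simp: i_def free_module_sel)
  have hom2: "(%h x. h (?b x)) \<in> left_module_hom R (free_module R (?b ` X)) (free_module R X)"
    unfolding left_module_hom_def
  proof (intro CollectI conjI Pi_I ballI)
    fix h assume h: "h \<in> carrier (free_module R (?b ` X))"
    have "inj ?b" using inj by (rule injI)
    then have "finite (?b -` {y. h y ~= \<zero>})" using free_moduleD(2)[OF h] by (intro finite_vimageI)
    then show "(%x. h (?b x)) \<in> carrier (free_module R X)"
      by (rule free_moduleI[of _ _ "?b -` {y. h y ~= \<zero>}", rotated 2])
        (use free_moduleD(1,3)[OF h] inj in \<open>auto\<close>)
  qed (auto simp: free_module_sel)
  show "\<exists>Y :: ('x => 'a) set. \<exists>i\<in>left_module_hom R (free_module R X) (free_module R Y).
      \<exists>p\<in>left_module_hom R (free_module R Y) (free_module R X). \<forall>x\<in>carrier (free_module R X). p (i x) = x"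
    by (rule exI, rule bexI[OF _ hom1], rule bexI[OF _ hom2]) (simp add: i)
qed

end

text \<open>The homomorphism out of a free module with prescribed values \<open>b\<close> on the
  basis.\<close>

definition free_map :: "('r, 's) ring_scheme => ('r, 'm, 't) module_scheme => ('x => 'm) => ('x => 'r) => 'm" where
  "free_map R M b f = finsum M (%x. f x \<odot>\<^bsub>M\<^esub> b x) {x. f x ~= \<zero>\<^bsub>R\<^esub>}"

context left_module
begin

lemma smult_l_null: "x \<in> carrier M ==> \<zero>\<^bsub>R\<^esub> \<odot>\<^bsub>M\<^esub> x = \<zero>\<^bsub>M\<^esub>"
proof -
  assume x: "x \<in> carrier M"
  have "\<zero>\<^bsub>R\<^esub> \<odot>\<^bsub>M\<^esub> x \<oplus>\<^bsub>M\<^esub> \<zero>\<^bsub>R\<^esub> \<odot>\<^bsub>M\<^esub> x = \<zero>\<^bsub>R\<^esub> \<odot>\<^bsub>M\<^esub> x"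
    using smult_l_distr[of "\<zero>\<^bsub>R\<^esub>" "\<zero>\<^bsub>R\<^esub>" x] x by simp
  then show ?thesis
    using smult_closed[of "\<zero>\<^bsub>R\<^esub>" x] x by simp
qed

lemma smult_r_null: "a \<in> carrier R ==> a \<odot>\<^bsub>M\<^esub> \<zero>\<^bsub>M\<^esub> = \<zero>\<^bsub>M\<^esub>"
proof -
  assume a: "a \<in> carrier R"
  have "a \<odot>\<^bsub>M\<^esub> \<zero>\<^bsub>M\<^esub> \<oplus>\<^bsub>M\<^esub> a \<odot>\<^bsub>M\<^esub> \<zero>\<^bsub>M\<^esub> = a \<odot>\<^bsub>M\<^esub> \<zero>\<^bsub>M\<^esub>"
    using smult_r_distr[of a "\<zero>\<^bsub>M\<^esub>" "\<zero>\<^bsub>M\<^esub>"] a by simp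
  then show ?thesis
    using smult_closed[of a "\<zero>\<^bsub>M\<^esub>"] a by simp
qed

lemma free_map_eq:
  assumes f: "f \<in> carrier (free_module R X)" and b: "b \<in> X \<rightarrow> carrier M"
    and A: "finite A" "{x. f x ~= \<zero>\<^bsub>R\<^esub>} \<subseteq> A" "A \<subseteq> X"
  shows "free_map R M b f = finsum M (%x. f x \<odot>\<^bsub>M\<^esub> b x) A"
  unfolding free_map_def
  by (rule M.add.finprod_mono_neutral_cong_left)
    (use A b free_moduleD(1)[OF f] smult_l_null smult_closed in \<open>auto simp: Pi_def subset_iff\<close>)

lemma finsum_smult:
  assumes "finite A" "a \<in> carrier R" "F \<in> A \<rightarrow> carrier M"
  shows "a \<odot>\<^bsub>M\<^esub> finsum M F A = finsum M (%x. a \<odot>\<^bsub>M\<^esub> F x) A"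
  using assms(1,3)
proof (induction A rule: finite_induct)
  case empty
  then show ?case using smult_r_null[OF assms(2)] by simp
next
  case (insert x A)
  then have c: "F x \<in> carrier M" "F \<in> A \<rightarrow> carrier M" by auto
  moreover have "(%x. a \<odot>\<^bsub>M\<^esub> F x) \<in> A \<rightarrow> carrier M" "a \<odot>\<^bsub>M\<^esub> F x \<in> carrier M"
    using c smult_closed[OF assms(2)] by auto
  ultimately show ?case
    using insert smult_r_distr[OF assms(2) c(1) M.finsum_closed[OF c(2)]] by (simp add: M.finsum_insert)
qed

lemma free_map_hom:
  assumes b: "b \<in> X \<rightarrow> carrier M"
  shows "free_map R M b \<in> left_module_hom R (free_module R X) M"
  unfolding left_module_hom_def
proof (intro CollectI conjI Pi_I ballI)
  interpret F: left_module R "free_module R X" by (rule R.left_module_free)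
  have Fb: "(%x. f x \<odot>\<^bsub>M\<^esub> b x) \<in> A \<rightarrow> carrier M"
    if "f \<in> carrier (free_module R X)" "A \<subseteq> X" for f A
    using that b free_moduleD(1)[OF that(1)] smult_closed by (auto simp: Pi_def)
  fix f assume f: "f \<in> carrier (free_module R X)"
  show "free_map R M b f \<in> carrier M"
    unfolding free_map_def by (rule M.finsum_closed[OF Fb[OF f free_moduleD(3)[OF f]]])
  {
    fix a assume a: "a \<in> carrier R"
    let ?A = "{x. f x ~= \<zero>\<^bsub>R\<^esub>}"
    note A = free_moduleD(2,3)[OF f]
    have af: "a \<odot>\<^bsub>free_module R X\<^esub> f \<in> carrier (free_module R X)" by (rule F.smult_closed[OF a f])
    have "free_map R M b (a \<odot>\<^bsub>free_module R X\<^esub> f) = finsum M (%x. (a \<odot>\<^bsub>free_module R X\<^esub> f) x \<odot>\<^bsub>M\<^esub> b x) ?A"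
      by (rule free_map_eq[OF af b A(1) _ A(2)]) (use a in \<open>auto simp: free_module_sel\<close>)
    also have "... = finsum M (%x. a \<odot>\<^bsub>M\<^esub> (f x \<odot>\<^bsub>M\<^esub> b x)) ?A"
    proof (rule M.finsum_cong')
      show "(%x. a \<odot>\<^bsub>M\<^esub> (f x \<odot>\<^bsub>M\<^esub> b x)) \<in> ?A \<rightarrow> carrier M"
        using Fb[OF f A(2)] smult_closed[OF a] by (auto simp: Pi_def)
      show "(a \<odot>\<^bsub>free_module R X\<^esub> f) x \<odot>\<^bsub>M\<^esub> b x = a \<odot>\<^bsub>M\<^esub> (f x \<odot>\<^bsub>M\<^esub> b x)" if "x \<in> ?A" for x
        unfolding free_module_sel using that A b by (intro smult_assoc a free_moduleD(1)[OF f]) auto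
    qed simp
    also have "... = a \<odot>\<^bsub>M\<^esub> free_map R M b f"
      unfolding free_map_def by (rule finsum_smult[OF A(1) a Fb[OF f A(2)], symmetric])
    finally show "free_map R M b (a \<odot>\<^bsub>free_module R X\<^esub> f) = a \<odot>\<^bsub>M\<^esub> free_map R M b f" .
  }
  fix g assume g: "g \<in> carrier (free_module R X)"
  let ?A = "{x. f x ~= \<zero>\<^bsub>R\<^esub>} \<union> {x. g x ~= \<zero>\<^bsub>R\<^esub>}"
  have A: "finite ?A" "?A \<subseteq> X" using free_moduleD(2,3)[OF f] free_moduleD(2,3)[OF g] by auto
  have "free_map R M b (f \<oplus>\<^bsub>free_module R X\<^esub> g) = finsum M (%x. (f \<oplus>\<^bsub>free_module R X\<^esub> g) x \<odot>\<^bsub>M\<^esub> b x) ?A"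
    by (rule free_map_eq[OF F.M.a_closed[OF f g] b A(1) _ A(2)]) (auto simp: free_module_sel)
  also have "... = finsum M (%x. f x \<odot>\<^bsub>M\<^esub> b x \<oplus>\<^bsub>M\<^esub> g x \<odot>\<^bsub>M\<^esub> b x) ?A"
  proof (rule M.finsum_cong')
    show "(%x. f x \<odot>\<^bsub>M\<^esub> b x \<oplus>\<^bsub>M\<^esub> g x \<odot>\<^bsub>M\<^esub> b x) \<in> ?A \<rightarrow> carrier M"
      using Fb[OF f A(2)] Fb[OF g A(2)] by (auto simp: Pi_def)
    show "(f \<oplus>\<^bsub>free_module R X\<^esub> g) x \<odot>\<^bsub>M\<^esub> b x = f x \<odot>\<^bsub>M\<^esub> b x \<oplus>\<^bsub>M\<^esub> g x \<odot>\<^bsub>M\<^esub> b x" if "x \<in> ?A" for x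
      unfolding free_module_sel
      using that A b by (intro smult_l_distr free_moduleD(1)[OF f] free_moduleD(1)[OF g]) auto
  qed simp
  also have "... = finsum M (%x. f x \<odot>\<^bsub>M\<^esub> b x) ?A \<oplus>\<^bsub>M\<^esub> finsum M (%x. g x \<odot>\<^bsub>M\<^esub> b x) ?A"
    by (rule M.finsum_addf[OF Fb[OF f A(2)] Fb[OF g A(2)]])
  also have "... = free_map R M b f \<oplus>\<^bsub>M\<^esub> free_map R M b g"
    by (intro arg_cong2[where f = "(\<oplus>\<^bsub>M\<^esub>)"] free_map_eq[symmetric, OF _ b A(1) _ A(2)] f g) auto
  finally show "free_map R M b (f \<oplus>\<^bsub>free_module R X\<^esub> g) = free_map R M b f \<oplus>\<^bsub>M\<^esub> free_map R M b g" .
qed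

lemma free_map_basis_vector:
  assumes "b \<in> X \<rightarrow> carrier M" "x \<in> X"
  shows "free_map R M b (basis_vector R x) = b x"
proof -
  have c: "b x \<in> carrier M" using assms by auto
  have "free_map R M b (basis_vector R x) = finsum M (%y. basis_vector R x y \<odot>\<^bsub>M\<^esub> b y) {x}"
    by (rule free_map_eq[OF R.basis_vector_carrier[OF assms(2)] assms(1)]) (use assms(2) in \<open>auto simp: basis_vector_def\<close>)
  also have "... = b x"
    using c smult_one by (simp add: M.finsum_insert basis_vector_def)
  finally show ?thesis .
qed

end

context ring
begin

lemma countable_free_module:
  assumes "countable (carrier R)"
  shows "countable (carrier (free_module R (X :: nat set)))"
proof -
  define F where "F l i = (if i < length l then l ! i else \<zero>)" for l :: "'a list" and i
  have "f \<in> F ` lists (carrier R)" if f: "f \<in> carrier (free_module R X)" for f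
  proof -
    obtain n where n: "{x. f x ~= \<zero>} \<subseteq> {..<n}"
      using free_moduleD(2)[OF f] finite_nat_iff_bounded by blast
    have "f = F (map f [0..<n])"
    proof
      fix i show "f i = F (map f [0..<n]) i"
        using n by (cases "i < n") (auto simp: F_def)
    qed
    moreover have "map f [0..<n] \<in> lists (carrier R)"
      using free_moduleD(1)[OF f] by auto
    ultimately show ?thesis by blast
  qed
  then have "carrier (free_module R X) \<subseteq> F ` lists (carrier R)" by blast
  then show ?thesis
    using assms by (auto intro: countable_subset)
qed

lemma fg_free_module:
  assumes "\<one> ~= \<zero>" "finite X"
  shows "fg_module R (free_module R X)"
  unfolding fg_module_def
proof (intro exI conjI ballI)
  let ?b = "basis_vector R" and ?F = "free_module R X"
  interpret F: left_module R ?F by (rule left_module_free)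
  have inj: "x = y" if "?b x = ?b y" for x y
    using fun_cong[OF that, of x] assms(1) by (auto simp: basis_vector_def split: if_splits)
  show "finite (?b ` X)" "?b ` X \<subseteq> carrier ?F"
    using assms(2) basis_vector_carrier by auto
  fix f assume f: "f \<in> carrier ?F"
  define a where "a s = f (inv_into X ?b s)" for s
  have a: "a (?b x) = f x" if "x \<in> X" for x
  proof -
    have "inj_on ?b X" using inj by (auto simp: inj_on_def)
    then show ?thesis using inv_into_f_f[of ?b X x] that by (simp add: a_def)
  qed
  have c: "(%x. f x \<odot>\<^bsub>?F\<^esub> ?b x) \<in> X \<rightarrow> carrier ?F"
    by (intro Pi_I F.smult_closed free_moduleD(1)[OF f] basis_vector_carrier)
  have "finsum ?F (%s. a s \<odot>\<^bsub>?F\<^esub> s) (?b ` X) = finsum ?F (%x. f x \<odot>\<^bsub>?F\<^esub> ?b x) X"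
  proof (subst F.M.finsum_reindex)
    show "(%s. a s \<odot>\<^bsub>?F\<^esub> s) \<in> ?b ` X \<rightarrow> carrier ?F" using c a by auto
    show "inj_on ?b X" using inj by (auto simp: inj_on_def)
    show "finsum ?F (%x. a (?b x) \<odot>\<^bsub>?F\<^esub> ?b x) X = finsum ?F (%x. f x \<odot>\<^bsub>?F\<^esub> ?b x) X"
      by (rule F.M.finsum_cong'[OF HOL.refl c]) (simp add: a)
  qed
  also have "... = f"
  proof (rule ext)
    fix y
    have "finsum ?F (%x. f x \<odot>\<^bsub>?F\<^esub> ?b x) A y = (if y \<in> A then f y else \<zero>)" if "A \<subseteq> X" for A
      using finite_subset[OF that assms(2)] that
    proof (induction A rule: finite_induct)
      case (insert x A)
      have "(%x. f x \<odot>\<^bsub>?F\<^esub> ?b x) \<in> A \<rightarrow> carrier ?F" "f x \<odot>\<^bsub>?F\<^esub> ?b x \<in> carrier ?F"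
        using insert.prems c by auto
      then have "finsum ?F (%x. f x \<odot>\<^bsub>?F\<^esub> ?b x) (insert x A) y
          = f x \<otimes> ?b x y \<oplus> finsum ?F (%x. f x \<odot>\<^bsub>?F\<^esub> ?b x) A y"
        using insert.hyps by (simp add: F.M.finsum_insert free_module_sel)
      then show ?case
        using insert free_moduleD(1)[OF f] by (auto simp: basis_vector_def)
    qed (simp add: free_module_sel)
    from this[of X] show "finsum ?F (%x. f x \<odot>\<^bsub>?F\<^esub> ?b x) X y = f y"
      using free_moduleD(3)[OF f] by (cases "f y = \<zero>") auto
  qed
  finally have "f = finsum ?F (%s. a s \<odot>\<^bsub>?F\<^esub> s) (?b ` X)" ..
  moreover have "a \<in> ?b ` X \<rightarrow> carrier R"
    using free_moduleD(1)[OF f] by (auto simp: a_def)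
  ultimately show "\<exists>a\<in>?b ` X \<rightarrow> carrier R. f = finsum ?F (%s. a s \<odot>\<^bsub>?F\<^esub> s) (?b ` X)" by (rule bexI)
qed

end

lemma left_module_hom_zero:
  assumes "left_module R M" "left_module R N" "\<phi> \<in> left_module_hom R M N"
  shows "\<phi> \<zero>\<^bsub>M\<^esub> = \<zero>\<^bsub>N\<^esub>"
proof -
  interpret M: left_module R M by fact
  interpret N: left_module R N by fact
  show ?thesis
    using left_module_homD(3)[OF assms(3), of "\<zero>\<^bsub>R\<^esub>" "\<zero>\<^bsub>M\<^esub>"] left_module_homD(1)[OF assms(3), of "\<zero>\<^bsub>M\<^esub>"]
      M.smult_l_null N.smult_l_null by simp
qed

lemma left_module_hom_finsum:
  assumes "left_module R M" "left_module R N" "\<phi> \<in> left_module_hom R M N"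
    and "finite A" "F \<in> A \<rightarrow> carrier M"
  shows "\<phi> (finsum M F A) = finsum N (%x. \<phi> (F x)) A"
proof -
  interpret M: left_module R M by fact
  interpret N: left_module R N by fact
  note hom = left_module_homD[OF assms(3)]
  show ?thesis
    using assms(4,5)
  proof (induction A rule: finite_induct)
    case empty
    then show ?case using left_module_hom_zero[OF assms(1-3)] by simp
  next
    case (insert x A)
    then have F: "F \<in> A \<rightarrow> carrier M" "F x \<in> carrier M" by auto
    then have "(%x. \<phi> (F x)) \<in> A \<rightarrow> carrier N" "\<phi> (F x) \<in> carrier N" using hom(1) by auto
    then show ?case
      using insert F hom(2)[OF F(2) M.M.finsum_closed[OF F(1)]]
      by (simp add: M.M.finsum_insert N.M.finsum_insert)
  qed
qed

lemma free_map_kernel: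
  assumes "left_module R M" "left_module R N" "\<phi> \<in> left_module_hom R M N"
    and b: "!!x. x \<in> X ==> b x \<in> carrier M & \<phi> (b x) = \<zero>\<^bsub>N\<^esub>"
    and f: "f \<in> carrier (free_module R X)"
  shows "\<phi> (free_map R M b f) = \<zero>\<^bsub>N\<^esub>"
proof -
  interpret M: left_module R M by fact
  interpret N: left_module R N by fact
  note hom = left_module_homD[OF assms(3)]
  let ?A = "{x. f x ~= \<zero>\<^bsub>R\<^esub>}"
  note A = free_moduleD[OF f]
  have "(%x. f x \<odot>\<^bsub>M\<^esub> b x) \<in> ?A \<rightarrow> carrier M" using A b M.smult_closed by auto
  then have "\<phi> (free_map R M b f) = finsum N (%x. \<phi> (f x \<odot>\<^bsub>M\<^esub> b x)) ?A"
    unfolding free_map_def by (rule left_module_hom_finsum[OF assms(1-3) A(2)])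
  also have "... = finsum N (%x. \<zero>\<^bsub>N\<^esub>) ?A"
  proof (rule N.M.finsum_cong')
    show "\<phi> (f x \<odot>\<^bsub>M\<^esub> b x) = \<zero>\<^bsub>N\<^esub>" if "x \<in> ?A" for x
      using that hom(3)[OF A(1), of "b x"] b[of x] A(3) N.smult_r_null[OF A(1)] by auto
  qed auto
  also have "... = \<zero>\<^bsub>N\<^esub>" by (rule N.M.finsum_zero)
  finally show ?thesis .
qed

text \<open>Only two terms have to be finitely generated. Every later kernel is countable, because
  the ring is, and is covered by the free module on all of \<open>nat\<close> whose basis enumerates
  the kernel.\<close>

theorem type_FP1I:
  fixes R (structure)
  assumes M: "left_module R M" and R: "countable (carrier R)" "\<one> ~= \<zero>"
    and X: "finite (X :: nat set)" "e \<in> left_module_hom R (free_module R X) M"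
      "e ` carrier (free_module R X) = carrier M"
    and Y: "finite (Y :: nat set)" "d\<^sub>0 \<in> left_module_hom R (free_module R Y) (free_module R X)"
      "d\<^sub>0 ` carrier (free_module R Y) = {f \<in> carrier (free_module R X). e f = \<zero>\<^bsub>M\<^esub>}"
  shows "type_FP 1 R M"
proof -
  interpret M: left_module R M by fact
  let ?F = "%Z :: nat set. free_module R Z"
  define P where "P n = ?F (if n = 0 then X else if n = 1 then Y else UNIV)" for n :: nat
  define step where "step n d = free_map R (P (Suc n))
      (from_nat_into {f \<in> carrier (P (Suc n)). d f = \<zero>\<^bsub>P n\<^esub>})" for n d
  define d where "d = rec_nat d\<^sub>0 step"
  have P: "P 0 = ?F X" "P (Suc 0) = ?F Y" "P (Suc (Suc n)) = ?F UNIV" for n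
    by (simp_all add: P_def)
  have Pm: "left_module R (P n)" for n unfolding P_def by (rule M.R.left_module_free)
  have d: "d 0 = d\<^sub>0" "d (Suc n) = step n (d n)" for n by (simp_all add: d_def)
  have exact: "d (Suc n) \<in> left_module_hom R (P (Suc (Suc n))) (P (Suc n)) &
      d (Suc n) ` carrier (P (Suc (Suc n))) = {f \<in> carrier (P (Suc n)). d n f = \<zero>\<^bsub>P n\<^esub>}"
    if hom: "d n \<in> left_module_hom R (P (Suc n)) (P n)" for n
  proof -
    let ?K = "{f \<in> carrier (P (Suc n)). d n f = \<zero>\<^bsub>P n\<^esub>}"
    interpret S: left_module R "P (Suc n)" by (rule Pm)
    have "\<zero>\<^bsub>P (Suc n)\<^esub> \<in> ?K"
      using left_module_hom_zero[OF Pm Pm hom] by simp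
    then have K0: "?K ~= {}" by blast
    have "countable (carrier (P (Suc n)))"
      unfolding P_def by (rule M.R.countable_free_module[OF R(1)])
    then have Kc: "countable ?K" by (rule countable_subset[rotated]) blast
    let ?b = "from_nat_into ?K"
    have b: "?b i \<in> ?K" for i by (rule from_nat_into[OF K0])
    have bc: "?b \<in> UNIV \<rightarrow> carrier (P (Suc n))" using b by blast
    have dS: "d (Suc n) = free_map R (P (Suc n)) ?b" by (simp add: d step_def)
    have h: "free_map R (P (Suc n)) ?b \<in> left_module_hom R (?F UNIV) (P (Suc n))"
      by (rule S.free_map_hom[OF bc])
    have "free_map R (P (Suc n)) ?b ` carrier (?F UNIV) = ?K"
    proof (intro equalityI subsetI)
      fix g assume "g \<in> free_map R (P (Suc n)) ?b ` carrier (?F UNIV)"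
      then obtain f where f: "f \<in> carrier (?F UNIV)" "g = free_map R (P (Suc n)) ?b f" by blast
      have "d n g = \<zero>\<^bsub>P n\<^esub>"
        unfolding f(2) by (rule free_map_kernel[OF Pm Pm hom _ f(1)]) (use b in blast)
      then show "g \<in> ?K" using left_module_homD(1)[OF h f(1)] f(2) by simp
    next
      fix g assume "g \<in> ?K"
      then obtain i where "g = ?b i"
        using from_nat_into_surj[OF Kc, of g] by metis
      then have "g = free_map R (P (Suc n)) ?b (basis_vector R i)"
        using S.free_map_basis_vector[OF bc, of i] by simp
      then show "g \<in> free_map R (P (Suc n)) ?b ` carrier (?F UNIV)"
        using M.R.basis_vector_carrier[of i UNIV] by blast
    qed
    then show ?thesis unfolding dS P(3) using h by (rule conjI[rotated])
  qed
  have hom: "d n \<in> left_module_hom R (P (Suc n)) (P n)" for n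
  proof (induction n)
    case 0
    show ?case unfolding P d by (rule Y(2))
  next
    case (Suc n)
    then show ?case using exact by blast
  qed
  have "projective_resolution R M P d e"
    unfolding projective_resolution_def
  proof (intro conjI allI M)
    show "projective_module R (P n)" for n
      unfolding P_def by (rule M.R.projective_free_module[OF R(2)])
    show "e \<in> left_module_hom R (P 0) M" "e ` carrier (P 0) = carrier M"
      unfolding P using X by blast+
    show "d n \<in> left_module_hom R (P (Suc n)) (P n)" for n by (rule hom)
    show "d 0 ` carrier (P 1) = {x \<in> carrier (P 0). e x = \<zero>\<^bsub>M\<^esub>}"
      unfolding d One_nat_def P by (rule Y(3))
    show "d (Suc n) ` carrier (P (Suc (Suc n))) = {x \<in> carrier (P (Suc n)). d n x = \<zero>\<^bsub>P n\<^esub>}" for n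
      using exact[OF hom] by blast
  qed
  moreover have "fg_module R (P n)" if "n \<le> 1" for n
    unfolding P_def using that X(1) Y(1) by (intro M.R.fg_free_module[OF R(2)]) auto
  ultimately show ?thesis
    unfolding type_FP_def by blast
qed

section \<open>Characters whose monoid is of type FP1\<close>

definition weighted_sum :: "('a => int) => ('a => int) => int" where
  "weighted_sum F r = (\<Sum>z | r z ~= 0. F z * r z)"

lemma weighted_sum_eq:
  "finite A ==> {x. r x ~= 0} \<subseteq> A ==> weighted_sum F r = (\<Sum>z\<in>A. F z * r z)"
  unfolding weighted_sum_def by (intro sum.mono_neutral_left) auto

lemma weighted_sum_add:
  assumes "r \<in> carrier (monoid_ring M)" "s \<in> carrier (monoid_ring M)"
  shows "weighted_sum F (%z. r z + s z) = weighted_sum F r + weighted_sum F s"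
proof -
  let ?A = "{x. r x ~= 0} \<union> {x. s x ~= 0}"
  have A: "finite ?A" using assms[THEN monoid_ring_finite] by simp
  have "weighted_sum F (%z. r z + s z) = (\<Sum>x\<in>?A. F x * (r x + s x))"
    by (rule weighted_sum_eq[OF A]) auto
  also have "... = weighted_sum F r + weighted_sum F s"
    unfolding distrib_left sum.distrib
    using weighted_sum_eq[OF A, of r F] weighted_sum_eq[OF A, of s F] by auto
  finally show ?thesis .
qed

text \<open>The ring element \<open>n g - n h\<close>. Carrying \<open>n\<close> along makes these
  elements stable under left multiplication by \<open>single g k\<close>.\<close>

definition shift :: "'a => 'a => int => 'a => int" where
  "shift g h n = (%z. single g n z + single h (- n) z)"

lemma countable_monoid_ring:
  assumes "countable (carrier M)"
  shows "countable (carrier (monoid_ring M))"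
proof -
  define F where "F l z = (case map_of l z of None => 0 | Some n => n)" for l :: "('a \<times> int) list" and z
  have "r \<in> F ` lists (carrier M \<times> UNIV)" if r: "r \<in> carrier (monoid_ring M)" for r
  proof -
    obtain xs where xs: "set xs = {z. r z ~= 0}"
      using finite_list[OF monoid_ring_finite[OF r]] by blast
    have "F (map (%x. (x, r x)) xs) z = r z" for z
      using xs by (auto simp: F_def map_of_map_restrict restrict_map_def)
    then have "r = F (map (%x. (x, r x)) xs)" by (intro ext) simp
    moreover have "map (%x. (x, r x)) xs \<in> lists (carrier M \<times> UNIV)"
      using xs monoid_ring_nonzero[OF r] by auto
    ultimately show ?thesis by blast
  qed
  then have "carrier (monoid_ring M) \<subseteq> F ` lists (carrier M \<times> UNIV)" by blast
  then show ?thesis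
    using assms by (auto intro: countable_subset)
qed

lemma trivial_module_sel:
  "carrier (trivial_module :: ('a => int, int) module) = UNIV"
  "\<zero>\<^bsub>trivial_module :: ('a => int, int) module\<^esub> = 0"
  "m \<oplus>\<^bsub>trivial_module :: ('a => int, int) module\<^esub> n = m + n"
  "r \<odot>\<^bsub>trivial_module\<^esub> n = augmentation r * n"
  by (simp_all add: trivial_module_def augmentation_def)

context monoid
begin

text \<open>A weight that is invariant under right translation by the support of \<open>a\<close>
  cannot tell \<open>a\<close> from its augmentation.\<close>

lemma weighted_sum_mult:
  assumes r: "r \<in> carrier ZM" and a: "a \<in> carrier ZM"
    and F: "!!x y. x \<in> carrier G ==> a y ~= 0 ==> F (x \<otimes> y) = F x"
  shows "weighted_sum F (r \<star> a) = weighted_sum F r * augmentation a"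
proof -
  have "weighted_sum F (r \<star> a) = (\<Sum>x | r x ~= 0. \<Sum>y | a y ~= 0. F (x \<otimes> y) * (r x * a y))"
    unfolding weighted_sum_def by (rule functional_mult[OF r a])
  also have "... = (\<Sum>x | r x ~= 0. \<Sum>y | a y ~= 0. F x * r x * a y)"
    using F monoid_ring_nonzero[OF r] by (intro sum.cong HOL.refl) (simp add: mult.assoc)
  also have "... = weighted_sum F r * augmentation a"
    unfolding weighted_sum_def augmentation_def sum_product ..
  finally show ?thesis .
qed

lemma single_mult_single:
  assumes "g \<in> carrier G" "h \<in> carrier G"
  shows "single g n \<star> single h k = single (g \<otimes> h) (n * k)"
proof (rule ext)
  fix z
  have "(single g n \<star> single h k) z = (\<Sum>x\<in>{g}. \<Sum>y\<in>{h}. if x \<otimes> y = z then single g n x * single h k y else 0)"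
    by (rule monoid_ring_mult) (auto simp: single_def)
  then show "(single g n \<star> single h k) z = single (g \<otimes> h) (n * k) z"
    by (auto simp: single_def)
qed

lemma single_add_closed: "g \<in> carrier G ==> h \<in> carrier G ==> (%z. single g n z + single h k z) \<in> carrier ZM"
  by (intro ZM_add_closed single_carrier)

lemma shift_carrier: "g \<in> carrier G ==> h \<in> carrier G ==> shift g h n \<in> carrier ZM"
  unfolding shift_def by (rule single_add_closed)

lemma augmentation_shift: "g \<in> carrier G ==> h \<in> carrier G ==> augmentation (shift g h n) = 0"
  unfolding shift_def using augmentation_add[OF single_carrier single_carrier, of g G h n "- n"] by simp

lemma single_mult_shift:
  assumes "g \<in> carrier G" "a \<in> carrier G" "b \<in> carrier G"
  shows "single g n \<star> shift a b k = shift (g \<otimes> a) (g \<otimes> b) (n * k)"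
proof -
  interpret Z: ring ZM by (rule ZM_ring)
  have "single g n \<star> (single a k \<oplus>\<^bsub>ZM\<^esub> single b (- k))
      = single g n \<star> single a k \<oplus>\<^bsub>ZM\<^esub> single g n \<star> single b (- k)"
    by (rule Z.r_distr) (rule single_carrier assms)+
  then show ?thesis
    using assms by (simp add: single_mult_single shift_def del: monoid_ring_simps(1))
qed

text \<open>An element of augmentation zero is the sum of the terms \<open>r z (z - 1)\<close>. The
  induction carries partial sums corrected at \<open>\<one>\<close>, so that each of them has
  augmentation zero.\<close>

lemma augmentation_ideal_generated:
  assumes mult: "!!a r. a \<in> carrier ZM ==> r \<in> J ==> a \<star> r \<in> J"
    and add: "!!r s. r \<in> J ==> s \<in> J ==> (%z. r z + s z) \<in> J"
    and shift: "!!g. g \<in> carrier G ==> shift g \<one> 1 \<in> J"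
    and r: "r \<in> carrier ZM" "augmentation r = 0"
  shows "r \<in> J"
proof -
  have sh: "shift g \<one> n \<in> J" if "g \<in> carrier G" for g n
    using mult[OF single_carrier[OF one_closed, of n] shift[OF that]] that
    by (simp add: single_mult_shift)
  have "(%z. (if z \<in> A then r z else 0) + single \<one> (- sum r A) z) \<in> J"
    if "finite A" "A \<subseteq> carrier G" for A
    using that
  proof (induction A rule: finite_induct)
    case empty
    have "shift \<one> \<one> 0 \<in> J" by (rule sh) simp
    then show ?case by (simp add: shift_def single_def)
  next
    case (insert x A)
    have "(%z. ((if z \<in> A then r z else 0) + single \<one> (- sum r A) z) + shift x \<one> (r x) z) \<in> J"
      using insert by (intro add sh insert.IH) auto
    also have "(%z. ((if z \<in> A then r z else 0) + single \<one> (- sum r A) z) + shift x \<one> (r x) z)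
        = (%z. (if z \<in> insert x A then r z else 0) + single \<one> (- sum r (insert x A)) z)"
      using insert.hyps by (auto simp: shift_def single_def fun_eq_iff)
    finally show ?case .
  qed
  from this[of "{z. r z ~= 0}"]
  have "(%z. (if r z ~= 0 then r z else 0) + single \<one> (- augmentation r) z) \<in> J"
    using monoid_ring_finite[OF r(1)] monoid_ring_support[OF r(1)] by (simp add: augmentation_def)
  also have "(%z. (if r z ~= 0 then r z else 0) + single \<one> (- augmentation r) z) = r"
    using r(2) by (auto simp: single_def)
  finally show ?thesis .
qed

text \<open>\<open>gen\<close> is generation of the augmentation ideal by the elements
  \<open>s - 1\<close>, stated as an induction principle over \<open>J\<close>. It gives the
  beginning of a resolution: the ring, embedded by \<open>emb\<close> as the free module on one
  point, and the free module on the finitely many generators.\<close>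

lemma monoid_type_FP1I:
  assumes C: "countable (carrier G)" and S: "finite S" "S \<subseteq> carrier G"
    and gen: "!!J r. (!!a r. a \<in> carrier ZM ==> r \<in> J ==> a \<star> r \<in> J) ==>
      (!!r s. r \<in> J ==> s \<in> J ==> (%z. r z + s z) \<in> J) ==>
      (!!s. s \<in> S ==> shift s \<one> 1 \<in> J) ==> r \<in> carrier ZM ==> augmentation r = 0 ==> r \<in> J"
  shows "monoid_type_FP 1 G"
proof -
  let ?Z = "trivial_module :: ('a => int, int) module"
  let ?P = "free_module ZM {0 :: nat}"
  interpret Z: left_module ZM ?Z by (rule left_module_trivial)
  interpret P: left_module ZM ?P by (rule Z.R.left_module_free)
  obtain h where h: "bij_betw h {0..<card S} S"
    using ex_bij_betw_nat_finite[OF S(1)] by blast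
  have hS: "h i \<in> carrier G" if "i < card S" for i
    using h that S(2) by (auto simp: bij_betw_def)
  define emb :: "('a => int) => nat => 'a => int" where "emb r i = (if i = 0 then r else \<zero>\<^bsub>ZM\<^esub>)" for r i
  define e where "e = free_map ZM ?Z (%_ :: nat. 1)"
  define b where "b i = emb (shift (h i) \<one> 1)" for i :: nat
  define d where "d = free_map ZM ?P b"
  let ?Q = "free_module ZM {..<card S}"
  have emb: "emb r \<in> carrier ?P" if "r \<in> carrier ZM" for r
    by (rule free_moduleI[of _ _ "{0}"])
      (use that Z.R.zero_closed in \<open>auto simp: emb_def simp del: monoid_ring_simps\<close>)
  have emb_surj: "emb (y 0) = y" if "y \<in> carrier ?P" for y
  proof (rule ext)
    fix i
    have "y i = \<zero>\<^bsub>ZM\<^esub>" if "i ~= 0" using free_moduleD(3)[OF \<open>y \<in> carrier ?P\<close>] that by blast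
    then show "emb (y 0) i = y i" unfolding emb_def by (cases "i = 0") (simp_all only: if_True if_False simp_thms)
  qed
  have ehom: "e \<in> left_module_hom ZM ?P ?Z"
    unfolding e_def by (rule Z.free_map_hom) (simp add: trivial_module_def)
  have e: "e y = augmentation (y 0)" if "y \<in> carrier ?P" for y
  proof -
    have "e y = finsum ?Z (%i. y i \<odot>\<^bsub>?Z\<^esub> 1) {0}"
      unfolding e_def using free_moduleD(3)[OF that]
      by (intro Z.free_map_eq[OF that]) (auto simp: trivial_module_def)
    also have "... = (y 0 \<odot>\<^bsub>?Z\<^esub> 1) \<oplus>\<^bsub>?Z\<^esub> finsum ?Z (%i. y i \<odot>\<^bsub>?Z\<^esub> 1) {}"
      by (rule Z.M.finsum_insert) (simp_all add: trivial_module_sel)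
    also have "... = augmentation (y 0)"
      unfolding Z.M.finsum_empty trivial_module_sel by simp
    finally show ?thesis .
  qed
  have bP: "b i \<in> carrier ?P & e (b i) = \<zero>\<^bsub>?Z\<^esub>" if "i \<in> {..<card S}" for i
  proof -
    have "shift (h i) \<one> 1 \<in> carrier ZM" "augmentation (shift (h i) \<one> 1) = 0"
      using hS[of i] that by (simp_all only: shift_carrier augmentation_shift one_closed lessThan_iff)
    then show ?thesis
      using emb[of "shift (h i) \<one> 1"] e[of "b i"] by (simp add: b_def emb_def trivial_module_def del: monoid_ring_simps)
  qed
  have bc: "b \<in> {..<card S} \<rightarrow> carrier ?P" using bP by blast
  have dhom: "d \<in> left_module_hom ZM ?Q ?P"
    unfolding d_def by (rule P.free_map_hom[OF bc])
  interpret Q: left_module ZM ?Q by (rule Z.R.left_module_free)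
  have ker: "d ` carrier ?Q = {y \<in> carrier ?P. e y = \<zero>\<^bsub>?Z\<^esub>}"
  proof (intro equalityI subsetI)
    fix y assume "y \<in> d ` carrier ?Q"
    then obtain q where q: "q \<in> carrier ?Q" "y = d q" by blast
    have "e y = \<zero>\<^bsub>?Z\<^esub>"
      unfolding q(2) d_def using bP
      by (rule free_map_kernel[OF P.left_module_axioms Z.left_module_axioms ehom _ q(1)])
    then show "y \<in> {y \<in> carrier ?P. e y = \<zero>\<^bsub>?Z\<^esub>}"
      using left_module_homD(1)[OF dhom q(1)] q(2) by blast
  next
    fix y assume "y \<in> {y \<in> carrier ?P. e y = \<zero>\<^bsub>?Z\<^esub>}"
    then have y: "y \<in> carrier ?P" "e y = \<zero>\<^bsub>?Z\<^esub>" by blast+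
    let ?J = "{r. emb r \<in> d ` carrier ?Q}"
    have "y 0 \<in> ?J"
    proof (rule gen)
      fix a r assume a: "a \<in> carrier ZM" and "r \<in> ?J"
      then obtain q where q: "q \<in> carrier ?Q" "emb r = d q" by blast
      have "emb (a \<star> r) = a \<odot>\<^bsub>?P\<^esub> emb r"
        using Z.R.r_null[OF a] by (auto simp: emb_def free_module_sel fun_eq_iff simp del: monoid_ring_simps)
      also have "... = d (a \<odot>\<^bsub>?Q\<^esub> q)"
        unfolding q(2) by (rule left_module_homD(3)[OF dhom a q(1), symmetric])
      finally show "a \<star> r \<in> ?J" using Q.smult_closed[OF a q(1)] by blast
    next
      fix r s assume "r \<in> ?J" "s \<in> ?J"
      then obtain q q' where q: "q \<in> carrier ?Q" "emb r = d q" "q' \<in> carrier ?Q" "emb s = d q'" by blast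
      have "emb (%z. r z + s z) = emb r \<oplus>\<^bsub>?P\<^esub> emb s"
        by (auto simp: emb_def free_module_sel)
      also have "... = d (q \<oplus>\<^bsub>?Q\<^esub> q')"
        unfolding q(2,4) by (rule left_module_homD(2)[OF dhom q(1,3), symmetric])
      finally show "(%z. r z + s z) \<in> ?J" using Q.M.a_closed[OF q(1,3)] by blast
    next
      fix s assume "s \<in> S"
      then have "s \<in> h ` {..<card S}" using h by (simp add: bij_betw_def atLeast0LessThan)
      then obtain i where i: "i \<in> {..<card S}" "s = h i" by blast
      have "d (basis_vector ZM i) = b i"
        unfolding d_def by (rule P.free_map_basis_vector[OF bc i(1)])
      then show "shift s \<one> 1 \<in> ?J"
        using Z.R.basis_vector_carrier[OF i(1)] i(2) unfolding b_def mem_Collect_eq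
        by (intro image_eqI[of _ d "basis_vector ZM i"]) simp_all
    next
      show "y 0 \<in> carrier ZM" by (rule free_moduleD(1)[OF y(1)])
      show "augmentation (y 0) = 0" using e[OF y(1)] y(2) by (simp add: trivial_module_def)
    qed
    then show "y \<in> d ` carrier ?Q" using emb_surj[OF y(1)] by simp
  qed
  have surj: "e ` carrier ?P = carrier ?Z"
  proof -
    have "n \<in> e ` carrier ?P" for n
      using e[OF emb[OF single_carrier[OF one_closed, of n]]] emb[OF single_carrier[OF one_closed, of n]]
      by (intro image_eqI[of _ _ "emb (single \<one> n)"]) (simp_all add: emb_def del: monoid_ring_simps)
    then show ?thesis by (auto simp: trivial_module_def)
  qed
  have "\<one>\<^bsub>ZM\<^esub> ~= \<zero>\<^bsub>ZM\<^esub>" by (auto dest: fun_cong[of _ _ \<one>])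
  then show ?thesis
    unfolding monoid_type_FP_def
    by (intro type_FP1I[OF left_module_trivial countable_monoid_ring[OF C] _ _ ehom surj _ dhom ker]) auto
qed

text \<open>A projective cover of \<open>\<int>\<close> sits in a free module. Weighting coordinates by the indicator of a set
  that is closed under right translation by all supports involved turns the action of the ring into
  multiplication by the weight times the augmentation, so it annihilates all relations.\<close>

lemma monoid_type_FP1D:
  assumes "monoid_type_FP 1 G"
  obtains T where "finite T" "T \<subseteq> carrier G"
    "!!C. (!!g t. g \<in> carrier G ==> t \<in> T ==> g \<otimes> t \<in> C \<longleftrightarrow> g \<in> C) ==> \<one> \<in> C ==> carrier G \<subseteq> C"
proof -
  let ?Z = "trivial_module :: ('a => int, int) module"
  obtain P :: "nat => ('a => int, nat => 'a => int) module" and d e where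
    res: "projective_resolution ZM ?Z P d e" and fg: "!!n. n \<le> 1 ==> fg_module ZM (P n)"
    using assms unfolding monoid_type_FP_def type_FP_def by blast
  note res = res[unfolded projective_resolution_def]
  have e: "e \<in> left_module_hom ZM (P 0) ?Z" "e ` carrier (P 0) = carrier ?Z"
    and dn: "\<forall>n. d n \<in> left_module_hom ZM (P (Suc n)) (P n)"
    and dker: "d 0 ` carrier (P 1) = {x \<in> carrier (P 0). e x = \<zero>\<^bsub>?Z\<^esub>}"
    and projn: "\<forall>n. projective_module ZM (P n)"
    using res by - ((elim conjE, assumption)+)
  note d = dn[rule_format, of 0, folded One_nat_def] dker
  note proj = projn[rule_format]
  have Pm: "left_module ZM (P n)" for n
    using proj[of n] unfolding projective_module_def by blast
  obtain X :: "(nat => 'a => int) set" and i p where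
    i: "i \<in> left_module_hom ZM (P 0) (free_module ZM X)"
    and p: "p \<in> left_module_hom ZM (free_module ZM X) (P 0)"
    and pi: "!!x. x \<in> carrier (P 0) ==> p (i x) = x"
    using proj[of 0] unfolding projective_module_def by blast
  let ?F = "free_module ZM X"
  interpret Z: left_module ZM ?Z by (rule left_module_trivial)
  interpret P0: left_module ZM "P 0" by (rule Pm)
  interpret P1: left_module ZM "P 1" by (rule Pm)
  interpret F: left_module ZM ?F by (rule Z.R.left_module_free)
  \<comment> \<open>The augmentation transported to the ambient free module; it is determined by its
    values \<open>n x\<close> on the basis.\<close>
  define E where "E h = e (p h)" for h
  define n where "n x = E (basis_vector ZM x)" for x
  have E_add: "E (h \<oplus>\<^bsub>?F\<^esub> k) = E h + E k" if "h \<in> carrier ?F" "k \<in> carrier ?F" for h k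
    unfolding E_def left_module_homD(2)[OF p that]
      left_module_homD(2)[OF e(1) left_module_homD(1)[OF p that(1)] left_module_homD(1)[OF p that(2)]] trivial_module_sel ..
  have E_smult: "E (r \<odot>\<^bsub>?F\<^esub> h) = augmentation r * E h" if "r \<in> carrier ZM" "h \<in> carrier ?F" for h r
    unfolding E_def left_module_homD(3)[OF p that]
      left_module_homD(3)[OF e(1) that(1) left_module_homD(1)[OF p that(2)]] trivial_module_sel ..
  have E_zero: "E \<zero>\<^bsub>?F\<^esub> = 0"
    using E_add[OF F.M.zero_closed F.M.zero_closed] by simp
  have E_sum: "E h = (\<Sum>x | h x ~= \<zero>\<^bsub>ZM\<^esub>. augmentation (h x) * n x)" if h: "h \<in> carrier ?F" for h
  proof -
    note hD = free_moduleD[OF h]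
    have "k \<in> carrier ?F & E k = (\<Sum>x\<in>A. augmentation (h x) * n x)"
      if "finite A" "A \<subseteq> {x. h x ~= \<zero>\<^bsub>ZM\<^esub>}" "k = (%x. if x \<in> A then h x else \<zero>\<^bsub>ZM\<^esub>)" for A k
      using that
    proof (induction A arbitrary: k rule: finite_induct)
      case empty
      then have "k = \<zero>\<^bsub>?F\<^esub>" by (simp add: free_module_sel)
      then show ?case using F.M.zero_closed E_zero by simp
    next
      case (insert x A)
      define l where "l = (%x. if x \<in> A then h x else \<zero>\<^bsub>ZM\<^esub>)"
      have l: "l \<in> carrier ?F" "E l = (\<Sum>x\<in>A. augmentation (h x) * n x)"
        using insert.IH[of l] insert.prems(1) by (auto simp: l_def)
      let ?y = "h x \<odot>\<^bsub>?F\<^esub> basis_vector ZM x"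
      have bv: "basis_vector ZM x \<in> carrier ?F"
        using insert.prems(1) hD(3) by (intro Z.R.basis_vector_carrier) blast
      have y: "?y \<in> carrier ?F" by (rule F.smult_closed[OF hD(1) bv])
      have k: "k = ?y \<oplus>\<^bsub>?F\<^esub> l"
      proof (rule ext)
        fix z show "k z = (?y \<oplus>\<^bsub>?F\<^esub> l) z"
          unfolding insert.prems(2) free_module_sel l_def basis_vector_def
          using insert.hyps(2) hD(1) Z.R.r_null[OF hD(1)] Z.R.r_one[OF hD(1)]
            Z.R.r_zero[OF hD(1)] Z.R.l_zero[OF hD(1)] Z.R.r_zero[OF Z.R.zero_closed]
          by (auto simp del: monoid_ring_simps)
      qed
      show ?case
        unfolding k E_add[OF y l(1)] E_smult[OF hD(1) bv] l(2) n_def[symmetric]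
        using insert.hyps F.M.a_closed[OF y l(1)] by simp
    qed
    moreover have "h = (%x. if x \<in> {x. h x ~= \<zero>\<^bsub>ZM\<^esub>} then h x else \<zero>\<^bsub>ZM\<^esub>)"
      by (rule ext) (simp only: mem_Collect_eq split: if_splits, blast)
    ultimately show ?thesis using hD(2) subset_refl by blast
  qed
  obtain p0 where p0: "p0 \<in> carrier (P 0)" "e p0 = 1"
    using e(2) by (auto simp: trivial_module_def image_iff set_eq_iff) metis
  obtain S where S: "finite S" "S \<subseteq> carrier (P 1)"
      "!!x. x \<in> carrier (P 1) ==> \<exists>a\<in>S \<rightarrow> carrier ZM. x = finsum (P 1) (%s. a s \<odot>\<^bsub>P 1\<^esub> s) S"
    using fg[of 1] unfolding fg_module_def by auto
  have dS: "d 0 s \<in> carrier (P 0)" "e (d 0 s) = 0" if "s \<in> S" for s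
    using d(2) that S(2) by (auto simp: trivial_module_sel)
  have ic: "i y \<in> carrier ?F" if "y \<in> carrier (P 0)" for y by (rule left_module_homD(1)[OF i that])
  define supp where "supp y = (\<Union>x\<in>{x. i y x ~= \<zero>\<^bsub>ZM\<^esub>}. {z. i y x z ~= 0})" for y
  have supp: "finite (supp y)" "supp y \<subseteq> carrier G" if "y \<in> carrier (P 0)" for y
    unfolding supp_def using free_moduleD(2)[OF ic[OF that]] monoid_ring_finite[OF free_moduleD(1)[OF ic[OF that]]]
      monoid_ring_support[OF free_moduleD(1)[OF ic[OF that]]] by blast+
  \<comment> \<open>The supports of finitely many elements: the generators of the kernel of
    \<open>e\<close> and a preimage \<open>p0\<close> of 1.\<close>
  let ?T = "(\<Union>s\<in>S. supp (d 0 s)) \<union> supp p0"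
  show ?thesis
  proof (rule that[of ?T])
    show "finite ?T" using supp(1) dS(1) p0(1) S(1) by blast
    show "?T \<subseteq> carrier G" using supp(2) dS(1) p0(1) by blast
    fix C assume C: "!!g t. g \<in> carrier G ==> t \<in> ?T ==> g \<otimes> t \<in> C \<longleftrightarrow> g \<in> C" and one: "\<one> \<in> C"
    define w where "w z = (if z \<in> C then 1 else 0 :: int)" for z
    \<comment> \<open>With the constant weight 1 this would be \<open>e\<close>. With the indicator
      of \<open>C\<close> it is still additive, and it multiplies by \<open>e\<close> on elements
      supported in \<open>?T\<close>.\<close>
    define \<Psi> where "\<Psi> y = (\<Sum>x | i y x ~= \<zero>\<^bsub>ZM\<^esub>. weighted_sum w (i y x) * n x)" for y
    have w0: "weighted_sum w \<zero>\<^bsub>ZM\<^esub> = 0" by (simp add: weighted_sum_def)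
    have \<Psi>: "\<Psi> y = (\<Sum>x\<in>A. weighted_sum w (i y x) * n x)" if "finite A" "{x. i y x ~= \<zero>\<^bsub>ZM\<^esub>} \<subseteq> A" for y A
      unfolding \<Psi>_def using that w0 by (intro sum.mono_neutral_left) auto
    have \<Psi>_add: "\<Psi> (y \<oplus>\<^bsub>P 0\<^esub> z) = \<Psi> y + \<Psi> z" if y: "y \<in> carrier (P 0)" and z: "z \<in> carrier (P 0)" for y z
    proof -
      let ?A = "{x. i y x ~= \<zero>\<^bsub>ZM\<^esub>} \<union> {x. i z x ~= \<zero>\<^bsub>ZM\<^esub>}"
      have A: "finite ?A" using free_moduleD(2)[OF ic[OF y]] free_moduleD(2)[OF ic[OF z]] by blast
      have yz: "i (y \<oplus>\<^bsub>P 0\<^esub> z) x = (%v. i y x v + i z x v)" for x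
        unfolding left_module_homD(2)[OF i y z] free_module_sel by simp
      have "\<Psi> (y \<oplus>\<^bsub>P 0\<^esub> z) = (\<Sum>x\<in>?A. weighted_sum w (%v. i y x v + i z x v) * n x)"
        unfolding yz[symmetric] by (rule \<Psi>[OF A]) (auto simp: yz)
      also have "... = \<Psi> y + \<Psi> z"
        unfolding weighted_sum_add[OF free_moduleD(1)[OF ic[OF y]] free_moduleD(1)[OF ic[OF z]]]
          \<Psi>[OF A Un_upper1] \<Psi>[OF A Un_upper2] distrib_right sum.distrib ..
      finally show ?thesis .
    qed
    have \<Psi>_smult: "\<Psi> (r \<odot>\<^bsub>P 0\<^esub> y) = weighted_sum w r * e y"
      if r: "r \<in> carrier ZM" and y: "y \<in> carrier (P 0)" and T: "supp y \<subseteq> ?T" for r y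
    proof -
      note yD = free_moduleD[OF ic[OF y]]
      let ?A = "{x. i y x ~= \<zero>\<^bsub>ZM\<^esub>}"
      have ry: "i (r \<odot>\<^bsub>P 0\<^esub> y) x = r \<star> i y x" for x
        unfolding left_module_homD(3)[OF i r y] free_module_sel ..
      have "{x. i (r \<odot>\<^bsub>P 0\<^esub> y) x ~= \<zero>\<^bsub>ZM\<^esub>} \<subseteq> ?A"
        unfolding ry using Z.R.r_null[OF r] by (auto simp del: monoid_ring_simps)
      then have "\<Psi> (r \<odot>\<^bsub>P 0\<^esub> y) = (\<Sum>x\<in>?A. weighted_sum w (r \<star> i y x) * n x)"
        unfolding ry[symmetric] by (rule \<Psi>[OF yD(2)])
      also have "... = (\<Sum>x\<in>?A. weighted_sum w r * (augmentation (i y x) * n x))"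
      proof (intro sum.cong HOL.refl)
        fix x assume x: "x \<in> ?A"
        have "t \<in> ?T" if "i y x t ~= 0" for t using that T x unfolding supp_def[of y] by blast
        then have "w (g \<otimes> t) = w g" if "g \<in> carrier G" "i y x t ~= 0" for g t
          unfolding w_def using C[OF that(1), of t] that(2) by simp
        from weighted_sum_mult[OF r yD(1) this]
        show "weighted_sum w (r \<star> i y x) * n x = weighted_sum w r * (augmentation (i y x) * n x)" by simp
      qed
      also have "... = weighted_sum w r * e y"
        using E_sum[OF ic[OF y]] pi[OF y] by (simp add: sum_distrib_left E_def del: monoid_ring_simps)
      finally show ?thesis .
    qed
    have \<Psi>_zero: "\<Psi> \<zero>\<^bsub>P 0\<^esub> = 0" using \<Psi>_add[OF P0.M.zero_closed P0.M.zero_closed] by simp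
    show "carrier G \<subseteq> C"
    proof
      fix g assume g: "g \<in> carrier G"
      \<comment> \<open>\<open>(g - 1) p0\<close> lies in the kernel of \<open>e\<close>, so
        \<open>\<Psi>\<close> kills it; on the other hand \<open>\<Psi>\<close> gives the weight of
        \<open>g\<close> minus that of \<open>\<one>\<close>.\<close>
      let ?r = "shift g \<one> 1"
      have r: "?r \<in> carrier ZM" "augmentation ?r = 0"
        using g shift_carrier augmentation_shift by simp_all
      have "e (?r \<odot>\<^bsub>P 0\<^esub> p0) = 0"
        using left_module_homD(3)[OF e(1) r(1) p0(1)] r(2) by (simp add: trivial_module_sel)
      then have "?r \<odot>\<^bsub>P 0\<^esub> p0 \<in> d 0 ` carrier (P 1)"
        unfolding d(2) trivial_module_sel using P0.smult_closed[OF r(1) p0(1)] by blast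
      then obtain q where q: "q \<in> carrier (P 1)" "?r \<odot>\<^bsub>P 0\<^esub> p0 = d 0 q" by blast
      obtain a where a: "a \<in> S \<rightarrow> carrier ZM" "q = finsum (P 1) (%s. a s \<odot>\<^bsub>P 1\<^esub> s) S"
        using S(3)[OF q(1)] by blast
      have asc: "(%s. a s \<odot>\<^bsub>P 1\<^esub> s) \<in> S \<rightarrow> carrier (P 1)"
        using a(1) S(2) P1.smult_closed by (auto simp: Pi_def subset_iff simp del: monoid_ring_simps)
      have dq: "d 0 q = finsum (P 0) (%s. d 0 (a s \<odot>\<^bsub>P 1\<^esub> s)) S"
        unfolding a(2) by (rule left_module_hom_finsum[OF Pm Pm d(1) S(1) asc])
      have "\<Psi> (finsum (P 0) (%s. d 0 (a s \<odot>\<^bsub>P 1\<^esub> s)) B) = 0" if "B \<subseteq> S" for B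
        using finite_subset[OF that S(1)] that
      proof (induction rule: finite_induct)
        case (insert s B)
        have c: "d 0 (a s \<odot>\<^bsub>P 1\<^esub> s) \<in> carrier (P 0)" "(%s. d 0 (a s \<odot>\<^bsub>P 1\<^esub> s)) \<in> B \<rightarrow> carrier (P 0)"
          using insert.prems left_module_homD(1)[OF d(1) funcset_mem[OF asc]] by auto
        have s: "s \<in> S" using insert.prems by blast
        have "d 0 (a s \<odot>\<^bsub>P 1\<^esub> s) = a s \<odot>\<^bsub>P 0\<^esub> d 0 s"
          using s a(1) S(2) by (intro left_module_homD(3)[OF d(1)]) auto
        moreover have "\<Psi> (a s \<odot>\<^bsub>P 0\<^esub> d 0 s) = weighted_sum w (a s) * e (d 0 s)"
          using s a(1) by (intro \<Psi>_smult dS) auto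
        ultimately have "\<Psi> (d 0 (a s \<odot>\<^bsub>P 1\<^esub> s)) = 0" using dS s by simp
        then show ?case
          using insert c \<Psi>_add[OF c(1) P0.M.finsum_closed[OF c(2)]]
          by (simp add: P0.M.finsum_insert)
      qed (simp add: \<Psi>_zero)
      from this[OF subset_refl] have "\<Psi> (?r \<odot>\<^bsub>P 0\<^esub> p0) = 0" unfolding q(2) dq .
      then have "weighted_sum w ?r = 0"
        using \<Psi>_smult[OF r(1) p0(1)] p0(2) by simp
      moreover have "weighted_sum w ?r = (\<Sum>z\<in>{g, \<one>}. w z * ?r z)"
        by (rule weighted_sum_eq) (auto simp: shift_def single_def split: if_splits)
      ultimately show "g \<in> C"
        using one by (cases "g = \<one>") (auto simp: shift_def single_def w_def split: if_splits)
    qed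
  qed
qed

end

lemma character_monoid_simps [simp]:
  "carrier (character_monoid G \<chi>) = half_space G \<chi> 0"
  "x \<otimes>\<^bsub>character_monoid G \<chi>\<^esub> y = x \<otimes>\<^bsub>G\<^esub> y"
  "\<one>\<^bsub>character_monoid G \<chi>\<^esub> = \<one>\<^bsub>G\<^esub>"
  by (simp_all add: character_monoid_def half_space_def)

lemma (in group) monoid_character_monoid: "additive G \<chi> ==> monoid (character_monoid G \<chi>)"
  by (rule monoidI) (auto simp: half_space_def m_assoc additiveD additive_one)

context generators
begin

text \<open>Along a path in the half-space \<open>g - 1\<close> telescopes into differences
  \<open>g s - g\<close>. If \<open>\<chi>\<close> is nonnegative at \<open>s\<close>, this is a
  left multiple of \<open>s - 1\<close>; otherwise it is minus the multiple of
  \<open>s^-1 - 1\<close> by \<open>g s\<close>, which still lies in the half-space.\<close>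

lemma half_connected_imp_monoid_type_FP1:
  assumes \<chi>: "additive G \<chi>" and t: "fst t \<in> X" "0 < \<chi> (lv t)"
    and fin: "finite X" "countable (carrier G)"
    and conn: "half_connected G X f \<chi>"
  shows "monoid_type_FP 1 (character_monoid G \<chi>)"
proof -
  let ?M = "character_monoid G \<chi>"
  interpret M: monoid ?M by (rule monoid_character_monoid[OF \<chi>])
  let ?S = "lv ` {s \<in> X \<times> UNIV. 0 \<le> \<chi> (lv s)}"
  have SM: "?S \<subseteq> half_space G \<chi> 0" by (auto simp: half_space_def)
  show ?thesis
  proof (rule M.monoid_type_FP1I)
    show "countable (carrier ?M)"
      using fin(2) by (rule countable_subset[rotated]) (auto simp: half_space_def)
    show "finite ?S" using fin(1) by auto
    show "?S \<subseteq> carrier ?M" using SM by simp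
    fix J r assume mult: "!!a r. a \<in> carrier M.ZM ==> r \<in> J ==> a \<otimes>\<^bsub>M.ZM\<^esub> r \<in> J"
      and add: "!!r s. r \<in> J ==> s \<in> J ==> (%z. r z + s z) \<in> J"
      and gen: "!!s. s \<in> ?S ==> shift s \<one>\<^bsub>?M\<^esub> 1 \<in> J"
      and r: "r \<in> carrier M.ZM" "augmentation r = 0"
    have letter: "shift (g \<otimes> lv s) g n \<in> J"
      if g: "g \<in> half_space G \<chi> 0" "g \<otimes> lv s \<in> half_space G \<chi> 0" "fst s \<in> X" for g s n
    proof -
      have gc: "g \<in> carrier G" using g(1) by (simp add: half_space_def)
      show ?thesis
      proof (cases "0 \<le> \<chi> (lv s)")
        case True
        then have s: "lv s \<in> ?S" using g(3) by (cases s) auto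
        have "single g n \<otimes>\<^bsub>M.ZM\<^esub> shift (lv s) \<one> 1 \<in> J"
          using gen[OF s] g(1) by (intro mult single_carrier) simp_all
        then show ?thesis
          using M.single_mult_shift[of g "lv s" \<one> n 1] g gc subsetD[OF SM s] M.one_closed by simp
      next
        case False
        let ?s = "inv_letter s"
        have s: "lv ?s \<in> ?S"
          using False g(3) additive_inv[OF \<chi>, of "lv s"] fst_inv_letter[of s]
          by (intro imageI) (simp add: mem_Times_iff)
        have "single (g \<otimes> lv s) (- n) \<otimes>\<^bsub>M.ZM\<^esub> shift (lv ?s) \<one> 1 \<in> J"
          using gen[OF s] g(2) by (intro mult single_carrier) simp_all
        then have "shift (g \<otimes> lv s \<otimes> lv ?s) (g \<otimes> lv s) (- n) \<in> J"
          using M.single_mult_shift[of "g \<otimes> lv s" "lv ?s" \<one> "- n" 1] g subsetD[OF SM s] M.one_closed gc by simp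
        then have "shift g (g \<otimes> lv s) (- n) \<in> J"
          using g(3) gc by (simp add: m_assoc r_inv)
        also have "shift g (g \<otimes> lv s) (- n) = shift (g \<otimes> lv s) g n"
          by (simp add: shift_def add.commute)
        finally show ?thesis .
      qed
    qed
    have path: "shift (g \<otimes> wv w) g n \<in> J"
      if "w \<in> words X" "path (half_space G \<chi> 0) g w" for g w n
      using that
    proof (induction w arbitrary: g)
      case Nil
      \<comment> \<open>\<open>J\<close> is only known to be closed under sums and multiples; the
        zero multiple of a generator puts 0 into it.\<close>
      have tS: "lv t \<in> ?S" using t by (cases t) auto
      then have tc: "lv t \<in> half_space G \<chi> 0" using SM by blast
      have "single \<one> 0 \<otimes>\<^bsub>M.ZM\<^esub> shift (lv t) \<one> 1 \<in> J"
        using gen[OF tS] M.one_closed by (intro mult single_carrier) simp_all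
      then have "shift (\<one> \<otimes> lv t) (\<one> \<otimes> \<one>) 0 \<in> J"
        using M.single_mult_shift[of \<one> "lv t" \<one> 0 1] tc M.one_closed by simp
      also have "shift (\<one> \<otimes> lv t) (\<one> \<otimes> \<one>) 0 = shift (g \<otimes> wv []) g n"
        using Nil by (auto simp: shift_def single_def half_space_def fun_eq_iff)
      finally show ?case .
    next
      case (Cons s w)
      then have g: "g \<in> half_space G \<chi> 0" "g \<otimes> lv s \<in> half_space G \<chi> 0"
        using path_in_start by auto
      have "(%z. shift (g \<otimes> lv s \<otimes> wv w) (g \<otimes> lv s) n z + shift (g \<otimes> lv s) g n z) \<in> J"
        using Cons by (intro add letter g Cons.IH) auto
      also have "(%z. shift (g \<otimes> lv s \<otimes> wv w) (g \<otimes> lv s) n z + shift (g \<otimes> lv s) g n z) = shift (g \<otimes> wv (s # w)) g n"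
        using Cons.prems g by (auto simp: shift_def single_def fun_eq_iff m_assoc half_space_def)
      finally show ?case .
    qed
    show "r \<in> J"
    proof (rule M.augmentation_ideal_generated[OF mult add _ r])
      fix g assume "g \<in> carrier ?M"
      then obtain w where w: "w \<in> words X" "path (half_space G \<chi> 0) \<one> w" "wv w = g"
        using conn unfolding half_connected_def by auto
      then show "shift g \<one>\<^bsub>?M\<^esub> 1 \<in> J" using path[OF w(1,2), of 1] word_val_closed[OF w(1)] by simp
    qed
  qed
qed

text \<open>Let \<open>c\<close> bound the depth of chosen words for the finite set
  \<open>T\<close>. Within the half-space the component of \<open>\<one>\<close> at height
  \<open>-c\<close> is then unchanged under right multiplication by \<open>T\<close>, so it contains
  the half-space, and \<open>coarsely_half_connected\<close> removes the \<open>c\<close>.\<close>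

lemma monoid_type_FP1_imp_half_connected:
  assumes \<chi>: "additive G \<chi>" and t: "fst t \<in> X" "0 < \<chi> (lv t)"
    and gen: "carrier G \<subseteq> wv ` words X"
    and FP: "monoid_type_FP 1 (character_monoid G \<chi>)"
  shows "half_connected G X f \<chi>"
proof -
  let ?M = "character_monoid G \<chi>"
  interpret M: monoid ?M by (rule monoid_character_monoid[OF \<chi>])
  obtain T where T: "finite T" "T \<subseteq> half_space G \<chi> 0"
    and sep: "!!C. (!!g t. g \<in> half_space G \<chi> 0 ==> t \<in> T ==> g \<otimes> t \<in> C \<longleftrightarrow> g \<in> C) ==> \<one> \<in> C
      ==> half_space G \<chi> 0 \<subseteq> C"
    using M.monoid_type_FP1D[OF FP] by (metis character_monoid_simps)
  have "\<exists>w. \<tau> \<in> T --> w \<in> words X & wv w = \<tau>" for \<tau>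
    using gen T(2) by (auto simp: half_space_def)
  then have "\<exists>W. \<forall>\<tau>. \<tau> \<in> T --> W \<tau> \<in> words X & wv (W \<tau>) = \<tau>" by (intro choice allI)
  then obtain W where W: "!!\<tau>. \<tau> \<in> T ==> W \<tau> \<in> words X" "!!\<tau>. \<tau> \<in> T ==> wv (W \<tau>) = \<tau>" by blast
  let ?D = "insert 0 (\<Union>\<tau>\<in>T. (%i. - \<chi> (wv (take i (W \<tau>)))) ` {..length (W \<tau>)})"
  have fin: "finite ?D" using T(1) by auto
  define c where "c = Max ?D"
  have c: "0 \<le> c" "- \<chi> (wv (take i (W \<tau>))) \<le> c" if "\<tau> \<in> T" "i \<le> length (W \<tau>)" for i \<tau>
    unfolding c_def using that by (intro Max_ge fin; auto)+
  have c0: "0 \<le> c" unfolding c_def by (intro Max_ge fin) auto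
  have "path (half_space G \<chi> (- c)) \<one> (W \<tau>)" if "\<tau> \<in> T" for \<tau>
  proof -
    have "- c \<le> \<chi> (wv (take i (W \<tau>)))" if "i \<le> length (W \<tau>)" for i
      using c(2)[OF \<open>\<tau> \<in> T\<close> that] by linarith
    then show ?thesis
      using W(1)[OF that] by (simp add: path_iff_prefixes half_space_def words_take)
  qed
  then have pT: "path (half_space G \<chi> (- c)) g (W \<tau>)" if "\<tau> \<in> T" "g \<in> half_space G \<chi> 0" for g \<tau>
    using path_half_space_translate[OF \<chi>, of g "W \<tau>" "- c"] that W(1)[OF that(1)]
    by (auto simp: half_space_def elim!: path_in_mono)
  have "half_space G \<chi> 0 \<subseteq> reach \<chi> (- c)"
  proof (rule sep)
    have "path (half_space G \<chi> (- c)) \<one> []" using c0 additive_one[OF \<chi>] by (simp add: half_space_def)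
    then show "\<one> \<in> reach \<chi> (- c)" using reachI[of "[]"] by simp
    fix g \<tau> assume g: "g \<in> half_space G \<chi> 0" and \<tau>: "\<tau> \<in> T"
    have gc: "g \<in> carrier G" "\<tau> \<in> carrier G" using g \<tau> T(2) by (auto simp: half_space_def)
    note Wt = W(1)[OF \<tau>] W(2)[OF \<tau>]
    show "g \<otimes> \<tau> \<in> reach \<chi> (- c) \<longleftrightarrow> g \<in> reach \<chi> (- c)"
    proof
      assume "g \<in> reach \<chi> (- c)"
      then obtain u where u: "u \<in> words X" "path (half_space G \<chi> (- c)) \<one> u" "wv u = g" by (auto simp: reach_def)
      then have "path (half_space G \<chi> (- c)) \<one> (u @ W \<tau>)"
        using path_append[of \<one> u "W \<tau>"] Wt pT[OF \<tau> g] gc by simp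
      then show "g \<otimes> \<tau> \<in> reach \<chi> (- c)"
        using reachI[of "u @ W \<tau>"] u Wt by simp
    next
      assume "g \<otimes> \<tau> \<in> reach \<chi> (- c)"
      then obtain u where u: "u \<in> words X" "path (half_space G \<chi> (- c)) \<one> u" "wv u = g \<otimes> \<tau>" by (auto simp: reach_def)
      have "path (half_space G \<chi> (- c)) (g \<otimes> \<tau>) (inv_word (W \<tau>))"
        using path_inv[of g "W \<tau>"] Wt gc pT[OF \<tau> g] by simp
      then have "path (half_space G \<chi> (- c)) \<one> (u @ inv_word (W \<tau>))"
        using path_append[of \<one> u "inv_word (W \<tau>)"] Wt u gc by simp
      then show "g \<in> reach \<chi> (- c)"
        using reachI[of "u @ inv_word (W \<tau>)"] u Wt gc by (simp add: m_assoc r_inv)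
    qed
  qed
  then show ?thesis by (rule coarsely_half_connected[OF \<chi> t])
qed

end

section \<open>Integer vectors\<close>

text \<open>Gaussian elimination without division: cross-multiplying with the pivot
  \<open>a j k\<close> removes the unknown \<open>k\<close>, and the solution found is scaled by the
  pivot to recover it.\<close>

lemma homogeneous_system:
  fixes a :: "'j => 'i => int"
  assumes "finite J" "finite I" "card J < card I"
  shows "\<exists>c. (\<exists>i\<in>I. c i ~= 0) & (\<forall>j\<in>J. (\<Sum>i\<in>I. c i * a j i) = 0)"
  using assms
proof (induction J arbitrary: I a rule: finite_induct)
  case empty
  then obtain i where "i \<in> I" by fastforce
  then show ?case by (intro exI[of _ "%_. 1"]) auto
next
  case (insert j J)
  show ?case
  proof (cases "\<forall>i\<in>I. a j i = 0")
    case True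
    then show ?thesis using insert.IH[of I a] insert.prems insert.hyps by auto
  next
    case False
    then obtain k where k: "k \<in> I" "a j k ~= 0" by blast
    let ?I = "I - {k}"
    have "card J < card ?I" using insert.prems insert.hyps k by simp
    then obtain c where c: "\<exists>i\<in>?I. c i ~= 0"
      "!!l. l \<in> J ==> (\<Sum>i\<in>?I. c i * (a j k * a l i - a l k * a j i)) = 0"
      using insert.IH[of ?I "%l i. a j k * a l i - a l k * a j i"] insert.prems by auto
    define d where "d i = (if i = k then - (\<Sum>i\<in>?I. c i * a j i) else a j k * c i)" for i
    have d: "(\<Sum>i\<in>I. d i * a l i) = a j k * (\<Sum>i\<in>?I. c i * a l i) - (\<Sum>i\<in>?I. c i * a j i) * a l k" for l
    proof -
      have "(\<Sum>i\<in>I. d i * a l i) = d k * a l k + (\<Sum>i\<in>?I. d i * a l i)"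
        using insert.prems k by (intro sum.remove) auto
      also have "(\<Sum>i\<in>?I. d i * a l i) = a j k * (\<Sum>i\<in>?I. c i * a l i)"
        unfolding sum_distrib_left by (intro sum.cong) (auto simp: d_def)
      finally show ?thesis by (simp add: d_def)
    qed
    have "(\<Sum>i\<in>I. d i * a l i) = 0" if "l \<in> insert j J" for l
    proof (cases "l = j")
      case False
      then have "0 = (\<Sum>i\<in>?I. c i * (a j k * a l i - a l k * a j i))" using c(2) that by auto
      also have "... = a j k * (\<Sum>i\<in>?I. c i * a l i) - (\<Sum>i\<in>?I. c i * a j i) * a l k"
        unfolding sum_distrib_left sum_distrib_right sum_subtractf[symmetric]
        by (intro sum.cong) (auto simp: algebra_simps)
      finally show ?thesis using d by simp
    qed (simp add: d)
    moreover have "\<exists>i\<in>I. d i ~= 0" using c(1) k by (auto simp: d_def)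
    ultimately show ?thesis by blast
  qed
qed

definition independent_vectors :: "nat => (nat => int) set => bool" where
  "independent_vectors n Z \<longleftrightarrow> finite Z &
    (\<forall>c. (\<forall>i<n. (\<Sum>z\<in>Z. c z * z i) = 0) --> (\<forall>z\<in>Z. c z = 0))"

definition pairing :: "nat => (nat => real) => (nat => int) => real" where
  "pairing n \<zeta> z = (\<Sum>i<n. \<zeta> i * real_of_int (z i))"

lemma pairing_of_int: "pairing n (%i. real_of_int (c i)) z = real_of_int (\<Sum>i<n. c i * z i)"
  by (simp add: pairing_def)

text \<open>Full rank of \<open>Y\<close>, expressed by real functionals so that it can be applied
  directly to characters.\<close>

definition separates :: "nat => (nat => int) set => bool" where
  "separates n Y \<longleftrightarrow> (\<forall>\<zeta>. (\<forall>z\<in>Y. pairing n \<zeta> z = 0) --> (\<forall>i<n. \<zeta> i = 0))"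

lemma separatesD: "separates n Y ==> (!!z. z \<in> Y ==> pairing n \<zeta> z = 0) ==> i < n ==> \<zeta> i = 0"
  unfolding separates_def by blast

lemma independent_vectorsD:
  "independent_vectors n Z ==> (!!i. i < n ==> (\<Sum>z\<in>Z. c z * z i) = 0) ==> z \<in> Z ==> c z = 0"
  unfolding independent_vectors_def by blast

lemma independent_vectors_empty: "independent_vectors n {}"
  by (simp add: independent_vectors_def)

lemma independent_vectors_card:
  assumes "independent_vectors n Z"
  shows "finite Z" "card Z \<le> n"
proof -
  show fin: "finite Z" using assms by (simp add: independent_vectors_def)
  show "card Z \<le> n"
  proof (rule ccontr)
    assume "\<not> card Z \<le> n"
    then obtain c where "\<exists>z\<in>Z. c z ~= 0" "\<forall>i\<in>{..<n}. (\<Sum>z\<in>Z. c z * z i) = 0"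
      using homogeneous_system[of "{..<n}" Z "%i z. z i"] fin by auto
    then show False using independent_vectorsD[OF assms, of c] by blast
  qed
qed

lemma integral_annihilator:
  assumes "finite Z" "card Z < n"
  obtains c :: "nat => int" where "\<exists>i<n. c i ~= 0" "!!z. z \<in> Z ==> pairing n (%i. real_of_int (c i)) z = 0"
proof -
  obtain c where c: "\<exists>i\<in>{..<n}. c i ~= 0" "!!z. z \<in> Z ==> (\<Sum>i<n. c i * z i) = 0"
    using homogeneous_system[of Z "{..<n}" "%z i. z i"] assms by auto
  have "pairing n (%i. real_of_int (c i)) z = 0" if "z \<in> Z" for z
    using c(2)[OF that] by (simp add: pairing_of_int)
  then show ?thesis using that[of c] c(1) by blast
qed

lemma separates_card: "separates n Z ==> finite Z ==> n \<le> card Z"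
proof (rule ccontr)
  assume Z: "separates n Z" "finite Z" "\<not> n \<le> card Z"
  then obtain c :: "nat => int" where c: "\<exists>i<n. c i ~= 0" "!!z. z \<in> Z ==> pairing n (%i. real_of_int (c i)) z = 0"
    using integral_annihilator[of Z n] by (metis not_le)
  then show False using separatesD[OF Z(1), of "%i. real_of_int (c i)"] by auto
qed

lemma pairing_sum:
  assumes "!!i. i < n ==> M * y i = (\<Sum>z\<in>Z. c z * z i)"
  shows "real_of_int M * pairing n \<zeta> y = (\<Sum>z\<in>Z. real_of_int (c z) * pairing n \<zeta> z)"
proof -
  have "real_of_int M * pairing n \<zeta> y = (\<Sum>i<n. \<zeta> i * real_of_int (M * y i))"
    unfolding pairing_def sum_distrib_left by (intro sum.cong) auto
  also have "... = (\<Sum>i<n. \<Sum>z\<in>Z. real_of_int (c z) * (\<zeta> i * real_of_int (z i)))"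
    using assms by (intro sum.cong HOL.refl) (simp add: sum_distrib_left mult_ac)
  also have "... = (\<Sum>z\<in>Z. real_of_int (c z) * pairing n \<zeta> z)"
    unfolding pairing_def sum_distrib_left by (rule sum.swap)
  finally show ?thesis .
qed

lemma independent_vectors_insert:
  assumes Z: "independent_vectors n Z" and \<zeta>: "!!z. z \<in> Z ==> pairing n \<zeta> z = 0" "pairing n \<zeta> v ~= 0"
  shows "v \<notin> Z" "independent_vectors n (insert v Z)"
proof -
  show v: "v \<notin> Z" using \<zeta> by blast
  have fin: "finite Z" by (rule independent_vectors_card[OF Z])
  have "c z = 0" if c: "\<forall>i<n. (\<Sum>z\<in>insert v Z. c z * z i) = 0" and "z \<in> insert v Z" for c z
  proof -
    have "c v * v i = (\<Sum>z\<in>Z. - c z * z i)" if "i < n" for i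
      using c that fin v by (simp add: sum_negf eq_neg_iff_add_eq_0)
    then have "real_of_int (c v) * pairing n \<zeta> v = (\<Sum>z\<in>Z. real_of_int (- c z) * pairing n \<zeta> z)"
      by (rule pairing_sum)
    then have cv: "c v = 0" using \<zeta> by simp
    then have "(\<Sum>z\<in>Z. c z * z i) = 0" if "i < n" for i using c that fin v by simp
    then show "c z = 0" using cv independent_vectorsD[OF Z, of c z] \<open>z \<in> insert v Z\<close> by blast
  qed
  then show "independent_vectors n (insert v Z)"
    unfolding independent_vectors_def using fin by blast
qed

lemma pairing_unit_vector: "i < n ==> pairing n \<zeta> (%j. if j = i then 1 else 0) = \<zeta> i"
  by (simp add: pairing_def if_distrib[of real_of_int] if_distrib[of "(*) _"] cong: if_cong)

lemma independent_card_separates: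
  assumes "independent_vectors n Z" "card Z = n"
  shows "separates n Z"
  unfolding separates_def
proof (intro allI impI)
  fix \<zeta> i assume \<zeta>: "\<forall>z\<in>Z. pairing n \<zeta> z = 0" and i: "i < n"
  show "\<zeta> i = 0"
  proof (rule ccontr)
    let ?v = "%j. if j = i then 1 else 0 :: int"
    assume "\<zeta> i ~= 0"
    then have "pairing n \<zeta> ?v ~= 0" using pairing_unit_vector[OF i] by simp
    then have "?v \<notin> Z" "independent_vectors n (insert ?v Z)"
      using independent_vectors_insert[OF assms(1)] \<zeta> by blast+
    then show False
      using independent_vectors_card[of n "insert ?v Z"] independent_vectors_card(1)[OF assms(1)] assms(2) by simp
  qed
qed

lemma maximal_independent:
  assumes "independent_vectors n B0" "B0 \<subseteq> Y"
  obtains B where "B0 \<subseteq> B" "B \<subseteq> Y" "independent_vectors n B"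
    "!!Z. Z \<subseteq> Y ==> B \<subseteq> Z ==> independent_vectors n Z ==> Z = B"
proof -
  let ?P = "%B. B0 \<subseteq> B & B \<subseteq> Y & independent_vectors n B"
  have "\<exists>B. ?P B & (\<forall>Z. ?P Z --> card Z \<le> card B)"
  proof (rule ex_has_greatest_nat[of ?P B0 card "Suc n"])
    show "\<forall>B. ?P B --> card B < Suc n" using independent_vectors_card(2) by (simp add: less_Suc_eq_le)
  qed (use assms in blast)
  then obtain B where B: "?P B" "!!Z. ?P Z ==> card Z \<le> card B" by blast
  have "Z = B" if "Z \<subseteq> Y" "B \<subseteq> Z" "independent_vectors n Z" for Z
  proof -
    have "?P Z" using that B(1) by blast
    then show ?thesis
      using B(2)[of Z] that card_seteq[of Z B] independent_vectors_card(1)[OF that(3)] by blast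
  qed
  then show ?thesis using that B(1) by blast
qed

lemma maximal_independent_dependence:
  assumes B: "independent_vectors n B" "y \<notin> B ==> \<not> independent_vectors n (insert y B)"
  obtains M c where "M ~= 0" "!!i. i < n ==> M * y i = (\<Sum>b\<in>B. c b * b i)"
proof (cases "y \<in> B")
  case True
  have fin: "finite B" by (rule independent_vectors_card[OF B(1)])
  have "1 * y i = (\<Sum>b\<in>B. (if b = y then 1 else 0) * b i)" for i
    using True fin by (simp add: if_distrib[of "%x. x * _"] cong: if_cong)
  then show ?thesis using that[of 1 "%b. if b = y then 1 else 0"] by simp
next
  case False
  have fin: "finite B" by (rule independent_vectors_card[OF B(1)])
  obtain c z where c: "!!i. i < n ==> (\<Sum>z\<in>insert y B. c z * z i) = 0" "z \<in> insert y B" "c z ~= 0"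
    using B(2)[OF False] fin unfolding independent_vectors_def by auto
  have rel: "c y * y i + (\<Sum>b\<in>B. c b * b i) = 0" if "i < n" for i
    using c(1)[OF that] fin False by simp
  have "c y ~= 0"
  proof
    assume "c y = 0"
    then show False using independent_vectorsD[OF B(1), of c z] rel c(2,3) by auto
  qed
  moreover have "c y * y i = (\<Sum>b\<in>B. - c b * b i)" if "i < n" for i
    using rel[OF that] by (simp add: sum_negf)
  ultimately show ?thesis using that[of "c y" "%b. - c b"] by blast
qed

lemma maximal_independent_annihilator:
  assumes B: "independent_vectors n B" "y \<notin> B ==> \<not> independent_vectors n (insert y B)"
    and \<zeta>: "!!b. b \<in> B ==> pairing n \<zeta> b = 0"
  shows "pairing n \<zeta> y = 0"
proof -
  obtain M c where M: "M ~= 0" "!!i. i < n ==> M * y i = (\<Sum>b\<in>B. c b * b i)"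
    using maximal_independent_dependence[OF B] by blast
  have "real_of_int M * pairing n \<zeta> y = (\<Sum>b\<in>B. real_of_int (c b) * pairing n \<zeta> b)"
    by (rule pairing_sum[OF M(2)])
  then show ?thesis using \<zeta> M(1) by simp
qed

lemma separates_maximal:
  assumes Y: "separates n Y" and B0: "independent_vectors n B0" "B0 \<subseteq> Y"
  obtains B where "B0 \<subseteq> B" "B \<subseteq> Y" "independent_vectors n B" "card B = n"
proof -
  obtain B where B: "B0 \<subseteq> B" "B \<subseteq> Y" "independent_vectors n B"
    "!!Z. Z \<subseteq> Y ==> B \<subseteq> Z ==> independent_vectors n Z ==> Z = B"
    using maximal_independent[OF B0] by blast
  have "separates n B"
    unfolding separates_def
  proof (intro allI impI)
    fix \<zeta> i assume \<zeta>: "\<forall>z\<in>B. pairing n \<zeta> z = 0" and i: "i < n"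
    have "pairing n \<zeta> y = 0" if "y \<in> Y" for y
    proof (rule maximal_independent_annihilator[OF B(3)])
      show "\<not> independent_vectors n (insert y B)" if "y \<notin> B"
        using B(4)[of "insert y B"] B(2) \<open>y \<in> Y\<close> that by blast
    qed (use \<zeta> in blast)
    then show "\<zeta> i = 0" by (rule separatesD[OF Y _ i])
  qed
  then have "card B = n"
    using separates_card independent_vectors_card[OF B(3)] by (simp add: eq_iff)
  then show ?thesis using that B by blast
qed

lemma independent_card_dependence:
  assumes "independent_vectors n B" "card B = n"
  obtains M c where "M ~= 0" "!!i. i < n ==> M * y i = (\<Sum>b\<in>B. c b * b i)"
proof (rule maximal_independent_dependence[OF assms(1), of y])
  fix M c assume "M ~= 0" "!!i. i < n ==> M * y i = (\<Sum>b\<in>B. c b * b i)"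
  then show thesis by (rule that)
next
  show "\<not> independent_vectors n (insert y B)" if "y \<notin> B"
    using independent_vectors_card[of n "insert y B"] independent_vectors_card(1)[OF assms(1)] assms(2) that by auto
qed

text \<open>A nonzero multiple of \<open>y\<close> is an integral combination of a basis taken from
  \<open>L \<union> V\<close>, of which a functional vanishing on \<open>L\<close> only sees the
  members in \<open>V\<close>.\<close>

lemma separates_bound:
  assumes V: "finite V" and sep: "separates n (L \<union> V)"
  obtains C where "0 \<le> C" "!!\<eta>. (!!z. z \<in> L ==> pairing n \<eta> z = 0) ==>
    \<bar>pairing n \<eta> y\<bar> \<le> C * (\<Sum>v\<in>V. \<bar>pairing n \<eta> v\<bar>)"
proof -
  obtain B where B: "B \<subseteq> L \<union> V" "independent_vectors n B" "card B = n"
    using separates_maximal[OF sep independent_vectors_empty] by blast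
  obtain M c where M: "M ~= 0" "!!i. i < n ==> M * y i = (\<Sum>b\<in>B. c b * b i)"
    using independent_card_dependence[OF B(2,3)] by blast
  have fB: "finite B" by (rule independent_vectors_card[OF B(2)])
  let ?C = "\<Sum>b\<in>B. \<bar>real_of_int (c b)\<bar>"
  show ?thesis
  proof (rule that[of ?C])
    show C0: "0 \<le> ?C" by (intro sum_nonneg) simp
    fix \<eta> assume \<eta>: "!!z. z \<in> L ==> pairing n \<eta> z = 0"
    let ?S = "\<Sum>v\<in>V. \<bar>pairing n \<eta> v\<bar>"
    have b: "\<bar>pairing n \<eta> b\<bar> \<le> ?S" if "b \<in> B" for b
    proof (cases "b \<in> V")
      case True
      then show ?thesis using V by (intro member_le_sum) auto
    next
      case False
      then have "pairing n \<eta> b = 0" using \<eta> B(1) that by blast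
      then show ?thesis by (simp add: sum_nonneg)
    qed
    have "\<bar>pairing n \<eta> y\<bar> \<le> \<bar>real_of_int M\<bar> * \<bar>pairing n \<eta> y\<bar>"
    proof -
      have "1 \<le> \<bar>M\<bar>" using M(1) by simp
      then have "1 \<le> \<bar>real_of_int M\<bar>" by linarith
      then show ?thesis by (simp add: mult_le_cancel_right1)
    qed
    also have "... = \<bar>\<Sum>b\<in>B. real_of_int (c b) * pairing n \<eta> b\<bar>"
    proof -
      have "real_of_int M * pairing n \<eta> y = (\<Sum>b\<in>B. real_of_int (c b) * pairing n \<eta> b)"
        by (rule pairing_sum[OF M(2)])
      then show ?thesis by (simp add: abs_mult[symmetric])
    qed
    also have "... \<le> (\<Sum>b\<in>B. \<bar>real_of_int (c b) * pairing n \<eta> b\<bar>)" by (rule sum_abs)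
    also have "... \<le> (\<Sum>b\<in>B. \<bar>real_of_int (c b)\<bar> * ?S)"
      unfolding abs_mult by (intro sum_mono mult_left_mono b) auto
    finally show "\<bar>pairing n \<eta> y\<bar> \<le> ?C * ?S" by (simp add: sum_distrib_right)
  qed
qed

text \<open>On the moment curve \<open>1, t, t^2, ...\<close> a nonzero functional becomes a nonzero
  polynomial in \<open>t\<close>, so finitely many functionals exclude finitely many
  \<open>t\<close>.\<close>

lemma moment_vector:
  assumes "finite F" "!!\<zeta>. \<zeta> \<in> F ==> \<exists>i<n. \<zeta> i ~= 0"
  obtains v where "!!\<zeta>. \<zeta> \<in> F ==> pairing n \<zeta> v ~= 0"
proof -
  define p where "p \<zeta> = (\<Sum>i<n. monom (\<zeta> i) i)" for \<zeta> :: "nat => real"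
  have coeff: "coeff (p \<zeta>) i = \<zeta> i" if "i < n" for \<zeta> i
    using that by (simp add: p_def coeff_sum coeff_monom)
  have p: "pairing n \<zeta> (%i. int t ^ i) = poly (p \<zeta>) (real t)" for \<zeta> t
    by (simp add: pairing_def p_def poly_sum poly_monom)
  have "finite (\<Union>\<zeta>\<in>F. {x. poly (p \<zeta>) x = 0})"
  proof (intro finite_UN_I assms(1) poly_roots_finite)
    fix \<zeta> assume "\<zeta> \<in> F"
    then obtain i where "i < n" "\<zeta> i ~= 0" using assms(2) by blast
    then have "coeff (p \<zeta>) i ~= 0" using coeff by simp
    then show "p \<zeta> ~= 0" by auto
  qed
  then have "finite (real -` (\<Union>\<zeta>\<in>F. {x. poly (p \<zeta>) x = 0}))"
    by (intro finite_vimageI) (auto simp: inj_def)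
  then obtain t where "t \<notin> real -` (\<Union>\<zeta>\<in>F. {x. poly (p \<zeta>) x = 0})"
    using ex_new_if_finite infinite_UNIV_nat by blast
  then have "pairing n \<zeta> (%i. int t ^ i) ~= 0" if "\<zeta> \<in> F" for \<zeta>
    unfolding p using that by blast
  then show ?thesis using that by blast
qed

text \<open>For each \<open>L\<close> for which \<open>L \<union> V\<close> is not yet of full rank,
  some nonzero functional annihilates it. One vector on which all these functionals are nonzero
  raises all ranks at once.\<close>

lemma generic_vectors_aux:
  assumes "finite \<L>" "!!L. L \<in> \<L> ==> \<exists>S\<subseteq>L. independent_vectors n S & r L \<le> card S"
  shows "\<exists>V. finite V & card V \<le> j &
    (\<forall>L\<in>\<L>. \<exists>S\<subseteq>L \<union> V. independent_vectors n S & min n (r L + j) \<le> card S)"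
proof (induction j)
  case 0
  have "\<exists>S\<subseteq>L \<union> {}. independent_vectors n S & min n (r L + 0) \<le> card S" if "L \<in> \<L>" for L
    using assms(2)[OF that] by auto
  then show ?case by (intro exI[of _ "{}"]) simp
next
  case (Suc j)
  then obtain V where V: "finite V" "card V \<le> j"
    "!!L. L \<in> \<L> ==> \<exists>S\<subseteq>L \<union> V. independent_vectors n S & min n (r L + j) \<le> card S" by blast
  have "\<exists>\<zeta>. \<not> separates n (L \<union> V) --> (\<exists>i<n. \<zeta> i ~= 0) & (\<forall>z\<in>L \<union> V. pairing n \<zeta> z = 0)" for L
    unfolding separates_def by blast
  then have "\<exists>Z. \<forall>L. \<not> separates n (L \<union> V) --> (\<exists>i<n. Z L i ~= 0) & (\<forall>z\<in>L \<union> V. pairing n (Z L) z = 0)"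
    by (intro choice allI)
  then obtain Z where Z: "!!L. \<not> separates n (L \<union> V) ==> \<exists>i<n. Z L i ~= 0"
    "!!L z. \<not> separates n (L \<union> V) ==> z \<in> L \<union> V ==> pairing n (Z L) z = 0" by blast
  let ?F = "Z ` {L \<in> \<L>. \<not> separates n (L \<union> V)}"
  obtain v where v: "!!\<zeta>. \<zeta> \<in> ?F ==> pairing n \<zeta> v ~= 0"
    by (rule moment_vector[of ?F n]) (use assms(1) Z(1) in auto)
  have "\<exists>S\<subseteq>L \<union> insert v V. independent_vectors n S & min n (r L + Suc j) \<le> card S" if L: "L \<in> \<L>" for L
  proof (cases "separates n (L \<union> V)")
    case True
    then obtain B where "B \<subseteq> L \<union> V" "independent_vectors n B" "card B = n"
      using separates_maximal[OF True independent_vectors_empty] by blast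
    then show ?thesis by (intro exI[of _ B]) auto
  next
    case False
    obtain S where S: "S \<subseteq> L \<union> V" "independent_vectors n S" "min n (r L + j) \<le> card S"
      using V(3)[OF L] by blast
    have "pairing n (Z L) v ~= 0" using v False L by blast
    then have "v \<notin> S" "independent_vectors n (insert v S)"
      using independent_vectors_insert[OF S(2), of "Z L" v] Z(2)[OF False] S(1) by blast+
    then show ?thesis
      using S independent_vectors_card(1)[OF S(2)] by (intro exI[of _ "insert v S"]) auto
  qed
  moreover have "card (insert v V) \<le> Suc j" using V(1,2) by (simp add: card_insert_if)
  ultimately show ?case using V(1) by (intro exI[of _ "insert v V"]) auto
qed

text \<open>The empty set joins the family with rank 0; for it the conclusion says that
  \<open>V\<close> itself is independent of size \<open>p\<close>.\<close>

lemma generic_vectors: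
  assumes "finite \<L>" "!!L. L \<in> \<L> ==> \<exists>S\<subseteq>L. independent_vectors n S & n \<le> card S + p" and p: "p \<le> n"
  obtains V where "independent_vectors n V" "card V = p" "!!L. L \<in> \<L> ==> separates n (L \<union> V)"
proof -
  let ?r = "%L. if L = {} then 0 else n - p"
  have r: "\<exists>S\<subseteq>L. independent_vectors n S & ?r L \<le> card S" if "L \<in> insert {} \<L>" for L
  proof (cases "L = {}")
    case True
    then show ?thesis using independent_vectors_empty by (intro exI[of _ "{}"]) simp
  next
    case False
    with that have "L \<in> \<L>" by simp
    from assms(2)[OF this] obtain S where "S \<subseteq> L" "independent_vectors n S" "n \<le> card S + p"
      by (elim exE conjE)
    then show ?thesis using False by (intro exI[of _ S]) simp
  qed
  have "\<exists>V. finite V & card V \<le> p &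
      (\<forall>L\<in>insert {} \<L>. \<exists>S\<subseteq>L \<union> V. independent_vectors n S & min n (?r L + p) \<le> card S)"
    using assms(1) by (intro generic_vectors_aux r) simp_all
  then obtain V where V: "finite V" "card V \<le> p"
    "\<forall>L\<in>insert {} \<L>. \<exists>S\<subseteq>L \<union> V. independent_vectors n S & min n (?r L + p) \<le> card S"
    by (elim exE conjE) (rule that)
  note V3 = V(3)[rule_format]
  obtain S where S: "S \<subseteq> V" "independent_vectors n S" "p \<le> card S" using V3[of "{}"] p by auto
  then have "S = V" using V(1,2) by (intro card_seteq) auto
  moreover have "separates n (L \<union> V)" if L: "L \<in> \<L>" for L
  proof -
    obtain T where T: "T \<subseteq> L \<union> V" "independent_vectors n T" "n \<le> card T"
    proof (cases "L = {}")
      case True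
      then have "n \<le> p" using assms(2)[OF L] by auto
      then show ?thesis using S \<open>S = V\<close> that[of V] by auto
    next
      case False
      then show ?thesis using V3[of L] L p that by auto
    qed
    have "separates n T"
      by (rule independent_card_separates[OF T(2) le_antisym[OF independent_vectors_card(2)[OF T(2)] T(3)]])
    then show ?thesis using T(1) unfolding separates_def by blast
  qed
  ultimately show ?thesis using that[of V] S(2,3) V(2) by auto
qed

text \<open>\<open>V\<close> is extended to a basis \<open>B\<close>. As
  \<open>2 * card V \<le> n\<close>, each \<open>v\<close> gets its own partner \<open>u v\<close>
  in \<open>B - V\<close>, and its functional is proportional to the coordinate of
  \<open>u v\<close>.\<close>

lemma dual_vectors:
  assumes V: "independent_vectors n V" and p: "2 * card V \<le> n"
  obtains u \<xi> :: "(nat => int) => nat => int" where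
    "!!v w. v \<in> V ==> w \<in> V ==> (\<Sum>i<n. \<xi> v i * w i) = 0"
    "!!v w. v \<in> V ==> w \<in> V ==> v ~= w ==> (\<Sum>i<n. \<xi> v i * u w i) = 0"
    "!!v. v \<in> V ==> (\<Sum>i<n. \<xi> v i * u v i) ~= 0"
proof -
  have "separates n UNIV"
    unfolding separates_def
  proof (intro allI impI)
    fix \<zeta> i assume "\<forall>z\<in>UNIV. pairing n \<zeta> z = 0" "i < n"
    then show "\<zeta> i = 0" using pairing_unit_vector[of i n \<zeta>] by (simp only: UNIV_I simp_thms)
  qed
  then obtain B where B: "V \<subseteq> B" "independent_vectors n B" "card B = n"
    using separates_maximal[OF _ V] by blast
  have fB: "finite B" by (rule independent_vectors_card[OF B(2)])
  have "card V \<le> card (B - V)"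
    using B p fB card_Diff_subset[of V B] finite_subset[OF B(1) fB] by simp
  then obtain u where u: "inj_on u V" "u ` V \<subseteq> B - V"
    using fB B(1) finite_subset card_le_inj[of V "B - V"] by blast
  have sep: "separates n B" by (rule independent_card_separates[OF B(2,3)])
  have "\<exists>c. b \<in> B --> (\<forall>z\<in>B - {b}. (\<Sum>i<n. c i * z i) = 0) & (\<Sum>i<n. c i * b i) ~= (0 :: int)" for b
  proof (cases "b \<in> B")
    case True
    have "card (B - {b}) < n" using True fB B(3) by (metis card_Diff1_less)
    then obtain c where c: "\<exists>i\<in>{..<n}. c i ~= 0" "\<forall>z\<in>B - {b}. (\<Sum>i<n. c i * z i) = 0"
      using homogeneous_system[of "B - {b}" "{..<n}" "%z i. z i"] fB by auto
    have "(\<Sum>i<n. c i * b i) ~= 0"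
    proof
      assume "(\<Sum>i<n. c i * b i) = 0"
      then have "(\<Sum>i<n. c i * z i) = 0" if "z \<in> B" for z using c(2) that by blast
      then have "pairing n (%i. real_of_int (c i)) z = 0" if "z \<in> B" for z
        using that by (simp add: pairing_of_int)
      then show False using separatesD[OF sep, of "%i. real_of_int (c i)"] c(1) by auto
    qed
    then show ?thesis using c(2) by blast
  qed simp
  then have "\<exists>\<beta>. \<forall>b. b \<in> B --> (\<forall>z\<in>B - {b}. (\<Sum>i<n. \<beta> b i * z i) = 0) & (\<Sum>i<n. \<beta> b i * b i) ~= (0 :: int)"
    by (intro choice allI)
  then obtain \<beta> where \<beta>: "!!b z. b \<in> B ==> z \<in> B ==> z ~= b ==> (\<Sum>i<n. \<beta> b i * z i) = 0"
    "!!b. b \<in> B ==> (\<Sum>i<n. \<beta> b i * b i) ~= (0 :: int)" by blast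
  show ?thesis
  proof (rule that[of "%v. \<beta> (u v)" u])
    fix v w assume vw: "v \<in> V" "w \<in> V"
    show "(\<Sum>i<n. \<beta> (u v) i * w i) = 0" using vw u(2) B(1) by (intro \<beta>) auto
    show "(\<Sum>i<n. \<beta> (u v) i * u w i) = 0" if "v ~= w"
      using vw u that by (intro \<beta>) (auto dest: inj_onD)
  next
    show "(\<Sum>i<n. \<beta> (u v) i * u v i) ~= 0" if "v \<in> V" for v using that u(2) by (intro \<beta>) auto
  qed
qed

definition dot :: "nat => (nat => int) => (nat => int) => int" where
  "dot n \<xi> z = (\<Sum>i<n. \<xi> i * z i)"

text \<open>A product of transvections along the vectors of \<open>V\<close>, which commute if the
  functionals \<open>\<xi>\<close> vanish on \<open>V\<close>. The factor \<open>M\<close> makes the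
  increments realisable: \<open>M * v\<close> is the coordinate vector of a group element.\<close>

definition shear :: "nat => int => (nat => int) set => ((nat => int) => nat => int) => (nat => int) => nat => int" where
  "shear n M V \<xi> z = (%i. z i + (\<Sum>v\<in>V. dot n (\<xi> v) z * (M * v i)))"

lemma pairing_shear:
  assumes "finite V"
  shows "pairing n \<eta> (shear n M V \<xi> z) = pairing n \<eta> z + (\<Sum>v\<in>V. of_int (M * dot n (\<xi> v) z) * pairing n \<eta> v)"
proof -
  have "pairing n \<eta> (shear n M V \<xi> z)
      = pairing n \<eta> z + (\<Sum>i<n. \<Sum>v\<in>V. of_int (M * dot n (\<xi> v) z) * (\<eta> i * of_int (v i)))"
    unfolding pairing_def shear_def sum.distrib[symmetric]
    by (intro sum.cong) (auto simp: algebra_simps sum_distrib_left)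
  also have "(\<Sum>i<n. \<Sum>v\<in>V. of_int (M * dot n (\<xi> v) z) * (\<eta> i * of_int (v i)))
      = (\<Sum>v\<in>V. of_int (M * dot n (\<xi> v) z) * pairing n \<eta> v)"
    unfolding pairing_def sum_distrib_left by (rule sum.swap)
  finally show ?thesis .
qed

text \<open>On the kernel of \<open>L\<close> every functional is controlled by its values on \<open>V\<close>, and a large multiple
  of the shear moves the values on the dual vectors \<open>u v\<close> by much more than that control allows.\<close>

lemma generic_shear:
  assumes \<L>: "finite \<L>" "!!L. L \<in> \<L> ==> \<exists>S\<subseteq>L. independent_vectors n S & n \<le> 2 * card S" and M: "0 < M"
  obtains V \<xi> where "finite V" "!!v w. v \<in> V ==> w \<in> V ==> dot n (\<xi> v) w = 0"
    "\<forall>L\<in>\<L>. \<forall>L'\<in>\<L>. \<forall>\<eta>. (\<forall>z\<in>L. pairing n \<eta> (shear n M V \<xi> z) = 0) -->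
      (\<forall>z\<in>L'. pairing n \<eta> z = 0) --> (\<forall>i<n. \<eta> i = 0)"
proof -
  \<comment> \<open>Small enough for dual vectors to exist, and large enough to complete every
    \<open>L\<close>, since \<open>n \<le> 2 * card S\<close> gives
    \<open>n - card S \<le> n div 2\<close>.\<close>
  define p where "p = n div 2"
  have r: "\<exists>S\<subseteq>L. independent_vectors n S & n \<le> card S + p" if L: "L \<in> \<L>" for L
  proof -
    obtain S where "S \<subseteq> L" "independent_vectors n S" "n \<le> 2 * card S" using \<L>(2)[OF L] by (elim exE conjE)
    then show ?thesis unfolding p_def by (intro exI[of _ S]) auto
  qed
  obtain V where V: "independent_vectors n V" "card V = p" "!!L. L \<in> \<L> ==> separates n (L \<union> V)"
    using generic_vectors[OF \<L>(1) r] by (auto simp: p_def)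
  have Vp: "2 * card V \<le> n" using V(2) by (simp add: p_def)
  obtain u \<xi> where \<xi>: "!!v w. v \<in> V ==> w \<in> V ==> dot n (\<xi> v) w = 0"
    "!!v w. v \<in> V ==> w \<in> V ==> v ~= w ==> dot n (\<xi> v) (u w) = 0"
    "!!v. v \<in> V ==> dot n (\<xi> v) (u v) ~= 0"
    by (rule dual_vectors[folded dot_def, OF V(1) Vp]) (rule that)
  have fV: "finite V" by (rule independent_vectors_card[OF V(1)])
  let ?T = "%\<eta>. \<Sum>v\<in>V. \<bar>pairing n \<eta> v\<bar>"
  have "\<exists>C. fst x \<in> \<L> --> 0 \<le> C & (\<forall>\<eta>. (\<forall>z\<in>fst x. pairing n \<eta> z = 0) --> \<bar>pairing n \<eta> (u (snd x))\<bar> \<le> C * ?T \<eta>)" for x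
  proof (cases "fst x \<in> \<L>")
    case True
    obtain C where "0 \<le> C" "!!\<eta>. (!!z. z \<in> fst x ==> pairing n \<eta> z = 0) ==> \<bar>pairing n \<eta> (u (snd x))\<bar> \<le> C * ?T \<eta>"
      using separates_bound[OF fV V(3)[OF True], of "u (snd x)"] by blast
    then show ?thesis by (intro exI[of _ C]) simp
  qed simp
  then have "\<exists>C. \<forall>x. fst x \<in> \<L> --> 0 \<le> C x & (\<forall>\<eta>. (\<forall>z\<in>fst x. pairing n \<eta> z = 0) --> \<bar>pairing n \<eta> (u (snd x))\<bar> \<le> C x * ?T \<eta>)"
    by (intro choice allI)
  then obtain C where C: "\<forall>x. fst x \<in> \<L> --> 0 \<le> C x & (\<forall>\<eta>. (\<forall>z\<in>fst x. pairing n \<eta> z = 0) --> \<bar>pairing n \<eta> (u (snd x))\<bar> \<le> C x * ?T \<eta>)" ..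
  define D where "D = (\<Sum>x\<in>\<L> \<times> V. C x)"
  have D0: "0 \<le> D" unfolding D_def by (intro sum_nonneg) (use C in auto)
  have T0: "0 \<le> ?T \<eta>" for \<eta> by (intro sum_nonneg) simp
  have bound: "\<bar>pairing n \<eta> (u v)\<bar> \<le> D * ?T \<eta>"
    if "L \<in> \<L>" "v \<in> V" "!!z. z \<in> L ==> pairing n \<eta> z = 0" for L v \<eta>
  proof -
    have "\<bar>pairing n \<eta> (u v)\<bar> \<le> C (L, v) * ?T \<eta>" using C[rule_format, of "(L, v)"] that by simp
    also have "C (L, v) \<le> D"
      unfolding D_def using that \<L>(1) fV C by (intro member_le_sum) auto
    finally show ?thesis using T0[of \<eta>] by (simp add: mult_right_mono)
  qed
  \<comment> \<open>Each of the \<open>p\<close> values on \<open>V\<close> will be at most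
    \<open>2 * D / N\<close> times their total \<open>?T \<eta>\<close>; beyond
    \<open>2 * D * p\<close> this forces the total to vanish.\<close>
  obtain N :: nat where N: "2 * D * p < N" using reals_Archimedean2 by blast
  let ?\<xi> = "%v i. int N * \<xi> v i"
  have dN: "dot n (?\<xi> v) z = int N * dot n (\<xi> v) z" for v z
    by (simp add: dot_def sum_distrib_left mult.assoc)
  show ?thesis
  proof (rule that[of V ?\<xi>])
    show "finite V" by (rule fV)
    show "dot n (?\<xi> v) w = 0" if "v \<in> V" "w \<in> V" for v w using \<xi>(1)[OF that] dN by simp
    show "\<forall>L\<in>\<L>. \<forall>L'\<in>\<L>. \<forall>\<eta>. (\<forall>z\<in>L. pairing n \<eta> (shear n M V ?\<xi> z) = 0) -->
        (\<forall>z\<in>L'. pairing n \<eta> z = 0) --> (\<forall>i<n. \<eta> i = 0)"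
    proof (intro ballI allI impI)
      fix L L' \<eta> i assume L: "L \<in> \<L>" "L' \<in> \<L>" and zs: "\<forall>z\<in>L. pairing n \<eta> (shear n M V ?\<xi> z) = 0"
        "\<forall>z\<in>L'. pairing n \<eta> z = 0" and i: "i < n"
      note z = zs(1)[rule_format] and z' = zs(2)[rule_format]
      \<comment> \<open>The pullback of \<open>\<eta>\<close> under the shear. It agrees with
        \<open>\<eta>\<close> on \<open>V\<close>, so the bound for \<open>\<eta>'\<close>, which
        vanishes on \<open>L\<close>, and the bound for \<open>\<eta>\<close>, which vanishes on
        \<open>L'\<close>, have the same right-hand side.\<close>
      define \<eta>' where "\<eta>' i = \<eta> i + (\<Sum>v\<in>V. of_int (M * ?\<xi> v i) * pairing n \<eta> v)" for i
      have \<eta>': "pairing n \<eta>' z = pairing n \<eta> (shear n M V ?\<xi> z)" for z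
      proof -
        have "pairing n \<eta>' z = pairing n \<eta> z + (\<Sum>i<n. \<Sum>v\<in>V. of_int (M * ?\<xi> v i) * pairing n \<eta> v * of_int (z i))"
          unfolding \<eta>'_def pairing_def[of n _ z] sum.distrib[symmetric]
          by (intro sum.cong) (auto simp: algebra_simps sum_distrib_left sum_distrib_right)
        also have "(\<Sum>i<n. \<Sum>v\<in>V. of_int (M * ?\<xi> v i) * pairing n \<eta> v * of_int (z i))
            = (\<Sum>v\<in>V. \<Sum>i<n. of_int (M * ?\<xi> v i) * pairing n \<eta> v * of_int (z i))"
          by (rule sum.swap)
        also have "... = (\<Sum>v\<in>V. of_int (M * dot n (?\<xi> v) z) * pairing n \<eta> v)"
          unfolding dot_def of_int_mult of_int_sum sum_distrib_left sum_distrib_right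
          by (intro sum.cong HOL.refl) (simp add: mult_ac)
        finally show ?thesis unfolding pairing_shear[OF fV] .
      qed
      have \<eta>V: "pairing n \<eta>' w = pairing n \<eta> w" if "w \<in> V" for w
        unfolding \<eta>' pairing_shear[OF fV] dN using \<xi>(1)[OF _ that] by simp
      have T: "?T \<eta>' = ?T \<eta>" using \<eta>V by (intro sum.cong) auto
      have "N * \<bar>pairing n \<eta> v\<bar> \<le> 2 * D * ?T \<eta>" if v: "v \<in> V" for v
      proof -
        have "pairing n \<eta>' (u v) = pairing n \<eta> (u v) + (\<Sum>w\<in>{v}. of_int (M * dot n (?\<xi> w) (u v)) * pairing n \<eta> w)"
          unfolding \<eta>' pairing_shear[OF fV] dN using \<xi>(2)[OF _ v] v fV
          by (intro arg_cong2[where f = "(+)"] HOL.refl sum.mono_neutral_right) auto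
        then have e: "N * (of_int (M * dot n (\<xi> v) (u v)) * pairing n \<eta> v) = pairing n \<eta>' (u v) - pairing n \<eta> (u v)"
          by (simp add: dN mult_ac)
        have "1 \<le> \<bar>M * dot n (\<xi> v) (u v)\<bar>" using M \<xi>(3)[OF v] by (metis abs_ge_zero int_one_le_iff_zero_less mult_eq_0_iff order_less_le zero_less_abs_iff)
        then have "1 \<le> \<bar>real_of_int (M * dot n (\<xi> v) (u v))\<bar>" by linarith
        then have "N * \<bar>pairing n \<eta> v\<bar> \<le> N * (\<bar>real_of_int (M * dot n (\<xi> v) (u v))\<bar> * \<bar>pairing n \<eta> v\<bar>)"
          by (intro mult_left_mono) (simp_all add: mult_le_cancel_right1)
        also have "... = \<bar>pairing n \<eta>' (u v) - pairing n \<eta> (u v)\<bar>"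
          unfolding e[symmetric] abs_mult by simp
        also have "... \<le> \<bar>pairing n \<eta>' (u v)\<bar> + \<bar>pairing n \<eta> (u v)\<bar>" by (rule abs_triangle_ineq4)
        also have "... \<le> D * ?T \<eta>' + D * ?T \<eta>"
          using bound[OF L(1) v, of \<eta>'] bound[OF L(2) v z'] z \<eta>' by (intro add_mono) auto
        finally show ?thesis unfolding T by simp
      qed
      then have "(\<Sum>v\<in>V. N * \<bar>pairing n \<eta> v\<bar>) \<le> (\<Sum>v\<in>V. 2 * D * ?T \<eta>)" by (rule sum_mono)
      then have "N * ?T \<eta> \<le> 2 * D * p * ?T \<eta>" using V(2) by (simp add: sum_distrib_left mult_ac)
      then have "?T \<eta> \<le> 0" using N by (simp add: mult_le_cancel_right)
      then have "?T \<eta> = 0" using T0[of \<eta>] by linarith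
      then have "pairing n \<eta> v = 0" if "v \<in> V" for v
        using that fV by (simp add: sum_nonneg_eq_0_iff)
      then show "\<eta> i = 0" using separatesD[OF V(3)[OF L(2)], of \<eta> i] z' i by blast
    qed
  qed
qed

section \<open>Coordinates on a finitely generated abelian group\<close>

definition power_prod :: "('a, 'b) monoid_scheme => 'a set => ('a => int) => 'a" where
  "power_prod A S c = finprod A (%s. s [^]\<^bsub>A\<^esub> c s) S"

lemma int_independent_iff: "int_independent A S \<longleftrightarrow> S \<subseteq> carrier A & finite S &
    (\<forall>c. power_prod A S c = \<one>\<^bsub>A\<^esub> --> (\<forall>s\<in>S. c s = 0))"
  by (simp add: int_independent_def power_prod_def)

context comm_group
begin

lemma power_prod_closed [simp]: "S \<subseteq> carrier G ==> power_prod G S c \<in> carrier G"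
  unfolding power_prod_def by (intro finprod_closed) auto

lemma power_prod_add:
  "S \<subseteq> carrier G ==> power_prod G S (%s. c s + d s) = power_prod G S c \<otimes> power_prod G S d"
  unfolding power_prod_def
  by (subst finprod_multf[symmetric]) (auto intro!: finprod_cong' simp: int_pow_mult)

lemma power_prod_insert:
  "finite S ==> y \<notin> S ==> insert y S \<subseteq> carrier G ==> power_prod G (insert y S) c = y [^] c y \<otimes> power_prod G S c"
  unfolding power_prod_def by (subst finprod_insert) auto

lemma power_prod_cong:
  "S \<subseteq> carrier G ==> (!!s. s \<in> S ==> c s = d s) ==> power_prod G S c = power_prod G S d"
  unfolding power_prod_def by (intro finprod_cong') auto

lemma power_prod_power:
  assumes "finite S" "S \<subseteq> carrier G"
  shows "power_prod G S (%s. k * c s) = power_prod G S c [^] (k :: int)"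
  using assms
proof (induction S rule: finite_induct)
  case (insert s S)
  then show ?case
    by (simp add: power_prod_insert int_pow_distrib int_pow_pow mult.commute)
qed (simp add: power_prod_def)

lemma power_prod_zero: "S \<subseteq> carrier G ==> (!!s. s \<in> S ==> c s = 0) ==> power_prod G S c = \<one>"
  unfolding power_prod_def by (intro finprod_one_eqI) auto

lemma power_prod_single:
  assumes "finite S" "S \<subseteq> carrier G" "y \<in> S"
  shows "power_prod G S (%s. if s = y then k else 0) = y [^] k"
proof -
  have "power_prod G (insert y (S - {y})) (%s. if s = y then k else 0) = y [^] k"
  proof -
    have "power_prod G (S - {y}) (%s. if s = y then k else 0) = \<one>"
      by (rule power_prod_zero) (use assms in auto)
    then show ?thesis using assms by (subst power_prod_insert) auto
  qed
  then show ?thesis using assms(3) by (simp add: insert_absorb)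
qed

lemma additive_int_pow: "additive G \<chi> ==> g \<in> carrier G ==> \<chi> (g [^] (k :: int)) = of_int k * \<chi> g"
proof (induction k rule: int_induct[where k = 0])
  case (step1 i)
  have "g [^] (i + 1) = g [^] i \<otimes> g" using int_pow_mult[of g i 1] step1 by simp
  then show ?case using step1 additiveD[of \<chi> "g [^] i" g] by (simp add: algebra_simps)
next
  case (step2 i)
  have "g [^] (i - 1) = g [^] i \<otimes> inv g"
    using int_pow_diff[of g i 1] step2 by simp
  then show ?case using step2 additiveD[of \<chi> "g [^] i" "inv g"] additive_inv[of \<chi> g] by (simp add: algebra_simps)
qed (simp add: additive_one)

lemma additive_power_prod:
  assumes \<chi>: "additive G \<chi>" and "finite S" "S \<subseteq> carrier G"
  shows "\<chi> (power_prod G S c) = (\<Sum>s\<in>S. of_int (c s) * \<chi> s)"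
  using assms(2,3)
proof (induction S rule: finite_induct)
  case (insert s S)
  then show ?case
    using additiveD[OF \<chi>, of "s [^] c s" "power_prod G S c"]
    by (simp add: power_prod_insert additive_int_pow[OF \<chi>])
qed (simp add: power_prod_def additive_one[OF \<chi>])

end

text \<open>The \<open>M\<close>-th power of \<open>q\<close> is \<open>\<Prod> s\<^sub>i ^ E q i\<close>, for a maximal independent family \<open>s\<close>.\<close>

locale coordinates = comm_group G for G (structure) +
  fixes n :: nat and E :: "'a => nat => int" and s :: "nat => 'a" and M :: int
  assumes s_closed: "i < n ==> s i \<in> carrier G"
    and M_pos: "0 < M"
    and E_mult: "g \<in> carrier G ==> h \<in> carrier G ==> E (g \<otimes> h) i = E g i + E h i"
    and E_s: "i < n ==> j < n ==> E (s i) j = (if j = i then M else 0)"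
    and additive_E: "additive G \<chi> ==> g \<in> carrier G ==> of_int M * \<chi> g = (\<Sum>i<n. of_int (E g i) * \<chi> (s i))"
    and torsion_E: "g \<in> carrier G ==> (!!i. i < n ==> E g i = 0) ==> g [^] M = \<one>"
    and finite_E: "finite {g \<in> carrier G. \<forall>i<n. E g i = 0}"

text \<open>For a maximal independent set \<open>S\<close> of generators, each generator has a
  positive power that is a product over \<open>S\<close>. The product \<open>M\<close> of these
  exponents serves all elements, and independence makes the exponents of \<open>g [^] M\<close>
  unique, hence additive in \<open>g\<close>.\<close>

lemma (in generators) coordinates_exist:
  assumes comm: "comm_group G" and fin: "finite X" and gen: "carrier G = wv ` words X"
  obtains n E s M where "coordinates G n E s M"
proof -
  interpret comm_group G by fact
  let ?Y = "f ` X"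
  have Y: "finite ?Y" "?Y \<subseteq> carrier G" using fin generator_closed by auto
  have fs: "finite S" if "S \<subseteq> ?Y" for S using finite_subset[OF that Y(1)] .
  have "int_independent G {}" by (simp add: int_independent_iff power_prod_def)
  then have "\<exists>S. (S \<subseteq> ?Y & int_independent G S) & (\<forall>T. T \<subseteq> ?Y & int_independent G T --> card T \<le> card S)"
    by (intro ex_has_greatest_nat[of _ "{}" card "Suc (card ?Y)"]) (use card_mono[OF Y(1)] in \<open>auto simp: less_Suc_eq_le\<close>)
  then obtain S where S: "S \<subseteq> ?Y" "int_independent G S"
    and max: "!!T. T \<subseteq> ?Y ==> int_independent G T ==> card T \<le> card S" by blast
  note fS = fs[OF S(1)]
  have Sc: "S \<subseteq> carrier G" using S(1) Y(2) by blast
  have ind: "c y = 0" if "power_prod G S c = \<one>" "y \<in> S" for c y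
    using S(2) that unfolding int_independent_iff by blast
  have "\<exists>(m :: int) c. 0 < m & y [^] m = power_prod G S c" if y: "y \<in> ?Y" for y :: 'a
  proof (cases "y \<in> S")
    case True
    then show ?thesis
      using power_prod_single[OF fS Sc True, of 1]
      by (intro exI[of _ "1 :: int"] exI[of _ "%s. if s = y then 1 else 0"]) simp
  next
    case False
    have yc: "y \<in> carrier G" using y Y(2) by blast
    have "\<not> int_independent G (insert y S)"
      using max[of "insert y S"] y S(1) False fS by auto
    then obtain c z where c: "power_prod G (insert y S) c = \<one>" "z \<in> insert y S" "c z ~= 0"
      using yc Sc fS unfolding int_independent_iff by auto
    have rel: "y [^] c y \<otimes> power_prod G S c = \<one>"
      using c(1) fS False Sc yc by (simp add: power_prod_insert)
    have cy: "c y ~= 0"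
    proof
      assume "c y = 0"
      then have "power_prod G S c = \<one>" using rel Sc by simp
      then show False using ind c(2,3) \<open>c y = 0\<close> by blast
    qed
    have e1: "y [^] (- c y) = power_prod G S c"
      using rel yc Sc inv_equality[of "power_prod G S c" "y [^] c y"] m_comm[of "y [^] c y" "power_prod G S c"]
      by (simp add: int_pow_neg)
    have e2: "y [^] c y = power_prod G S (%s. - c s)"
    proof -
      have "y [^] c y = inv (inv (y [^] c y))" using yc by simp
      also have "... = inv (power_prod G S c)" using e1 yc by (simp add: int_pow_neg)
      also have "... = power_prod G S (%s. - c s)"
        using power_prod_power[OF fS Sc, of "-1" c] Sc by (simp add: int_pow_neg)
      finally show ?thesis .
    qed
    show ?thesis
    proof (cases "0 < c y")
      case True
      then show ?thesis using e2 by blast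
    next
      case False
      then have "0 < - c y" using cy by simp
      then show ?thesis using e1 by blast
    qed
  qed
  then have "\<exists>m. y \<in> ?Y --> 0 < m & (\<exists>c. y [^] (m :: int) = power_prod G S c)" for y by blast
  then have "\<exists>m. \<forall>y. y \<in> ?Y --> 0 < m y & (\<exists>c. y [^] (m y :: int) = power_prod G S c)"
    by (intro choice allI)
  then obtain m :: "'a => int" where m: "!!y. y \<in> ?Y ==> 0 < m y" "!!y. y \<in> ?Y ==> \<exists>c. y [^] m y = power_prod G S c"
    by blast
  define M where "M = prod m ?Y"
  have M: "0 < M" unfolding M_def using m(1) by (intro prod_pos) auto
  have YM: "\<exists>c. y [^] M = power_prod G S c" if y: "y \<in> ?Y" for y
  proof -
    obtain c where c: "y [^] m y = power_prod G S c" using m(2)[OF y] by blast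
    have "M = m y * prod m (?Y - {y})" unfolding M_def using Y(1) y by (rule prod.remove)
    then have "y [^] M = (y [^] m y) [^] prod m (?Y - {y})"
      using y Y(2) by (auto simp: int_pow_pow)
    also have "... = power_prod G S (%s. prod m (?Y - {y}) * c s)"
      unfolding c by (rule power_prod_power[OF fS Sc, symmetric])
    finally show ?thesis by blast
  qed
  have prod_Y: "\<exists>a. wv w = power_prod G ?Y a" if "w \<in> words X" for w
    using that
  proof (induction w)
    case Nil
    then show ?case using power_prod_zero[OF Y(2), of "%_. 0"] by (intro exI[of _ "%_. 0"]) simp
  next
    case (Cons t w)
    then obtain a where a: "wv w = power_prod G ?Y a" by auto
    have t: "f (fst t) \<in> ?Y" using Cons.prems by simp
    have "lv t = power_prod G ?Y (%y. if y = f (fst t) then (if snd t then 1 else - 1) else 0)"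
      unfolding power_prod_single[OF Y t] letter_val_def using Y(2) t by (auto simp: int_pow_neg)
    then have "wv (t # w) = power_prod G ?Y (%y. (if y = f (fst t) then (if snd t then 1 else - 1) else 0) + a y)"
      using a power_prod_add[OF Y(2)] by simp
    then show ?case by blast
  qed
  have gY: "\<exists>a. g = power_prod G ?Y a" if "g \<in> carrier G" for g using that prod_Y gen by auto
  have pM: "\<exists>c. power_prod G T a [^] M = power_prod G S c" if "T \<subseteq> ?Y" for T a
    using fs[OF that] that
  proof (induction T rule: finite_induct)
    case empty
    show ?case using power_prod_zero[OF Sc, of "%_. 0"] by (intro exI[of _ "%_. 0"]) (simp add: power_prod_def)
  next
    case (insert y T)
    then obtain c where c: "power_prod G T a [^] M = power_prod G S c" by auto
    obtain d where d: "y [^] M = power_prod G S d" using YM insert.prems by blast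
    have yc: "y \<in> carrier G" "T \<subseteq> carrier G" using insert.prems Y(2) by auto
    have "power_prod G (insert y T) a [^] M = (y [^] a y) [^] M \<otimes> power_prod G T a [^] M"
      using insert.hyps yc by (simp add: power_prod_insert int_pow_distrib)
    also have "(y [^] a y) [^] M = (y [^] M) [^] a y" using yc by (simp add: int_pow_pow mult.commute)
    also have "... = power_prod G S (%s. a y * d s)" unfolding d by (rule power_prod_power[OF fS Sc, symmetric])
    finally have "power_prod G (insert y T) a [^] M = power_prod G S (%s. a y * d s + c s)"
      unfolding c power_prod_add[OF Sc] .
    then show ?case by blast
  qed
  have gM: "\<exists>c. g [^] M = power_prod G S c" if "g \<in> carrier G" for g
    using gY[OF that] pM[OF subset_refl] by blast
  define e where "e g = (SOME c. g [^] M = power_prod G S c)" for g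
  have e: "g [^] M = power_prod G S (e g)" if "g \<in> carrier G" for g
    unfolding e_def using gM[OF that] by (rule someI_ex)
  have inj: "c y = d y" if "power_prod G S c = power_prod G S d" "y \<in> S" for c d y
  proof -
    have "power_prod G S (%s. c s + - 1 * d s) = \<one>"
      unfolding power_prod_add[OF Sc] power_prod_power[OF fS Sc] that(1)
      using Sc by (simp add: int_pow_neg r_inv)
    then show ?thesis using ind[of "%s. c s + - 1 * d s" y] that(2) by simp
  qed
  obtain s where s: "bij_betw s {0..<card S} S"
    using ex_bij_betw_nat_finite[OF fS] by blast
  have sS: "s i \<in> S" if "i < card S" for i using s that by (auto simp: bij_betw_def)
  have s_inj: "s i = s j \<longleftrightarrow> i = j" if "i < card S" "j < card S" for i j
    using s that by (auto simp: bij_betw_def inj_on_def)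
  have sum_s: "(\<Sum>i<card S. F (s i)) = (\<Sum>y\<in>S. F y)" for F :: "'a => real"
    using sum.reindex_bij_betw[OF s, of F] by (simp add: atLeast0LessThan)
  have zero: "e g y = 0" if z: "!!i. i < card S ==> e g (s i) = 0" and y: "y \<in> S" for g y
  proof -
    have "y \<in> s ` {0..<card S}" using s y by (simp add: bij_betw_def)
    then show ?thesis using z by auto
  qed
  have torsion: "g [^] M = \<one>" if "g \<in> carrier G" "!!i. i < card S ==> e g (s i) = 0" for g
    unfolding e[OF that(1)] using zero[OF that(2)] by (intro power_prod_zero[OF Sc])
  have "coordinates G (card S) (%g i. if i < card S then e g (s i) else 0) s M"
  proof (unfold_locales, goal_cases)
    case (1 i)
    then show ?case using sS Sc by blast
  next
    case 2
    show ?case by (rule M)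
  next
    case (3 g h i)
    then have "power_prod G S (e (g \<otimes> h)) = power_prod G S (%y. e g y + e h y)"
      unfolding power_prod_add[OF Sc] by (simp add: e[symmetric] int_pow_distrib)
    then show ?case using inj sS by auto
  next
    case (4 i j)
    then have "power_prod G S (e (s i)) = power_prod G S (%y. if y = s i then M else 0)"
      using sS[of i] Sc by (auto simp: power_prod_single[OF fS Sc] e[symmetric])
    from inj[OF this sS[OF 4(2)]] show ?case using s_inj[OF 4(2,1)] 4 by simp
  next
    case (5 \<chi> g)
    then have "of_int M * \<chi> g = (\<Sum>y\<in>S. of_int (e g y) * \<chi> y)"
      unfolding additive_int_pow[OF 5, symmetric] e[OF 5(2)] by (intro additive_power_prod fS Sc)
    then show ?case unfolding sum_s[of "%y. of_int (e g y) * \<chi> y", symmetric] by simp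
  next
    case (6 g)
    then show ?case by (intro torsion) auto
  next
    case 7
    let ?K = "{g \<in> carrier G. \<forall>i<card S. (if i < card S then e g (s i) else 0) = 0}"
    have Kt: "g [^] M = \<one>" if "g \<in> ?K" for g using that by (intro torsion) auto
    let ?R = "PiE ?Y (%_. {0..<M})"
    define a where "a g = (SOME a. g = power_prod G ?Y a)" for g
    have a: "g = power_prod G ?Y (a g)" if "g \<in> carrier G" for g
      unfolding a_def using gY[OF that] by (rule someI_ex)
    \<comment> \<open>Exponents over the generators are reduced modulo \<open>M\<close>. The
      discarded part is an \<open>M\<close>-th power, hence a product over \<open>S\<close>; among
      elements killed by \<open>M\<close> it is determined by the reduced exponents, which leaves
      finitely many elements.\<close>
    define \<rho> where "\<rho> g = (\<lambda>y\<in>?Y. a g y mod M)" for g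
    have "inj_on \<rho> ?K"
    proof (rule inj_onI)
      fix g h assume gh: "g \<in> ?K" "h \<in> ?K" "\<rho> g = \<rho> h"
      have dec: "\<exists>c. k = power_prod G ?Y (\<rho> k) \<otimes> power_prod G S c" if "k \<in> carrier G" for k
      proof -
        have "k = power_prod G ?Y (%y. \<rho> k y + M * (a k y div M))"
          using a[OF that] by (subst power_prod_cong[OF Y(2), of _ "a k"]) (auto simp: \<rho>_def)
        also have "... = power_prod G ?Y (\<rho> k) \<otimes> power_prod G ?Y (%y. a k y div M) [^] M"
          unfolding power_prod_add[OF Y(2)] power_prod_power[OF Y] ..
        finally show ?thesis using pM[OF subset_refl] by metis
      qed
      obtain c where c: "g = power_prod G ?Y (\<rho> g) \<otimes> power_prod G S c" using dec gh(1) by blast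
      obtain d where d: "h = power_prod G ?Y (\<rho> g) \<otimes> power_prod G S d" using dec gh(2,3) by auto
      let ?r = "power_prod G ?Y (\<rho> g)"
      have rc: "?r \<in> carrier G" using Y(2) by simp
      have "?r [^] M \<otimes> power_prod G S c [^] M = ?r [^] M \<otimes> power_prod G S d [^] M"
        using Kt[OF gh(1)] Kt[OF gh(2)] c d rc Sc by (metis int_pow_distrib power_prod_closed)
      then have "power_prod G S (%s. M * c s) = power_prod G S (%s. M * d s)"
        using rc Sc by (simp add: power_prod_power[OF fS Sc])
      then have "M * c y = M * d y" if "y \<in> S" for y using inj that by blast
      then have "c y = d y" if "y \<in> S" for y using M that by simp
      then show "g = h" using c d power_prod_cong[OF Sc, of c d] by simp
    qed
    moreover have "\<rho> ` ?K \<subseteq> ?R" using M by (auto simp: \<rho>_def)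
    moreover have "finite ?R" using Y(1) by (intro finite_PiE) auto
    ultimately show ?case by (meson inj_on_finite)
  qed
  then show ?thesis by (rule that)
qed

section \<open>Subgroups, ranks and automorphisms in coordinates\<close>

lemma (in comm_group) subgroup_imp_comm_group:
  assumes "subgroup C G"
  shows "comm_group (G\<lparr>carrier := C\<rparr>)"
  using subgroup.subset[OF assms] m_comm
  by (intro group.group_comm_groupI subgroup.subgroup_is_group[OF assms] group_axioms) auto

lemma (in comm_group) finprod_subgroup:
  assumes "subgroup C G" "finite S" "F \<in> S \<rightarrow> C"
  shows "finprod (G\<lparr>carrier := C\<rparr>) F S = finprod G F S"
  using assms(2,3)
proof (induction S rule: finite_induct)
  case empty
  interpret C: comm_group "G\<lparr>carrier := C\<rparr>" by (rule subgroup_imp_comm_group[OF assms(1)])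
  show ?case by simp
next
  case (insert x S)
  interpret C: comm_group "G\<lparr>carrier := C\<rparr>" by (rule subgroup_imp_comm_group[OF assms(1)])
  have "finprod (G\<lparr>carrier := C\<rparr>) F (insert x S) = F x \<otimes> finprod (G\<lparr>carrier := C\<rparr>) F S"
    using insert by (subst C.finprod_insert) auto
  also have "... = finprod G F (insert x S)"
    using insert subgroup.subset[OF assms(1)] by (subst finprod_insert) auto
  finally show ?case .
qed

lemma (in comm_group) int_independent_subgroup:
  assumes C: "subgroup C G"
  shows "int_independent (G\<lparr>carrier := C\<rparr>) S \<longleftrightarrow> S \<subseteq> C & int_independent G S"
proof -
  have "power_prod (G\<lparr>carrier := C\<rparr>) S c = power_prod G S c" if S: "S \<subseteq> C" "finite S" for c
  proof -
    have "(%s. s [^]\<^bsub>G\<lparr>carrier := C\<rparr>\<^esub> c s) s = s [^] c s" if "s \<in> S" for s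
      using int_pow_consistent[OF C, of s "c s"] that S(1) by auto
    moreover have "s [^] c s \<in> C" if "s \<in> S" for s
      using that S(1) C subgroup_int_pow_closed by blast
    ultimately have "finprod (G\<lparr>carrier := C\<rparr>) (%s. s [^]\<^bsub>G\<lparr>carrier := C\<rparr>\<^esub> c s) S
        = finprod (G\<lparr>carrier := C\<rparr>) (%s. s [^] c s) S"
      by (intro comm_monoid.finprod_cong' comm_group.axioms(1) subgroup_imp_comm_group[OF C]) auto
    also have "... = finprod G (%s. s [^] c s) S"
      using S subgroup_int_pow_closed[OF C] by (intro finprod_subgroup[OF C]) auto
    finally show ?thesis unfolding power_prod_def .
  qed
  then show ?thesis
    unfolding int_independent_iff using subgroup.subset[OF C] by auto
qed

context coordinates
begin

lemma E_additive: "additive G (%g. real_of_int (E g i))"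
  by (simp add: additive_def E_mult)

lemma E_one: "E \<one> i = 0"
  using additive_one[OF E_additive, of i] by simp

lemma E_inv: "g \<in> carrier G ==> E (inv g) i = - E g i"
  using additive_inv[OF E_additive, of g i] by (simp flip: of_int_minus)

lemma E_int_pow: "g \<in> carrier G ==> E (g [^] (k :: int)) i = k * E g i"
  using additive_int_pow[OF E_additive, of g k i] by (simp flip: of_int_mult)

lemma E_finprod:
  assumes "finite S" "F \<in> S \<rightarrow> carrier G"
  shows "E (finprod G F S) i = (\<Sum>x\<in>S. E (F x) i)"
  using assms
proof (induction S rule: finite_induct)
  case (insert x S)
  then show ?case by (simp add: E_mult)
qed (simp add: E_one)

lemma E_power_prod:
  assumes "finite S" "S \<subseteq> carrier G"
  shows "E (power_prod G S c) i = (\<Sum>x\<in>S. c x * E x i)"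
  unfolding power_prod_def using assms
  by (subst E_finprod) (auto simp: E_int_pow subset_iff intro!: sum.cong)

text \<open>A relation between coordinate vectors only makes a product torsion; its
  \<open>M\<close>-th power is a genuine relation, with coefficients multiplied by
  \<open>M\<close>.\<close>

lemma int_independent_imp_vectors:
  assumes "int_independent G S"
  shows "inj_on E S" "independent_vectors n (E ` S)"
proof -
  have S: "S \<subseteq> carrier G" "finite S" and ind: "!!c y. power_prod G S c = \<one> ==> y \<in> S ==> c y = 0"
    using assms unfolding int_independent_iff by blast+
  have rel: "c y = 0" if c: "!!i. i < n ==> (\<Sum>x\<in>S. c x * E x i) = 0" and y: "y \<in> S" for c y
  proof -
    have "power_prod G S (%x. M * c x) = power_prod G S c [^] M" by (rule power_prod_power[OF S(2,1)])
    also have "... = \<one>" using c by (intro torsion_E power_prod_closed S) (simp add: E_power_prod[OF S(2,1)])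
    finally show ?thesis using ind[OF _ y, of "%x. M * c x"] M_pos by simp
  qed
  show inj: "inj_on E S"
  proof (rule inj_onI, rule ccontr)
    fix x y assume xy: "x \<in> S" "y \<in> S" "E x = E y" "x ~= y"
    let ?c = "%z. if z = x then 1 else if z = y then - 1 else 0 :: int"
    have "(\<Sum>z\<in>S. ?c z * E z i) = (\<Sum>z\<in>{x, y}. ?c z * E z i)" for i
      using S(2) xy by (intro sum.mono_neutral_right) auto
    then have "(\<Sum>z\<in>S. ?c z * E z i) = 0" for i using xy(3,4) by simp
    from rel[of ?c, OF this xy(1)] show False by simp
  qed
  show "independent_vectors n (E ` S)"
    unfolding independent_vectors_def
  proof (intro conjI allI impI ballI)
    show "finite (E ` S)" using S(2) by simp
    fix c z assume c: "\<forall>i<n. (\<Sum>z\<in>E ` S. c z * z i) = 0" and "z \<in> E ` S"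
    then obtain y where y: "y \<in> S" "z = E y" by blast
    have "(\<Sum>x\<in>S. c (E x) * E x i) = 0" if "i < n" for i
      using c that by (simp add: sum.reindex[OF inj])
    then show "c z = 0" using rel[of "%x. c (E x)", OF _ y(1)] y(2) by simp
  qed
qed

lemma vectors_imp_int_independent:
  assumes Z: "independent_vectors n Z" "Z \<subseteq> E ` C" and C: "C \<subseteq> carrier G"
  obtains S where "S \<subseteq> C" "int_independent G S" "card S = card Z" "E ` S = Z"
proof -
  obtain S where S: "S \<subseteq> C" "inj_on E S" "Z = E ` S"
    using Z(2) unfolding subset_image_inj by blast
  have fin: "finite S" using independent_vectors_card(1)[OF Z(1)] finite_imageD S by blast
  have Sc: "S \<subseteq> carrier G" using S(1) C by blast
  have "int_independent G S"
    unfolding int_independent_iff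
  proof (intro conjI allI impI ballI Sc fin)
    fix c y assume c: "power_prod G S c = \<one>" and y: "y \<in> S"
    define d where "d z = c (inv_into S E z)" for z
    have d: "d (E x) = c x" if "x \<in> S" for x unfolding d_def using S(2) that by simp
    have "(\<Sum>z\<in>Z. d z * z i) = 0" for i
    proof -
      have "(\<Sum>z\<in>Z. d z * z i) = (\<Sum>x\<in>S. c x * E x i)"
        unfolding S(3) sum.reindex[OF S(2)] using d by simp
      also have "... = 0" using E_power_prod[OF fin Sc, of c i] c E_one by simp
      finally show ?thesis .
    qed
    then have "d (E y) = 0" using independent_vectorsD[OF Z(1)] S(3) y by blast
    then show "c y = 0" using d[OF y] by simp
  qed
  then show ?thesis using that[of S] S card_image by metis
qed

text \<open>The supremum in the definition of the rank is a maximum, because independent sets have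
  at most \<open>n\<close> elements.\<close>

lemma torsion_free_rank_subgroup:
  assumes C: "subgroup C G"
  shows "\<exists>Z. Z \<subseteq> E ` C & independent_vectors n Z & card Z = torsion_free_rank (G\<lparr>carrier := C\<rparr>)"
    and "Z \<subseteq> E ` C ==> independent_vectors n Z ==> card Z \<le> torsion_free_rank (G\<lparr>carrier := C\<rparr>)"
proof -
  let ?R = "{card S |S. int_independent (G\<lparr>carrier := C\<rparr>) S}"
  have Cc: "C \<subseteq> carrier G" by (rule subgroup.subset[OF C])
  have vec: "\<exists>Z. Z \<subseteq> E ` C & independent_vectors n Z & card Z = k" if k: "k \<in> ?R" for k
  proof -
    obtain S where S: "k = card S" "S \<subseteq> C" "int_independent G S"
      using k unfolding int_independent_subgroup[OF C] mem_Collect_eq by (elim exE conjE)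
    then show ?thesis
      using int_independent_imp_vectors[OF S(3)] by (intro exI[of _ "E ` S"]) (auto simp: card_image)
  qed
  have bd: "k \<le> n" if "k \<in> ?R" for k using vec[OF that] independent_vectors_card(2) by blast
  then have fin: "finite ?R" by (meson finite_nat_set_iff_bounded_le)
  have Rin: "card Z \<in> ?R" if Z: "Z \<subseteq> E ` C" "independent_vectors n Z" for Z
  proof -
    obtain S where "S \<subseteq> C" "int_independent G S" "card S = card Z"
      using vectors_imp_int_independent[OF Z(2,1) Cc] by blast
    then have "int_independent (G\<lparr>carrier := C\<rparr>) S" unfolding int_independent_subgroup[OF C] by blast
    then show ?thesis using \<open>card S = card Z\<close> by (intro CollectI exI[of _ S]) simp
  qed
  have ne: "?R ~= {}" using Rin[of "{}"] independent_vectors_empty by blast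
  have Sup: "torsion_free_rank (G\<lparr>carrier := C\<rparr>) = Max ?R"
    unfolding torsion_free_rank_def using fin ne by (rule cSup_eq_Max)
  show "\<exists>Z. Z \<subseteq> E ` C & independent_vectors n Z & card Z = torsion_free_rank (G\<lparr>carrier := C\<rparr>)"
    unfolding Sup by (rule vec[OF Max_in[OF fin ne]])
  show "card Z \<le> torsion_free_rank (G\<lparr>carrier := C\<rparr>)" if "Z \<subseteq> E ` C" "independent_vectors n Z"
    unfolding Sup by (rule Max_ge[OF fin Rin[OF that]])
qed

lemma torsion_free_rank_eq: "torsion_free_rank G = n"
proof -
  let ?Z = "(%i. E (s i)) ` {..<n}"
  have inj: "inj_on (%i. E (s i)) {..<n}"
  proof (rule inj_onI)
    fix i j assume ij: "i \<in> {..<n}" "j \<in> {..<n}" "E (s i) = E (s j)"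
    then show "i = j" using E_s[of i i] E_s[of j i] M_pos by (auto split: if_splits)
  qed
  have "independent_vectors n ?Z"
    unfolding independent_vectors_def
  proof (intro conjI allI impI ballI)
    fix c z assume c: "\<forall>i<n. (\<Sum>z\<in>?Z. c z * z i) = 0" and "z \<in> ?Z"
    then obtain j where j: "j < n" "z = E (s j)" by blast
    have "0 = (\<Sum>i<n. c (E (s i)) * E (s i) j)" using c j(1) by (simp add: sum.reindex[OF inj])
    also have "... = (\<Sum>i<n. if i = j then c (E (s i)) * M else 0)"
      using j(1) by (intro sum.cong) (auto simp: E_s)
    also have "... = c z * M" using j by simp
    finally show "c z = 0" using M_pos by simp
  qed simp
  moreover have "?Z \<subseteq> E ` carrier G" using s_closed by auto
  moreover have "card ?Z = n" using card_image[OF inj] by simp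
  ultimately have "n \<le> torsion_free_rank (G\<lparr>carrier := carrier G\<rparr>)"
    using torsion_free_rank_subgroup(2)[OF subgroup_self, of ?Z] by simp
  moreover have "torsion_free_rank (G\<lparr>carrier := carrier G\<rparr>) \<le> n"
    using torsion_free_rank_subgroup(1)[OF subgroup_self] independent_vectors_card(2) by metis
  ultimately show ?thesis by simp
qed

text \<open>Elements with equal coordinates differ by one of the finitely many elements with zero
  coordinates.\<close>

lemma finite_E_bounded: "finite {g \<in> carrier G. \<forall>i<n. \<bar>E g i\<bar> \<le> B}"
proof -
  let ?R = "PiE {..<n} (%_. {- B..B})"
  let ?r = "%g. \<lambda>i\<in>{..<n}. E g i"
  let ?fib = "%r. {g \<in> carrier G. ?r g = r}"
  have fib: "finite (?fib r)" for r
  proof (cases "?fib r = {}")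
    case False
    then obtain h where h: "h \<in> carrier G" "?r h = r" by blast
    have "g \<in> (%k. k \<otimes> h) ` {g \<in> carrier G. \<forall>i<n. E g i = 0}" if g: "g \<in> ?fib r" for g
    proof (rule image_eqI)
      have gc: "g \<in> carrier G" using g by blast
      have "E g i = E h i" if "i < n" for i
      proof -
        have "?r g i = ?r h i" using g h(2) by simp
        then show ?thesis using that by simp
      qed
      then show "g \<otimes> inv h \<in> {g \<in> carrier G. \<forall>i<n. E g i = 0}" using gc h(1) by (simp add: E_mult E_inv)
      show "g = g \<otimes> inv h \<otimes> h" using gc h(1) by (simp add: m_assoc)
    qed
    then have "?fib r \<subseteq> (%k. k \<otimes> h) ` {g \<in> carrier G. \<forall>i<n. E g i = 0}" by blast
    then show ?thesis using finite_E finite_surj by blast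
  next
    case True
    show ?thesis unfolding True by simp
  qed
  have "finite (\<Union>r\<in>?R. ?fib r)" by (intro finite_UN_I fib finite_PiE) auto
  moreover have "{g \<in> carrier G. \<forall>i<n. \<bar>E g i\<bar> \<le> B} \<subseteq> (\<Union>r\<in>?R. ?fib r)"
  proof
    fix g assume g: "g \<in> {g \<in> carrier G. \<forall>i<n. \<bar>E g i\<bar> \<le> B}"
    then have "?r g \<in> ?R" by (auto simp: abs_le_iff)
    then show "g \<in> (\<Union>r\<in>?R. ?fib r)" using g by blast
  qed
  ultimately show ?thesis by (rule finite_subset[rotated])
qed

text \<open>The correction \<open>t \<epsilon>\<close> is a homomorphism that kills every value of
  \<open>t \<delta>\<close>, so the maps for \<open>\<epsilon> = 1\<close> and
  \<open>\<epsilon> = - 1\<close> are mutually inverse.\<close>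

lemma shear_automorphism:
  assumes V: "finite V" "!!v w. v \<in> V ==> w \<in> V ==> dot n (\<xi> v) w = 0"
  obtains \<mu> where "\<mu> \<in> iso G G" "!!g i. g \<in> carrier G ==> i < n ==> E (\<mu> g) i = shear n M V \<xi> (E g) i"
proof -
  define x where "x v = finprod G (%i. s i [^] (v i :: int)) {..<n}" for v :: "nat => int"
  have xc: "x v \<in> carrier G" for v unfolding x_def using s_closed by (intro finprod_closed) auto
  have Ex: "E (x v) j = M * v j" if "j < n" for v j
  proof -
    have "E (x v) j = (\<Sum>i<n. v i * E (s i) j)"
      unfolding x_def using s_closed by (subst E_finprod) (auto simp: E_int_pow)
    also have "... = (\<Sum>i<n. if i = j then v i * M else 0)"
      using that by (intro sum.cong) (auto simp: E_s)
    finally show ?thesis using that by simp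
  qed
  define t where "t \<epsilon> g = finprod G (%v. x v [^] (\<epsilon> * dot n (\<xi> v) (E g))) V" for \<epsilon> g
  have tc: "t \<epsilon> g \<in> carrier G" for \<epsilon> g unfolding t_def using xc by (intro finprod_closed) auto
  have Et: "E (t \<epsilon> g) i = (\<Sum>v\<in>V. \<epsilon> * dot n (\<xi> v) (E g) * (M * v i))" if "i < n" for \<epsilon> g i
    unfolding t_def using V(1) xc that by (subst E_finprod) (auto simp: E_int_pow Ex)
  have dot_add: "dot n \<zeta> (E (g \<otimes> h)) = dot n \<zeta> (E g) + dot n \<zeta> (E h)" if "g \<in> carrier G" "h \<in> carrier G" for \<zeta> g h
    using that by (simp add: dot_def E_mult distrib_left sum.distrib)
  have dot_t: "dot n (\<xi> w) (E (t \<epsilon> g)) = 0" if "w \<in> V" for w \<epsilon> g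
  proof -
    have "dot n (\<xi> w) (E (t \<epsilon> g)) = (\<Sum>i<n. \<Sum>v\<in>V. \<epsilon> * dot n (\<xi> v) (E g) * M * (\<xi> w i * v i))"
      unfolding dot_def[of n "\<xi> w"] by (intro sum.cong) (auto simp: Et sum_distrib_left mult_ac)
    also have "... = (\<Sum>v\<in>V. \<epsilon> * dot n (\<xi> v) (E g) * M * dot n (\<xi> w) v)"
      unfolding dot_def[of n "\<xi> w"] sum_distrib_left by (rule sum.swap)
    also have "... = 0" using V(2)[OF that] by simp
    finally show ?thesis .
  qed
  have t_mult: "t \<epsilon> (g \<otimes> h) = t \<epsilon> g \<otimes> t \<epsilon> h" if "g \<in> carrier G" "h \<in> carrier G" for \<epsilon> g h
    unfolding t_def using xc that
    by (subst finprod_multf[symmetric]) (auto intro!: finprod_cong' simp: dot_add distrib_left int_pow_mult)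
  have t_t: "t \<epsilon> (t \<delta> g) = \<one>" for \<epsilon> \<delta> g
    unfolding t_def[of \<epsilon>] using dot_t by (intro finprod_one_eqI) simp
  have t_neg: "t (- \<epsilon>) g \<otimes> t \<epsilon> g = \<one>" for \<epsilon> g
    unfolding t_def using xc
    by (subst finprod_multf[symmetric]) (auto intro!: finprod_one_eqI simp: int_pow_mult[symmetric])
  define \<mu> where "\<mu> \<epsilon> g = g \<otimes> t \<epsilon> g" for \<epsilon> g
  have \<mu>c: "\<mu> \<epsilon> g \<in> carrier G" if "g \<in> carrier G" for \<epsilon> g unfolding \<mu>_def using that tc by simp
  have inv: "\<mu> (- \<epsilon>) (\<mu> \<epsilon> g) = g" if "g \<in> carrier G" for \<epsilon> g
  proof -
    have "t (- \<epsilon>) (\<mu> \<epsilon> g) = t (- \<epsilon>) g" unfolding \<mu>_def using that tc by (simp add: t_mult t_t)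
    then show ?thesis
      unfolding \<mu>_def[of "- \<epsilon>"] unfolding \<mu>_def
      using that tc t_neg[of \<epsilon> g] by (simp add: m_assoc m_comm[of "t \<epsilon> g"])
  qed
  have "\<mu> 1 \<in> iso G G"
  proof (rule isoI)
    show "\<mu> 1 \<in> hom G G"
      by (rule homI) (use \<mu>c tc in \<open>auto simp: \<mu>_def t_mult m_ac\<close>)
    show "bij_betw (\<mu> 1) (carrier G) (carrier G)"
      by (rule bij_betw_byWitness[of _ "\<mu> (- 1)"]) (use inv[of _ 1] inv[of _ "- 1"] \<mu>c in auto)
  qed
  moreover have "E (\<mu> 1 g) i = shear n M V \<xi> (E g) i" if "g \<in> carrier G" "i < n" for g i
    unfolding \<mu>_def shear_def using that tc by (simp add: E_mult Et)
  ultimately show ?thesis using that by blast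
qed

end

section \<open>The BNS invariant and half-connectedness\<close>

lemma (in generators) word_val_hom:
  assumes "group_hom G K \<phi>" "w \<in> words X"
  shows "\<phi> (wv w) = word_val K (\<phi> \<circ> f) w"
proof -
  interpret h: group_hom G K \<phi> by fact
  have "\<phi> (lv s) = letter_val K (\<phi> \<circ> f) s" if "fst s \<in> X" for s
    using that generator_closed by (simp add: letter_val_def)
  then show ?thesis
    using assms(2) by (induction w) auto
qed

lemma (in generators) generators_hom:
  "group_hom G K \<phi> ==> generators K X (\<phi> \<circ> f)"
  by (auto simp: generators_def generators_axioms_def group_hom_def group_hom_axioms_def hom_def generator_closed)

lemma (in generators) half_connected_iff_monoid_type_FP1:
  assumes \<chi>: "additive G \<chi>" "g \<in> carrier G" "\<chi> g ~= 0" and X: "finite X" "carrier G \<subseteq> wv ` words X"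
  shows "half_connected G X f \<chi> \<longleftrightarrow> monoid_type_FP 1 (character_monoid G \<chi>)"
proof -
  obtain t where t: "fst t \<in> X" "0 < \<chi> (lv t)"
    using nonzero_letter[OF \<chi>(1)] \<chi>(2,3) X(2) by blast
  have "countable (words X)"
    unfolding words_def using X(1) by (intro countable_lists countable_finite) simp
  then have "countable (carrier G)"
    by (rule countable_subset[OF X(2) countable_image])
  then show ?thesis
    using half_connected_imp_monoid_type_FP1[OF \<chi>(1) t X(1)]
      monoid_type_FP1_imp_half_connected[OF \<chi>(1) t X(2)] by blast
qed

lemma character_in_class: "\<chi> \<in> characters G ==> \<chi> \<in> character_class G \<chi>"
  unfolding character_class_def characters_def
  by (intro CollectI exI[of _ 1]) (auto simp: fun_eq_iff extensional_def)

lemma character_class_eqD: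
  assumes "character_class G \<chi> = character_class G \<chi>'" "\<chi> \<in> characters G"
  obtains t where "0 < t" "!!g. g \<in> carrier G ==> \<chi> g = t * \<chi>' g"
proof -
  have "\<chi> \<in> character_class G \<chi>'" using character_in_class[OF assms(2)] assms(1) by simp
  then obtain t where "0 < t" "\<chi> = (\<lambda>g\<in>carrier G. t * \<chi>' g)" by (auto simp: character_class_def)
  then show ?thesis using that by simp
qed

lemma character_monoid_cong:
  assumes "!!g. g \<in> carrier G ==> \<chi> g = t * \<chi>' g" "0 < t"
  shows "character_monoid G \<chi> = character_monoid G \<chi>'"
proof -
  have "{g \<in> carrier G. 0 \<le> \<chi> g} = {g \<in> carrier G. 0 \<le> \<chi>' g}"
    using assms by (auto simp: zero_le_mult_iff)
  then show ?thesis by (simp add: character_monoid_def)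
qed

text \<open>Characters of one class differ by a positive factor and have the same half-space, so the
  condition can be tested at any representative.\<close>

lemma BNS_invariant_iff:
  assumes "\<chi> \<in> nonzero_characters G"
  shows "character_class G \<chi> \<in> BNS_invariant G \<longleftrightarrow> monoid_type_FP 1 (character_monoid G \<chi>)"
proof
  assume "character_class G \<chi> \<in> BNS_invariant G"
  then obtain \<chi>' where \<chi>': "character_class G \<chi> = character_class G \<chi>'" "monoid_type_FP 1 (character_monoid G \<chi>')"
    by (auto simp: BNS_invariant_def)
  have "\<chi> \<in> characters G" using assms by (simp add: nonzero_characters_def)
  then obtain t where "0 < t" "!!g. g \<in> carrier G ==> \<chi> g = t * \<chi>' g"
    using character_class_eqD[OF \<chi>'(1)] by blast
  then show "monoid_type_FP 1 (character_monoid G \<chi>)"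
    using \<chi>'(2) character_monoid_cong[of G \<chi> t \<chi>'] by simp
qed (use assms in \<open>auto simp: BNS_invariant_def\<close>)

lemma character_subsphere_iff:
  assumes "\<chi> \<in> nonzero_characters G" "K \<subseteq> carrier G"
  shows "character_class G \<chi> \<in> character_subsphere G K \<longleftrightarrow> (\<forall>k\<in>K. \<chi> k = 0)"
proof
  assume "character_class G \<chi> \<in> character_subsphere G K"
  then obtain \<chi>' where \<chi>': "character_class G \<chi> = character_class G \<chi>'" "\<forall>k\<in>K. \<chi>' k = 0"
    by (auto simp: character_subsphere_def)
  have "\<chi> \<in> characters G" using assms by (simp add: nonzero_characters_def)
  then obtain t where "0 < t" "!!g. g \<in> carrier G ==> \<chi> g = t * \<chi>' g"
    using character_class_eqD[OF \<chi>'(1)] by blast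
  then show "\<forall>k\<in>K. \<chi> k = 0" using \<chi>'(2) assms(2) by auto
qed (use assms in \<open>auto simp: character_subsphere_def\<close>)

lemma (in generators) half_connected_iff:
  assumes \<chi>: "additive G \<chi>" "\<exists>g\<in>carrier G. \<chi> g ~= 0" and X: "finite X" "carrier G \<subseteq> wv ` words X"
    and \<Lambda>: "!!K. K \<in> \<Lambda> ==> K \<subseteq> carrier G"
    and BNS: "character_sphere G - BNS_invariant G = (\<Union>K\<in>\<Lambda>. character_subsphere G K)"
  shows "half_connected G X f \<chi> \<longleftrightarrow> \<not> (\<exists>K\<in>\<Lambda>. \<forall>k\<in>K. \<chi> k = 0)"
proof -
  let ?\<chi> = "restrict \<chi> (carrier G)"
  have nz: "?\<chi> \<in> nonzero_characters G"
    using \<chi> by (auto simp: nonzero_characters_def characters_def additive_def)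
  have sph: "character_class G ?\<chi> \<in> character_sphere G"
    using nz by (auto simp: character_sphere_def)
  have "half_connected G X f \<chi> \<longleftrightarrow> monoid_type_FP 1 (character_monoid G \<chi>)"
    using \<chi>(2) half_connected_iff_monoid_type_FP1[OF \<chi>(1) _ _ X] by blast
  also have "character_monoid G \<chi> = character_monoid G ?\<chi>"
    by (rule character_monoid_cong[of _ _ 1]) auto
  also have "monoid_type_FP 1 (character_monoid G ?\<chi>) \<longleftrightarrow> character_class G ?\<chi> \<in> BNS_invariant G"
    by (rule BNS_invariant_iff[OF nz, symmetric])
  also have "... \<longleftrightarrow> character_class G ?\<chi> \<notin> (\<Union>K\<in>\<Lambda>. character_subsphere G K)"
    using sph BNS by blast
  also have "... \<longleftrightarrow> \<not> (\<exists>K\<in>\<Lambda>. \<forall>k\<in>K. \<chi> k = 0)"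
  proof -
    have "character_class G ?\<chi> \<in> character_subsphere G K \<longleftrightarrow> (\<forall>k\<in>K. \<chi> k = 0)" if "K \<in> \<Lambda>" for K
      using character_subsphere_iff[OF nz \<Lambda>[OF that]] \<Lambda>[OF that] by (auto simp: subset_iff)
    then show ?thesis by blast
  qed
  finally show ?thesis .
qed

section \<open>Fibre products over the abelianisation\<close>

context group
begin

abbreviation "N \<equiv> commutator_subgroup G"
abbreviation "Q \<equiv> G Mod N"
abbreviation "\<pi> \<equiv> %g. N #> g"

lemma abelianisation_hom: "group_hom G Q \<pi>"
  using normal.r_coset_hom_Mod[OF derived_self_is_normal] normal.factorgroup_is_group[OF derived_self_is_normal]
  by (simp add: group_hom_def group_hom_axioms_def)

lemma abelianisation_carrier: "carrier Q = \<pi> ` carrier G"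
  by (auto simp: carrier_FactGroup)

lemma abelianisation_mult: "g \<in> carrier G ==> h \<in> carrier G ==> \<pi> (g \<otimes> h) = \<pi> g \<otimes>\<^bsub>Q\<^esub> \<pi> h"
  using normal.rcos_sum[OF derived_self_is_normal, of g h] by simp

lemma abelianisation_one: "n \<in> N ==> \<pi> n = \<one>\<^bsub>Q\<^esub>"
  using coset_join2[OF _ derived_is_subgroup] derived_in_carrier[of "carrier G"] by auto

lemma subgroup_Mod:
  assumes K: "subgroup K G" "N \<subseteq> K"
  shows "G\<lparr>carrier := K\<rparr> Mod N = Q\<lparr>carrier := \<pi> ` K\<rparr>" and "subgroup (\<pi> ` K) Q"
proof -
  interpret h: group_hom G Q \<pi> by (rule abelianisation_hom)
  show "subgroup (\<pi> ` K) Q" by (rule h.subgroup_img_is_subgroup[OF K(1)])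
  show "G\<lparr>carrier := K\<rparr> Mod N = Q\<lparr>carrier := \<pi> ` K\<rparr>"
    by (auto simp: FactGroup_def RCOSETS_def r_coset_def set_mult_def fun_eq_iff)
qed

end

lemma (in generators) abelianisation_coordinates:
  assumes X: "finite X" "carrier G = wv ` words X"
  obtains n E s M where "coordinates Q n E s M"
proof -
  interpret h: group_hom G Q \<pi> by (rule abelianisation_hom)
  interpret Q: generators Q X "\<pi> \<circ> f" by (rule generators_hom[OF abelianisation_hom])
  have "carrier Q = \<pi> ` carrier G" by (rule abelianisation_carrier)
  also have "... = \<pi> ` wv ` words X" by (rule arg_cong[OF X(2)])
  also have "... = Q.wv ` words X"
    unfolding image_image by (intro image_cong HOL.refl word_val_hom[OF abelianisation_hom])
  finally have "carrier Q = Q.wv ` words X" .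
  then show ?thesis
    using Q.coordinates_exist[OF derived_quot_is_comm_group X(1)] that by blast
qed

lemma (in group) inv_mult_eqD:
  assumes "a \<in> carrier G" "b \<in> carrier G" "x \<in> carrier G" "y \<in> carrier G" and "inv a \<otimes> x = inv b \<otimes> y"
  shows "x \<otimes> inv y = a \<otimes> inv b"
proof -
  have "x = a \<otimes> (inv a \<otimes> x)" using assms(1,3) by (simp add: m_assoc[symmetric])
  also have "... \<otimes> inv y = a \<otimes> (inv b \<otimes> y \<otimes> inv y)" using assms by (simp add: m_assoc)
  also have "... = a \<otimes> inv b" using assms(1-4) by (simp add: m_assoc)
  finally show ?thesis .
qed

locale abelianised = group G + C: coordinates "G Mod commutator_subgroup G" n E s M
  for G (structure) and n E s M
begin

lemma additive_pairing: "additive Q (%q. pairing n \<eta> (E q))"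
  by (simp add: additive_def pairing_def C.E_mult distrib_left sum.distrib del: mult_FactGroup)

text \<open>A character of the abelianisation is determined by its values at the \<open>s i\<close>;
  dividing by \<open>M\<close> undoes the power in the definition of the coordinates.\<close>

lemma additive_eq_pairing:
  assumes "additive Q \<chi>"
  obtains \<eta> where "!!q. q \<in> carrier Q ==> \<chi> q = pairing n \<eta> (E q)"
proof (rule that[of "%i. \<chi> (s i) / of_int M"])
  fix q assume "q \<in> carrier Q"
  from C.additive_E[OF assms this] show "\<chi> q = pairing n (%i. \<chi> (s i) / of_int M) (E q)"
    using C.M_pos by (simp add: pairing_def sum_divide_distrib[symmetric] field_simps)
qed

lemma additive_lift: "additive Q \<chi> ==> additive G (%g. \<chi> (\<pi> g))"
  using abelianisation_mult abelianisation_carrier by (simp add: additive_def)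

lemma additive_iso: "\<mu> \<in> iso Q Q ==> additive Q \<chi> ==> additive Q (%q. \<chi> (\<mu> q))"
  by (auto simp: additive_def iso_def hom_def Pi_def)

lemma pairing_nonzero:
  assumes \<mu>: "\<mu> \<in> iso Q Q" and i: "i < n" "\<eta> i ~= 0"
  shows "\<exists>g\<in>carrier G. pairing n \<eta> (E (\<mu> (\<pi> g))) ~= 0"
proof -
  have "s i \<in> \<mu> ` carrier Q"
    using C.s_closed[OF i(1)] \<mu> by (simp add: iso_def bij_betw_def)
  then obtain g where g: "g \<in> carrier G" "s i = \<mu> (\<pi> g)" unfolding abelianisation_carrier by blast
  have "pairing n \<eta> (E (s i)) = (\<Sum>j<n. if j = i then \<eta> i * M else 0)"
    unfolding pairing_def using i(1) by (intro sum.cong) (auto simp: C.E_s)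
  then have "pairing n \<eta> (E (s i)) ~= 0" using i C.M_pos by simp
  then show ?thesis using g by auto
qed

lemma fibre_product_iff:
  "p \<in> fibre_product G N \<mu> \<longleftrightarrow> fst p \<in> carrier G & snd p \<in> carrier G & \<mu> (\<pi> (fst p)) = \<pi> (snd p)"
  by (cases p) (auto simp: fibre_product_def)

context
  fixes \<mu> assumes \<mu>: "\<mu> \<in> iso Q Q"
begin

lemma group_hom_\<mu>: "group_hom Q Q \<mu>"
  using \<mu> C.group_axioms by (simp add: group_hom_def group_hom_axioms_def iso_def)

lemma subgroup_fibre_product: "subgroup (fibre_product G N \<mu>) (G \<times>\<times> G)"
proof -
  interpret GG: group "G \<times>\<times> G" by (rule DirProd_group[OF group_axioms group_axioms])
  interpret h: group_hom G Q \<pi> by (rule abelianisation_hom)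
  interpret m: group_hom Q Q \<mu> by (rule group_hom_\<mu>)
  show ?thesis
  proof (rule GG.subgroupI)
    show "fibre_product G N \<mu> \<subseteq> carrier (G \<times>\<times> G)" by (auto simp: fibre_product_def)
    have "\<one>\<^bsub>G \<times>\<times> G\<^esub> \<in> fibre_product G N \<mu>"
      using h.hom_one m.hom_one by (simp add: fibre_product_iff DirProd_def)
    then show "fibre_product G N \<mu> ~= {}" by blast
    fix p assume p: "p \<in> fibre_product G N \<mu>"
    note p' = p[unfolded fibre_product_iff]
    have "inv\<^bsub>G \<times>\<times> G\<^esub> p = (inv (fst p), inv (snd p))"
      using inv_DirProd[OF group_axioms group_axioms, of "fst p" "snd p"] p' by simp
    then show "inv\<^bsub>G \<times>\<times> G\<^esub> p \<in> fibre_product G N \<mu>"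
      using p' h.hom_inv[of "fst p"] h.hom_inv[of "snd p"] m.hom_inv[of "\<pi> (fst p)"] h.hom_closed[of "fst p"]
      by (simp add: fibre_product_iff)
    fix q assume q: "q \<in> fibre_product G N \<mu>"
    note q' = q[unfolded fibre_product_iff]
    have "p \<otimes>\<^bsub>G \<times>\<times> G\<^esub> q = (fst p \<otimes> fst q, snd p \<otimes> snd q)"
      by (simp add: DirProd_def case_prod_beta)
    then show "p \<otimes>\<^bsub>G \<times>\<times> G\<^esub> q \<in> fibre_product G N \<mu>"
      using p' q' h.hom_mult[of "fst p" "fst q"] h.hom_mult[of "snd p" "snd q"] h.hom_closed[of "fst p"] h.hom_closed[of "fst q"]
        m.hom_mult[of "\<pi> (fst p)" "\<pi> (fst q)"]
      by (simp add: fibre_product_iff)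
  qed
qed

lemma fibre_product_proj:
  "carrier G \<subseteq> fst ` fibre_product G N \<mu>" "carrier G \<subseteq> snd ` fibre_product G N \<mu>"
proof -
  interpret h: group_hom G Q \<pi> by (rule abelianisation_hom)
  interpret m: group_hom Q Q \<mu> by (rule group_hom_\<mu>)
  have "g \<in> fst ` fibre_product G N \<mu>" "g \<in> snd ` fibre_product G N \<mu>" if g: "g \<in> carrier G" for g
  proof -
    have "\<mu> (\<pi> g) \<in> \<pi> ` carrier G" using g h.hom_closed m.hom_closed unfolding abelianisation_carrier[symmetric] by blast
    then obtain g2 where "g2 \<in> carrier G" "\<mu> (\<pi> g) = \<pi> g2" by blast
    then have "(g, g2) \<in> fibre_product G N \<mu>" using g by (simp add: fibre_product_iff)
    then show "g \<in> fst ` fibre_product G N \<mu>" by (metis fst_conv image_eqI)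
    have "\<pi> g \<in> \<mu> ` carrier Q" using \<mu> h.hom_closed[OF g] by (simp add: iso_def bij_betw_def)
    then obtain g1 where "g1 \<in> carrier G" "\<pi> g = \<mu> (\<pi> g1)" unfolding abelianisation_carrier by blast
    then have "(g1, g) \<in> fibre_product G N \<mu>" using g by (simp add: fibre_product_iff)
    then show "g \<in> snd ` fibre_product G N \<mu>" by (metis snd_conv image_eqI)
  qed
  then show "carrier G \<subseteq> fst ` fibre_product G N \<mu>" "carrier G \<subseteq> snd ` fibre_product G N \<mu>" by blast+
qed

lemma fibre_product_commutators:
  assumes "c \<in> N"
  shows "(c, \<one>) \<in> fibre_product G N \<mu> & (\<one>, c) \<in> fibre_product G N \<mu>"
proof -
  interpret h: group_hom G Q \<pi> by (rule abelianisation_hom)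
  interpret m: group_hom Q Q \<mu> by (rule group_hom_\<mu>)
  have "\<pi> c = \<one>\<^bsub>Q\<^esub>" "\<pi> \<one> = \<one>\<^bsub>Q\<^esub>" "c \<in> carrier G"
    using abelianisation_one[OF assms] h.hom_one derived_in_carrier[of "carrier G"] assms by auto
  then show ?thesis using m.hom_one by (simp add: fibre_product_iff)
qed

text \<open>The coset of \<open>v\<close> is determined by the defect \<open>d v\<close> in the
  abelianisation, and the coordinates of the defect are the differences assumed to be
  bounded.\<close>

lemma fibre_product_finite_cosets:
  "finite ((%v. fibre_product G N \<mu> #>\<^bsub>G \<times>\<times> G\<^esub> v) `
    {v \<in> carrier (G \<times>\<times> G). \<forall>i<n. \<bar>E (\<pi> (snd v)) i - E (\<mu> (\<pi> (fst v))) i\<bar> \<le> B})"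
proof -
  let ?H = "fibre_product G N \<mu>" and ?GG = "G \<times>\<times> G"
  let ?A = "{v \<in> carrier ?GG. \<forall>i<n. \<bar>E (\<pi> (snd v)) i - E (\<mu> (\<pi> (fst v))) i\<bar> \<le> B}"
  interpret GG: group ?GG by (rule DirProd_group[OF group_axioms group_axioms])
  interpret h: group_hom G Q \<pi> by (rule abelianisation_hom)
  interpret m: group_hom Q Q \<mu> by (rule group_hom_\<mu>)
  define d where "d v = inv\<^bsub>Q\<^esub> (\<mu> (\<pi> (fst v))) \<otimes>\<^bsub>Q\<^esub> \<pi> (snd v)" for v
  have c: "fst v \<in> carrier G" "snd v \<in> carrier G" "\<pi> (fst v) \<in> carrier Q" "\<pi> (snd v) \<in> carrier Q" "\<mu> (\<pi> (fst v)) \<in> carrier Q"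
    if "v \<in> carrier ?GG" for v
    using that h.hom_closed m.hom_closed by (auto simp: mem_Times_iff)
  have Ed: "E (d v) i = E (\<pi> (snd v)) i - E (\<mu> (\<pi> (fst v))) i" if "v \<in> carrier ?GG" for v i
    using c[OF that] by (simp add: d_def C.E_mult C.E_inv del: mult_FactGroup)
  have "d ` ?A \<subseteq> {q \<in> carrier Q. \<forall>i<n. \<bar>E q i\<bar> \<le> B}"
  proof
    fix q assume "q \<in> d ` ?A"
    then obtain v where v: "v \<in> carrier ?GG" "\<forall>i<n. \<bar>E (\<pi> (snd v)) i - E (\<mu> (\<pi> (fst v))) i\<bar> \<le> B" "q = d v" by blast
    have "d v \<in> carrier Q" using c[OF v(1)] by (simp add: d_def del: mult_FactGroup)
    then show "q \<in> {q \<in> carrier Q. \<forall>i<n. \<bar>E q i\<bar> \<le> B}" using v Ed[OF v(1)] by simp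
  qed
  then have fin: "finite (d ` ?A)" using C.finite_E_bounded finite_subset by blast
  have coset: "?H #>\<^bsub>?GG\<^esub> v = ?H #>\<^bsub>?GG\<^esub> w" if v: "v \<in> carrier ?GG" and w: "w \<in> carrier ?GG" and vw: "d v = d w" for v w
  proof -
    have "v \<otimes>\<^bsub>?GG\<^esub> inv\<^bsub>?GG\<^esub> w = (fst v \<otimes> inv (fst w), snd v \<otimes> inv (snd w))"
      using inv_DirProd[OF group_axioms group_axioms, of "fst w" "snd w"] c[OF w] by (simp add: DirProd_def case_prod_beta)
    moreover have "\<mu> (\<pi> (fst v \<otimes> inv (fst w))) = \<pi> (snd v \<otimes> inv (snd w))"
    proof -
      let ?a = "\<mu> (\<pi> (fst v))" and ?b = "\<mu> (\<pi> (fst w))" and ?x = "\<pi> (snd v)" and ?y = "\<pi> (snd w)"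
      have "?x \<otimes>\<^bsub>Q\<^esub> inv\<^bsub>Q\<^esub> ?y = ?a \<otimes>\<^bsub>Q\<^esub> inv\<^bsub>Q\<^esub> ?b"
        using vw unfolding d_def by (rule C.inv_mult_eqD[OF c(5)[OF v] c(5)[OF w] c(4)[OF v] c(4)[OF w]])
      then show ?thesis
        using c[OF v] c[OF w] by (simp add: h.hom_mult h.hom_inv m.hom_mult m.hom_inv del: mult_FactGroup)
    qed
    ultimately have "v \<otimes>\<^bsub>?GG\<^esub> inv\<^bsub>?GG\<^esub> w \<in> ?H"
      using c[OF v] c[OF w] by (simp add: fibre_product_iff)
    then have "?H #>\<^bsub>?GG\<^esub> (v \<otimes>\<^bsub>?GG\<^esub> inv\<^bsub>?GG\<^esub> w) = ?H"
      using GG.coset_join2[OF _ subgroup_fibre_product] subgroup.mem_carrier[OF subgroup_fibre_product] by blast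
    then show ?thesis by (rule GG.coset_mult_inv1[OF _ v w subgroup.subset[OF subgroup_fibre_product]])
  qed
  have "(%v. ?H #>\<^bsub>?GG\<^esub> v) ` ?A \<subseteq> (%q. ?H #>\<^bsub>?GG\<^esub> inv_into ?A d q) ` (d ` ?A)"
  proof (rule image_subsetI)
    fix v assume v: "v \<in> ?A"
    let ?w = "inv_into ?A d (d v)"
    have w: "?w \<in> ?A" "d ?w = d v" by (rule inv_into_into[OF imageI[OF v]]) (rule f_inv_into_f[OF imageI[OF v]])
    have "?H #>\<^bsub>?GG\<^esub> v = ?H #>\<^bsub>?GG\<^esub> ?w"
      using v w(1) by (intro coset w(2)[symmetric]) blast+
    then show "?H #>\<^bsub>?GG\<^esub> v \<in> (%q. ?H #>\<^bsub>?GG\<^esub> inv_into ?A d q) ` (d ` ?A)" using v by blast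
  qed
  then show ?thesis using fin finite_surj by blast
qed

end

end

section \<open>The two directions of the rank condition\<close>

lemma pairing_inner_prod: "inner_prod n \<eta> (%i. real_of_int (z i)) = pairing n \<eta> z"
  by (simp add: inner_prod_def pairing_def)

lemma pairing_cong: "(!!i. i < n ==> y i = z i) ==> pairing n \<eta> y = pairing n \<eta> z"
  by (simp add: pairing_def)

lemma pairing_uminus: "pairing n (%i. - \<eta> i) z = - pairing n \<eta> z"
  by (simp add: pairing_def sum_negf)

context abelianised
begin

lemma rank_vectors:
  assumes K: "subgroup K G" "N \<subseteq> K"
  obtains Z where "Z \<subseteq> E ` \<pi> ` K" "independent_vectors n Z"
    "card Z = torsion_free_rank (G\<lparr>carrier := K\<rparr> Mod N)"
    "!!y. y \<in> E ` \<pi> ` K ==> y \<notin> Z ==> \<not> independent_vectors n (insert y Z)"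
proof -
  note sub = subgroup_Mod[OF K]
  obtain Z where Z: "Z \<subseteq> E ` \<pi> ` K" "independent_vectors n Z" "card Z = torsion_free_rank (G\<lparr>carrier := K\<rparr> Mod N)"
    unfolding sub(1) using C.torsion_free_rank_subgroup(1)[OF sub(2)] by blast
  have "\<not> independent_vectors n (insert y Z)" if "y \<in> E ` \<pi> ` K" "y \<notin> Z" for y
  proof
    assume "independent_vectors n (insert y Z)"
    then have "card (insert y Z) \<le> card Z"
      unfolding Z(3) sub(1) using that Z(1) by (intro C.torsion_free_rank_subgroup(2)[OF sub(2)]) auto
    then show False using that(2) independent_vectors_card(1)[OF Z(2)] by simp
  qed
  then show ?thesis using that[of Z] Z by blast
qed

text \<open>Vanishing on \<open>K\<close> is a condition on one maximal independent set, so
  vanishing on \<open>K\<close> and on its image under \<open>\<mu>\<close> costs at most twice the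
  rank many equations in \<open>n\<close> unknowns. The sign in \<open>\<chi>2\<close> makes the two
  characters cancel on the fibre product.\<close>

lemma rank_condition_necessary:
  assumes H: "\<mu> \<in> iso Q Q" "finitely_presented ((G \<times>\<times> G)\<lparr>carrier := fibre_product G N \<mu>\<rparr>)"
    and \<Lambda>: "!!K. K \<in> \<Lambda> ==> subgroup K G & N \<subseteq> K"
    and BNS: "character_sphere G - BNS_invariant G = (\<Union>K\<in>\<Lambda>. character_subsphere G K)"
    and K: "K \<in> \<Lambda>"
  shows "n \<le> 2 * torsion_free_rank (G\<lparr>carrier := K\<rparr> Mod N)"
proof (rule ccontr)
  let ?r = "torsion_free_rank (G\<lparr>carrier := K\<rparr> Mod N)"
  let ?GG = "G \<times>\<times> G"
  let ?H = "?GG\<lparr>carrier := fibre_product G N \<mu>\<rparr>"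
  assume "\<not> n \<le> 2 * ?r"
  then have r: "2 * ?r < n" by simp
  have Kc: "K \<subseteq> carrier G" using \<Lambda>[OF K] subgroup.subset by blast
  have \<pi>K: "\<pi> ` K \<subseteq> carrier Q" unfolding abelianisation_carrier using Kc by (rule image_mono)
  obtain Z where Z: "Z \<subseteq> E ` \<pi> ` K" "independent_vectors n Z" "card Z = ?r"
    "!!y. y \<in> E ` \<pi> ` K ==> y \<notin> Z ==> \<not> independent_vectors n (insert y Z)"
    using rank_vectors \<Lambda>[OF K] by blast
  obtain S where S: "S \<subseteq> \<pi> ` K" "inj_on E S" "Z = E ` S"
    using Z(1) unfolding subset_image_inj by blast
  have finZ: "finite Z" by (rule independent_vectors_card[OF Z(2)])
  have finS: "finite S" using finZ finite_imageD S by blast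
  have cardS: "card S = ?r" using card_image[OF S(2)] S(3) Z(3) by simp
  let ?Y = "Z \<union> (%q. E (\<mu> q)) ` S"
  have "card ?Y \<le> card Z + card ((%q. E (\<mu> q)) ` S)" by (rule card_Un_le)
  also have "... \<le> ?r + ?r" using card_image_le[OF finS] cardS Z(3) by (intro add_mono) auto
  finally have cardY: "card ?Y < n" using r by simp
  have finY: "finite ?Y" using finZ finS by simp
  obtain c :: "nat => int" where c: "\<exists>i<n. c i ~= 0"
    "!!z. z \<in> ?Y ==> pairing n (%i. real_of_int (c i)) z = 0"
    by (rule integral_annihilator[OF finY cardY]) (rule that)
  define \<zeta> where "\<zeta> i = real_of_int (c i)" for i
  have \<zeta>: "\<exists>i<n. \<zeta> i ~= 0" "!!z. z \<in> ?Y ==> pairing n \<zeta> z = 0"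
    using c by (auto simp: \<zeta>_def[abs_def])
  have kill: "pairing n \<eta> (E (\<pi> k)) = 0" if k: "k \<in> K" and \<eta>: "!!z. z \<in> Z ==> pairing n \<eta> z = 0" for k \<eta>
    using maximal_independent_annihilator[OF Z(2) Z(4)[of "E (\<pi> k)"] \<eta>] k by blast
  define \<chi>1 where "\<chi>1 g = pairing n \<zeta> (E (\<mu> (\<pi> g)))" for g
  define \<chi>2 where "\<chi>2 g = pairing n (%i. - \<zeta> i) (E (\<pi> g))" for g
  have \<chi>: "additive G \<chi>1" "additive G \<chi>2"
    unfolding \<chi>1_def[abs_def] \<chi>2_def[abs_def]
    by (intro additive_lift additive_iso[OF H(1)] additive_pairing)
      (intro additive_lift additive_pairing)
  have kill2: "\<forall>k\<in>K. \<chi>2 k = 0"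
    unfolding \<chi>2_def pairing_uminus using kill \<zeta>(2) by simp
  have kill1: "\<forall>k\<in>K. \<chi>1 k = 0"
  proof -
    \<comment> \<open>The character pulled back along \<open>\<mu>\<close> is again a pairing. It
      vanishes on \<open>Z\<close> because \<open>\<zeta>\<close> kills the images under
      \<open>\<mu>\<close>, and from \<open>Z\<close> this extends to all of
      \<open>K\<close>.\<close>
    obtain \<eta> where \<eta>: "!!q. q \<in> carrier Q ==> pairing n \<zeta> (E (\<mu> q)) = pairing n \<eta> (E q)"
      using additive_eq_pairing[OF additive_iso[OF H(1) additive_pairing[of \<zeta>]]] by blast
    have "pairing n \<eta> z = 0" if z: "z \<in> Z" for z
    proof -
      obtain q where q: "q \<in> S" "z = E q" using z S(3) by blast
      have "q \<in> carrier Q" using q(1) S(1) \<pi>K by blast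
      then show ?thesis using \<eta>[of q] \<zeta>(2)[of "E (\<mu> q)"] q by auto
    qed
    then show ?thesis
      unfolding \<chi>1_def using kill[of _ \<eta>] \<eta> \<pi>K by auto
  qed
  obtain i where i: "i < n" "\<zeta> i ~= 0" using \<zeta>(1) by blast
  have nz1: "\<exists>g\<in>carrier G. \<chi>1 g ~= 0"
    unfolding \<chi>1_def by (rule pairing_nonzero[of \<mu> i \<zeta>, OF H(1) i])
  have nz2: "\<exists>g\<in>carrier G. \<chi>2 g ~= 0"
    unfolding \<chi>2_def using pairing_nonzero[of "%q. q" i "%i. - \<zeta> i", OF iso_set_refl i(1)] i(2) by simp
  have sub: "subgroup (fibre_product G N \<mu>) ?GG" by (rule subgroup_fibre_product[OF H(1)])
  have gGG: "group ?GG" by (rule DirProd_group[OF group_axioms group_axioms])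
  have gH: "group ?H" by (rule subgroup.subgroup_is_group[OF sub gGG])
  obtain X :: "nat set" and R f where X: "finite X" "finite R" "R \<subseteq> words X" "generators ?H X f"
    "word_val ?H f ` words X = carrier ?H"
    "!!w. w \<in> words X ==> word_val ?H f w = \<one>\<^bsub>?H\<^esub> \<longleftrightarrow> (w, []) \<in> presentation_rel X R"
    using finitely_presentedE[OF gH H(2)] by blast
  have hom: "group_hom ?H G fst" "group_hom ?H G snd"
    using gH group_axioms subgroup.subset[OF sub]
    by (auto simp: group_hom_def group_hom_axioms_def hom_def DirProd_def)
  interpret H: generators ?H X f by (rule X(4))
  interpret A: generators G X "fst \<circ> f" by (rule H.generators_hom[OF hom(1)])
  interpret B: generators G X "snd \<circ> f" by (rule H.generators_hom[OF hom(2)])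
  have gen: "carrier G \<subseteq> A.wv ` words X" "carrier G \<subseteq> B.wv ` words X"
  proof -
    have "fst ` fibre_product G N \<mu> = fst ` H.wv ` words X" "snd ` fibre_product G N \<mu> = snd ` H.wv ` words X"
      using X(5) by simp_all
    moreover have "fst ` H.wv ` words X = A.wv ` words X" "snd ` H.wv ` words X = B.wv ` words X"
      unfolding image_image by (intro image_cong HOL.refl H.word_val_hom hom; assumption)+
    ultimately show "carrier G \<subseteq> A.wv ` words X" "carrier G \<subseteq> B.wv ` words X"
      using fibre_product_proj[OF H(1)] by simp_all
  qed
  have \<Lambda>c: "K \<subseteq> carrier G" if "K \<in> \<Lambda>" for K using \<Lambda>[OF that] subgroup.subset by blast
  have "half_connected G X (fst \<circ> f) \<chi>1 | half_connected G X (snd \<circ> f) \<chi>2"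
  proof (rule finitely_presented_imp_half_connected[OF group_axioms sub X(4,1,2) _ _ X(3)])
    show "H.wv ` words X = fibre_product G N \<mu>" using X(5) by simp
    show "H.wv w = \<one>\<^bsub>?GG\<^esub> \<longleftrightarrow> (w, []) \<in> presentation_rel X R" if "w \<in> words X" for w
      using X(6)[OF that] by simp
    show "carrier G \<subseteq> fst ` fibre_product G N \<mu>" "carrier G \<subseteq> snd ` fibre_product G N \<mu>"
      by (rule fibre_product_proj[OF H(1)])+
    show "(c, \<one>) \<in> fibre_product G N \<mu> & (\<one>, c) \<in> fibre_product G N \<mu>" if "c \<in> N" for c
      by (rule fibre_product_commutators[OF H(1) that])
    show "\<chi>1 (fst p) = - \<chi>2 (snd p)" if "p \<in> fibre_product G N \<mu>" for p
      using that by (simp add: fibre_product_iff \<chi>1_def \<chi>2_def pairing_uminus)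
  qed (rule \<chi> nz1)+
  then show False
    using A.half_connected_iff[OF \<chi>(1) nz1 X(1) gen(1) \<Lambda>c BNS] B.half_connected_iff[OF \<chi>(2) nz2 X(1) gen(2) \<Lambda>c BNS]
      K kill1 kill2 by blast
qed

text \<open>The generic shear is taken for the coordinate images of the members of
  \<open>\<Lambda>\<close>. If neither factor character were half-connected in a direction
  \<open>u\<close>, then \<open>u\<close> would vanish on the shear of one image and on a second,
  possibly equal, image.\<close>

lemma rank_condition_sufficient:
  assumes fp: "finitely_presented G" and fin: "finite \<Lambda>"
    and \<Lambda>: "!!K. K \<in> \<Lambda> ==> subgroup K G & N \<subseteq> K"
    and BNS: "character_sphere G - BNS_invariant G = (\<Union>K\<in>\<Lambda>. character_subsphere G K)"
    and rank: "!!K. K \<in> \<Lambda> ==> n \<le> 2 * torsion_free_rank (G\<lparr>carrier := K\<rparr> Mod N)"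
  obtains \<mu> where "\<mu> \<in> iso Q Q" "finitely_presented ((G \<times>\<times> G)\<lparr>carrier := fibre_product G N \<mu>\<rparr>)"
proof -
  let ?\<L> = "(%K. E ` \<pi> ` K) ` \<Lambda>"
  have \<L>: "\<exists>S\<subseteq>L. independent_vectors n S & n \<le> 2 * card S" if L: "L \<in> ?\<L>" for L
  proof -
    obtain K where K: "K \<in> \<Lambda>" "L = E ` \<pi> ` K" using L by blast
    have KN: "subgroup K G" "N \<subseteq> K" using \<Lambda>[OF K(1)] by blast+
    obtain Z where "Z \<subseteq> E ` \<pi> ` K" "independent_vectors n Z"
      "card Z = torsion_free_rank (G\<lparr>carrier := K\<rparr> Mod N)"
      by (rule rank_vectors[OF KN]) (rule that)
    then show ?thesis unfolding K(2) using rank[OF K(1)] by (intro exI[of _ Z] conjI) simp_all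
  qed
  obtain V \<xi> where V: "finite V" "!!v w. v \<in> V ==> w \<in> V ==> dot n (\<xi> v) w = 0"
    and generic: "\<forall>L\<in>?\<L>. \<forall>L'\<in>?\<L>. \<forall>\<eta>. (\<forall>z\<in>L. pairing n \<eta> (shear n M V \<xi> z) = 0) -->
      (\<forall>z\<in>L'. pairing n \<eta> z = 0) --> (\<forall>i<n. \<eta> i = 0)"
    by (rule generic_shear[OF finite_imageI[OF fin] \<L> C.M_pos]) (assumption, rule that, assumption+)
  obtain \<mu> where \<mu>: "\<mu> \<in> iso Q Q" and E\<mu>: "!!q i. q \<in> carrier Q ==> i < n ==> E (\<mu> q) i = shear n M V \<xi> (E q) i"
    by (rule C.shear_automorphism[where V = V and \<xi> = \<xi>]) (rule V, rule V, assumption+, rule that, assumption+)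
  obtain X :: "nat set" and R f where X: "finite X" "finite R" "R \<subseteq> words X" "generators G X f"
    "word_val G f ` words X = carrier G"
    "!!w. w \<in> words X ==> word_val G f w = \<one> \<longleftrightarrow> (w, []) \<in> presentation_rel X R"
    using finitely_presentedE[OF group_axioms fp] by blast
  interpret X: generators G X f by (rule X(4))
  have \<Lambda>c: "K \<subseteq> carrier G" if "K \<in> \<Lambda>" for K using \<Lambda>[OF that] subgroup.subset by blast
  have gen: "carrier G \<subseteq> X.wv ` words X" using X(5) by simp
  define a where "a g i = real_of_int (E (\<mu> (\<pi> g)) i)" for g i
  define b where "b g i = real_of_int (E (\<pi> g) i)" for g i
  have a: "inner_prod n u (a g) = pairing n u (E (\<mu> (\<pi> g)))" for u g
    unfolding a_def[abs_def] by (rule pairing_inner_prod)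
  have b: "inner_prod n u (b g) = pairing n u (E (\<pi> g))" for u g
    unfolding b_def[abs_def] by (rule pairing_inner_prod)
  have add_a: "additive G (%g. pairing n u (E (\<mu> (\<pi> g))))" for u
    by (intro additive_lift additive_iso[OF \<mu>] additive_pairing)
  have add_b: "additive G (%g. pairing n u (E (\<pi> g)))" for u
    by (intro additive_lift additive_pairing)
  have mult: "\<pi> (g \<otimes> g') = \<pi> g \<otimes>\<^bsub>Q\<^esub> \<pi> g'" "\<pi> g \<in> carrier Q" "\<pi> g' \<in> carrier Q"
      "\<mu> (\<pi> g \<otimes>\<^bsub>Q\<^esub> \<pi> g') = \<mu> (\<pi> g) \<otimes>\<^bsub>Q\<^esub> \<mu> (\<pi> g')" "\<mu> (\<pi> g) \<in> carrier Q" "\<mu> (\<pi> g') \<in> carrier Q"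
    if "g \<in> carrier G" "g' \<in> carrier G" for g g'
  proof -
    interpret m: group_hom Q Q \<mu> by (rule group_hom_\<mu>[OF \<mu>])
    show 1: "\<pi> (g \<otimes> g') = \<pi> g \<otimes>\<^bsub>Q\<^esub> \<pi> g'" by (rule abelianisation_mult[OF that])
    show 2: "\<pi> g \<in> carrier Q" "\<pi> g' \<in> carrier Q" unfolding abelianisation_carrier using that by blast+
    show "\<mu> (\<pi> g \<otimes>\<^bsub>Q\<^esub> \<pi> g') = \<mu> (\<pi> g) \<otimes>\<^bsub>Q\<^esub> \<mu> (\<pi> g')" by (rule m.hom_mult[OF 2])
    show "\<mu> (\<pi> g) \<in> carrier Q" "\<mu> (\<pi> g') \<in> carrier Q" using 2 by (simp_all only: m.hom_closed)
  qed
  have unit: "\<exists>i<n. u i ~= 0" if "norm2 n u = 1" for u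
  proof (rule ccontr)
    assume "\<not> (\<exists>i<n. u i ~= 0)"
    then have "norm2 n u = norm2 n (%_. 0 * 0)" by (intro norm2_cong) auto
    also have "... = 0" unfolding norm2_scale by simp
    finally show False using that by simp
  qed
  have nz_a: "\<exists>g\<in>carrier G. pairing n u (E (\<mu> (\<pi> g))) ~= 0"
    and nz_b: "\<exists>g\<in>carrier G. pairing n u (E (\<pi> g)) ~= 0" if u: "norm2 n u = 1" for u
  proof -
    obtain i where i: "i < n" "u i ~= 0" using unit[OF u] by blast
    show "\<exists>g\<in>carrier G. pairing n u (E (\<mu> (\<pi> g))) ~= 0" by (rule pairing_nonzero[of \<mu> i u, OF \<mu> i])
    show "\<exists>g\<in>carrier G. pairing n u (E (\<pi> g)) ~= 0" using pairing_nonzero[of "%q. q" i u, OF iso_set_refl i] by simp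
  qed
  interpret S: square_group G X f R n a b
  proof (unfold_locales, goal_cases)
    case 1 then show ?case by (rule X(1))
  next
    case 2 then show ?case by (rule X(2))
  next
    case 3 then show ?case by (rule X(3))
  next
    case (4 r)
    have "r \<in> words X" using 4 X(3) by blast
    moreover have "([] @ r @ [], [] @ []) \<in> presentation_rel X R"
      using calculation 4 by (intro presentation_rel.relator) auto
    ultimately show ?case using X(6) by simp
  next
    case (5 w) then show ?case using X(6) by simp
  next
    case 6 then show ?case by (rule gen)
  next
    case (7 g g' i) then show ?case using mult[OF 7(1,2)] by (simp add: a_def C.E_mult del: mult_FactGroup)
  next
    case (8 g g' i) then show ?case using mult[OF 8(1,2)] by (simp add: b_def C.E_mult del: mult_FactGroup)
  next
    case (9 u) then show ?case unfolding a by (rule nz_a)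
  next
    case (10 u) then show ?case unfolding b by (rule nz_b)
  next
    case (11 u)
    show ?case
    proof (rule ccontr)
      assume "\<not> ?case"
      then have not: "\<not> half_connected G X f (%g. pairing n (%i. - u i) (E (\<mu> (\<pi> g))))"
        "\<not> half_connected G X f (%g. pairing n u (E (\<pi> g)))" unfolding a b pairing_uminus by blast+
      have nz: "\<exists>g\<in>carrier G. pairing n (%i. - u i) (E (\<mu> (\<pi> g))) ~= 0"
        using nz_a[OF 11] unfolding pairing_uminus by simp
      obtain K where K: "K \<in> \<Lambda>" "!!k. k \<in> K ==> pairing n (%i. - u i) (E (\<mu> (\<pi> k))) = 0"
        using X.half_connected_iff[OF add_a nz X(1) gen \<Lambda>c BNS] not(1) by blast
      obtain K' where K': "K' \<in> \<Lambda>" "!!k. k \<in> K' ==> pairing n u (E (\<pi> k)) = 0"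
        using X.half_connected_iff[OF add_b nz_b[OF 11] X(1) gen \<Lambda>c BNS] not(2) by blast
      have van1: "\<forall>z\<in>E ` \<pi> ` K. pairing n u (shear n M V \<xi> z) = 0"
      proof
        fix z assume "z \<in> E ` \<pi> ` K"
        then obtain k where k: "k \<in> K" "z = E (\<pi> k)" by blast
        have "k \<in> carrier G" using k(1) \<Lambda>c[OF K(1)] by blast
        then have "\<pi> k \<in> carrier Q" unfolding abelianisation_carrier by blast
        then have "pairing n u (shear n M V \<xi> z) = pairing n u (E (\<mu> (\<pi> k)))"
          unfolding k(2) by (intro pairing_cong E\<mu>[symmetric])
        also have "... = 0" using K(2)[OF k(1)] by (simp add: pairing_uminus)
        finally show "pairing n u (shear n M V \<xi> z) = 0" .
      qed
      have van2: "\<forall>z\<in>E ` \<pi> ` K'. pairing n u z = 0" using K'(2) by blast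
      have "\<forall>i<n. u i = 0"
        by (rule mp[OF mp[OF spec[OF bspec[OF bspec[OF generic imageI[OF K(1)]] imageI[OF K'(1)]]] van1] van2])
      then show False using unit[OF 11] by blast
    qed
  qed
  let ?H = "fibre_product G N \<mu>"
  have "finitely_presented ((G \<times>\<times> G)\<lparr>carrier := ?H\<rparr>)"
  proof (rule S.finitely_presented_kernel)
    show "subgroup ?H (G \<times>\<times> G)" by (rule subgroup_fibre_product[OF \<mu>])
    show "S.h k i = 0" if "k \<in> ?H" "i < n" for k i
      using that by (simp add: S.h_def a_def b_def fibre_product_iff)
    fix \<rho> :: real
    have "{v \<in> carrier (G \<times>\<times> G). norm2 n (S.h v) \<le> \<rho>}
        \<subseteq> {v \<in> carrier (G \<times>\<times> G). \<forall>i<n. \<bar>E (\<pi> (snd v)) i - E (\<mu> (\<pi> (fst v))) i\<bar> \<le> \<lceil>\<rho>\<rceil>}"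
    proof (intro Collect_mono impI conjI allI; elim conjE)
      fix v i assume v: "norm2 n (S.h v) \<le> \<rho>" and i: "i < n"
      have "\<bar>S.h v i\<bar> \<le> norm2 n (S.h v)"
      proof -
        have "\<bar>inner_prod n (%j. if j = i then 1 else 0) (S.h v)\<bar> \<le> norm2 n (%j. if j = i then 1 else 0) * norm2 n (S.h v)"
          by (rule inner_prod_bound)
        moreover have "inner_prod n (%j. if j = i then 1 else 0) w = w i" for w
          using i by (simp add: inner_prod_def if_distrib[of "%x. x * _"] cong: if_cong)
        moreover have "norm2 n (%j. if j = i then 1 else 0) = 1"
          using norm2_sq[of n "%j. if j = i then 1 else 0"] calculation(2) norm2_nonneg
          by (simp add: power2_eq_1_iff) (metis norm2_nonneg not_one_le_zero neg_0_le_iff_le)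
        ultimately show ?thesis by simp
      qed
      then have "\<bar>real_of_int (E (\<pi> (snd v)) i - E (\<mu> (\<pi> (fst v))) i)\<bar> \<le> \<rho>"
        using v by (simp add: S.h_def a_def b_def)
      then show "\<bar>E (\<pi> (snd v)) i - E (\<mu> (\<pi> (fst v))) i\<bar> \<le> \<lceil>\<rho>\<rceil>" by linarith
    qed
    then show "finite ((%v. ?H #>\<^bsub>G \<times>\<times> G\<^esub> v) ` {v \<in> carrier (G \<times>\<times> G). norm2 n (S.h v) \<le> \<rho>})"
      by (rule finite_subset[OF image_mono fibre_product_finite_cosets[OF \<mu>]])
  qed
  then show ?thesis by (rule that[OF \<mu>])
qed

end

theorem theorem5p2:
  fixes G :: "('a, 'b) monoid_scheme" and \<Lambda> :: "'a set set"
  assumes "group G"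
    and "finitely_presented G"
    and "finite \<Lambda>"
    and "\<And>K. K \<in> \<Lambda> \<Longrightarrow> subgroup K G \<and> commutator_subgroup G \<subseteq> K"
    and "character_sphere G - BNS_invariant G = (\<Union>K\<in>\<Lambda>. character_subsphere G K)"
  shows "(\<exists>H. is_commutator_fibre_product G H \<and> finitely_presented ((G \<times>\<times> G)\<lparr>carrier := H\<rparr>)) \<longleftrightarrow>
    (\<forall>K\<in>\<Lambda>. torsion_free_rank (G Mod commutator_subgroup G)
            \<le> 2 * torsion_free_rank (G\<lparr>carrier := K\<rparr> Mod commutator_subgroup G))"
proof -
  obtain X :: "nat set" and R f where X: "finite X" "generators G X f" "word_val G f ` words X = carrier G"
    using finitely_presentedE[OF assms(1,2)] by metis
  interpret X: generators G X f by (rule X(2))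
  obtain n E s M where C: "coordinates X.Q n E s M"
    using X.abelianisation_coordinates[OF X(1) X(3)[symmetric]] by blast
  interpret C: abelianised G n E s M
    by (intro abelianised.intro assms(1) C)
  have n: "torsion_free_rank X.Q = n" by (rule C.C.torsion_free_rank_eq)
  show ?thesis
    unfolding n is_commutator_fibre_product_def
  proof (intro iffI ballI)
    fix K assume "\<exists>H. (\<exists>\<mu>\<in>iso X.Q X.Q. H = fibre_product G X.N \<mu>) & finitely_presented ((G \<times>\<times> G)\<lparr>carrier := H\<rparr>)"
      and K: "K \<in> \<Lambda>"
    then obtain \<mu> where "\<mu> \<in> iso X.Q X.Q" "finitely_presented ((G \<times>\<times> G)\<lparr>carrier := fibre_product G X.N \<mu>\<rparr>)" by blast
    then show "n \<le> 2 * torsion_free_rank (G\<lparr>carrier := K\<rparr> Mod X.N)"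
      using assms(4,5) K by (rule C.rank_condition_necessary)
  next
    assume rank: "\<forall>K\<in>\<Lambda>. n \<le> 2 * torsion_free_rank (G\<lparr>carrier := K\<rparr> Mod X.N)"
    obtain \<mu> where "\<mu> \<in> iso X.Q X.Q" "finitely_presented ((G \<times>\<times> G)\<lparr>carrier := fibre_product G X.N \<mu>\<rparr>)"
      using C.rank_condition_sufficient[OF assms(2,3,4,5)] rank by blast
    then show "\<exists>H. (\<exists>\<mu>\<in>iso X.Q X.Q. H = fibre_product G X.N \<mu>) & finitely_presented ((G \<times>\<times> G)\<lparr>carrier := H\<rparr>)"
      by blast
  qed
qed

end
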